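(* (i) Let $\phi$ and $\phi^*$ be conjugate special Bernstein functions with representations, for $\theta\ge 0$, $$\phi(\theta)=\kappa+\mathrm{d}\theta+\int_{(0,\infty)}(1-e^{-\theta x})\Upsilon(dx),\qquad \phi^*(\theta)=\kappa^*+\mathrm{d}^*\theta+\int_{(0,\infty)}(1-e^{-\theta x})\Upsilon^*(dx),$$ such that both $\Upsilon$ and $\Upsilon^*$ are absolutely continuous with non-increasing densities on $(0,\infty)$. Then there exist a pair of scale functions $W$ and $W^*$ such that $W$ is concave (on $[0,\infty)$), its first derivative is a convex function (on $(0,\infty)$), and $$W(x)=\mathrm{d}^*+\kappa^*x+\int_0^x\Upsilon^*(y,\infty)\,dy,\qquad W^*(x)=\mathrm{d}+\kappa x+\int_0^x\Upsilon(y,\infty)\,dy,\qquad x\ge 0,$$ where $W$ and $W^*$ are the scale functions of spectrally negative Lévy processes with respective Laplace exponents $$\psi(\theta)=\frac{\theta^2}{\phi^*(\theta)}=\theta\phi(\theta),\qquad \psi^*(\theta)=\frac{\theta^2}{\phi(\theta)}=\theta\phi^*(\theta),\qquad\theta\ge0.$$ (ii) Conversely, let $\psi$ be the Laplace exponent of a spectrally negative Lévy process that does not drift to $-\infty$ and whose associated scale function $W$ is a concave function (on $[0,\infty)$) whose first derivative is a convex function (on $(0,\infty)$). Then there exist a pair of conjugate Bernstein functions $\phi$ and $\phi^*$ (with representations as displayed in (i) for some $(\kappa,\mathrm{d},\Upsilon)$ and $(\kappa^*,\mathrm{d}^*,\Upsilon^* )$) and a function $\psi^*$ such that $\psi^*$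 is the Laplace exponent of a spectrally negative Lévy process, $\psi(\theta)=\theta^2/\phi^*(\theta)=\theta\phi(\theta)$ and $\psi^*(\theta)=\theta^2/\phi(\theta)=\theta\phi^*(\theta)$ for $\theta\ge0$, and the scale functions $W$ and $W^*$ associated to $\psi$ and $\psi^*$ satisfy $W(x)=\mathrm{d}^*+\kappa^*x+\int_0^x\Upsilon^*(y,\infty)\,dy$ and $W^*(x)=\mathrm{d}+\kappa x+\int_0^x\Upsilon(y,\infty)\,dy$ for $x\ge 0$.
   Context: A spectrally negative Lévy process is a real-valued Lévy process $X$ (not killed) with no positive jumps which is not the negative of a subordinator. Its Laplace exponent is $\psi(\theta)=\log\mathbb{E}[e^{\theta X_1}]$, $\theta\ge 0$ ($X_0=0$). It does not drift to $-\infty$ if and only if $\psi'(0+)\ge 0$; in that case $\psi(\theta)>0$ for all $\theta>0$. For such a process not drifting to $-\infty$, its scale function $W:\mathbb{R}\to[0,\infty)$ is the function vanishing on $(-\infty,0)$, continuous on $[0,\infty)$ (right continuous at the origin), with $\int_0^\infty e^{-\theta x}W(x)\,dx=1/\psi(\theta)$ for $\theta>0$. A Bernstein function is a function of the form $\phi(\theta)=\kappa+\mathrm{d}\theta+\int_{(0,\infty)}(1-e^{-\theta x})\Upsilon(dx)$, $\theta\ge0$, with $\kappa,\mathrm{d}\ge 0$ and $\Upsilon$ a measure on $(0,\infty)$ with $\int_{(0,\infty)}(1\wedge x)\Upsilon(dx)<\infty$. A Bernstein function $\phi$ is special if there is a Bernstein function $\phi^*$ with $\phi(\theta)=\theta/\phi^*(\theta)$;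 then $\phi^*$ is also special, and $\phi,\phi^*$ are called conjugate. Quotients are understood at $\theta=0$ as limits as $\theta\downarrow 0$. The notation $\Upsilon(y,\infty)$ means the $\Upsilon$-measure of the interval $(y,\infty)$. *)

theory Defs
  imports "HOL-Probability.Probability"
begin

section \<open>Spectrally negative Levy processes\<close>

text \<open>
  A process is a family \<open>X t\<close> of random variables indexed by a real time \<open>t\<close>;
  the values at negative times are irrelevant and unconstrained.
\<close>

locale levy_process = prob_space M for M :: "'a measure" +
  fixes X :: "real \<Rightarrow> 'a \<Rightarrow> real"
  assumes measurable_X: "\<And>t. 0 \<le> t \<Longrightarrow> X t \<in> borel_measurable M"
    and starts_at_zero: "AE \<omega> in M. X 0 \<omega> = 0"
    and indep_increments:
      "\<And>(t :: nat \<Rightarrow> real) n. 0 \<le> t 0 \<Longrightarrow> (\<And>i. i < n \<Longrightarrow> t i \<le> t (Suc i)) \<Longrightarrow>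
         indep_vars (\<lambda>_. borel) (\<lambda>i \<omega>. X (t (Suc i)) \<omega> - X (t i) \<omega>) {..<n}"
    and stationary_increments:
      "\<And>s t. 0 \<le> s \<Longrightarrow> s \<le> t \<Longrightarrow>
         distr M borel (\<lambda>\<omega>. X t \<omega> - X s \<omega>) = distr M borel (X (t - s))"
    and right_continuous_paths:
      "AE \<omega> in M. \<forall>t\<ge>0. ((\<lambda>s. X s \<omega>) \<longlongrightarrow> X t \<omega>) (at_right t)"
    and left_limits:
      "AE \<omega> in M. \<forall>t>0. \<exists>l. ((\<lambda>s. X s \<omega>) \<longlongrightarrow> l) (at_left t)"

definition subordinator :: "'a measure \<Rightarrow> (real \<Rightarrow> 'a \<Rightarrow> real) \<Rightarrow> bool" where
  "subordinator M X \<longleftrightarrow>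
     levy_process M X \<and> (AE \<omega> in M. mono_on {0..} (\<lambda>t. X t \<omega>))"

definition spectrally_negative_levy :: "'a measure \<Rightarrow> (real \<Rightarrow> 'a \<Rightarrow> real) \<Rightarrow> bool" where
  "spectrally_negative_levy M X \<longleftrightarrow>
     levy_process M X \<and>
     (AE \<omega> in M. \<forall>t>0. \<forall>l. ((\<lambda>s. X s \<omega>) \<longlongrightarrow> l) (at_left t) \<longrightarrow> X t \<omega> \<le> l) \<and>
     \<not> subordinator M (\<lambda>t \<omega>. - X t \<omega>)"

definition drifts_to_minus_infinity :: "'a measure \<Rightarrow> (real \<Rightarrow> 'a \<Rightarrow> real) \<Rightarrow> bool" where
  "drifts_to_minus_infinity M X \<longleftrightarrow>
     (AE \<omega> in M. filterlim (\<lambda>t. X t \<omega>) at_bot at_top)"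

text \<open>
  Integrability, which every spectrally negative Levy process satisfies, is what makes the
  logarithm of the expectation meaningful: the Bochner integral of a non-integrable function is 0.
\<close>

definition laplace_exponent ::
    "'a measure \<Rightarrow> (real \<Rightarrow> 'a \<Rightarrow> real) \<Rightarrow> (real \<Rightarrow> real) \<Rightarrow> bool" where
  "laplace_exponent M X \<psi> \<longleftrightarrow>
     (\<forall>\<theta>\<ge>0. integrable M (\<lambda>\<omega>. exp (\<theta> * X 1 \<omega>)) \<and>
            \<psi> \<theta> = ln (\<integral>\<omega>. exp (\<theta> * X 1 \<omega>) \<partial>M))"

text \<open>
  Meant for the Laplace exponent \<open>\<psi>\<close> of a spectrally negative Levy process that does not drift
  to \<open>-\<infinity>\<close>, so that \<open>\<psi> \<theta> > 0\<close> for \<open>\<theta> > 0\<close>.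
\<close>

definition scale_function :: "(real \<Rightarrow> real) \<Rightarrow> (real \<Rightarrow> real) \<Rightarrow> bool" where
  "scale_function \<psi> W \<longleftrightarrow>
     (\<forall>x. 0 \<le> W x) \<and> (\<forall>x<0. W x = 0) \<and> continuous_on {0..} W \<and>
     (\<forall>\<theta>>0. set_integrable lborel {0..} (\<lambda>x. exp (- \<theta> * x) * W x) \<and>
            (LBINT x:{0..}. exp (- \<theta> * x) * W x) = 1 / \<psi> \<theta>)"


section \<open>Conjugate special Bernstein functions\<close>

text \<open>The measure \<open>\<Upsilon>\<close> lives on the open half-line: its space is \<open>{0<..}\<close>.\<close>

definition bernstein_representation ::
    "real \<Rightarrow> real \<Rightarrow> real measure \<Rightarrow> (real \<Rightarrow> real) \<Rightarrow> bool" where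
  "bernstein_representation \<kappa> d \<Upsilon> \<phi> \<longleftrightarrow>
     0 \<le> \<kappa> \<and> 0 \<le> d \<and>
     sets \<Upsilon> = sets (restrict_space borel {0<..}) \<and>
     (\<integral>\<^sup>+x. ennreal (min 1 x) \<partial>\<Upsilon>) < \<infinity> \<and>
     (\<forall>\<theta>\<ge>0. \<phi> \<theta> = \<kappa> + d * \<theta> + (\<integral>x. 1 - exp (- \<theta> * x) \<partial>\<Upsilon>))"

definition bernstein_function :: "(real \<Rightarrow> real) \<Rightarrow> bool" where
  "bernstein_function \<phi> \<longleftrightarrow> (\<exists>\<kappa> d \<Upsilon>. bernstein_representation \<kappa> d \<Upsilon> \<phi>)"

text \<open>
  \<open>h = f / g\<close> on \<open>[0, \<infinity>)\<close>, where the quotient at 0 is the limit from the right.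
  The condition \<open>g \<theta> \<noteq> 0\<close> excludes the convention \<open>x / 0 = 0\<close>.
\<close>

definition is_quotient ::
    "(real \<Rightarrow> real) \<Rightarrow> (real \<Rightarrow> real) \<Rightarrow> (real \<Rightarrow> real) \<Rightarrow> bool" where
  "is_quotient h f g \<longleftrightarrow>
     (\<forall>\<theta>>0. g \<theta> \<noteq> 0 \<and> h \<theta> = f \<theta> / g \<theta>) \<and>
     ((\<lambda>\<theta>. f \<theta> / g \<theta>) \<longlongrightarrow> h 0) (at_right 0)"

text \<open>
  A Bernstein function is special iff it has a conjugate; both members of a conjugate pair
  are then special.
\<close>

definition conjugate_bernstein :: "(real \<Rightarrow> real) \<Rightarrow> (real \<Rightarrow> real) \<Rightarrow> bool" where
  "conjugate_bernstein \<phi> \<phi>s \<longleftrightarrow>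
     bernstein_function \<phi> \<and> bernstein_function \<phi>s \<and> is_quotient \<phi> (\<lambda>\<theta>. \<theta>) \<phi>s"

definition has_nonincreasing_density :: "real measure \<Rightarrow> bool" where
  "has_nonincreasing_density \<Upsilon> \<longleftrightarrow>
     (\<exists>u :: real \<Rightarrow> real. (\<forall>x>0. 0 \<le> u x) \<and> antimono_on {0<..} u \<and>
        \<Upsilon> = density (restrict_space lborel {0<..}) (\<lambda>x. ennreal (u x)))"

definition concave_with_convex_derivative :: "(real \<Rightarrow> real) \<Rightarrow> bool" where
  "concave_with_convex_derivative W \<longleftrightarrow>
     concave_on {0..} W \<and> (\<forall>x>0. W differentiable (at x)) \<and> convex_on {0<..} (deriv W)"

end

theory Submission
  imports Defs "HOL-Complex_Analysis.Complex_Analysis" "HOL-Real_Asymp.Real_Asymp"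
begin

text \<open>
  Both parts rest on one existence result: if \<open>W \<ge> 0\<close>, not identically 0, is continuous and concave on the half-line with convex
  derivative, and \<open>L\<close> is its Laplace transform, then \<open>\<theta> ^ 3 * L \<theta>\<close> is the exponent of a spectrally negative
  process that does not drift to \<open>-\<infinity>\<close>. On a lattice of mesh \<open>\<epsilon>\<close> the third differences of \<open>W\<close> are
  nonnegative, hence up to a factor they are step probabilities of a walk whose upward steps have size \<open>\<epsilon>\<close>;
  its transform is \<open>1 + h * E \<theta>\<close> with \<open>E \<theta>\<close> close to \<open>\<theta> ^ 3 * L \<theta>\<close>, and letting \<open>\<epsilon>\<close> and \<open>h\<close> tend
  to 0 produces the one-dimensional laws. Independent increments with these laws are glued along the dyadic times,
  and an Ottaviani type estimate for pairs of oscillations makes the paths extendable to cadlag ones.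
  The mean of the process is nonnegative, which excludes drift to \<open>-\<infinity>\<close>.

  For a Bernstein function \<open>\<phi>\<close> the function \<open>V x = d + \<kappa> * x + \<integral>\<^sub>0\<^sup>x \<Upsilon>(y, \<infinity>) dy\<close> has transform
  \<open>\<phi> \<theta> / \<theta>\<^sup>2\<close>. If \<open>\<phi> \<theta> * \<phi>s \<theta> = \<theta>\<close>, this is \<open>1 / (\<theta> * \<phi>s \<theta>)\<close>, so \<open>V\<close> is the scale function for
  \<open>\<theta> * \<phi>s \<theta>\<close>, while the existence result applied to \<open>V\<close> produces a process with exponent \<open>\<theta> * \<phi> \<theta>\<close>.
  For the converse, \<open>\<Upsilon>s\<close> is read off \<open>W'\<close>, and \<open>\<psi> \<theta> / \<theta>\<close> is a Bernstein function by the
  Levy--Khintchine formula: the measures \<open>n (e\<^sup>x - 1)\<^sup>2 P(X\<^bsub>1/n\<^esub> \<in> dx)\<close> have a weak limit, which does not charge the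
  positive half-line because there are no positive jumps.
\<close>

section \<open>Laplace transforms of probability laws\<close>

text \<open>Formally \<open>\<theta> ^ 3 * L \<theta>\<close> is the transform of the third
  derivative of \<open>W\<close> together with boundary terms at 0. Convexity of the derivative
  makes this third derivative a nonnegative measure, and its reflection to the negative half-line is
  the Levy measure of the process. Differences in place of derivatives cope with kinks of
  \<open>W'\<close> and with its explosion at 0. The left tail of the laws may be too heavy for
  second moments. Hence laws are identified through their exponential moments at real \<theta> \<ge>
  0 only, and tails are estimated through the square of \<open>exp (\<theta> * x) - 1\<close>. That
  the walks rise by single lattice units is not carried through the limit. Positive jumps are
  excluded instead by the quadratic growth of the exponent: at large \<theta> it makes an upward
  move above a fixed size during time h have probability o(h). The obstacle to regular paths is that
  a large increment during time h has probability of order h only, while there are about 1/h cells,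
  so single large increments cannot be excluded. Two of them in the same cell have probability of
  order h squared, which is summable over the cells and still enough for one-sided limits.\<close>

lemma tendsto_integral_at_within:
  fixes f :: "'b::metric_space \<Rightarrow> 'a \<Rightarrow> 'c::{banach,second_countable_topology}"
  assumes meas: "\<And>h. f h \<in> borel_measurable M" "g \<in> borel_measurable M"
    and w: "integrable M w"
    and lim: "AE x in M. ((\<lambda>h. f h x) \<longlongrightarrow> g x) (at a within S)"
    and bound: "eventually (\<lambda>h. AE x in M. norm (f h x) \<le> w x) (at a within S)"
  shows "((\<lambda>h. \<integral>x. f h x \<partial>M) \<longlongrightarrow> (\<integral>x. g x \<partial>M)) (at a within S)"
proof (subst tendsto_at_iff_sequentially, intro allI impI)
  fix X :: "nat \<Rightarrow> 'b" assume X: "\<forall>i. X i \<in> S - {a}" "X \<longlonglongrightarrow> a"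
  then have flim: "filterlim X (at a within S) sequentially"
    by (auto simp: filterlim_at eventually_sequentially)
  with bound have "eventually (\<lambda>n. AE x in M. norm (f (X n) x) \<le> w x) sequentially"
    by (auto simp: filterlim_iff)
  then obtain N where N: "\<And>n. n \<ge> N \<Longrightarrow> AE x in M. norm (f (X n) x) \<le> w x"
    by (auto simp: eventually_sequentially)
  have "(\<lambda>n. \<integral>x. f (X (n + N)) x \<partial>M) \<longlonglongrightarrow> (\<integral>x. g x \<partial>M)"
  proof (rule integral_dominated_convergence[where w=w])
    show "AE x in M. (\<lambda>i. f (X (i + N)) x) \<longlonglongrightarrow> g x"
      using lim
    proof eventually_elim
      case (elim x)
      have "(\<lambda>i. f (X i) x) \<longlonglongrightarrow> g x"
        using filterlim_compose[OF elim flim] by simp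
      then show ?case by (rule LIMSEQ_ignore_initial_segment)
    qed
  qed (use meas w N in auto)
  then have "(\<lambda>n. \<integral>x. f (X n) x \<partial>M) \<longlonglongrightarrow> (\<integral>x. g x \<partial>M)"
    by (rule LIMSEQ_offset)
  then show "((\<lambda>h. \<integral>x. f h x \<partial>M) \<circ> X) \<longlonglongrightarrow> (\<integral>x. g x \<partial>M)"
    by (simp add: o_def)
qed

text \<open>Only \<theta> \<ge> 0 is covered: exponential moments exist on the side where jumps are
  absent, and the left tail stays unrestricted.\<close>

definition has_laplace :: "real measure \<Rightarrow> (real \<Rightarrow> real) \<Rightarrow> bool" where
  "has_laplace \<mu> L \<longleftrightarrow> real_distribution \<mu> \<and>
     (\<forall>\<theta>\<ge>0. integrable \<mu> (\<lambda>x. exp (\<theta> * x)) \<and> (\<integral>x. exp (\<theta> * x) \<partial>\<mu>) = L \<theta>)"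

lemma has_laplace_distr:
  assumes "prob_space M" "X \<in> borel_measurable M"
  shows "has_laplace (distr M borel X) L \<longleftrightarrow>
    (\<forall>\<theta>\<ge>0. integrable M (\<lambda>x. exp (\<theta> * X x)) \<and> (\<integral>x. exp (\<theta> * X x) \<partial>M) = L \<theta>)"
proof -
  interpret prob_space M by fact
  show ?thesis
    using assms real_distribution_distr[OF assms(2)]
    by (simp add: has_laplace_def integral_distr integrable_distr_eq)
qed

lemma norm_exp_quotient_le:
  fixes h :: complex and x :: real
  assumes "h \<noteq> 0"
  shows "norm ((exp (h * of_real x) - 1) / h) \<le> \<bar>x\<bar> * exp (norm h * \<bar>x\<bar>)"
proof -
  have "norm (exp (h * of_real x) - 1) \<le> norm (h * of_real x) * exp (norm (h * of_real x))"
    using Taylor_exp_field[of "h * of_real x" 0] by (simp add: mult.commute)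
  also have "\<dots> = norm h * (\<bar>x\<bar> * exp (norm h * \<bar>x\<bar>))"
    by (simp add: norm_mult)
  finally show ?thesis
    using assms by (simp add: norm_divide field_simps)
qed

text \<open>Differentiation under the integral. The complex variable is brought in solely to make
  the identity theorem available for transforms known on the positive reals.\<close>

lemma laplace_holomorphic:
  fixes \<mu> :: "real measure"
  assumes sets: "sets \<mu> = sets borel"
    and int: "\<And>\<theta>. 0 < \<theta> \<Longrightarrow> integrable \<mu> (\<lambda>x. exp (\<theta> * x))"
  shows "(\<lambda>z. \<integral>x. exp (z * complex_of_real x) \<partial>\<mu>) holomorphic_on {z. 0 < Re z}"
proof (rule holomorphic_onI)
  fix z :: complex assume "z \<in> {z. 0 < Re z}"
  define r where "r = Re z"
  then have r: "r > 0" using \<open>z \<in> _\<close> by simp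
  have [measurable]: "f \<in> borel_measurable \<mu>" if "f \<in> borel_measurable borel" for f :: "real \<Rightarrow> complex"
    using that sets measurable_cong_sets by blast
  \<comment> \<open>With \<open>r = Re z\<close> and \<open>norm h < r/4\<close>, the factors
    \<open>\<bar>x\<bar>\<close> and \<open>exp (norm h * \<bar>x\<bar>)\<close> each cost at most a
    multiple of \<open>exp ((r/4) * \<bar>x\<bar>)\<close>. The exponent thus moves from
    \<open>r\<close> at most to \<open>r/2\<close> or \<open>3*r/2\<close>; both are positive, where
    integrability is assumed.\<close>
  define w where "w x = (4/r) * (exp ((r/2) * x) + exp ((3*r/2) * x))" for x :: real
  have w: "integrable \<mu> w"
    unfolding w_def using r by (intro integrable_mult_right Bochner_Integration.integrable_add int) auto
  have bound: "norm (exp (z * of_real x) * ((exp (h * of_real x) - 1) / h)) \<le> w x"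
    if "h \<noteq> 0" "norm h < r/4" for h x
  proof -
    have "\<bar>x\<bar> * (r/4) \<le> exp (\<bar>x\<bar> * (r/4))"
      using exp_ge_add_one_self[of "\<bar>x\<bar> * (r/4)"] by linarith
    then have 1: "\<bar>x\<bar> \<le> (4/r) * exp ((r/4) * \<bar>x\<bar>)"
      using r by (simp add: field_simps)
    have "norm (exp (z * of_real x) * ((exp (h * of_real x) - 1) / h))
        \<le> exp (r * x) * (\<bar>x\<bar> * exp (norm h * \<bar>x\<bar>))"
    proof -
      have "norm (exp (z * of_real x)) = exp (r * x)" by (simp add: r_def)
      then show ?thesis
        using mult_left_mono[OF norm_exp_quotient_le[OF that(1), of x], of "exp (r * x)"]
        by (simp only: norm_mult) simp
    qed
    also have "\<dots> \<le> exp (r * x) * (((4/r) * exp ((r/4) * \<bar>x\<bar>)) * exp ((r/4) * \<bar>x\<bar>))"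
    proof -
      have "norm h * \<bar>x\<bar> \<le> (r/4) * \<bar>x\<bar>" using that by (intro mult_right_mono) auto
      then show ?thesis using 1 r by (intro mult_left_mono mult_mono) auto
    qed
    also have "\<dots> = (4/r) * exp (r * x + (r/2) * \<bar>x\<bar>)"
      by (simp add: exp_add[symmetric] field_simps)
    also have "\<dots> \<le> w x"
      unfolding w_def using r
      by (cases "x \<ge> 0") (auto intro!: divide_right_mono mult_left_mono simp: abs_if field_simps)
    finally show ?thesis .
  qed
  have intz: "integrable \<mu> (\<lambda>x. exp (v * complex_of_real x))" if "Re v > 0" for v
    by (rule Bochner_Integration.integrable_bound[OF int[OF that]]) auto
  have "((\<lambda>h. \<integral>x. exp (z * of_real x) * ((exp (h * of_real x) - 1) / h) \<partial>\<mu>) \<longlongrightarrow>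
         (\<integral>x. exp (z * of_real x) * of_real x \<partial>\<mu>)) (at 0)"
  proof (rule tendsto_integral_at_within[where w=w])
    have "((\<lambda>h. (exp (h * complex_of_real x) - 1) / h) \<longlongrightarrow> of_real x) (at 0)" for x
    proof -
      have "((\<lambda>h. exp (h * complex_of_real x)) has_field_derivative of_real x) (at 0)"
        by (auto intro!: derivative_eq_intros)
      then show ?thesis by (simp add: DERIV_def)
    qed
    then show "AE x in \<mu>. ((\<lambda>h. exp (z * complex_of_real x) * ((exp (h * complex_of_real x) - 1) / h)) \<longlongrightarrow>
        exp (z * complex_of_real x) * complex_of_real x) (at 0)"
      by (intro AE_I2 tendsto_mult) auto
    show "\<forall>\<^sub>F h in at 0. AE x in \<mu>.
       norm (exp (z * complex_of_real x) * ((exp (h * complex_of_real x) - 1) / h)) \<le> w x"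
      unfolding eventually_at using r
      by (intro exI[of _ "r/4"] conjI ballI impI AE_I2 bound) auto
  qed (use w in auto)
  then have "((\<lambda>h. ((\<integral>x. exp ((z + h) * complex_of_real x) \<partial>\<mu>) - (\<integral>x. exp (z * complex_of_real x) \<partial>\<mu>)) / h) \<longlongrightarrow>
         (\<integral>x. exp (z * of_real x) * of_real x \<partial>\<mu>)) (at 0)"
  proof (rule Lim_transform_eventually)
    have "(\<integral>x. exp (z * of_real x) * ((exp (h * of_real x) - 1) / h) \<partial>\<mu>) =
      ((\<integral>x. exp ((z + h) * of_real x) \<partial>\<mu>) - (\<integral>x. exp (z * of_real x) \<partial>\<mu>)) / h"
      if "h \<noteq> 0" "norm h < r" for h
    proof -
      have "Re (z + h) > 0"
        using abs_Re_le_cmod[of h] that by (auto simp: r_def)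
      then have "integrable \<mu> (\<lambda>x. exp ((z+h) * complex_of_real x))" by (rule intz)
      moreover have "integrable \<mu> (\<lambda>x. exp (z * complex_of_real x))"
        using r by (intro intz) (simp add: r_def)
      ultimately have "(\<integral>x. exp ((z + h) * of_real x) \<partial>\<mu>) - (\<integral>x. exp (z * of_real x) \<partial>\<mu>)
          = (\<integral>x. exp ((z + h) * of_real x) - exp (z * of_real x) \<partial>\<mu>)" by simp
      also have "\<dots> / h = (\<integral>x. (exp ((z + h) * of_real x) - exp (z * of_real x)) / h \<partial>\<mu>)"
        by simp
      also have "\<dots> = (\<integral>x. exp (z * of_real x) * ((exp (h * of_real x) - 1) / h) \<partial>\<mu>)"
        by (intro Bochner_Integration.integral_cong) (auto simp: exp_add algebra_simps diff_divide_distrib)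
      finally show ?thesis by (rule sym)
    qed
    then show "\<forall>\<^sub>F h in at 0. (\<integral>x. exp (z * of_real x) * ((exp (h * of_real x) - 1) / h) \<partial>\<mu>) =
      ((\<integral>x. exp ((z + h) * of_real x) \<partial>\<mu>) - (\<integral>x. exp (z * of_real x) \<partial>\<mu>)) / h"
      unfolding eventually_at using r by (intro exI[of _ r]) auto
  qed
  then have "((\<lambda>z. \<integral>x. exp (z * complex_of_real x) \<partial>\<mu>) has_field_derivative
      (\<integral>x. exp (z * of_real x) * of_real x \<partial>\<mu>)) (at z)"
    by (simp add: DERIV_def)
  then show "(\<lambda>z. \<integral>x. exp (z * complex_of_real x) \<partial>\<mu>) field_differentiable at z within {z. 0 < Re z}"
    by (meson field_differentiable_at_within field_differentiable_def)
qed

text \<open>Both transforms are holomorphic on the right half-plane and agree on the positive reals,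
  hence on the whole half-plane. The imaginary axis lies on the boundary, so the characteristic
  functions are reached as limits for real parts decreasing to 0, dominated by
  \<open>1 + exp x\<close>.\<close>

theorem has_laplace_unique:
  assumes \<mu>: "has_laplace \<mu> L" and \<nu>: "has_laplace \<nu> L"
  shows "\<mu> = \<nu>"
proof -
  define F where "F \<rho> z = (\<integral>x. exp (z * complex_of_real x) \<partial>\<rho>)" for \<rho> and z :: complex
  have real: "F \<rho> (of_real \<theta>) = of_real (L \<theta>)" if "has_laplace \<rho> L" "\<theta> \<ge> 0" for \<rho> \<theta>
  proof -
    have "F \<rho> (of_real \<theta>) = (\<integral>x. complex_of_real (exp (\<theta> * x)) \<partial>\<rho>)"
      unfolding F_def by (simp add: exp_of_real[symmetric])
    then show ?thesis using that by (simp only: integral_complex_of_real has_laplace_def)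
  qed
  have hol: "F \<rho> holomorphic_on {z. 0 < Re z}" if "has_laplace \<rho> L" for \<rho>
    unfolding F_def using that real_distribution.events_eq_borel
    by (intro laplace_holomorphic) (auto simp: has_laplace_def)
  have eq: "F \<mu> z = F \<nu> z" if "0 < Re z" for z
  proof -
    let ?S = "{z. 0 < Re z}" and ?U = "of_real ` {0<..} :: complex set"
    have "(1::complex) islimpt ?U"
    proof -
      have "(1::real) islimpt {0<..}"
        by (intro interior_limit_point) (auto simp: interior_open)
      then have "\<exists>f. (\<forall>n. f n \<in> {0<..} - {1::real}) \<and> f \<longlonglongrightarrow> 1"
        by (simp add: islimpt_sequential)
      then obtain f where f: "\<forall>n. f n \<in> {0<..} - {1::real}" "f \<longlonglongrightarrow> 1" by blast
      then show ?thesis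
        unfolding islimpt_sequential
        by (intro exI[of _ "\<lambda>n. of_real (f n)"]) (auto intro!: tendsto_eq_intros)
    qed
    have "F \<mu> z - F \<nu> z = 0"
    proof (rule analytic_continuation[of "\<lambda>z. F \<mu> z - F \<nu> z" ?S ?U 1])
      show "(\<lambda>z. F \<mu> z - F \<nu> z) holomorphic_on ?S"
        by (intro holomorphic_on_diff hol \<mu> \<nu>)
      show "open ?S" by (simp add: open_halfspace_Re_gt)
      show "connected ?S" by (intro convex_connected convex_halfspace_Re_gt)
    qed (use that \<open>1 islimpt ?U\<close> real[OF \<mu>] real[OF \<nu>] in auto)
    then show ?thesis by simp
  qed
  have lim: "((\<lambda>\<delta>. F \<rho> (Complex \<delta> t)) \<longlongrightarrow> char \<rho> t) (at_right 0)" if "has_laplace \<rho> L" for \<rho> t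
  proof -
    interpret real_distribution \<rho> using that by (simp add: has_laplace_def)
    have i1: "integrable \<rho> (\<lambda>x. exp x)"
      using that by (auto simp: has_laplace_def dest!: spec[of _ 1])
    show ?thesis
      unfolding F_def char_def
    proof (rule tendsto_integral_at_within[where w="\<lambda>x. 1 + exp x"])
      show "AE x in \<rho>. ((\<lambda>h. exp (Complex h t * complex_of_real x)) \<longlongrightarrow> iexp (t * x)) (at_right 0)"
        unfolding Complex_eq by (intro AE_I2) (auto intro!: tendsto_eq_intros simp: algebra_simps)
      have "exp (h * x) \<le> 1 + exp x" if "0 < h" "h < 1" for h x :: real
      proof (cases "x \<ge> 0")
        case True
        then have "h * x \<le> x" using that by (simp add: mult_left_le_one_le)
        then show ?thesis by (smt (verit) exp_le_cancel_iff)
      next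
        case False
        then have "exp (h * x) \<le> 1" using that by (simp add: mult_nonneg_nonpos)
        then show ?thesis by (smt (verit) exp_gt_zero)
      qed
      then show "\<forall>\<^sub>F h in at_right 0. AE x in \<rho>. norm (exp (Complex h t * complex_of_real x)) \<le> 1 + exp x"
        unfolding eventually_at by (intro exI[of _ 1]) auto
    qed (use i1 in \<open>auto simp: Complex_eq\<close>)
  qed
  have "char \<mu> = char \<nu>"
  proof
    fix t
    have "((\<lambda>\<delta>. F \<mu> (Complex \<delta> t)) \<longlongrightarrow> char \<nu> t) (at_right 0)"
      using lim[OF \<nu>, of t]
      by (rule Lim_transform_eventually) (auto simp: eventually_at eq intro!: exI[of _ 1])
    with lim[OF \<mu>, of t] show "char \<mu> t = char \<nu> t"
      by (intro tendsto_unique[of "at_right (0::real)"]) auto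
  qed
  then show ?thesis
    using \<mu> \<nu> by (intro Levy_uniqueness) (auto simp: has_laplace_def)
qed

text \<open>Almost sure convergence controls bounded test functions only. Truncation at level
  \<open>k\<close> costs at most \<open>exp (2 * \<theta> * y) / k\<close>, and the transforms at
  \<open>2 * \<theta>\<close> converge, so the cost is uniformly small in \<open>n\<close>. Monotone
  convergence in \<open>k\<close> then gives integrability and the value together.\<close>

lemma laplace_AE_limit:
  fixes X :: "nat \<Rightarrow> 'a \<Rightarrow> real"
  assumes "prob_space M" and [measurable]: "\<And>n. X n \<in> borel_measurable M" "Y \<in> borel_measurable M"
    and lim: "AE \<omega> in M. (\<lambda>n. X n \<omega>) \<longlonglongrightarrow> Y \<omega>"
    and lap: "\<And>n. has_laplace (distr M borel (X n)) (L n)"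
    and conv: "\<And>\<theta>. 0 \<le> \<theta> \<Longrightarrow> (\<lambda>n. L n \<theta>) \<longlonglongrightarrow> K \<theta>"
  shows "has_laplace (distr M borel Y) K"
proof -
  interpret prob_space M by fact
  have int: "integrable M (\<lambda>\<omega>. exp (\<theta> * X n \<omega>))" and
       eq: "(\<integral>\<omega>. exp (\<theta> * X n \<omega>) \<partial>M) = L n \<theta>" if "\<theta> \<ge> 0" for \<theta> n
    using lap[of n] that by (auto simp: has_laplace_distr[OF prob_space_axioms])
  have "has_bochner_integral M (\<lambda>\<omega>. exp (\<theta> * Y \<omega>)) (K \<theta>)" if \<theta>: "\<theta> \<ge> 0" for \<theta>
  proof -
    define T where "T k y = min (exp (\<theta> * y)) (real k)" for k :: nat and y
    have [measurable]: "T k \<in> borel_measurable borel" for k unfolding T_def by measurable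
    have bT: "norm (T k y) \<le> real k" for k y unfolding T_def by auto
    have iT: "integrable M (\<lambda>\<omega>. T k (Z \<omega>))" if [measurable]: "Z \<in> borel_measurable M" for Z k
      by (rule integrable_const_bound[where B="real k"]) (use bT in auto)
    have limT: "(\<lambda>n. \<integral>\<omega>. T k (X n \<omega>) \<partial>M) \<longlonglongrightarrow> (\<integral>\<omega>. T k (Y \<omega>) \<partial>M)" for k
    proof (rule integral_dominated_convergence[where w="\<lambda>_. real k"])
      show "AE x in M. (\<lambda>i. T k (X i x)) \<longlonglongrightarrow> T k (Y x)"
        using lim by eventually_elim (auto simp: T_def intro!: tendsto_intros)
    qed (use bT in auto)
    have tail: "exp (\<theta> * y) - T k y \<le> exp (2 * \<theta> * y) / k" if "k > 0" for k y
    proof (cases "exp (\<theta> * y) \<le> k")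
      case False
      then have "exp (\<theta> * y) * k \<le> exp (\<theta> * y) * exp (\<theta> * y)" by simp
      then show ?thesis using that False
        by (simp add: T_def exp_add[symmetric] field_simps) (metis add_increasing zero_le_square)
    qed (simp add: T_def)
    have up: "(\<integral>\<omega>. T k (Y \<omega>) \<partial>M) \<le> K \<theta>" for k
      by (rule LIMSEQ_le[OF limT conv[OF \<theta>]])
        (auto intro!: exI[of _ 0] integral_mono iT int \<theta> simp: eq[OF \<theta>, symmetric] T_def)
    have low: "K \<theta> - K (2 * \<theta>) / k \<le> (\<integral>\<omega>. T k (Y \<omega>) \<partial>M)" if "k > 0" for k
    proof (rule LIMSEQ_le[OF _ limT])
      show "(\<lambda>n. L n \<theta> - L n (2 * \<theta>) / k) \<longlonglongrightarrow> K \<theta> - K (2 * \<theta>) / k"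
        using \<theta> by (intro tendsto_intros conv) (use that in auto)
      have "L n \<theta> - L n (2 * \<theta>) / k \<le> (\<integral>\<omega>. T k (X n \<omega>) \<partial>M)" for n
      proof -
        have "(\<integral>\<omega>. exp (\<theta> * X n \<omega>) - T k (X n \<omega>) \<partial>M) \<le> (\<integral>\<omega>. exp (2 * \<theta> * X n \<omega>) / k \<partial>M)"
          using \<theta> that by (intro integral_mono Bochner_Integration.integrable_diff iT int tail integrable_divide) auto
        then show ?thesis
          using \<theta> eq[of "2*\<theta>" n] by (simp add: iT int eq)
      qed
      then show "\<exists>N. \<forall>n\<ge>N. L n \<theta> - L n (2 * \<theta>) / k \<le> (\<integral>\<omega>. T k (X n \<omega>) \<partial>M)" by blast
    qed
    have "(\<lambda>k. \<integral>\<omega>. T k (Y \<omega>) \<partial>M) \<longlonglongrightarrow> K \<theta>"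
    proof (rule tendsto_sandwich)
      show "\<forall>\<^sub>F k in sequentially. K \<theta> - K (2 * \<theta>) / k \<le> (\<integral>\<omega>. T k (Y \<omega>) \<partial>M)"
        using low by (auto simp: eventually_sequentially intro!: exI[of _ 1])
      have "(\<lambda>k. K \<theta> - K (2 * \<theta>) / real k) \<longlonglongrightarrow> K \<theta> - 0"
        by (intro tendsto_intros lim_const_over_n)
      then show "(\<lambda>k. K \<theta> - K (2 * \<theta>) / real k) \<longlonglongrightarrow> K \<theta>" by simp
    qed (use up in auto)
    moreover have "(\<lambda>k. T k y) \<longlonglongrightarrow> exp (\<theta> * y)" for y
    proof -
      have "\<forall>\<^sub>F k in sequentially. T k y = exp (\<theta> * y)"
        using eventually_ge_at_top[of "nat \<lceil>exp (\<theta> * y)\<rceil>"]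
        by eventually_elim (auto simp: T_def nat_ceiling_le_eq)
      then show ?thesis by (rule tendsto_eventually)
    qed
    ultimately show ?thesis
      by (intro has_bochner_integral_monotone_convergence[of M "\<lambda>k \<omega>. T k (Y \<omega>)"])
         (use iT in \<open>auto simp: mono_def T_def\<close>)
  qed
  then show ?thesis
    by (auto simp: has_laplace_distr[OF prob_space_axioms] has_bochner_integral_iff)
qed

text \<open>Skorohod's representation turns weak convergence into almost sure convergence on another
  space.\<close>

lemma laplace_weak_limit:
  assumes "\<And>n. has_laplace (\<nu> n) (L n)" "real_distribution \<mu>" "weak_conv_m \<nu> \<mu>"
    and "\<And>\<theta>. 0 \<le> \<theta> \<Longrightarrow> (\<lambda>n. L n \<theta>) \<longlonglongrightarrow> K \<theta>"
  shows "has_laplace \<mu> K"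
proof -
  have rd: "real_distribution (\<nu> n)" for n using assms(1) by (simp add: has_laplace_def)
  obtain \<Omega> :: "real measure" and Y_seq Y where *: "prob_space \<Omega>" "\<And>n. Y_seq n \<in> borel_measurable \<Omega>"
    "\<And>n. distr \<Omega> borel (Y_seq n) = \<nu> n" "Y \<in> borel_measurable \<Omega>" "distr \<Omega> borel Y = \<mu>"
    "\<And>x. x \<in> space \<Omega> \<Longrightarrow> (\<lambda>n. Y_seq n x) \<longlonglongrightarrow> Y x"
    using Skorohod[OF rd assms(2,3)] by auto metis
  have "has_laplace (distr \<Omega> borel Y) K"
    by (rule laplace_AE_limit[of \<Omega> Y_seq Y L]) (use * assms in auto)
  with * show ?thesis by simp
qed

text \<open>Right tails are bounded by Markov's inequality for \<open>exp x\<close>. For left tails,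
  \<open>1 - L n \<theta>\<close> is small at small \<theta> because \<open>K\<close> tends to 1 at
  0, whereas \<open>1 - exp (\<theta> * x)\<close> is at least 1/2 far to the left.\<close>

lemma laplace_tight:
  assumes lap: "\<And>n. has_laplace (\<nu> n) (L n)"
    and conv: "\<And>\<theta>. 0 \<le> \<theta> \<Longrightarrow> (\<lambda>n. L n \<theta>) \<longlonglongrightarrow> K \<theta>"
    and cont: "(K \<longlongrightarrow> 1) (at_right 0)"
  shows "tight \<nu>"
  unfolding tight_def
proof (intro conjI allI impI)
  show rd: "real_distribution (\<nu> n)" for n using lap by (simp add: has_laplace_def)
  fix \<epsilon> :: real assume "\<epsilon> > 0"
  have int: "integrable (\<nu> n) (\<lambda>x. exp (\<theta> * x))" and
       eq: "(\<integral>x. exp (\<theta> * x) \<partial>(\<nu> n)) = L n \<theta>" if "\<theta> \<ge> 0" for \<theta> n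
    using lap[of n] that by (auto simp: has_laplace_def)
  interpret \<nu>: real_distribution "\<nu> n" for n by (rule rd)
  have Lpos: "L n \<theta> \<ge> 0" if "\<theta> \<ge> 0" for n \<theta>
    using eq[OF that, of n, symmetric] by simp
  have bdd: "\<exists>B>0. \<forall>n. L n \<theta> \<le> B" if "\<theta> \<ge> 0" for \<theta>
  proof -
    have "Bseq (\<lambda>n. L n \<theta>)" using conv[OF that] by (intro convergent_imp_Bseq convergentI)
    then show ?thesis by (auto elim!: BseqE simp: abs_le_iff)
  qed
  obtain B1 where B1: "B1 > 0" "\<And>n. L n 1 \<le> B1" using bdd[of 1] by auto
  obtain B2 where B2: "B2 > 0" "\<And>n. L n 2 \<le> B2" using bdd[of 2] by auto
  \<comment> \<open>Makes \<open>exp b\<close> at least \<open>B1 * 4 / \<epsilon>\<close>, so that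
    Markov's inequality leaves at most \<open>\<epsilon> / 4\<close>.\<close>
  define b where "b = \<bar>ln (B1 * 4 / \<epsilon>)\<bar> + 1"
  have right: "measure (\<nu> n) {b<..} < \<epsilon> / 2" for n
  proof -
    have "measure (\<nu> n) {b<..} * exp b = (\<integral>x. exp b * indicator {b<..} x \<partial>\<nu> n)" by simp
    also have "\<dots> \<le> (\<integral>x. exp (1 * x) \<partial>\<nu> n)"
      by (intro integral_mono int integrable_mult_right \<nu>.integrable_const_bound[where B=1]) (auto split: split_indicator)
    also have "\<dots> \<le> B1" using B1(2)[of n] eq[of 1 n] by simp
    finally have "measure (\<nu> n) {b<..} * exp b \<le> B1" .
    moreover have "B1 * 4 / \<epsilon> \<le> exp b"
    proof -
      have "B1 * 4 / \<epsilon> = exp (ln (B1 * 4 / \<epsilon>))" using B1 \<open>\<epsilon> > 0\<close> by simp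
      also have "\<dots> \<le> exp b" unfolding b_def by (subst exp_le_cancel_iff) linarith
      finally show ?thesis .
    qed
    ultimately have "measure (\<nu> n) {b<..} * (B1 * 4 / \<epsilon>) \<le> B1"
      by (meson measure_nonneg mult_left_mono order_trans)
    then have "measure (\<nu> n) {b<..} \<le> \<epsilon> / 4"
      using B1(1) \<open>\<epsilon> > 0\<close> by (simp add: field_simps)
    then show ?thesis using \<open>\<epsilon> > 0\<close> by simp
  qed
  have left: "\<exists>a. \<forall>n. measure (\<nu> n) {..a} < \<epsilon> / 2"
  proof -
    \<comment> \<open>For \<open>x > 0\<close> the function \<open>1 - exp (\<theta> * x)\<close> is
      negative. Adding \<open>\<theta> * exp (2 * x)\<close> makes it nonnegative everywhere, at a
      price of at most \<open>\<theta> * B2\<close> in the integral.\<close>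
    have "((\<lambda>\<theta>. 1 - K \<theta> + \<theta> * B2) \<longlongrightarrow> 1 - 1 + 0 * B2) (at_right 0)"
      by (intro tendsto_intros cont)
    then have "eventually (\<lambda>\<theta>. 1 - K \<theta> + \<theta> * B2 < \<epsilon> / 4) (at_right 0)"
      using \<open>\<epsilon> > 0\<close> by (intro order_tendstoD(2)[of _ 0]) auto
    moreover have "eventually (\<lambda>\<theta>::real. 0 < \<theta> \<and> \<theta> < 1) (at_right 0)"
      by (auto simp: eventually_at intro!: exI[of _ 1])
    ultimately have "eventually (\<lambda>\<theta>. 1 - K \<theta> + \<theta> * B2 < \<epsilon> / 4 \<and> 0 < \<theta> \<and> \<theta> < 1) (at_right 0)"
      by eventually_elim auto
    then obtain \<theta> where \<theta>: "1 - K \<theta> + \<theta> * B2 < \<epsilon> / 4" "0 < \<theta>" "\<theta> < 1"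
      using eventually_happens'[of "at_right (0::real)"] by (auto simp: trivial_limit_at_right_real)
    have "(\<lambda>n. 1 - L n \<theta> + \<theta> * B2) \<longlonglongrightarrow> 1 - K \<theta> + \<theta> * B2"
      using \<theta> by (intro tendsto_intros conv) auto
    then have "eventually (\<lambda>n. 1 - L n \<theta> + \<theta> * B2 < \<epsilon> / 4) sequentially"
      using \<theta>(1) by (rule order_tendstoD)
    then obtain N where N: "\<And>n. n \<ge> N \<Longrightarrow> 1 - L n \<theta> + \<theta> * B2 < \<epsilon> / 4"
      by (auto simp: eventually_sequentially)
    define a0 where "a0 = - (ln 2 / \<theta>)"
    have a0: "exp (\<theta> * a0) = 1/2" using \<theta> by (simp add: a0_def exp_minus)
    have a0': "a0 < 0" using \<theta> by (simp add: a0_def)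
    have big: "measure (\<nu> n) {..a0} < \<epsilon> / 2" if "n \<ge> N" for n
    proof -
      have "measure (\<nu> n) {..a0} * (1/2) = (\<integral>x. (1/2) * indicator {..a0} x \<partial>\<nu> n)" by simp
      also have "\<dots> \<le> (\<integral>x. 1 - exp (\<theta> * x) + \<theta> * exp (2 * x) \<partial>\<nu> n)"
      proof (intro integral_mono)
        show "integrable (\<nu> n) (\<lambda>x. (1/2) * indicator {..a0} x :: real)"
          by (intro \<nu>.integrable_const_bound[where B=1]) (auto split: split_indicator)
        show "integrable (\<nu> n) (\<lambda>x. 1 - exp (\<theta> * x) + \<theta> * exp (2 * x))"
          using \<theta> int by auto
        fix x
        have *: "exp (\<theta> * x) - 1 \<le> \<theta> * exp (2 * x)" if "x \<ge> 0"
        proof -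
          have "exp (\<theta> * x) * (1 - \<theta> * x) \<le> exp (\<theta> * x) * exp (- (\<theta> * x))"
            using exp_ge_add_one_self[of "- (\<theta> * x)"] by (intro mult_left_mono) auto
          then have "exp (\<theta> * x) - 1 \<le> \<theta> * (x * exp (\<theta> * x))"
            by (simp add: exp_minus algebra_simps)
          also have "\<dots> \<le> \<theta> * (exp x * exp x)"
          proof -
            have "x \<le> exp x" using exp_ge_add_one_self[of x] by linarith
            moreover have "exp (\<theta> * x) \<le> exp x" using \<theta> that by (simp add: mult_left_le_one_le)
            ultimately show ?thesis using \<theta> that by (intro mult_left_mono mult_mono) auto
          qed
          finally show ?thesis by (simp add: exp_add[symmetric])
        qed
        show "1/2 * indicator {..a0} x \<le> 1 - exp (\<theta> * x) + \<theta> * exp (2 * x)"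
        proof (cases "x \<le> a0")
          case True
          then have "exp (\<theta> * x) \<le> 1/2" unfolding a0[symmetric] using \<theta> by simp
          moreover have "0 \<le> \<theta> * exp (2 * x)" using \<theta> by simp
          ultimately show ?thesis using True by simp
        next
          case False
          have "exp (\<theta> * x) - 1 \<le> \<theta> * exp (2 * x)"
          proof (cases "x \<ge> 0")
            case False
            then have "exp (\<theta> * x) \<le> 1" using \<theta> by (simp add: mult_nonneg_nonpos)
            moreover have "0 \<le> \<theta> * exp (2 * x)" using \<theta> by simp
            ultimately show ?thesis by linarith
          qed (rule *)
          then show ?thesis using False by simp
        qed
      qed
      also have "\<dots> = 1 - L n \<theta> + \<theta> * L n 2"
        using \<theta> int[of \<theta> n] int[of 2 n] eq[of \<theta> n] eq[of 2 n] by (simp add: \<nu>.prob_space[of n, unfolded \<nu>.space_eq_univ])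
      also have "\<dots> \<le> 1 - L n \<theta> + \<theta> * B2" using B2(2)[of n] \<theta> by (simp add: mult_left_mono)
      also have "\<dots> < \<epsilon> / 4" using N[OF that] .
      finally show ?thesis by simp
    qed
    \<comment> \<open>\<open>a0\<close> serves all \<open>n \<ge> N\<close>; each of the finitely
      many other laws has its own small left tail.\<close>
    have "\<exists>a. measure (\<nu> n) {..a} < \<epsilon> / 2" for n
    proof -
      have "eventually (\<lambda>a. cdf (\<nu> n) a < \<epsilon> / 2) at_bot"
        using \<nu>.cdf_lim_at_bot[of n] \<open>\<epsilon> > 0\<close> by (intro order_tendstoD) auto
      then show ?thesis unfolding cdf_def eventually_at_bot_linorder by blast
    qed
    then obtain a1 where a1: "\<And>n. measure (\<nu> n) {..a1 n} < \<epsilon> / 2" by metis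
    define a where "a = Min (insert a0 (a1 ` {..<N}))"
    have "measure (\<nu> n) {..a} < \<epsilon> / 2" for n
    proof (cases "n < N")
      case True
      then have "a \<le> a1 n" unfolding a_def by (intro Min_le) auto
      then have "measure (\<nu> n) {..a} \<le> measure (\<nu> n) {..a1 n}" by (intro \<nu>.finite_measure_mono) auto
      then show ?thesis using a1[of n] by simp
    next
      case False
      have "a \<le> a0" unfolding a_def by (intro Min_le) auto
      then have "measure (\<nu> n) {..a} \<le> measure (\<nu> n) {..a0}" by (intro \<nu>.finite_measure_mono) auto
      then show ?thesis using big[of n] False by simp
    qed
    then show ?thesis by blast
  qed
  then obtain a where a: "\<And>n. measure (\<nu> n) {..a} < \<epsilon> / 2" by auto
  have "measure (\<nu> n) {min a 0<..b} > 1 - \<epsilon>" for n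
  proof -
    have "measure (\<nu> n) (UNIV - {min a 0<..b}) \<le> measure (\<nu> n) ({..a} \<union> {b<..})"
      by (intro \<nu>.finite_measure_mono) auto
    also have "\<dots> \<le> measure (\<nu> n) {..a} + measure (\<nu> n) {b<..}"
      by (intro measure_Un_le) auto
    also have "\<dots> < \<epsilon>" using a[of n] right[of n] by simp
    finally show ?thesis
      using \<nu>.prob_compl[of "{min a 0<..b}" n] by (simp add: \<nu>.space_eq_univ)
  qed
  moreover have "min a 0 < b" unfolding b_def by linarith
  ultimately show "\<exists>a b. a < b \<and> (\<forall>n. 1 - \<epsilon> < measure (\<nu> n) {a<..b})" by blast
qed

text \<open>The continuity theorem for one-sided transforms. The subsequence is part of the
  conclusion because the Levy--Khintchine limit integrates bounded continuous functions along
  it.\<close>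

theorem laplace_closure:
  assumes lap: "\<And>n. has_laplace (\<nu> n) (L n)"
    and conv: "\<And>\<theta>. 0 \<le> \<theta> \<Longrightarrow> (\<lambda>n. L n \<theta>) \<longlonglongrightarrow> K \<theta>"
    and cont: "(K \<longlongrightarrow> 1) (at_right 0)"
  obtains s \<mu> where "strict_mono s" "has_laplace \<mu> K" "weak_conv_m (\<nu> \<circ> s) \<mu>"
proof -
  obtain s \<mu> where *: "strict_mono (s :: nat \<Rightarrow> nat)" "real_distribution \<mu>" "weak_conv_m (\<nu> \<circ> s) \<mu>"
    using tight_imp_convergent_subsubsequence[OF laplace_tight[OF assms] strict_mono_id] by auto
  have "has_laplace \<mu> K"
  proof (rule laplace_weak_limit[of "\<nu> \<circ> s" "L \<circ> s"])
    fix \<theta> :: real assume "0 \<le> \<theta>"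
    from LIMSEQ_subseq_LIMSEQ[OF conv[OF this] *(1)]
    show "(\<lambda>n. (L \<circ> s) n \<theta>) \<longlonglongrightarrow> K \<theta>" by (simp add: o_def)
  qed (use * lap in auto)
  with * show ?thesis using that by blast
qed

lemma has_laplace_nnI:
  assumes "real_distribution \<mu>"
    and "\<And>\<theta>. 0 \<le> \<theta> \<Longrightarrow> (\<integral>\<^sup>+x. ennreal (exp (\<theta> * x)) \<partial>\<mu>) = ennreal (L \<theta>)"
    and "\<And>\<theta>. 0 \<le> \<theta> \<Longrightarrow> 0 \<le> L \<theta>"
  shows "has_laplace \<mu> L"
proof -
  interpret real_distribution \<mu> by fact
  have "has_bochner_integral \<mu> (\<lambda>x. exp (\<theta> * x)) (L \<theta>)" if "0 \<le> \<theta>" for \<theta>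
    using assms(2,3)[OF that] by (intro has_bochner_integral_nn_integral) auto
  then show ?thesis
    using assms(1) by (auto simp: has_laplace_def has_bochner_integral_iff)
qed

lemma has_laplace_nnD:
  assumes "has_laplace \<mu> L" "0 \<le> \<theta>"
  shows "(\<integral>\<^sup>+x. ennreal (exp (\<theta> * x)) \<partial>\<mu>) = ennreal (L \<theta>)" and "0 \<le> L \<theta>"
proof -
  have i: "integrable \<mu> (\<lambda>x. exp (\<theta> * x))" and e: "(\<integral>x. exp (\<theta> * x) \<partial>\<mu>) = L \<theta>"
    using assms by (auto simp: has_laplace_def)
  show "(\<integral>\<^sup>+x. ennreal (exp (\<theta> * x)) \<partial>\<mu>) = ennreal (L \<theta>)"
    using nn_integral_eq_integral[OF i] e by simp
  show "0 \<le> L \<theta>" unfolding e[symmetric] by simp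
qed

lemma has_laplace_convolution:
  assumes "has_laplace \<mu> L" "has_laplace \<nu> K"
  shows "has_laplace (\<mu> \<star> \<nu>) (\<lambda>\<theta>. L \<theta> * K \<theta>)"
proof (rule has_laplace_nnI)
  interpret \<mu>: real_distribution \<mu> using assms by (simp add: has_laplace_def)
  interpret \<nu>: real_distribution \<nu> using assms by (simp add: has_laplace_def)
  have nn: "(\<integral>\<^sup>+x. f x \<partial>(\<mu> \<star> \<nu>)) = (\<integral>\<^sup>+x. \<integral>\<^sup>+y. f (x + y) \<partial>\<nu> \<partial>\<mu>)" if "f \<in> borel_measurable borel" for f
    by (intro nn_integral_convolution that \<mu>.finite_measure_axioms \<nu>.finite_measure_axioms) auto
  show "real_distribution (\<mu> \<star> \<nu>)"
  proof (intro real_distribution.intro prob_spaceI real_distribution_axioms.intro)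
    show "emeasure (\<mu> \<star> \<nu>) (space (\<mu> \<star> \<nu>)) = 1"
      using nn[of "\<lambda>_. 1"] using \<mu>.emeasure_space_1 \<nu>.emeasure_space_1
      by (simp add: \<mu>.space_eq_univ \<nu>.space_eq_univ)
  qed simp
  fix \<theta> :: real assume \<theta>: "0 \<le> \<theta>"
  have "(\<integral>\<^sup>+x. ennreal (exp (\<theta> * x)) \<partial>(\<mu> \<star> \<nu>)) =
    (\<integral>\<^sup>+x. ennreal (exp (\<theta> * x)) * (\<integral>\<^sup>+y. ennreal (exp (\<theta> * y)) \<partial>\<nu>) \<partial>\<mu>)"
    by (subst nn) (auto intro!: nn_integral_cong simp: distrib_left exp_add ennreal_mult' nn_integral_cmult)
  then show "(\<integral>\<^sup>+x. ennreal (exp (\<theta> * x)) \<partial>(\<mu> \<star> \<nu>)) = ennreal (L \<theta> * K \<theta>)"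
    using has_laplace_nnD[OF assms(1) \<theta>] has_laplace_nnD[OF assms(2) \<theta>]
    by (simp add: nn_integral_multc ennreal_mult)
  show "0 \<le> L \<theta> * K \<theta>"
    using has_laplace_nnD[OF assms(1) \<theta>] has_laplace_nnD[OF assms(2) \<theta>] by simp
qed

lemma has_laplace_power:
  assumes "has_laplace \<mu> L"
  shows "\<exists>\<nu>. has_laplace \<nu> (\<lambda>\<theta>. L \<theta> ^ n)"
proof (induction n)
  case 0
  interpret prob_space "return borel (0::real)" by (rule prob_space_return) simp
  have "has_laplace (return borel 0) (\<lambda>\<theta>. L \<theta> ^ 0)"
    by (rule has_laplace_nnI)
      (auto simp: nn_integral_return intro!: real_distribution.intro real_distribution_axioms.intro prob_space_axioms)
  then show ?case by blast
next
  case (Suc n)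
  then show ?case using has_laplace_convolution[OF assms] by auto
qed

text \<open>\<open>ln (1 + y)\<close> differs from \<open>y\<close> by at most
  \<open>2 * y\<^sup>2\<close>. At \<open>y = x n / m n\<close>, after multiplication by
  \<open>m n\<close>, the error is of order \<open>1 / m n\<close>.\<close>

lemma tendsto_one_plus_power_exp:
  fixes x :: "nat \<Rightarrow> real" and m :: "nat \<Rightarrow> nat"
  assumes "x \<longlonglongrightarrow> c" and m: "filterlim m at_top sequentially"
  shows "(\<lambda>n. (1 + x n / m n) ^ m n) \<longlonglongrightarrow> exp c"
proof -
  have rm: "filterlim (\<lambda>n. real (m n)) at_top sequentially"
    using filterlim_compose[OF filterlim_real_sequentially m] by (simp add: o_def)
  have im: "(\<lambda>n. 1 / real (m n)) \<longlonglongrightarrow> 0"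
    using tendsto_divide_0[OF tendsto_const filterlim_at_top_imp_at_infinity[OF rm]] by auto
  have y0: "(\<lambda>n. x n / m n) \<longlonglongrightarrow> 0"
    using tendsto_mult[OF assms(1) im] by simp
  have "\<forall>\<^sub>F n in sequentially. -1/2 < x n / m n" "\<forall>\<^sub>F n in sequentially. x n / m n < 1/2"
    by (rule order_tendstoD[OF y0]; simp)+
  then have small: "\<forall>\<^sub>F n in sequentially. \<bar>x n / m n\<bar> \<le> 1/2"
    by eventually_elim linarith
  have pos: "\<forall>\<^sub>F n in sequentially. 1 \<le> real (m n)"
    using rm unfolding filterlim_at_top by blast
  have "(\<lambda>n. real (m n) * ln (1 + x n / m n) - x n) \<longlonglongrightarrow> 0"
  proof (rule Lim_null_comparison)
    show "(\<lambda>n. 2 * (x n)\<^sup>2 * (1 / m n)) \<longlonglongrightarrow> 0"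
      using tendsto_mult[OF tendsto_mult[OF tendsto_const tendsto_power[OF assms(1)]] im, of 2 2] by simp
    show "\<forall>\<^sub>F n in sequentially. norm (real (m n) * ln (1 + x n / m n) - x n) \<le> 2 * (x n)\<^sup>2 * (1 / m n)"
      using small pos
    proof eventually_elim
      case (elim n)
      have "\<bar>ln (1 + x n / m n) - x n / m n\<bar> \<le> 2 * (x n / m n)\<^sup>2"
        using elim by (intro abs_ln_one_plus_x_minus_x_bound) auto
      then have "real (m n) * \<bar>ln (1 + x n / m n) - x n / m n\<bar> \<le> real (m n) * (2 * (x n / m n)\<^sup>2)"
        by (intro mult_left_mono) auto
      also have "real (m n) * \<bar>ln (1 + x n / m n) - x n / m n\<bar> = \<bar>real (m n) * ln (1 + x n / m n) - x n\<bar>"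
        using elim by (simp add: abs_mult[symmetric, of "real (m n)", simplified] right_diff_distrib)
      finally show ?case using elim by (simp add: power2_eq_square)
    qed
  qed
  from tendsto_add[OF this assms(1)] have "(\<lambda>n. exp (real (m n) * ln (1 + x n / m n))) \<longlonglongrightarrow> exp c"
    by (intro tendsto_exp) simp
  moreover have "\<forall>\<^sub>F n in sequentially. exp (real (m n) * ln (1 + x n / m n)) = (1 + x n / m n) ^ m n"
    using small
  proof eventually_elim
    case (elim n)
    then have "1 + x n / m n > 0" by linarith
    then show ?case by (simp add: exp_of_nat_mult)
  qed
  ultimately show ?thesis by (rule Lim_transform_eventually)
qed

section \<open>Compensated lattice walks\<close>

text \<open>Multiplication by \<open>(1 - z)^3\<close> forms third differences of the coefficients;
  the two subtracted terms are those in which \<open>w\<close>, extended by 0 to negative indices,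
  is still involved. The exponent is \<open>j + 1\<close> because the difference at \<open>j\<close>
  becomes the weight of a downward step by \<open>j + 1\<close> lattice units.\<close>

lemma third_difference_sums:
  fixes w :: "nat \<Rightarrow> real" and z :: real
  assumes z: "0 < z" "z < 1" and w0: "w 0 = 0" and sum: "summable (\<lambda>k. w k * z ^ k)"
  shows "(\<lambda>j. (w (j+3) - 3 * w (j+2) + 3 * w (j+1) - w j) * z ^ (j+1)) sums
    ((1 - z)^3 * (\<Sum>k. w k * z ^ k) / z\<^sup>2 - w 1 / z - (w 2 - 3 * w 1))"
proof -
  define G where "G = (\<Sum>k. w k * z ^ k)"
  have G: "(\<lambda>k. w k * z ^ k) sums G" using sum by (simp add: G_def summable_sums)
  have s: "(\<lambda>j. w (j+m) * z ^ (j+m)) sums (G - (\<Sum>i<m. w i * z ^ i))" for m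
    using G by (rule sums_split_initial_segment)
  have "(\<lambda>j. (w (j+3) * z ^ (j+3)) / z\<^sup>2 - 3 * ((w (j+2) * z ^ (j+2)) / z) + 3 * (w (j+1) * z ^ (j+1)) - z * (w j * z ^ j)) sums
     ((G - (\<Sum>i<3. w i * z ^ i)) / z\<^sup>2 - 3 * ((G - (\<Sum>i<2. w i * z ^ i)) / z) + 3 * (G - (\<Sum>i<1. w i * z ^ i)) - z * G)"
    by (intro sums_add sums_diff sums_mult sums_divide s G)
  also have "(\<lambda>j. (w (j+3) * z ^ (j+3)) / z\<^sup>2 - 3 * ((w (j+2) * z ^ (j+2)) / z) + 3 * (w (j+1) * z ^ (j+1)) - z * (w j * z ^ j))
     = (\<lambda>j. (w (j+3) - 3 * w (j+2) + 3 * w (j+1) - w j) * z ^ (j+1))"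
    using z by (auto simp: fun_eq_iff field_simps power_add power2_eq_square power3_eq_cube)
  also have "((G - (\<Sum>i<3. w i * z ^ i)) / z\<^sup>2 - 3 * ((G - (\<Sum>i<2. w i * z ^ i)) / z) + 3 * (G - (\<Sum>i<1. w i * z ^ i)) - z * G)
    = (1 - z)^3 * G / z\<^sup>2 - w 1 / z - (w 2 - 3 * w 1)"
    using z by (simp add: w0 eval_nat_numeral lessThan_Suc field_simps)
  finally show ?thesis by (simp add: G_def)
qed

text \<open>
  The witness is the law of a step \<open>\<epsilon>(1 - k)\<close> taken with probability \<open>p k\<close>, where for \<open>k \<ge> 2\<close> the
  probabilities are multiples of the third differences of \<open>w\<close>.
\<close>

lemma lattice_step_law:
  fixes w :: "nat \<Rightarrow> real" and d h \<epsilon> A :: real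
  assumes w0: "w 0 = 0" and w1: "0 \<le> w 1" and d: "0 \<le> d" and h: "0 \<le> h" and \<epsilon>: "0 < \<epsilon>"
    and d2: "(\<lambda>j. w (j+2) - 2 * w (j+1) + w j) \<longlonglongrightarrow> 0"
    and d3: "\<And>j. 0 \<le> w (j+3) - 3 * w (j+2) + 3 * w (j+1) - w j"
    and small: "h * (2 * d + 3 * w 1 - w 2) \<le> 1"
    and sum: "\<And>z. 0 < z \<Longrightarrow> z < 1 \<Longrightarrow> summable (\<lambda>k. w k * z ^ k)"
  shows "\<exists>\<mu>. has_laplace \<mu> (\<lambda>\<theta>. let z = exp (- \<theta> * \<epsilon>) in if \<theta> = 0 then 1 else
      1 + h * (d * (1 - z)\<^sup>2 / z + (1 - z)^3 * (\<Sum>k. w k * z ^ k) / z\<^sup>2))"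
proof -
  define c where "c j = w (j+3) - 3 * w (j+2) + 3 * w (j+1) - w j" for j
  \<comment> \<open>Apart from the added 1 at \<open>k = 1\<close>, \<open>p k\<close> is
    \<open>h\<close> times the third difference of \<open>w\<close> extended by 0 to negative
    indices, plus \<open>h\<close> times the weights \<open>d\<close>, \<open>- 2 * d\<close>,
    \<open>d\<close> of \<open>d * (1 - z)\<^sup>2 / z\<close> at \<open>k = 0, 1, 2\<close>. The
    value at \<open>k = 1\<close> is the probability of no move, and \<open>small\<close> is exactly
    its nonnegativity.\<close>
  define p where "p k = (if k = 0 then h * (d + w 1) else if k = 1 then 1 - h * (2 * d + 3 * w 1 - w 2)
     else h * (c (k - 2) + (if k = 2 then d else 0)))" for k :: nat
  have p0: "0 \<le> p k" for k
  proof -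
    have "0 \<le> c j" for j using d3 by (simp add: c_def)
    then show ?thesis using assms(2-4) small by (auto simp: p_def)
  qed
  have gen: "(\<lambda>k. p k * (z ^ k / z)) sums (1 + h * (d * (1 - z)\<^sup>2 / z + S - 3 * w 1 + w 2 + w 1 / z))"
    if z: "0 < z" and S: "(\<lambda>j. c j * z ^ (j+1)) sums S" for z S
  proof -
    have "(\<lambda>j. h * (c j * z ^ (j+1) + (if j = 0 then d * z else 0))) sums (h * (S + d * z))"
      using sums_single[of 0 "\<lambda>_. d * z"] by (intro sums_mult sums_add S) auto
    also have "(\<lambda>j. h * (c j * z ^ (j+1) + (if j = 0 then d * z else 0))) = (\<lambda>j. p (j+2) * (z ^ (j+2) / z))"
      using z by (auto simp: p_def fun_eq_iff power_add power2_eq_square field_simps)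
    finally have "(\<lambda>k. p k * (z ^ k / z)) sums (h * (S + d * z) + (\<Sum>i<2. p i * (z ^ i / z)))"
      by (subst (asm) sums_iff_shift) simp
    moreover have "h * (S + d * z) + (\<Sum>i<2. p i * (z ^ i / z)) = 1 + h * (d * (1 - z)\<^sup>2 / z + S - 3 * w 1 + w 2 + w 1 / z)"
      using z by (simp add: p_def eval_nat_numeral lessThan_Suc field_simps)
    ultimately show ?thesis by simp
  qed
  have c1: "c sums (2 * w 1 - w 2)"
  proof -
    have "(\<lambda>j. (w (Suc j+2) - 2 * w (Suc j+1) + w (Suc j)) - (w (j+2) - 2 * w (j+1) + w j)) sums (0 - (w (0+2) - 2 * w (0+1) + w 0))"
      by (rule telescope_sums[OF d2])
    then show ?thesis by (simp add: w0 c_def[abs_def] eval_nat_numeral algebra_simps)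
  qed
  define L where "L \<theta> = (let z = exp (- \<theta> * \<epsilon>) in if \<theta> = 0 then 1 else
      1 + h * (d * (1 - z)\<^sup>2 / z + (1 - z)^3 * (\<Sum>k. w k * z ^ k) / z\<^sup>2))" for \<theta>
  have sL: "(\<lambda>k. p k * exp (\<theta> * (\<epsilon> * (1 - real k)))) sums L \<theta>" if "0 \<le> \<theta>" for \<theta>
  proof -
    let ?z = "exp (- \<theta> * \<epsilon>)"
    have e: "exp (\<theta> * (\<epsilon> * (1 - real k))) = ?z ^ k / ?z" for k
      by (simp add: exp_of_nat_mult[symmetric] exp_diff[symmetric] algebra_simps)
    show ?thesis
    proof (cases "\<theta> = 0")
      case True
      have "(\<lambda>j. c j * 1 ^ (j+1)) sums (2 * w 1 - w 2)" using c1 by simp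
      from gen[OF _ this] show ?thesis using True by (simp add: L_def)
    next
      case False
      then have z: "0 < ?z" "?z < 1" using that \<epsilon> by auto
      show ?thesis
        unfolding e using gen[OF z(1) third_difference_sums[where w=w, OF z w0 sum[OF z], folded c_def]] False
        by (simp add: L_def Let_def algebra_simps)
    qed
  qed
  have p1: "p sums 1" using sL[of 0] by (simp add: L_def)
  have "(\<Sum>k. ennreal (p k)) = ennreal 1" by (rule suminf_ennreal_eq[OF _ p1]) (rule p0)
  then have nn1: "(\<integral>\<^sup>+k. ennreal (p k) \<partial>count_space UNIV) = 1"
    by (simp add: nn_integral_count_space_nat)
  define P where "P = embed_pmf p"
  have P: "pmf P k = p k" for k unfolding P_def by (rule pmf_embed_pmf[OF p0 nn1])
  let ?\<mu> = "distr (measure_pmf P) borel (\<lambda>k. \<epsilon> * (1 - real k))"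
  have "has_laplace ?\<mu> L"
  proof (rule has_laplace_nnI)
    show "real_distribution ?\<mu>" by (intro prob_space.real_distribution_distr[OF prob_space_measure_pmf]) simp
    fix \<theta> :: real assume \<theta>: "0 \<le> \<theta>"
    have "(\<integral>\<^sup>+x. ennreal (exp (\<theta> * x)) \<partial>?\<mu>) = (\<Sum>k. ennreal (p k * exp (\<theta> * (\<epsilon> * (1 - real k)))))"
      by (simp add: nn_integral_distr nn_integral_measure_pmf P nn_integral_count_space_nat ennreal_mult' p0)
    also have "\<dots> = ennreal (L \<theta>)"
      using sL[OF \<theta>] by (intro suminf_ennreal_eq) (auto simp: p0)
    finally show "(\<integral>\<^sup>+x. ennreal (exp (\<theta> * x)) \<partial>?\<mu>) = ennreal (L \<theta>)" .
    show "0 \<le> L \<theta>" by (rule sums_le[OF _ sums_zero sL[OF \<theta>]]) (simp add: p0)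
  qed
  then show ?thesis unfolding L_def[abs_def] by blast
qed

section \<open>Infinitely divisible laws from concave functions\<close>

lemma has_bochner_integral_laplace_affine:
  fixes \<theta> a b :: real
  assumes \<theta>: "0 < \<theta>" and ab: "0 \<le> a" "0 \<le> b"
  shows "has_bochner_integral lborel (\<lambda>x. indicator {0..} x * (exp (- \<theta> * x) * (a + b * x))) (a / \<theta> + b / \<theta>\<^sup>2)"
proof (rule has_bochner_integral_nn_integral)
  have "(\<integral>\<^sup>+x. ennreal (exp (- \<theta> * x) * (a + b * x)) * indicator {0..} x \<partial>lborel) =
    0 - (- exp (- \<theta> * 0) * ((a + b * 0) / \<theta> + b / \<theta>\<^sup>2))"
  proof (rule nn_integral_FTC_atLeast)
    show "((\<lambda>x. - exp (- \<theta> * x) * ((a + b * x) / \<theta> + b / \<theta>\<^sup>2)) \<longlongrightarrow> 0) at_top"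
      using \<theta> by real_asymp
    fix x :: real
    show "((\<lambda>x. - exp (- \<theta> * x) * ((a + b * x) / \<theta> + b / \<theta>\<^sup>2)) has_real_derivative exp (- \<theta> * x) * (a + b * x)) (at x)"
      using \<theta> by (auto intro!: derivative_eq_intros simp: field_simps power2_eq_square)
  qed (use ab in auto)
  then show "(\<integral>\<^sup>+x. ennreal (indicator {0..} x * (exp (- \<theta> * x) * (a + b * x))) \<partial>lborel) = ennreal (a / \<theta> + b / \<theta>\<^sup>2)"
    by (simp add: indicator_mult_ennreal mult.commute add.commute)
qed (use assms in \<open>auto split: split_indicator\<close>)

text \<open>\<open>third\<close> expresses convexity of the derivative by finite differences, the
  form in which it becomes nonnegativity of step probabilities.\<close>

locale scale_shape =
  fixes W :: "real \<Rightarrow> real"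
  assumes nonneg: "0 \<le> x \<Longrightarrow> 0 \<le> W x"
    and cont: "continuous_on {0..} W"
    and concave: "concave_on {0..} W"
    and third: "0 \<le> x \<Longrightarrow> 0 < h \<Longrightarrow> 0 \<le> W (x + 3 * h) - 3 * W (x + 2 * h) + 3 * W (x + h) - W x"
begin

lemma concaveD:
  assumes "0 \<le> x" "x < y" "y < z"
  shows "(z - y) * W x + (y - x) * W z \<le> (z - x) * W y"
proof -
  define t where "t = (y - x) / (z - x)"
  have t: "0 \<le> t" "t \<le> 1" using assms by (auto simp: t_def)
  have y: "(1 - t) *\<^sub>R x + t *\<^sub>R z = y"
  proof -
    have "t * (z - x) = y - x" using assms by (simp add: t_def)
    then show ?thesis by (simp add: algebra_simps)
  qed
  have "(1 - t) * W x + t * W z \<le> W y"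
    using concave_onD[OF concave t, of x z] assms y by simp
  then have "(z - x) * ((1 - t) * W x + t * W z) \<le> (z - x) * W y"
    using assms by (intro mult_left_mono) auto
  moreover have "(z - x) * (1 - t) = z - y" "(z - x) * t = y - x"
    using assms by (auto simp: t_def field_simps)
  then have "(z - x) * ((1 - t) * W x + t * W z) = (z - y) * W x + (y - x) * W z"
    by (simp add: distrib_left mult.assoc[symmetric])
  ultimately show ?thesis by simp
qed

text \<open>A concave function that decreases once stays below a line of negative slope from then
  on, so it cannot remain nonnegative on the half-line.\<close>

lemma mono:
  assumes "0 \<le> x" "x \<le> y"
  shows "W x \<le> W y"
proof (rule ccontr)
  assume "\<not> W x \<le> W y"
  then have "x < y" "W y < W x" using assms by (auto simp: less_le)
  \<comment> \<open>The point at which the line through the graph at \<open>x\<close> and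
    \<open>y\<close> has come down to -1.\<close>
  define z where "z = y + (y - x) * (W y + 1) / (W x - W y)"
  have "y < z"
    using \<open>x < y\<close> \<open>W y < W x\<close> assms nonneg[of y] by (auto simp: z_def intro!: divide_pos_pos mult_pos_pos)
  from concaveD[OF assms(1) \<open>x < y\<close> this]
  have "(z - y) * (W x - W y) + (y - x) * W z \<le> (y - x) * W y"
    by (simp add: algebra_simps)
  moreover have "(z - y) * (W x - W y) = (y - x) * (W y + 1)"
    using \<open>W y < W x\<close> by (simp add: z_def)
  ultimately have "(y - x) * (1 + W z) \<le> 0" by (simp add: algebra_simps)
  moreover have "0 < (y - x) * (1 + W z)"
    using \<open>x < y\<close> \<open>y < z\<close> assms nonneg[of z] by (intro mult_pos_pos) auto
  ultimately show False by simp
qed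

lemma linear_bound:
  assumes "0 \<le> x"
  shows "W x \<le> W 1 + W 1 * x"
proof (cases "x \<le> 1")
  case True
  then show ?thesis using mono[OF assms True] nonneg[of 1] assms by (smt (verit) mult_nonneg_nonneg)
next
  case False
  then have "(x - 1) * W 0 + W x \<le> x * W 1" using concaveD[of 0 1 x] by simp
  moreover have "(x - 1) * W 0 \<ge> 0" using False nonneg[of 0] by simp
  ultimately show ?thesis using nonneg[of 1] by (simp add: mult.commute)
qed

text \<open>First differences decrease by concavity and are bounded below by monotonicity, so they
  converge. The vanishing of the second differences is what makes the step probabilities add up to
  1.\<close>

lemma second_difference_tendsto:
  assumes h: "0 < h"
  shows "(\<lambda>j. W (real (j+2) * h) - 2 * W (real (j+1) * h) + W (real j * h)) \<longlonglongrightarrow> 0"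
proof -
  define D where "D j = W (real (j+1) * h) - W (real j * h)" for j
  have "D (Suc j) \<le> D j" for j
  proof -
    have "h * W (real j * h) + h * W (real (j+2) * h) \<le> (2 * h) * W (real (j+1) * h)"
      using concaveD[of "real j * h" "real (j+1) * h" "real (j+2) * h"] h by (simp add: algebra_simps)
    then have "h * (W (real j * h) + W (real (j+2) * h)) \<le> h * (2 * W (real (j+1) * h))"
      by (simp add: algebra_simps)
    then have "W (real j * h) + W (real (j+2) * h) \<le> 2 * W (real (j+1) * h)"
      using h by (simp only: mult_le_cancel_left_pos)
    then show ?thesis by (simp add: D_def)
  qed
  then have "decseq D" by (rule decseq_SucI)
  moreover have "0 \<le> D j" for j using mono[of "real j * h" "real (j+1) * h"] h by (simp add: D_def)
  ultimately obtain l where l: "D \<longlonglongrightarrow> l" using decseq_convergent[of D 0] by blast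
  have "(\<lambda>j. D (Suc j) - D j) \<longlonglongrightarrow> l - l"
    by (intro tendsto_diff l LIMSEQ_Suc)
  moreover have "(\<lambda>j. D (Suc j) - D j) = (\<lambda>j. W (real (j+2) * h) - 2 * W (real (j+1) * h) + W (real j * h))"
    by (auto simp: D_def fun_eq_iff algebra_simps)
  ultimately show ?thesis by simp
qed

definition lap :: "real \<Rightarrow> real" where
  "lap \<theta> = (LBINT x:{0..}. exp (- \<theta> * x) * W x)"

lemma W_meas: "(\<lambda>x. indicator {0..} x * W x) \<in> borel_measurable borel"
  using borel_measurable_continuous_on_indicator[OF _ cont] by (simp add: mult.commute)

lemma integrand_meas [measurable]: "(\<lambda>x. indicator {0..} x * (exp (- \<theta> * x) * W x)) \<in> borel_measurable borel"
proof -
  have "(\<lambda>x. exp (- \<theta> * x) * (indicator {0..} x * W x)) \<in> borel_measurable borel"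
    using W_meas by measurable
  then show ?thesis by (simp add: ac_simps)
qed

lemma lap_bochner:
  assumes "0 < \<theta>"
  shows "has_bochner_integral lborel (\<lambda>x. indicator {0..} x * (exp (- \<theta> * x) * W x)) (lap \<theta>)"
    and "lap \<theta> \<le> W 1 / \<theta> + W 1 / \<theta>\<^sup>2" and "0 \<le> lap \<theta>"
proof -
  have b: "has_bochner_integral lborel (\<lambda>x. indicator {0..} x * (exp (- \<theta> * x) * (W 1 + W 1 * x))) (W 1 / \<theta> + W 1 / \<theta>\<^sup>2)"
    using assms nonneg[of 1] by (intro has_bochner_integral_laplace_affine) auto
  have le: "0 \<le> indicator {0..} x * (exp (- \<theta> * x) * W x)"
    "indicator {0..} x * (exp (- \<theta> * x) * W x) \<le> indicator {0..} x * (exp (- \<theta> * x) * (W 1 + W 1 * x))" for x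
    using linear_bound[of x] nonneg[of x] by (simp_all split: split_indicator)
  have ib: "integrable lborel (\<lambda>x. indicator {0..} x * (exp (- \<theta> * x) * (W 1 + W 1 * x)))"
    using b by (simp add: has_bochner_integral_iff)
  have i: "integrable lborel (\<lambda>x. indicator {0..} x * (exp (- \<theta> * x) * W x))"
  proof (rule Bochner_Integration.integrable_bound[OF ib])
    show "AE x in lborel. norm (indicator {0..} x * (exp (- \<theta> * x) * W x))
        \<le> norm (indicator {0..} x * (exp (- \<theta> * x) * (W 1 + W 1 * x)))"
      using le by (intro AE_I2) (smt (verit) real_norm_def)
    show "(\<lambda>x. indicator {0..} x * (exp (- \<theta> * x) * W x)) \<in> borel_measurable lborel"
      using integrand_meas[of \<theta>] by (simp only: measurable_lborel2)
  qed
  then show "has_bochner_integral lborel (\<lambda>x. indicator {0..} x * (exp (- \<theta> * x) * W x)) (lap \<theta>)"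
    by (simp add: has_bochner_integral_iff lap_def set_lebesgue_integral_def)
  have l: "lap \<theta> = (\<integral>x. indicator {0..} x * (exp (- \<theta> * x) * W x) \<partial>lborel)"
    by (simp add: lap_def set_lebesgue_integral_def)
  show "lap \<theta> \<le> W 1 / \<theta> + W 1 / \<theta>\<^sup>2"
    unfolding l has_bochner_integral_integral_eq[OF b, symmetric] by (rule integral_mono[OF i ib le(2)])
  show "0 \<le> lap \<theta>"
    unfolding l by (rule Bochner_Integration.integral_nonneg) (rule le(1))
qed

lemma lap_pos:
  assumes "0 < \<theta>" "0 \<le> x0" "0 < W x0"
  shows "0 < lap \<theta>"
proof -
  have i: "integrable lborel (\<lambda>x. indicator {x0..x0+1} x * (exp (- \<theta> * (x0 + 1)) * W x0))"
    by (intro integrable_mult_left integrable_real_indicator) auto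
  have "exp (- \<theta> * (x0 + 1)) * W x0 = (\<integral>x. indicator {x0..x0+1} x * (exp (- \<theta> * (x0 + 1)) * W x0) \<partial>lborel)"
    by simp
  also have "\<dots> \<le> (\<integral>x. indicator {0..} x * (exp (- \<theta> * x) * W x) \<partial>lborel)"
  proof (rule integral_mono[OF i])
    fix x
    show "indicator {x0..x0+1} x * (exp (- \<theta> * (x0 + 1)) * W x0) \<le> indicator {0..} x * (exp (- \<theta> * x) * W x)"
    proof (cases "x \<in> {x0..x0+1}")
      case True
      then have "exp (- \<theta> * (x0 + 1)) * W x0 \<le> exp (- \<theta> * x) * W x"
        using assms mono[OF assms(2), of x] nonneg[of x0] by (intro mult_mono) auto
      then show ?thesis using True assms by simp
    qed (use nonneg[of x] in \<open>simp split: split_indicator\<close>)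
  qed (use lap_bochner(1)[OF assms(1)] in \<open>simp add: has_bochner_integral_iff\<close>)
  also have "\<dots> = lap \<theta>"
    by (simp add: lap_def set_lebesgue_integral_def)
  finally have "exp (- \<theta> * (x0 + 1)) * W x0 \<le> lap \<theta>" .
  moreover have "0 < exp (- \<theta> * (x0 + 1)) * W x0" using assms by simp
  ultimately show ?thesis by linarith
qed

text \<open>An affine part \<open>a + b * x\<close> of \<open>W\<close> contributes
  \<open>a * \<theta>\<^sup>2 + b * \<theta>\<close>, a Brownian component and an upward drift; only
  the remainder produces jumps.\<close>

definition \<psi> :: "real \<Rightarrow> real" where "\<psi> \<theta> = \<theta> ^ 3 * lap \<theta>"

lemma \<psi>_0 [simp]: "\<psi> 0 = 0" by (simp add: \<psi>_def)

text \<open>Comparison with the affine bound of \<open>W\<close>. The decay at 0 serves tightness,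
  the quadratic growth at infinity later excludes positive jumps.\<close>

lemma \<psi>_bound:
  assumes "0 \<le> \<theta>"
  shows "0 \<le> \<psi> \<theta>" "\<psi> \<theta> \<le> W 1 * (\<theta>\<^sup>2 + \<theta>)"
proof -
  have "\<theta> > 0 \<Longrightarrow> \<theta> ^ 3 * lap \<theta> \<le> \<theta> ^ 3 * (W 1 / \<theta> + W 1 / \<theta>\<^sup>2)"
    using lap_bochner(2) by (intro mult_left_mono) auto
  moreover have "\<theta> > 0 \<Longrightarrow> \<theta> ^ 3 * (W 1 / \<theta> + W 1 / \<theta>\<^sup>2) = W 1 * (\<theta>\<^sup>2 + \<theta>)"
    by (simp add: field_simps power2_eq_square power3_eq_cube)
  ultimately show "\<psi> \<theta> \<le> W 1 * (\<theta>\<^sup>2 + \<theta>)"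
    using assms by (cases "\<theta> = 0") (auto simp: \<psi>_def)
  show "0 \<le> \<psi> \<theta>" using assms lap_bochner(3) by (cases "\<theta> = 0") (auto simp: \<psi>_def)
qed

lemma \<psi>_tendsto_0: "(\<psi> \<longlongrightarrow> 0) (at_right 0)"
proof (rule tendsto_sandwich[where f="\<lambda>_. 0" and h="\<lambda>\<theta>. W 1 * (\<theta>\<^sup>2 + \<theta>)"])
  have "((\<lambda>\<theta>::real. W 1 * (\<theta>\<^sup>2 + \<theta>)) \<longlongrightarrow> W 1 * (0\<^sup>2 + 0)) (at_right 0)"
    by (intro tendsto_intros)
  then show "((\<lambda>\<theta>::real. W 1 * (\<theta>\<^sup>2 + \<theta>)) \<longlongrightarrow> 0) (at_right 0)" by simp
  show "\<forall>\<^sub>F \<theta> in at_right 0. \<psi> \<theta> \<le> W 1 * (\<theta>\<^sup>2 + \<theta>)"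
    using \<psi>_bound by (auto simp: eventually_at intro!: exI[of _ 1])
  show "\<forall>\<^sub>F \<theta> in at_right 0. 0 \<le> \<psi> \<theta>"
    using \<psi>_bound by (auto simp: eventually_at intro!: exI[of _ 1])
qed auto

lemma summable_lattice:
  fixes z :: real
  assumes z: "0 < z" "z < 1" and m: "0 < m"
  shows "summable (\<lambda>k. (W (real k / m) - W 0) * z ^ k)"
proof (rule summable_comparison_test)
  show "summable (\<lambda>k. (W 1 * (1 + 1 / m)) * (real (Suc k) * z ^ k))"
    using geometric_deriv_sums[of z] z by (intro summable_mult) (auto simp: sums_iff)
  have "norm ((W (real k / m) - W 0) * z ^ k) \<le> (W 1 * (1 + 1 / m)) * (real (Suc k) * z ^ k)" for k
  proof -
    have "W (real k / m) - W 0 \<le> W 1 * (1 + real k / m)"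
      using linear_bound[of "real k / m"] nonneg[of 0] m by (simp add: algebra_simps)
    also have "\<dots> \<le> W 1 * ((1 + 1 / m) * real (Suc k))"
      using m nonneg[of 1] by (intro mult_left_mono) (auto simp: field_simps)
    finally have "W (real k / m) - W 0 \<le> (W 1 * (1 + 1 / m)) * real (Suc k)" by (simp add: mult.assoc)
    moreover have "0 \<le> W (real k / m) - W 0" using mono[of 0 "real k / m"] m by simp
    ultimately show ?thesis using z by (simp add: abs_mult mult_right_mono mult.assoc[symmetric])
  qed
  then show "\<exists>N. \<forall>k\<ge>N. norm ((W (real k / m) - W 0) * z ^ k) \<le> (W 1 * (1 + 1 / m)) * (real (Suc k) * z ^ k)" by blast
qed

text \<open>Step functions on the lattice are written as countable sums of indicators, so that their
  integrals are series of the kind that generating functions produce.\<close>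

lemma lattice_cells:
  fixes m :: real
  assumes m: "0 < m"
  defines "C \<equiv> \<lambda>k::nat. {real k / m ..< real (Suc k) / m}"
  shows "disjoint_family C" and "0 \<le> x \<Longrightarrow> x \<in> C (nat \<lfloor>m * x\<rfloor>)" and "x \<in> C k \<Longrightarrow> 0 \<le> x"
    and "(\<integral>\<^sup>+x. (\<Sum>k. ennreal (c k) * indicator (C k) x) \<partial>lborel) = (\<Sum>k. ennreal (c k) * ennreal (1 / m))"
proof -
  have k: "x \<in> C k \<Longrightarrow> k = nat \<lfloor>m * x\<rfloor>" for x k
  proof -
    assume "x \<in> C k"
    then have "real k \<le> m * x" "m * x < real k + 1" using m by (auto simp: C_def field_simps)
    then have "\<lfloor>m * x\<rfloor> = int k" by (intro floor_unique) auto
    then show "k = nat \<lfloor>m * x\<rfloor>" by simp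
  qed
  then show "disjoint_family C" unfolding disjoint_family_on_def by blast
  show "x \<in> C k \<Longrightarrow> 0 \<le> x" using m by (auto simp: C_def) (metis divide_nonneg_pos of_nat_0_le_iff order_trans)
  show "x \<in> C (nat \<lfloor>m * x\<rfloor>)" if "0 \<le> x"
  proof -
    have "real (nat \<lfloor>m * x\<rfloor>) \<le> m * x" "m * x < real (nat \<lfloor>m * x\<rfloor>) + 1"
      using that m by (auto intro: real_of_int_floor_add_one_gt)
    then show ?thesis using m by (simp add: C_def field_simps)
  qed
  have [measurable]: "C k \<in> sets borel" for k unfolding C_def by simp
  have "(\<integral>\<^sup>+x. (\<Sum>k. ennreal (c k) * indicator (C k) x) \<partial>lborel) = (\<Sum>k. ennreal (c k) * emeasure lborel (C k))"
    by (simp add: nn_integral_suminf nn_integral_cmult_indicator)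
  also have "\<dots> = (\<Sum>k. ennreal (c k) * ennreal (1 / m))"
    using m by (simp add: C_def divide_right_mono diff_divide_distrib[symmetric])
  finally show "(\<integral>\<^sup>+x. (\<Sum>k. ennreal (c k) * indicator (C k) x) \<partial>lborel) = (\<Sum>k. ennreal (c k) * ennreal (1 / m))" .
qed

text \<open>On the cell from \<open>k / m\<close> to \<open>(k + 1) / m\<close>, monotonicity puts
  the integrand between \<open>w (k / m) * z ^ (k + 1)\<close> and
  \<open>w ((k + 1) / m) * z ^ k\<close>. Since \<open>W 0\<close> has been subtracted,
  \<open>w 0 = 0\<close>, and the shifted upper sum is still the full \<open>G / z\<close>.\<close>

lemma lattice_sum_bounds:
  fixes m \<theta> :: real
  assumes m: "0 < m" and \<theta>: "0 < \<theta>"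
  defines "z \<equiv> exp (- \<theta> / m)"
  defines "G \<equiv> (\<Sum>k. (W (real k / m) - W 0) * z ^ k)"
  shows "z * (G / m) \<le> lap \<theta> - W 0 / \<theta>" "lap \<theta> - W 0 / \<theta> \<le> (G / m) / z"
proof -
  have z: "0 < z" "z < 1" using m \<theta> by (auto simp: z_def)
  define w where "w x = W x - W 0" for x
  have wm: "w x \<le> w y" if "0 \<le> x" "x \<le> y" for x y using mono[OF that] by (simp add: w_def)
  have w0: "0 \<le> w x" if "0 \<le> x" for x using wm[OF _ that] by (simp add: w_def)
  have G: "(\<lambda>k. w (real k / m) * z ^ k) sums G"
    unfolding G_def w_def by (intro summable_sums summable_lattice z m)
  define I where "I = lap \<theta> - W 0 / \<theta>"
  define f where "f x = indicator {0..} x * (exp (- \<theta> * x) * w x)" for x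
  have "has_bochner_integral lborel (\<lambda>x. indicator {0..} x * (exp (- \<theta> * x) * W x)
       - indicator {0..} x * (exp (- \<theta> * x) * (W 0 + 0 * x))) (lap \<theta> - (W 0 / \<theta> + 0 / \<theta>\<^sup>2))"
    by (intro has_bochner_integral_diff lap_bochner has_bochner_integral_laplace_affine \<theta> nonneg) auto
  also have "(\<lambda>x. indicator {0..} x * (exp (- \<theta> * x) * W x)
       - indicator {0..} x * (exp (- \<theta> * x) * (W 0 + 0 * x))) = f"
    by (auto simp: f_def w_def fun_eq_iff algebra_simps)
  finally have f: "has_bochner_integral lborel f I" by (simp add: I_def)
  have f0: "0 \<le> f x" for x using w0 by (auto simp: f_def split: split_indicator)
  have I0: "0 \<le> I" unfolding has_bochner_integral_integral_eq[OF f, symmetric] by (simp add: f0)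
  have nnf: "(\<integral>\<^sup>+x. ennreal (f x) \<partial>lborel) = ennreal I"
    using nn_integral_eq_integral[of lborel f] f f0 by (auto simp: has_bochner_integral_iff)
  define C where "C k = {real k / m ..< real (Suc k) / m}" for k :: nat
  note cells = lattice_cells[OF m, folded C_def]
  have zk: "z ^ k = exp (- \<theta> * (real k / m))" for k
    by (simp add: z_def exp_of_nat_mult[symmetric])
  have step: "(\<Sum>k. ennreal (c k) * indicator (C k) x) = (if 0 \<le> x then ennreal (c (nat \<lfloor>m * x\<rfloor>)) else 0)" for c x
  proof (cases "0 \<le> x")
    case True
    then show ?thesis using suminf_cmult_indicator[OF cells(1) cells(2)[OF True]] by simp
  next
    case False
    then have "indicator (C k) x = (0::ennreal)" for k using cells(3) by (auto split: split_indicator)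
    then show ?thesis using False by simp
  qed
  have cell: "real (nat \<lfloor>m * x\<rfloor>) / m \<le> x" "x \<le> real (Suc (nat \<lfloor>m * x\<rfloor>)) / m" if "0 \<le> x" for x
    using cells(2)[OF that] by (auto simp: C_def)
  have "ennreal (z * (G / m)) = (\<Sum>k. ennreal (w (real k / m) * z ^ Suc k * (1 / m)))"
  proof (rule sym, rule suminf_ennreal_eq)
    have "(\<lambda>k. w (real k / m) * z ^ k * (z / m)) sums (G * (z / m))" by (rule sums_mult2[OF G])
    then show "(\<lambda>k. w (real k / m) * z ^ Suc k * (1 / m)) sums (z * (G / m))" by (simp add: ac_simps)
  qed (use w0 z m in auto)
  also have "\<dots> = (\<integral>\<^sup>+x. (\<Sum>k. ennreal (w (real k / m) * z ^ Suc k) * indicator (C k) x) \<partial>lborel)"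
    unfolding cells(4) using z m w0 by (intro suminf_cong) (simp add: ennreal_mult'[symmetric] del: power_Suc)
  also have "\<dots> \<le> (\<integral>\<^sup>+x. ennreal (f x) \<partial>lborel)"
  proof (rule nn_integral_mono)
    fix x
    show "(\<Sum>k. ennreal (w (real k / m) * z ^ Suc k) * indicator (C k) x) \<le> ennreal (f x)"
    proof (cases "0 \<le> x")
      case True
      have "- \<theta> * (real (Suc (nat \<lfloor>m * x\<rfloor>)) / m) \<le> - \<theta> * x"
        using cell(2)[OF True] \<theta> by (intro mult_left_mono_neg) auto
      then have "w (real (nat \<lfloor>m * x\<rfloor>) / m) * z ^ Suc (nat \<lfloor>m * x\<rfloor>) \<le> w x * exp (- \<theta> * x)"
        unfolding zk using cell[OF True] \<theta> m True by (intro mult_mono wm w0) (auto simp del: of_nat_Suc)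
      then show ?thesis unfolding step using True by (auto simp: f_def mult.commute simp del: power_Suc intro!: ennreal_leI)
    qed (simp add: step)
  qed
  finally show "z * (G / m) \<le> lap \<theta> - W 0 / \<theta>" using I0 by (simp add: nnf I_def)
  have G0: "0 \<le> G" using z m by (intro sums_le[OF _ sums_zero G] mult_nonneg_nonneg w0) auto
  have "ennreal I = (\<integral>\<^sup>+x. ennreal (f x) \<partial>lborel)" using nnf by simp
  also have "\<dots> \<le> (\<integral>\<^sup>+x. (\<Sum>k. ennreal (w (real (Suc k) / m) * z ^ k) * indicator (C k) x) \<partial>lborel)"
  proof (rule nn_integral_mono)
    fix x
    show "ennreal (f x) \<le> (\<Sum>k. ennreal (w (real (Suc k) / m) * z ^ k) * indicator (C k) x)"
    proof (cases "0 \<le> x")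
      case True
      have "- \<theta> * x \<le> - \<theta> * (real (nat \<lfloor>m * x\<rfloor>) / m)"
        using cell(1)[OF True] \<theta> by (intro mult_left_mono_neg) auto
      then have "w x * exp (- \<theta> * x) \<le> w (real (Suc (nat \<lfloor>m * x\<rfloor>)) / m) * z ^ (nat \<lfloor>m * x\<rfloor>)"
        unfolding zk using cell[OF True] \<theta> m True by (intro mult_mono wm w0) (auto simp del: of_nat_Suc)
      then show ?thesis unfolding step using True by (auto simp: f_def mult.commute simp del: of_nat_Suc intro!: ennreal_leI)
    qed (simp add: step f_def)
  qed
  also have "\<dots> = (\<Sum>k. ennreal (w (real (Suc k) / m) * z ^ k * (1 / m)))"
    unfolding cells(4) using z m w0 by (intro suminf_cong) (simp add: ennreal_mult'[symmetric] del: of_nat_Suc)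
  also have "\<dots> = ennreal (G / m / z)"
  proof (rule suminf_ennreal_eq)
    have "(\<lambda>k. w (real (Suc k) / m) * z ^ (Suc k)) sums G"
      using sums_split_initial_segment[OF G, of 1] by (simp add: w_def)
    from sums_mult2[OF this, of "1 / m / z"]
    show "(\<lambda>k. w (real (Suc k) / m) * z ^ k * (1 / m)) sums (G / m / z)"
      using z by (simp add: ac_simps)
  qed (use w0 z m in auto)
  finally show "lap \<theta> - W 0 / \<theta> \<le> (G / m) / z"
    using G0 z m by (simp add: I_def[symmetric])
qed

text \<open>\<open>m * (1 - z)\<close> tends to \<theta> and \<open>G / m\<close> to the transform
  of \<open>W - W 0\<close>. The summand with \<open>(1 - z)\<^sup>2\<close> restores the
  contribution \<open>W 0 * \<theta>\<^sup>2\<close>, which is lost when the lattice function is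
  made to vanish at 0.\<close>

lemma lattice_exponent_tendsto:
  fixes m :: "nat \<Rightarrow> real" and \<theta> :: real
  assumes m: "\<And>n. 0 < m n" "filterlim m at_top sequentially" and \<theta>: "0 < \<theta>"
  defines "z \<equiv> \<lambda>n. exp (- \<theta> / m n)"
  defines "G \<equiv> \<lambda>n. (\<Sum>k. (W (real k / m n) - W 0) * z n ^ k)"
  shows "(\<lambda>n. (m n)\<^sup>2 * (W 0 * (1 - z n)\<^sup>2 / z n + (1 - z n)^3 * G n / (z n)\<^sup>2)) \<longlonglongrightarrow> \<psi> \<theta>"
proof -
  have z1: "z \<longlonglongrightarrow> 1"
  proof -
    have "((\<lambda>x::real. exp (- \<theta> / x)) \<longlongrightarrow> 1) at_top" using \<theta> by real_asymp
    from filterlim_compose[OF this m(2)] show ?thesis by (simp add: z_def)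
  qed
  have mz: "(\<lambda>n. m n * (1 - z n)) \<longlonglongrightarrow> \<theta>"
  proof -
    have "((\<lambda>x::real. x * (1 - exp (- \<theta> / x))) \<longlongrightarrow> \<theta>) at_top" using \<theta> by real_asymp
    from filterlim_compose[OF this m(2)] show ?thesis by (simp add: z_def)
  qed
  let ?I = "lap \<theta> - W 0 / \<theta>"
  have z0: "0 < z n" for n by (simp add: z_def)
  have lower: "z n * (G n / m n) \<le> ?I" and upper: "?I \<le> (G n / m n) / z n" for n
    unfolding G_def z_def by (rule lattice_sum_bounds[OF m(1) \<theta>])+
  have Gm: "(\<lambda>n. G n / m n) \<longlonglongrightarrow> ?I"
  proof (rule tendsto_sandwich)
    show "\<forall>\<^sub>F n in sequentially. z n * ?I \<le> G n / m n"
      using upper z0 by (intro always_eventually allI) (simp only: pos_le_divide_eq mult.commute)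
    show "\<forall>\<^sub>F n in sequentially. G n / m n \<le> ?I / z n"
      using lower z0 by (intro always_eventually allI) (simp only: pos_le_divide_eq mult.commute)
    show "(\<lambda>n. z n * ?I) \<longlonglongrightarrow> ?I" using tendsto_mult[OF z1 tendsto_const, of ?I] by simp
    show "(\<lambda>n. ?I / z n) \<longlonglongrightarrow> ?I" using tendsto_divide[OF tendsto_const z1, of ?I] by simp
  qed
  have "(\<lambda>n. W 0 * (m n * (1 - z n))\<^sup>2 / z n + (m n * (1 - z n))^3 * (G n / m n) / (z n)\<^sup>2)
      \<longlonglongrightarrow> W 0 * \<theta>\<^sup>2 / 1 + \<theta>^3 * ?I / 1\<^sup>2"
    by (intro tendsto_intros mz z1 Gm) auto
  moreover have "W 0 * \<theta>\<^sup>2 / 1 + \<theta>^3 * ?I / 1\<^sup>2 = \<psi> \<theta>"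
    using \<theta> by (simp add: \<psi>_def field_simps power2_eq_square power3_eq_cube)
  moreover have "W 0 * (m n * (1 - z n))\<^sup>2 / z n + (m n * (1 - z n))^3 * (G n / m n) / (z n)\<^sup>2
     = (m n)\<^sup>2 * (W 0 * (1 - z n)\<^sup>2 / z n + (1 - z n)^3 * G n / (z n)\<^sup>2)" for n
    using m(1)[of n] z0[of n] by (simp add: field_simps power2_eq_square power3_eq_cube)
  ultimately show ?thesis by simp
qed

text \<open>With mesh \<open>1 / m n\<close> one step changes the transform by
  \<open>t / m n * X n \<theta>\<close>, and \<open>(m n)\<^sup>2 * X n \<theta>\<close> tends to
  \<open>\<psi> \<theta>\<close>. Hence \<open>M n ^ 3\<close> steps accumulate the exponent
  \<open>t * \<psi> \<theta>\<close>.\<close>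

theorem exists_law:
  assumes t: "0 \<le> t"
  shows "\<exists>\<mu>. has_laplace \<mu> (\<lambda>\<theta>. exp (t * \<psi> \<theta>))"
proof -
  \<comment> \<open>Ensures \<open>t * (2 * W 0 + 3 * W 1) \<le> m n\<close>, which keeps the
    probability of no move nonnegative when \<open>h = t / m n\<close>.\<close>
  define n0 where "n0 = nat \<lceil>t * (2 * W 0 + 3 * W 1)\<rceil>"
  define M where "M n = n + 1 + n0" for n
  define m where "m n = real (M n)" for n
  have m0: "0 < m n" for n by (simp add: m_def M_def)
  have Mtop: "filterlim M at_top sequentially"
    unfolding filterlim_at_top
  proof (intro allI)
    fix Z show "\<forall>\<^sub>F n in sequentially. Z \<le> M n"
      unfolding M_def by (rule eventually_sequentiallyI[of Z]) simp
  qed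
  have mtop: "filterlim m at_top sequentially"
    unfolding m_def using filterlim_compose[OF filterlim_real_sequentially Mtop] by simp
  define z where "z n \<theta> = exp (- \<theta> / m n)" for n \<theta>
  define G where "G n \<theta> = (\<Sum>k. (W (real k / m n) - W 0) * z n \<theta> ^ k)" for n \<theta>
  define X where "X n \<theta> = W 0 * (1 - z n \<theta>)\<^sup>2 / z n \<theta> + (1 - z n \<theta>)^3 * G n \<theta> / (z n \<theta>)\<^sup>2" for n \<theta>
  define L where "L n \<theta> = (if \<theta> = 0 then 1 else 1 + t / m n * X n \<theta>)" for n \<theta>
  have "\<exists>\<mu>. has_laplace \<mu> (L n)" for n
  proof -
    define w where "w k = W (real k / m n) - W 0" for k :: nat
    have "\<exists>\<mu>. has_laplace \<mu> (\<lambda>\<theta>. let z = exp (- \<theta> * (1 / m n)) in if \<theta> = 0 then 1 else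
      1 + (t / m n) * (W 0 * (1 - z)\<^sup>2 / z + (1 - z)^3 * (\<Sum>k. w k * z ^ k) / z\<^sup>2))"
    proof (rule lattice_step_law)
      show "w 0 = 0" by (simp add: w_def)
      show w1: "0 \<le> w 1" using mono[of 0 "1 / m n"] m0[of n] by (simp add: w_def)
      show "0 \<le> W 0" by (simp add: nonneg)
      show "0 \<le> t / m n" using t m0[of n] by simp
      show "0 < 1 / m n" using m0[of n] by simp
      show "(\<lambda>j. w (j+2) - 2 * w (j+1) + w j) \<longlonglongrightarrow> 0"
      proof -
        have "(\<lambda>j. w (j+2) - 2 * w (j+1) + w j) =
          (\<lambda>j. W (real (j+2) * (1 / m n)) - 2 * W (real (j+1) * (1 / m n)) + W (real j * (1 / m n)))"
          by (simp add: w_def fun_eq_iff)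
        then show ?thesis using second_difference_tendsto[of "1 / m n"] m0[of n] by (simp only:) simp
      qed
      show "0 \<le> w (j+3) - 3 * w (j+2) + 3 * w (j+1) - w j" for j
        using third[of "real j / m n" "1 / m n"] m0[of n] by (simp add: w_def add_divide_distrib algebra_simps)
      have "2 * W 0 + 3 * w 1 - w 2 \<le> 2 * W 0 + 3 * W 1"
      proof -
        have "w 1 \<le> W 1" using mono[of "1 / m n" 1] nonneg[of 0] by (simp add: w_def m_def M_def)
        moreover have "0 \<le> w 2" using mono[of 0 "2 / m n"] m0[of n] by (simp add: w_def)
        ultimately show ?thesis by simp
      qed
      then have "t * (2 * W 0 + 3 * w 1 - w 2) \<le> t * (2 * W 0 + 3 * W 1)" using t by (rule mult_left_mono)
      also have "\<dots> \<le> m n" unfolding m_def M_def n0_def by linarith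
      finally show "t / m n * (2 * W 0 + 3 * w 1 - w 2) \<le> 1" using m0[of n] by (simp add: field_simps)
      show "summable (\<lambda>k. w k * z ^ k)" if "0 < z" "z < 1" for z
        unfolding w_def by (rule summable_lattice[OF that m0])
    qed
    moreover have "- \<theta> * (1 / m n) = - \<theta> / m n" for \<theta> by simp
    ultimately show ?thesis unfolding L_def[abs_def] X_def G_def z_def w_def Let_def by (simp only:)
  qed
  then have "\<exists>\<nu>. has_laplace \<nu> (\<lambda>\<theta>. L n \<theta> ^ (M n ^ 3))" for n using has_laplace_power by blast
  then obtain \<nu> where \<nu>: "\<And>n. has_laplace (\<nu> n) (\<lambda>\<theta>. L n \<theta> ^ (M n ^ 3))" by metis
  have conv: "(\<lambda>n. L n \<theta> ^ (M n ^ 3)) \<longlonglongrightarrow> exp (t * \<psi> \<theta>)" if "0 \<le> \<theta>" for \<theta>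
  proof (cases "\<theta> = 0")
    case False
    then have \<theta>: "0 < \<theta>" using that by simp
    have "(\<lambda>n. (1 + (t * ((m n)\<^sup>2 * X n \<theta>)) / real (M n ^ 3)) ^ (M n ^ 3)) \<longlonglongrightarrow> exp (t * \<psi> \<theta>)"
    proof (rule tendsto_one_plus_power_exp)
      show "(\<lambda>n. t * ((m n)\<^sup>2 * X n \<theta>)) \<longlonglongrightarrow> t * \<psi> \<theta>"
        using lattice_exponent_tendsto[OF m0 mtop \<theta>] unfolding X_def G_def z_def by (intro tendsto_mult tendsto_const)
      show "filterlim (\<lambda>n. M n ^ 3) at_top sequentially"
      proof (rule filterlim_at_top_mono[OF Mtop])
        show "\<forall>\<^sub>F n in sequentially. M n \<le> M n ^ 3"
          by (intro always_eventually allI self_le_power) (auto simp: M_def)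
      qed
    qed
    moreover have "1 + (t * ((m n)\<^sup>2 * X n \<theta>)) / real (M n ^ 3) = L n \<theta>" for n
      using False m0[of n] by (simp add: L_def m_def power2_eq_square power3_eq_cube)
    ultimately show ?thesis by simp
  qed (simp add: L_def)
  have "((\<lambda>\<theta>. exp (t * \<psi> \<theta>)) \<longlongrightarrow> exp (t * 0)) (at_right 0)"
    by (intro tendsto_intros \<psi>_tendsto_0)
  then have "((\<lambda>\<theta>. exp (t * \<psi> \<theta>)) \<longlongrightarrow> 1) (at_right 0)" by simp
  from laplace_closure[OF \<nu> conv this] show ?thesis by metis
qed

end

section \<open>Oscillations of sums of independent variables\<close>

context prob_space
begin

lemma indep_vars_blocks:
  fixes \<xi> :: "nat \<Rightarrow> 'a \<Rightarrow> real"
  assumes ind: "indep_vars (\<lambda>_. borel) \<xi> I" and sub: "A \<union> B \<subseteq> I" "A \<inter> B = {}"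
    and P: "Measurable.pred (PiM A (\<lambda>_. borel)) P" and Q: "Measurable.pred (PiM B (\<lambda>_. borel)) Q"
  shows "prob {\<omega> \<in> space M. P (\<lambda>i\<in>A. \<xi> i \<omega>) \<and> Q (\<lambda>i\<in>B. \<xi> i \<omega>)} =
    prob {\<omega> \<in> space M. P (\<lambda>i\<in>A. \<xi> i \<omega>)} * prob {\<omega> \<in> space M. Q (\<lambda>i\<in>B. \<xi> i \<omega>)}"
proof -
  have iv: "indep_var (PiM A (\<lambda>_. borel)) (\<lambda>\<omega>. \<lambda>i\<in>A. \<xi> i \<omega>) (PiM B (\<lambda>_. borel)) (\<lambda>\<omega>. \<lambda>i\<in>B. \<xi> i \<omega>)"
    using indep_var_restrict[OF ind sub(2)] sub(1) by (auto simp: restrict_def)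
  have [measurable]: "\<And>i. i \<in> A \<Longrightarrow> \<xi> i \<in> borel_measurable M" "\<And>i. i \<in> B \<Longrightarrow> \<xi> i \<in> borel_measurable M"
    using ind sub by (auto simp: indep_vars_def)
  let ?P = "{f \<in> space (PiM A (\<lambda>_. borel :: real measure)). P f}"
  let ?Q = "{f \<in> space (PiM B (\<lambda>_. borel :: real measure)). Q f}"
  have sp: "(\<lambda>i\<in>A. \<xi> i \<omega>) \<in> space (PiM A (\<lambda>_. borel :: real measure))"
     "(\<lambda>i\<in>B. \<xi> i \<omega>) \<in> space (PiM B (\<lambda>_. borel :: real measure))" for \<omega>
    by (auto simp: space_PiM)
  have "?P \<in> sets (PiM A (\<lambda>_. borel))" "?Q \<in> sets (PiM B (\<lambda>_. borel))"
    using P Q by (simp_all only: pred_def)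
  from indep_varD[OF iv this] show ?thesis
    by (simp add: vimage_def Int_def sp conj_commute conj_left_commute)
qed

end

locale increments = prob_space M for M :: "'a measure" +
  fixes \<xi> :: "nat \<Rightarrow> 'a \<Rightarrow> real" and N :: nat and c \<alpha> :: real
  assumes ind: "indep_vars (\<lambda>_. borel) \<xi> {..<N}"
    and \<alpha>: "\<alpha> \<le> 1/2"
    and incr: "i \<le> j \<Longrightarrow> j \<le> N \<Longrightarrow> prob {\<omega> \<in> space M. c < \<bar>\<Sum>l=i..<j. \<xi> l \<omega>\<bar>} \<le> \<alpha>"
begin

definition D :: "nat \<Rightarrow> nat \<Rightarrow> 'a \<Rightarrow> real" where "D i j \<omega> = (\<Sum>l=i..<j. \<xi> l \<omega>)"

lemma rv: "l < N \<Longrightarrow> \<xi> l \<in> borel_measurable M"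
  using ind by (auto simp: indep_vars_def)

lemma rv_D [measurable]: "j \<le> N \<Longrightarrow> D i j \<in> borel_measurable M"
  unfolding D_def by (intro borel_measurable_sum rv) auto

lemma D_split: "i \<le> j \<Longrightarrow> j \<le> k \<Longrightarrow> D i k \<omega> = D i j \<omega> + D j k \<omega>"
  by (simp add: D_def sum.atLeastLessThan_concat)

text \<open>The first exit of the partial sums started at \<open>m\<close> from the interval between
  \<open>- 2 * c\<close> and \<open>2 * c\<close>. The event is decided by the increments before
  \<open>k\<close>, hence independent of everything from \<open>k\<close> on.\<close>

definition first :: "nat \<Rightarrow> nat \<Rightarrow> 'a \<Rightarrow> bool" where
  "first m k \<omega> \<longleftrightarrow> 2 * c < \<bar>D m k \<omega>\<bar> \<and> (\<forall>j\<in>{m..<k}. \<bar>D m j \<omega>\<bar> \<le> 2 * c)"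

definition escape :: "nat \<Rightarrow> 'a \<Rightarrow> bool" where
  "escape m \<omega> \<longleftrightarrow> (\<exists>j\<in>{m..N}. 2 * c < \<bar>D m j \<omega>\<bar>)"

lemma measurable_D_bound:
  assumes "j \<le> N"
  shows "Measurable.pred M (\<lambda>\<omega>. a < \<bar>D i j \<omega>\<bar>)" "Measurable.pred M (\<lambda>\<omega>. \<bar>D i j \<omega>\<bar> \<le> a)"
  using rv_D[OF assms] by measurable

lemma measurable_first: "k \<le> N \<Longrightarrow> {\<omega> \<in> space M. first m k \<omega>} \<in> events"
  unfolding first_def pred_def[symmetric]
  by (intro pred_intros_logic pred_intros_finite measurable_D_bound) auto

lemma measurable_escape: "{\<omega> \<in> space M. escape m \<omega>} \<in> events"
  unfolding escape_def pred_def[symmetric]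
  by (intro pred_intros_finite measurable_D_bound) auto

lemma escape_iff: "escape m \<omega> \<longleftrightarrow> (\<exists>k\<in>{m..N}. first m k \<omega>)"
proof
  assume "escape m \<omega>"
  define k where "k = (LEAST j. m \<le> j \<and> j \<le> N \<and> 2 * c < \<bar>D m j \<omega>\<bar>)"
  have k: "m \<le> k \<and> k \<le> N \<and> 2 * c < \<bar>D m k \<omega>\<bar>"
    unfolding k_def by (rule LeastI_ex) (use \<open>escape m \<omega>\<close> in \<open>auto simp: escape_def\<close>)
  moreover have "\<bar>D m j \<omega>\<bar> \<le> 2 * c" if "j \<in> {m..<k}" for j
    using not_less_Least[of j "\<lambda>j. m \<le> j \<and> j \<le> N \<and> 2 * c < \<bar>D m j \<omega>\<bar>"] that k
    by (fastforce simp: k_def[symmetric])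
  ultimately show "\<exists>k\<in>{m..N}. first m k \<omega>" by (auto simp: first_def)
qed (auto simp: escape_def first_def)

lemma first_unique:
  assumes "first m k \<omega>" "first m k' \<omega>" "m \<le> k" "m \<le> k'"
  shows "k = k'"
proof (rule ccontr)
  assume "k \<noteq> k'"
  have "\<not> first m j' \<omega>" if "first m j \<omega>" "m \<le> j" "j < j'" for j j'
  proof
    assume "first m j' \<omega>"
    then have "\<bar>D m j \<omega>\<bar> \<le> 2 * c" using that by (auto simp: first_def)
    then show False using that(1) by (simp add: first_def)
  qed
  with \<open>k \<noteq> k'\<close> show False using assms by (meson linorder_neqE_nat)
qed

lemma sum_first: "(\<Sum>k=m..N. prob {\<omega> \<in> space M. first m k \<omega>}) = prob {\<omega> \<in> space M. escape m \<omega>}"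
proof -
  have "prob (\<Union>k\<in>{m..N}. {\<omega> \<in> space M. first m k \<omega>}) = (\<Sum>k=m..N. prob {\<omega> \<in> space M. first m k \<omega>})"
    by (intro finite_measure_finite_Union)
       (auto simp: disjoint_family_on_def measurable_first dest: first_unique)
  moreover have "(\<Union>k\<in>{m..N}. {\<omega> \<in> space M. first m k \<omega>}) = {\<omega> \<in> space M. escape m \<omega>}"
    by (auto simp: escape_iff)
  ultimately show ?thesis by simp
qed

lemma first_indep:
  assumes k: "m \<le> k" "k \<le> N" and Q[measurable]: "Measurable.pred (PiM {k..<N} (\<lambda>_. borel)) Q"
  shows "prob {\<omega> \<in> space M. first m k \<omega> \<and> Q (\<lambda>i\<in>{k..<N}. \<xi> i \<omega>)} =
    prob {\<omega> \<in> space M. first m k \<omega>} * prob {\<omega> \<in> space M. Q (\<lambda>i\<in>{k..<N}. \<xi> i \<omega>)}"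
proof -
  define P where "P f \<longleftrightarrow> 2 * c < \<bar>\<Sum>l=m..<k. f l\<bar> \<and> (\<forall>j\<in>{m..<k}. \<bar>\<Sum>l=m..<j. f l\<bar> \<le> 2 * c)" for f :: "nat \<Rightarrow> real"
  have s: "(\<lambda>f. \<Sum>l=m..<j. f l) \<in> borel_measurable (PiM {m..<k} (\<lambda>_. borel :: real measure))" if "j \<le> k" for j
    using that by (intro borel_measurable_sum measurable_component_singleton) auto
  have [measurable]: "Measurable.pred (PiM {m..<k} (\<lambda>_. borel :: real measure)) P"
  proof -
    have "Measurable.pred (PiM {m..<k} (\<lambda>_. borel)) (\<lambda>f. a < \<bar>\<Sum>l=m..<j. f l :: real\<bar>)"
      "Measurable.pred (PiM {m..<k} (\<lambda>_. borel)) (\<lambda>f. \<bar>\<Sum>l=m..<j. f l :: real\<bar> \<le> a)" if "j \<le> k" for j a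
      using s[OF that] by measurable
    then show ?thesis unfolding P_def by (intro pred_intros_logic pred_intros_finite) auto
  qed
  have P: "P (\<lambda>i\<in>{m..<k}. \<xi> i \<omega>) \<longleftrightarrow> first m k \<omega>" for \<omega>
  proof -
    have "(\<Sum>l=m..<j. (\<lambda>i\<in>{m..<k}. \<xi> i \<omega>) l) = D m j \<omega>" if "j \<le> k" for j
      unfolding D_def using that by (intro sum.cong) auto
    then show ?thesis by (auto simp: P_def first_def)
  qed
  show ?thesis
  proof -
    have "{m..<k} \<union> {k..<N} \<subseteq> {..<N}" "{m..<k} \<inter> {k..<N} = {}" using k by auto
    from indep_vars_blocks[OF ind this \<open>Measurable.pred _ P\<close> Q] show ?thesis by (simp only: P)
  qed
qed

lemma restrict_sum: "k \<le> i \<Longrightarrow> j \<le> N \<Longrightarrow> (\<Sum>l=i..<j. (\<lambda>i\<in>{k..<N}. \<xi> i \<omega>) l) = D i j \<omega>"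
  unfolding D_def by (intro sum.cong) auto

text \<open>Once the sums have left the interval at time \<open>k\<close>, an independent remainder
  of size at most \<open>c\<close> keeps \<open>\<bar>D m N\<bar>\<close> above \<open>c\<close>. So
  the escape probability times \<open>1 - \<alpha>\<close> is at most \<alpha>.\<close>

lemma ottaviani:
  assumes m: "m \<le> N"
  shows "prob {\<omega> \<in> space M. escape m \<omega>} \<le> 2 * \<alpha>"
proof -
  let ?Q = "\<lambda>k f. \<bar>\<Sum>l=k..<N. f l\<bar> \<le> c"
  have [measurable]: "Measurable.pred (PiM {k..<N} (\<lambda>_. borel :: real measure)) (?Q k)" for k by measurable
  have tail: "1 - \<alpha> \<le> prob {\<omega> \<in> space M. \<bar>D k N \<omega>\<bar> \<le> c}" if "k \<le> N" for k
  proof -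
    have "prob (space M - {\<omega> \<in> space M. c < \<bar>D k N \<omega>\<bar>}) = 1 - prob {\<omega> \<in> space M. c < \<bar>D k N \<omega>\<bar>}"
      using measurable_D_bound(1)[OF order_refl] by (intro prob_compl) (simp add: pred_def)
    moreover have "space M - {\<omega> \<in> space M. c < \<bar>D k N \<omega>\<bar>} = {\<omega> \<in> space M. \<bar>D k N \<omega>\<bar> \<le> c}" by auto
    ultimately show ?thesis using incr[OF that order_refl] by (simp add: D_def)
  qed
  have "prob {\<omega> \<in> space M. escape m \<omega>} * (1 - \<alpha>) = (\<Sum>k=m..N. prob {\<omega> \<in> space M. first m k \<omega>} * (1 - \<alpha>))"
    by (simp add: sum_first[symmetric] sum_distrib_right)
  also have "\<dots> \<le> (\<Sum>k=m..N. prob {\<omega> \<in> space M. first m k \<omega>} * prob {\<omega> \<in> space M. \<bar>D k N \<omega>\<bar> \<le> c})"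
    using tail by (intro sum_mono mult_left_mono) auto
  also have "\<dots> = (\<Sum>k=m..N. prob {\<omega> \<in> space M. first m k \<omega> \<and> \<bar>D k N \<omega>\<bar> \<le> c})"
  proof (intro sum.cong refl)
    fix k assume "k \<in> {m..N}"
    then show "prob {\<omega> \<in> space M. first m k \<omega>} * prob {\<omega> \<in> space M. \<bar>D k N \<omega>\<bar> \<le> c} =
        prob {\<omega> \<in> space M. first m k \<omega> \<and> \<bar>D k N \<omega>\<bar> \<le> c}"
      using first_indep[of m k "?Q k"] unfolding restrict_sum[OF order_refl order_refl] by auto
  qed
  also have "\<dots> = prob (\<Union>k\<in>{m..N}. {\<omega> \<in> space M. first m k \<omega> \<and> \<bar>D k N \<omega>\<bar> \<le> c})"
  proof (intro finite_measure_finite_Union[symmetric])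
    show "(\<lambda>k. {\<omega> \<in> space M. first m k \<omega> \<and> \<bar>D k N \<omega>\<bar> \<le> c}) ` {m..N} \<subseteq> events"
    proof safe
      fix k assume "k \<in> {m..N}"
      then have "{\<omega> \<in> space M. first m k \<omega>} \<inter> {\<omega> \<in> space M. \<bar>D k N \<omega>\<bar> \<le> c} \<in> events"
        using measurable_D_bound(2)[OF order_refl] by (intro sets.Int measurable_first) (auto simp: pred_def)
      then show "{\<omega> \<in> space M. first m k \<omega> \<and> \<bar>D k N \<omega>\<bar> \<le> c} \<in> events" by (simp add: Int_def conj_commute conj_left_commute)
    qed
  qed (auto simp: disjoint_family_on_def dest: first_unique)
  also have "\<dots> \<le> prob {\<omega> \<in> space M. c < \<bar>D m N \<omega>\<bar>}"
  proof (intro finite_measure_mono)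
    show "(\<Union>k\<in>{m..N}. {\<omega> \<in> space M. first m k \<omega> \<and> \<bar>D k N \<omega>\<bar> \<le> c}) \<subseteq> {\<omega> \<in> space M. c < \<bar>D m N \<omega>\<bar>}"
    proof safe
      fix k \<omega> assume *: "k \<in> {m..N}" "first m k \<omega>" "\<bar>D k N \<omega>\<bar> \<le> c"
      then have "D m N \<omega> = D m k \<omega> + D k N \<omega>" by (intro D_split) auto
      then show "c < \<bar>D m N \<omega>\<bar>" using * unfolding first_def by linarith
    qed
    show "{\<omega> \<in> space M. c < \<bar>D m N \<omega>\<bar>} \<in> events"
      using measurable_D_bound(1)[OF order_refl] by (simp add: pred_def)
  qed
  also have "\<dots> \<le> \<alpha>" using incr[OF m order_refl] by (simp add: D_def)
  finally have *: "prob {\<omega> \<in> space M. escape m \<omega>} * (1 - \<alpha>) \<le> \<alpha>" .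
  have "prob {\<omega> \<in> space M. escape m \<omega>} * (1/2) \<le> prob {\<omega> \<in> space M. escape m \<omega>} * (1 - \<alpha>)"
    using \<alpha> by (intro mult_left_mono) auto
  with * show ?thesis by linarith
qed

text \<open>The first of two consecutive oscillations above \<open>4 * c\<close> forces the sums to
  leave the interval around 0 at some \<open>k \<le> s\<close>; the second forces them to leave the
  interval around their position at \<open>k\<close>. The two exits involve disjoint blocks of
  increments, which produces the square.\<close>

lemma prob_two_oscillations:
  "prob {\<omega> \<in> space M. \<exists>r s u. r < s \<and> s < u \<and> u \<le> N \<and> 4 * c < \<bar>D r s \<omega>\<bar> \<and> 4 * c < \<bar>D s u \<omega>\<bar>} \<le> (2 * \<alpha>)\<^sup>2"
proof -
  let ?Q = "\<lambda>k f. \<exists>j\<in>{k..N}. 2 * c < \<bar>\<Sum>l=k..<j. f l\<bar>"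
  have [measurable]: "Measurable.pred (PiM {k..<N} (\<lambda>_. borel :: real measure)) (?Q k)" for k
  proof -
    have "(\<lambda>f. \<Sum>l=k..<j. f l) \<in> borel_measurable (PiM {k..<N} (\<lambda>_. borel :: real measure))" if "j \<le> N" for j
      using that by (intro borel_measurable_sum measurable_component_singleton) auto
    then have "Measurable.pred (PiM {k..<N} (\<lambda>_. borel)) (\<lambda>f. 2 * c < \<bar>\<Sum>l=k..<j. f l :: real\<bar>)" if "j \<le> N" for j
      using that by measurable
    then show ?thesis by (intro pred_intros_finite) auto
  qed
  have Q: "?Q k (\<lambda>i\<in>{k..<N}. \<xi> i \<omega>) \<longleftrightarrow> escape k \<omega>" for k \<omega>
    unfolding escape_def by (intro bex_cong refl) (auto simp: D_def)
  have E: "{\<omega> \<in> space M. first 0 k \<omega> \<and> escape k \<omega>} \<in> events" if "k \<le> N" for k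
    using sets.Int[OF measurable_first[OF that] measurable_escape] by (simp add: Int_def conj_commute conj_left_commute)
  have "prob {\<omega> \<in> space M. \<exists>r s u. r < s \<and> s < u \<and> u \<le> N \<and> 4 * c < \<bar>D r s \<omega>\<bar> \<and> 4 * c < \<bar>D s u \<omega>\<bar>}
     \<le> prob (\<Union>k\<in>{0..N}. {\<omega> \<in> space M. first 0 k \<omega> \<and> escape k \<omega>})"
  proof (intro finite_measure_mono sets.finite_UN)
    show "{\<omega> \<in> space M. \<exists>r s u. r < s \<and> s < u \<and> u \<le> N \<and> 4 * c < \<bar>D r s \<omega>\<bar> \<and> 4 * c < \<bar>D s u \<omega>\<bar>}
      \<subseteq> (\<Union>k\<in>{0..N}. {\<omega> \<in> space M. first 0 k \<omega> \<and> escape k \<omega>})"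
    proof safe
      fix \<omega> r s u
      assume \<omega>: "\<omega> \<in> space M" and *: "r < s" "s < u" "u \<le> N" "4 * c < \<bar>D r s \<omega>\<bar>" "4 * c < \<bar>D s u \<omega>\<bar>"
      have "D 0 s \<omega> = D 0 r \<omega> + D r s \<omega>" using * by (intro D_split) auto
      then have "2 * c < \<bar>D 0 r \<omega>\<bar> \<or> 2 * c < \<bar>D 0 s \<omega>\<bar>" using * by linarith
      then have "escape 0 \<omega>" using * by (auto simp: escape_def)
      then obtain k where k: "k \<le> N" "first 0 k \<omega>" by (auto simp: escape_iff)
      have "k \<le> s"
      proof (rule ccontr)
        assume "\<not> k \<le> s"
        then have "\<bar>D 0 r \<omega>\<bar> \<le> 2 * c" "\<bar>D 0 s \<omega>\<bar> \<le> 2 * c" using k * by (auto simp: first_def)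
        then show False using \<open>2 * c < \<bar>D 0 r \<omega>\<bar> \<or> 2 * c < \<bar>D 0 s \<omega>\<bar>\<close> by linarith
      qed
      then have "D k u \<omega> = D k s \<omega> + D s u \<omega>" using * by (intro D_split) auto
      then have "2 * c < \<bar>D k s \<omega>\<bar> \<or> 2 * c < \<bar>D k u \<omega>\<bar>" using * by linarith
      then have "escape k \<omega>" using * \<open>k \<le> s\<close> by (auto simp: escape_def)
      then show "\<omega> \<in> (\<Union>k\<in>{0..N}. {\<omega> \<in> space M. first 0 k \<omega> \<and> escape k \<omega>})" using k \<omega> by auto
    qed
  qed (use E in auto)
  also have "\<dots> \<le> (\<Sum>k=0..N. prob {\<omega> \<in> space M. first 0 k \<omega> \<and> escape k \<omega>})"
    using E by (intro finite_measure_subadditive_finite) auto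
  also have "\<dots> = (\<Sum>k=0..N. prob {\<omega> \<in> space M. first 0 k \<omega>} * prob {\<omega> \<in> space M. escape k \<omega>})"
  proof (intro sum.cong refl)
    fix k assume "k \<in> {0..N}"
    then show "prob {\<omega> \<in> space M. first 0 k \<omega> \<and> escape k \<omega>} =
        prob {\<omega> \<in> space M. first 0 k \<omega>} * prob {\<omega> \<in> space M. escape k \<omega>}"
      using first_indep[of 0 k "?Q k"] unfolding Q by auto
  qed
  also have "\<dots> \<le> (\<Sum>k=0..N. prob {\<omega> \<in> space M. first 0 k \<omega>} * (2 * \<alpha>))"
    using ottaviani by (intro sum_mono mult_left_mono) auto
  also have "\<dots> = prob {\<omega> \<in> space M. escape 0 \<omega>} * (2 * \<alpha>)"
    by (simp add: sum_first[symmetric] sum_distrib_right)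
  also have "\<dots> \<le> (2 * \<alpha>) * (2 * \<alpha>)"
    using ottaviani[of 0] order_trans[OF measure_nonneg ottaviani[of 0]] by (intro mult_right_mono) auto
  finally show ?thesis by (simp add: power2_eq_square)
qed

end

section \<open>Independent increments along the dyadic numbers\<close>

definition grid :: "nat \<Rightarrow> real set" where "grid n = {t. t * 2 ^ n \<in> \<nat>}"

lemma grid_iff: "t \<in> grid n \<longleftrightarrow> (\<exists>k. t = real k / 2 ^ n)"
  unfolding grid_def by (auto simp: Nats_def field_simps)

lemma grid_mono: "m \<le> n \<Longrightarrow> grid m \<subseteq> grid n"
proof
  fix t assume "m \<le> n" "t \<in> grid m"
  then obtain k where "t = real k / 2 ^ m" by (auto simp: grid_iff)
  moreover have "(2::real) ^ n = 2 ^ m * 2 ^ (n - m)"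
    using \<open>m \<le> n\<close> by (simp add: power_add[symmetric])
  ultimately have "t = real (k * 2 ^ (n - m)) / 2 ^ n" by simp
  then show "t \<in> grid n" unfolding grid_iff by blast
qed

definition dyadic_points :: "real set" where "dyadic_points = (\<Union>n. grid n)"

lemma grid_point [simp]: "real k / 2 ^ n \<in> grid n" by (auto simp: grid_iff)

lemma dyadic_point [simp]: "real k / 2 ^ n \<in> dyadic_points" by (auto simp: dyadic_points_def intro: grid_point)

lemma zero_dyadic [simp]: "0 \<in> dyadic_points" using dyadic_point[of 0 0] by simp

text \<open>\<open>\<nu> n\<close> plays the law of an increment over time
  \<open>1 / 2 ^ n\<close>.\<close>

locale dyadic_consistent =
  fixes \<nu> :: "nat \<Rightarrow> real measure"
  assumes rd: "real_distribution (\<nu> n)"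
    and conv: "\<nu> n = (\<nu> (Suc n) \<star> \<nu> (Suc n))"
begin

sublocale \<nu>: real_distribution "\<nu> n" for n by (rule rd)

definition Q :: "nat \<Rightarrow> (nat \<Rightarrow> real) measure" where "Q n = PiM UNIV (\<lambda>_. \<nu> n)"

sublocale Q: product_prob_space "\<lambda>_::nat. \<nu> n" UNIV for n ..

lemma sets_Q [measurable_cong, simp]: "sets (Q n) = sets (PiM UNIV (\<lambda>_. borel))"
  unfolding Q_def by (intro sets_PiM_cong) auto

lemma space_Q [simp]: "space (Q n) = UNIV"
  using sets_eq_imp_space_eq[OF sets_Q] by (simp add: space_PiM)

lemma prob_space_Q: "prob_space (Q n)"
  unfolding Q_def by (rule Q.P.prob_space_axioms)

lemma Q_component: "distr (Q n) borel (\<lambda>\<omega>. \<omega> i) = \<nu> n"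
  using Q.PiM_component[of i n] by (simp add: Q_def cong: distr_cong)

lemma Q_indep: "prob_space.indep_vars (Q n) (\<lambda>_. borel) (\<lambda>i \<omega>. \<omega> i) UNIV"
proof -
  interpret q: prob_space "Q n" by (rule prob_space_Q)
  have "distr (Q n) (PiM UNIV (\<lambda>_. borel)) (\<lambda>\<omega>. \<lambda>i\<in>UNIV. \<omega> i) = Q n"
    using distr_id2[of "PiM UNIV (\<lambda>_. borel)" "Q n"] by (simp add: restrict_UNIV)
  also have "\<dots> = PiM UNIV (\<lambda>i. distr (Q n) borel (\<lambda>\<omega>. \<omega> i))"
    by (simp add: Q_component) (simp add: Q_def)
  finally show ?thesis
    by (subst q.indep_vars_iff_distr_eq_PiM) (auto intro!: measurable_component_singleton simp: measurable_cong_sets[OF sets_Q refl])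
qed

definition merge :: "(nat \<Rightarrow> real) \<Rightarrow> nat \<Rightarrow> real" where
  "merge \<omega> i = \<omega> (2 * i) + \<omega> (2 * i + 1)"

lemma component_measurable [measurable]: "(\<lambda>\<omega>. \<omega> i) \<in> borel_measurable (Q n)"
  by (simp add: measurable_cong_sets[OF sets_Q refl])

lemma merge_measurable [measurable]: "merge \<in> measurable (Q n) (PiM UNIV (\<lambda>_. borel))"
proof -
  have "(\<lambda>\<omega>. \<lambda>i\<in>UNIV. \<omega> (2 * i) + \<omega> (2 * i + 1)) \<in> measurable (Q n) (PiM UNIV (\<lambda>_. borel :: real measure))"
    by (intro measurable_restrict borel_measurable_add component_measurable)
  then show ?thesis by (simp add: merge_def[abs_def] restrict_UNIV)
qed

text \<open>Neighbouring pairs use disjoint coordinates, so their sums are independent, and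
  \<open>conv\<close> gives them the law of the coarser level.\<close>

lemma distr_merge: "distr (Q (Suc n)) (PiM UNIV (\<lambda>_. borel)) merge = Q n"
proof -
  interpret q: prob_space "Q (Suc n)" by (rule prob_space_Q)
  have "q.indep_vars (\<lambda>j. PiM {2*j, 2*j+1} (\<lambda>_. borel)) (\<lambda>j \<omega>. restrict (\<lambda>i. \<omega> i) {2*j, 2*j+1}) (UNIV :: nat set)"
  proof (rule q.indep_vars_restrict[OF Q_indep])
    show "disjoint_family (\<lambda>j::nat. {2 * j, 2 * j + 1})"
      unfolding disjoint_family_on_def by (auto; presburger)
  qed simp
  then have ind: "q.indep_vars (\<lambda>j. borel) (\<lambda>j \<omega>. (\<lambda>f. f (2*j) + f (2*j+1)) (restrict (\<lambda>i. \<omega> i) {2*j, 2*j+1})) (UNIV :: nat set)"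
    by (rule q.indep_vars_compose2) (auto intro!: borel_measurable_add measurable_component_singleton)
  then have ind: "q.indep_vars (\<lambda>j. borel) (\<lambda>j \<omega>. merge \<omega> j) UNIV"
    by (simp add: merge_def)
  have marg: "distr (Q (Suc n)) borel (\<lambda>\<omega>. merge \<omega> j) = \<nu> n" for j
  proof -
    have "q.indep_var (PiM {2*j} (\<lambda>_. borel)) (\<lambda>\<omega>. restrict (\<lambda>i. \<omega> i) {2*j}) (PiM {2*j+1} (\<lambda>_. borel)) (\<lambda>\<omega>. restrict (\<lambda>i. \<omega> i) {2*j+1})"
      by (rule q.indep_var_restrict[OF Q_indep]) auto
    then have "q.indep_var borel ((\<lambda>f. f (2*j)) \<circ> (\<lambda>\<omega>. restrict (\<lambda>i. \<omega> i) {2*j})) borel ((\<lambda>f. f (2*j+1)) \<circ> (\<lambda>\<omega>. restrict (\<lambda>i. \<omega> i) {2*j+1}))"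
      by (rule q.indep_var_compose) (auto intro!: measurable_component_singleton)
    then have "q.indep_var borel (\<lambda>\<omega>. \<omega> (2*j)) borel (\<lambda>\<omega>. \<omega> (2*j+1))" by (simp add: o_def)
    from q.sum_indep_random_variable[OF this] show ?thesis
      by (simp add: merge_def Q_component conv[of n, symmetric])
  qed
  have "distr (Q (Suc n)) (PiM UNIV (\<lambda>_. borel)) (\<lambda>\<omega>. \<lambda>j\<in>UNIV. merge \<omega> j) = PiM UNIV (\<lambda>j. distr (Q (Suc n)) borel (\<lambda>\<omega>. merge \<omega> j))"
  proof (rule q.indep_vars_iff_distr_eq_PiM[THEN iffD1, OF _ _ ind])
    show "(\<lambda>\<omega>. merge \<omega> i) \<in> borel_measurable (Q (Suc n))" for i
      unfolding merge_def by (intro borel_measurable_add component_measurable)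
  qed simp
  then show ?thesis by (simp add: marg restrict_UNIV Q_def[of n])
qed

definition S :: "nat \<Rightarrow> real \<Rightarrow> (nat \<Rightarrow> real) \<Rightarrow> real" where
  "S n t \<omega> = (\<Sum>i<nat \<lfloor>t * 2 ^ n\<rfloor>. \<omega> i)"

lemma S_measurable [measurable]: "S n t \<in> borel_measurable (Q m)"
  unfolding S_def[abs_def] by (intro borel_measurable_sum component_measurable)

lemma S_merge:
  assumes "t \<in> grid n"
  shows "S n t (merge \<omega>) = S (Suc n) t \<omega>"
proof -
  obtain k where k: "t = real k / 2 ^ n" using assms by (auto simp: grid_iff)
  have "(\<Sum>i<k. \<omega> (2 * i) + \<omega> (2 * i + 1)) = (\<Sum>i<2*k. \<omega> i)"
    by (induction k) (auto simp: lessThan_Suc)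
  moreover have "t * 2 ^ n = real k" "t * 2 ^ Suc n = real (2 * k)" by (auto simp: k)
  ultimately show ?thesis unfolding S_def merge_def by (simp only: floor_of_nat nat_int)
qed

text \<open>The least level is just a canonical choice; any level containing \<open>J\<close> leads
  to the same law.\<close>

definition lev :: "real set \<Rightarrow> nat" where "lev J = (LEAST n. J \<subseteq> grid n)"

definition P :: "real set \<Rightarrow> (real \<Rightarrow> real) measure" where
  "P J = distr (Q (lev J)) (PiM J (\<lambda>_. borel)) (\<lambda>\<omega>. \<lambda>t\<in>J. S (lev J) t \<omega>)"

lemma finite_subset_grid:
  assumes "finite J" "J \<subseteq> dyadic_points" shows "\<exists>n. J \<subseteq> grid n"
  using assms
proof (induction J)
  case (insert t J)
  then obtain n m where "J \<subseteq> grid n" "t \<in> grid m" by (auto simp: dyadic_points_def)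
  then have "insert t J \<subseteq> grid (max n m)" using grid_mono[of n "max n m"] grid_mono[of m "max n m"] by auto
  then show ?case by blast
qed auto

text \<open>Induction upwards from the least level: merging pairs of increments carries one level to
  the next and leaves the sums at grid points unchanged.\<close>

lemma P_eq:
  assumes "J \<subseteq> grid n"
  shows "P J = distr (Q n) (PiM J (\<lambda>_. borel)) (\<lambda>\<omega>. \<lambda>t\<in>J. S n t \<omega>)"
proof -
  have 1: "J \<subseteq> grid (lev J)" unfolding lev_def by (rule LeastI[of _ n]) fact
  have 2: "lev J \<le> n" unfolding lev_def by (rule Least_le) fact
  from 2 show ?thesis
  proof (induction n rule: dec_induct)
    case base show ?case unfolding P_def ..
  next
    case (step m)
    have J: "J \<subseteq> grid m" using 1 grid_mono[OF step(1)] by auto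
    have "P J = distr (distr (Q (Suc m)) (PiM UNIV (\<lambda>_. borel)) merge) (PiM J (\<lambda>_. borel)) (\<lambda>\<omega>. \<lambda>t\<in>J. S m t \<omega>)"
      by (simp only: distr_merge step.IH)
    also have "\<dots> = distr (Q (Suc m)) (PiM J (\<lambda>_. borel)) (\<lambda>\<omega>. \<lambda>t\<in>J. S m t (merge \<omega>))"
    proof (subst distr_distr)
      show "(\<lambda>\<omega>. \<lambda>t\<in>J. S m t \<omega>) \<in> measurable (PiM UNIV (\<lambda>_. borel)) (PiM J (\<lambda>_. borel))"
        using S_measurable[of m _ 0] by (intro measurable_restrict) (simp add: measurable_cong_sets[OF sets_Q refl])
    qed (auto simp: o_def)
    also have "\<dots> = distr (Q (Suc m)) (PiM J (\<lambda>_. borel)) (\<lambda>\<omega>. \<lambda>t\<in>J. S (Suc m) t \<omega>)"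
      using J by (intro distr_cong refl restrict_ext S_merge) auto
    finally show ?case .
  qed
qed

text \<open>Kolmogorov's extension theorem over the dyadic times; the consistency conditions are
  read at a level fine enough for all times concerned.\<close>

sublocale proj: polish_projective dyadic_points P
proof (intro polish_projective.intro projective_family.intro)
  fix J H :: "real set" assume *: "J \<subseteq> H" "finite H" "H \<subseteq> dyadic_points"
  obtain n where n: "H \<subseteq> grid n" using finite_subset_grid[OF *(2,3)] by blast
  have "distr (P H) (PiM J (\<lambda>_. borel)) (\<lambda>f. restrict f J) =
    distr (Q n) (PiM J (\<lambda>_. borel)) (\<lambda>\<omega>. restrict (\<lambda>t\<in>H. S n t \<omega>) J)"
    unfolding P_eq[OF n] using *(1)
    by (subst distr_distr) (auto simp: o_def intro!: measurable_restrict_subset measurable_restrict)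
  also have "\<dots> = P J"
    using *(1) n by (subst P_eq[of J n]) (auto intro!: distr_cong simp: fun_eq_iff restrict_def)
  finally show "P J = distr (P H) (PiM J (\<lambda>_. borel)) (\<lambda>f. restrict f J)" by simp
next
  fix J :: "real set" assume "finite J" "J \<subseteq> dyadic_points"
  show "prob_space (P J)" unfolding P_def
    by (intro prob_space.prob_space_distr prob_space_Q measurable_restrict S_measurable)
qed

lemma distr_lim:
  assumes J: "finite J" "J \<subseteq> grid n"
  shows "distr proj.lim (PiM J (\<lambda>_. borel)) (\<lambda>\<omega>. restrict \<omega> J) = distr (Q n) (PiM J (\<lambda>_. borel)) (\<lambda>\<omega>. \<lambda>t\<in>J. S n t \<omega>)"
proof (rule measure_eqI)
  have Jd: "J \<subseteq> dyadic_points" using J by (auto simp: dyadic_points_def)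
  fix X assume "X \<in> sets (distr proj.lim (PiM J (\<lambda>_. borel)) (\<lambda>\<omega>. restrict \<omega> J))"
  then have X: "X \<in> sets (PiM J (\<lambda>_. borel))" by simp
  have m: "(\<lambda>\<omega>. restrict \<omega> J) \<in> measurable proj.lim (PiM J (\<lambda>_. borel))"
    using Jd by (simp add: measurable_cong_sets[OF proj.sets_lim refl] measurable_restrict_subset)
  have "emeasure (distr proj.lim (PiM J (\<lambda>_. borel)) (\<lambda>\<omega>. restrict \<omega> J)) X =
      emeasure proj.lim (prod_emb dyadic_points (\<lambda>_. borel) J X)"
    using m X by (simp add: emeasure_distr prod_emb_def space_PiM)
  also have "\<dots> = emeasure (P J) X" by (rule proj.emeasure_lim_emb[OF Jd J(1) X])
  finally show "emeasure (distr proj.lim (PiM J (\<lambda>_. borel)) (\<lambda>\<omega>. restrict \<omega> J)) X =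
     emeasure (distr (Q n) (PiM J (\<lambda>_. borel)) (\<lambda>\<omega>. \<lambda>t\<in>J. S n t \<omega>)) X"
    by (simp only: P_eq[OF J(2)])
qed simp

lemma lim_measurable: "t \<in> dyadic_points \<Longrightarrow> (\<lambda>\<omega>. \<omega> t) \<in> borel_measurable proj.lim"
  by (simp add: measurable_cong_sets[OF proj.sets_lim refl] measurable_component_singleton)

lemma distr_increments:
  "distr proj.lim (PiM {..<K} (\<lambda>_. borel)) (\<lambda>\<omega>. \<lambda>i\<in>{..<K}. \<omega> (real (Suc i) / 2 ^ n) - \<omega> (real i / 2 ^ n)) = PiM {..<K} (\<lambda>_. \<nu> n)"
proof -
  define J where "J = (\<lambda>i. real i / 2 ^ n) ` {..K}"
  have J: "finite J" "J \<subseteq> grid n" by (auto simp: J_def)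
  have inJ: "real i / 2 ^ n \<in> J" if "i \<le> K" for i using that by (auto simp: J_def)
  define g where "g f = (\<lambda>i\<in>{..<K}. f (real (Suc i) / 2 ^ n) - f (real i / 2 ^ n))" for f :: "real \<Rightarrow> real"
  have g: "g \<in> measurable (PiM J (\<lambda>_. borel)) (PiM {..<K} (\<lambda>_. borel))"
    unfolding g_def[abs_def]
    by (intro measurable_restrict borel_measurable_diff measurable_component_singleton inJ) auto
  have gr: "g (restrict f J) = g f" for f
    unfolding g_def by (intro restrict_ext) (auto simp: inJ Suc_le_eq less_imp_le simp del: of_nat_Suc)
  have m: "(\<lambda>\<omega>. restrict \<omega> J) \<in> measurable proj.lim (PiM J (\<lambda>_. borel))"
  proof -
    have "J \<subseteq> dyadic_points" using J(2) by (auto simp: dyadic_points_def)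
    then show ?thesis by (simp add: measurable_cong_sets[OF proj.sets_lim refl] measurable_restrict_subset)
  qed
  have mS: "(\<lambda>\<omega>. \<lambda>t\<in>J. S n t \<omega>) \<in> measurable (Q n) (PiM J (\<lambda>_. borel))"
    by (intro measurable_restrict S_measurable)
  have "distr proj.lim (PiM {..<K} (\<lambda>_. borel)) g = distr (distr proj.lim (PiM J (\<lambda>_. borel)) (\<lambda>\<omega>. restrict \<omega> J)) (PiM {..<K} (\<lambda>_. borel)) g"
    by (simp add: distr_distr[OF g m] o_def gr)
  also have "\<dots> = distr (Q n) (PiM {..<K} (\<lambda>_. borel)) (\<lambda>\<omega>. g (\<lambda>t. S n t \<omega>))"
    unfolding distr_lim[OF J] by (simp add: distr_distr[OF g mS] o_def gr)
  also have "(\<lambda>\<omega>. g (\<lambda>t. S n t \<omega>)) = (\<lambda>\<omega>. restrict \<omega> {..<K})"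
    unfolding g_def S_def by (intro ext restrict_ext) (simp add: nat_add_distrib lessThan_Suc del: of_nat_Suc)
  also have "distr (Q n) (PiM {..<K} (\<lambda>_. borel)) (\<lambda>\<omega>. restrict \<omega> {..<K}) = PiM {..<K} (\<lambda>_. \<nu> n)"
    using Q.distr_PiM_restrict_finite[of "{..<K}" n] sets_PiM_cong[OF refl, of "{..<K}" "\<lambda>_. borel" "\<lambda>_. \<nu> n"]
    by (simp add: Q_def cong: distr_cong)
  finally show ?thesis unfolding g_def[abs_def] .
qed

lemma distr_increment:
  "distr proj.lim borel (\<lambda>\<omega>. \<omega> (real (Suc i) / 2 ^ n) - \<omega> (real i / 2 ^ n)) = \<nu> n"
proof -
  let ?X = "\<lambda>\<omega>. \<lambda>i\<in>{..<Suc i}. \<omega> (real (Suc i) / 2 ^ n) - \<omega> (real i / 2 ^ n)"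
  have m: "?X \<in> measurable proj.lim (PiM {..<Suc i} (\<lambda>_. borel))"
    by (intro measurable_restrict borel_measurable_diff lim_measurable) (auto simp del: of_nat_Suc)
  have "distr (distr proj.lim (PiM {..<Suc i} (\<lambda>_. borel)) ?X) borel (\<lambda>f. f i) = \<nu> n"
    unfolding distr_increments
    using distr_PiM_component[of "{..<Suc i}" "\<lambda>_. \<nu> n" i] \<nu>.prob_space_axioms by (simp cong: distr_cong)
  then show ?thesis
    by (subst (asm) distr_distr[OF _ m]) (auto simp: o_def intro!: measurable_component_singleton)
qed

lemma indep_increments:
  "prob_space.indep_vars proj.lim (\<lambda>_. borel) (\<lambda>i \<omega>. \<omega> (real (Suc i) / 2 ^ n) - \<omega> (real i / 2 ^ n)) {..<K}"
proof (cases "K = 0")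
  case False
  show ?thesis
    using False
    by (subst proj.P.indep_vars_iff_distr_eq_PiM)
       (auto simp: distr_increments distr_increment simp del: of_nat_Suc intro!: borel_measurable_diff lim_measurable)
next
  case True
  then show ?thesis by (simp add: proj.P.indep_vars_def proj.P.indep_sets_def)
qed

lemma start_zero: "AE \<omega> in proj.lim. \<omega> 0 = 0"
proof -
  have z: "{0} \<subseteq> grid 0" by (auto simp: grid_iff)
  have m: "(\<lambda>\<omega>. restrict \<omega> {0}) \<in> measurable proj.lim (PiM {0} (\<lambda>_. borel))"
    by (simp add: measurable_cong_sets[OF proj.sets_lim refl] measurable_restrict_subset)
  have "AE f in distr proj.lim (PiM {0} (\<lambda>_. borel)) (\<lambda>\<omega>. restrict \<omega> {0}). f 0 = 0"
    unfolding distr_lim[OF _ z, simplified]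
    by (subst AE_distr_iff) (auto intro!: measurable_restrict S_measurable simp: S_def)
  then show ?thesis by (subst (asm) AE_distr_iff[OF m]) auto
qed

end

section \<open>Cadlag extension from the dyadic numbers\<close>

text \<open>
  Up to any level \<open>c\<close>, no cell of a fine enough dyadic grid contains two consecutive oscillations. A cadlag path
  satisfies this although a jump makes a single oscillation unavoidable; conversely it yields one-sided limits.
\<close>

definition osc_regular :: "(real \<Rightarrow> real) \<Rightarrow> bool" where
  "osc_regular f \<longleftrightarrow> (\<forall>c>0. \<forall>T::nat. \<exists>m::nat. \<forall>j<T * 2 ^ m. \<forall>r\<in>dyadic_points. \<forall>s\<in>dyadic_points. \<forall>u\<in>dyadic_points.
     real j / 2 ^ m \<le> r \<and> r < s \<and> s < u \<and> u \<le> real (Suc j) / 2 ^ m \<longrightarrow> \<bar>f s - f r\<bar> \<le> c \<or> \<bar>f u - f s\<bar> \<le> c)"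

text \<open>The dyadic approximation from strictly above, so that limits along it are right limits.\<close>

definition app :: "nat \<Rightarrow> real \<Rightarrow> real" where
  "app n t = real (nat \<lfloor>t * 2 ^ n\<rfloor> + 1) / 2 ^ n"

lemma app_dyadic [simp]: "app n t \<in> dyadic_points"
  unfolding app_def by (rule dyadic_point)

lemma app_bounds:
  assumes "0 \<le> t" shows "t < app n t" "app n t \<le> t + 1 / 2 ^ n"
proof -
  have "real (nat \<lfloor>t * 2 ^ n\<rfloor>) = of_int \<lfloor>t * 2 ^ n\<rfloor>" using assms by simp
  then have "t * 2 ^ n < real (nat \<lfloor>t * 2 ^ n\<rfloor> + 1)" "real (nat \<lfloor>t * 2 ^ n\<rfloor> + 1) \<le> t * 2 ^ n + 1"
    using floor_correct[of "t * 2 ^ n"] by auto linarith+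
  then show "t < app n t" "app n t \<le> t + 1 / 2 ^ n"
    by (auto simp: app_def field_simps)
qed

lemma inverse_two_power_tendsto: "(\<lambda>n. 1 / 2 ^ n :: real) \<longlonglongrightarrow> 0"
  using LIMSEQ_realpow_zero[of "1/2::real"] by (simp add: power_one_over)

lemma app_tendsto: "0 \<le> t \<Longrightarrow> (\<lambda>n. app n t) \<longlonglongrightarrow> t"
proof (rule tendsto_sandwich[of "\<lambda>_. t" _ _ "\<lambda>n. t + 1 / 2 ^ n"])
  have "(\<lambda>n. t + 1 / 2 ^ n) \<longlonglongrightarrow> t + 0" by (intro tendsto_intros inverse_two_power_tendsto)
  then show "(\<lambda>n. t + 1 / 2 ^ n) \<longlonglongrightarrow> t" by simp
qed (auto simp: app_bounds less_imp_le)

lemma app_eventually: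
  assumes "0 \<le> t" "t < b"
  shows "\<forall>\<^sub>F n in sequentially. t < app n t \<and> app n t < b"
  using order_tendstoD(2)[OF app_tendsto[OF assms(1)] assms(2)]
  by eventually_elim (simp add: app_bounds[OF assms(1)])

locale osc_path =
  fixes f :: "real \<Rightarrow> real"
  assumes reg: "osc_regular f"
begin

text \<open>Because the step from \<open>r'\<close> to \<open>s'\<close> is large, both
  \<open>\<bar>f r - f s'\<bar>\<close> and \<open>\<bar>f s - f s'\<bar>\<close> must be at most
  \<open>c\<close>, which leaves at most \<open>2 * c\<close> for the later pair.\<close>

lemma two_pairs:
  assumes "0 < c" "r' < s'" "s' < r" "r < s" "2 * c < \<bar>f s - f r\<bar>" "2 * c < \<bar>f s' - f r'\<bar>"
    and "{r', s', r, s} \<subseteq> dyadic_points"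
    and H: "\<And>r s u. r \<in> dyadic_points \<Longrightarrow> s \<in> dyadic_points \<Longrightarrow> u \<in> dyadic_points \<Longrightarrow> a \<le> r \<Longrightarrow> r < s \<Longrightarrow> s < u \<Longrightarrow> u \<le> b \<Longrightarrow>
      \<bar>f s - f r\<bar> \<le> c \<or> \<bar>f u - f s\<bar> \<le> c"
    and "a \<le> r'" "s \<le> b"
  shows False
proof -
  have "\<bar>f s' - f r'\<bar> \<le> c \<or> \<bar>f r - f s'\<bar> \<le> c" using assms by (intro H) auto
  moreover have "\<bar>f s' - f r'\<bar> \<le> c \<or> \<bar>f s - f s'\<bar> \<le> c" using assms by (intro H) auto
  ultimately show False using assms(1,5,6) by linarith
qed

text \<open>\<open>I \<delta>\<close> stands for one-sided neighbourhoods of a point, and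
  \<open>shrink\<close> says that some neighbourhood lies entirely to one side of a given pair. If
  every neighbourhood contained a pair differing by more than \<open>e\<close>, two such pairs would
  lie side by side in one cell, against \<open>two_pairs\<close>. Left and right limits become
  instances.\<close>

lemma one_sided_modulus:
  fixes I :: "real \<Rightarrow> real set" and \<delta>0 :: real
  assumes e: "0 < e" and I: "\<And>\<delta>. 0 < \<delta> \<Longrightarrow> \<delta> < \<delta>0 \<Longrightarrow> I \<delta> \<subseteq> {a..b}" and \<delta>0: "0 < \<delta>0"
    and j: "a = real j / 2 ^ m" "b = real (Suc j) / 2 ^ m"
    and H: "\<And>r s u. r \<in> dyadic_points \<Longrightarrow> s \<in> dyadic_points \<Longrightarrow> u \<in> dyadic_points \<Longrightarrow> a \<le> r \<Longrightarrow> r < s \<Longrightarrow> s < u \<Longrightarrow> u \<le> b \<Longrightarrow>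
      \<bar>f s - f r\<bar> \<le> e / 2 \<or> \<bar>f u - f s\<bar> \<le> e / 2"
    and shrink: "\<And>\<delta> r s. 0 < \<delta> \<Longrightarrow> \<delta> < \<delta>0 \<Longrightarrow> r \<in> I \<delta> \<Longrightarrow> s \<in> I \<delta> \<Longrightarrow> r < s \<Longrightarrow>
      \<exists>\<delta>'>0. \<delta>' < \<delta>0 \<and> ((\<forall>x\<in>I \<delta>'. x < r) \<or> (\<forall>x\<in>I \<delta>'. s < x))"
  shows "\<exists>\<delta>>0. \<delta> < \<delta>0 \<and> (\<forall>r\<in>dyadic_points \<inter> I \<delta>. \<forall>s\<in>dyadic_points \<inter> I \<delta>. \<bar>f s - f r\<bar> \<le> e)"
proof (rule ccontr)
  assume neg: "\<not> ?thesis"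
  have ex: "\<exists>r s. r \<in> dyadic_points \<inter> I \<delta> \<and> s \<in> dyadic_points \<inter> I \<delta> \<and> r < s \<and> e < \<bar>f s - f r\<bar>" if "0 < \<delta>" "\<delta> < \<delta>0" for \<delta>
  proof -
    have "\<not> (\<forall>r\<in>dyadic_points \<inter> I \<delta>. \<forall>s\<in>dyadic_points \<inter> I \<delta>. \<bar>f s - f r\<bar> \<le> e)"
    proof
      assume "\<forall>r\<in>dyadic_points \<inter> I \<delta>. \<forall>s\<in>dyadic_points \<inter> I \<delta>. \<bar>f s - f r\<bar> \<le> e"
      with that have "\<exists>\<delta>>0. \<delta> < \<delta>0 \<and> (\<forall>r\<in>dyadic_points \<inter> I \<delta>. \<forall>s\<in>dyadic_points \<inter> I \<delta>. \<bar>f s - f r\<bar> \<le> e)"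
        by (intro exI[of _ \<delta>] conjI)
      with neg show False by (rule notE)
    qed
    then have "\<exists>r\<in>dyadic_points \<inter> I \<delta>. \<exists>s\<in>dyadic_points \<inter> I \<delta>. \<not> \<bar>f s - f r\<bar> \<le> e" by meson
    then obtain r s where rs: "r \<in> dyadic_points \<inter> I \<delta>" "s \<in> dyadic_points \<inter> I \<delta>" "\<not> \<bar>f s - f r\<bar> \<le> e"
      by (elim bexE) (rule that)
    then have "e < \<bar>f s - f r\<bar>" by (simp only: not_le)
    note rs = rs(1,2) this
    then have "r \<noteq> s" using e by auto
    then consider "r < s" | "s < r" by linarith
    then show ?thesis
    proof cases
      case 2
      then show ?thesis using rs by (intro exI[of _ s] exI[of _ r]) (auto simp: abs_minus_commute)
    next
      case 1
      then show ?thesis using rs by (intro exI[of _ r] exI[of _ s] conjI)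
    qed
  qed
  obtain \<delta> where \<delta>: "0 < \<delta>" "\<delta> < \<delta>0" using dense[OF \<delta>0] by blast
  obtain r s where rs: "r \<in> dyadic_points \<inter> I \<delta>" "s \<in> dyadic_points \<inter> I \<delta>" "r < s" "e < \<bar>f s - f r\<bar>"
    using ex[OF \<delta>] by blast
  obtain \<delta>' where \<delta>': "0 < \<delta>'" "\<delta>' < \<delta>0" "(\<forall>x\<in>I \<delta>'. x < r) \<or> (\<forall>x\<in>I \<delta>'. s < x)"
    using shrink[of \<delta> r s] \<delta> rs by auto
  obtain r' s' where rs': "r' \<in> dyadic_points \<inter> I \<delta>'" "s' \<in> dyadic_points \<inter> I \<delta>'" "r' < s'" "e < \<bar>f s' - f r'\<bar>"
    using ex[OF \<delta>'(1,2)] by blast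
  have ab: "r \<in> {a..b}" "s \<in> {a..b}" "r' \<in> {a..b}" "s' \<in> {a..b}"
    using I[OF \<delta>] I[OF \<delta>'(1,2)] rs rs' by auto
  from \<delta>'(3) show False
  proof
    assume "\<forall>x\<in>I \<delta>'. x < r"
    then have "s' < r" using rs' by auto
    then show False
      using two_pairs[of "e/2" r' s' r s a b] rs rs' e ab H by auto
  next
    assume "\<forall>x\<in>I \<delta>'. s < x"
    then have "s < r'" using rs' by auto
    then show False
      using two_pairs[of "e/2" r s r' s' a b] rs rs' e ab H by auto
  qed
qed

lemma right_modulus:
  assumes t: "0 \<le> t" and e: "0 < e"
  shows "\<exists>\<delta>>0. \<forall>r\<in>dyadic_points \<inter> {t<..<t+\<delta>}. \<forall>s\<in>dyadic_points \<inter> {t<..<t+\<delta>}. \<bar>f s - f r\<bar> \<le> e"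
proof -
  define T where "T = nat \<lfloor>t\<rfloor> + 1"
  have T: "t < real T" using t by (simp add: T_def) linarith
  obtain m where m: "\<forall>j<T * 2 ^ m. \<forall>r\<in>dyadic_points. \<forall>s\<in>dyadic_points. \<forall>u\<in>dyadic_points.
     real j / 2 ^ m \<le> r \<and> r < s \<and> s < u \<and> u \<le> real (Suc j) / 2 ^ m \<longrightarrow> \<bar>f s - f r\<bar> \<le> e / 2 \<or> \<bar>f u - f s\<bar> \<le> e / 2"
    using reg e unfolding osc_regular_def by (meson half_gt_zero)
  \<comment> \<open>The cell that may have \<open>t\<close> as its left but not as its right end, so
    a right neighbourhood of \<open>t\<close> lies inside.\<close>
  define j where "j = nat \<lfloor>t * 2 ^ m\<rfloor>"
  have j: "real j \<le> t * 2 ^ m" "t * 2 ^ m < real (Suc j)"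
    using t floor_correct[of "t * 2 ^ m"] by (auto simp: j_def) linarith
  have "real j < real (T * 2 ^ m)" using j(1) T by (simp add: order_le_less_trans[OF j(1)])
  then have jT: "j < T * 2 ^ m" by (simp only: of_nat_less_iff)
  have b: "real j / 2 ^ m \<le> t" "t < real (Suc j) / 2 ^ m" using j by (auto simp: field_simps)
  have "\<exists>\<delta>>0. \<delta> < real (Suc j) / 2 ^ m - t \<and> (\<forall>r\<in>dyadic_points \<inter> {t<..<t+\<delta>}. \<forall>s\<in>dyadic_points \<inter> {t<..<t+\<delta>}. \<bar>f s - f r\<bar> \<le> e)"
  proof (rule one_sided_modulus[where a="real j / 2 ^ m" and b="real (Suc j) / 2 ^ m", OF e _ _ refl refl])
    show "\<exists>\<delta>'>0. \<delta>' < real (Suc j) / 2 ^ m - t \<and> ((\<forall>x\<in>{t<..<t+\<delta>'}. x < r) \<or> (\<forall>x\<in>{t<..<t+\<delta>'}. s < x))"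
      if "\<delta> < real (Suc j) / 2 ^ m - t" "r \<in> {t<..<t+\<delta>}" for \<delta> r s
      using that by (intro exI[of _ "r - t"]) auto
  qed (use b m jT in \<open>auto simp del: of_nat_Suc\<close>)
  then show ?thesis by blast
qed

lemma left_modulus:
  assumes t: "0 < t" and e: "0 < e"
  shows "\<exists>\<delta>>0. \<delta> < t \<and> (\<forall>r\<in>dyadic_points \<inter> {t-\<delta><..<t}. \<forall>s\<in>dyadic_points \<inter> {t-\<delta><..<t}. \<bar>f s - f r\<bar> \<le> e)"
proof -
  define T where "T = nat \<lceil>t\<rceil>"
  have T: "t \<le> real T" using t by (simp add: T_def)
  obtain m where m: "\<forall>j<T * 2 ^ m. \<forall>r\<in>dyadic_points. \<forall>s\<in>dyadic_points. \<forall>u\<in>dyadic_points.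
     real j / 2 ^ m \<le> r \<and> r < s \<and> s < u \<and> u \<le> real (Suc j) / 2 ^ m \<longrightarrow> \<bar>f s - f r\<bar> \<le> e / 2 \<or> \<bar>f u - f s\<bar> \<le> e / 2"
    using reg e unfolding osc_regular_def by (meson half_gt_zero)
  \<comment> \<open>Rounding up and subtracting 1 gives the cell that may have \<open>t\<close> as
    its right but not as its left end. A left neighbourhood of \<open>t\<close> lies inside even if
    \<open>t\<close> is a grid point.\<close>
  define j where "j = nat (\<lceil>t * 2 ^ m\<rceil> - 1)"
  have "0 < t * 2 ^ m" using t by simp
  then have "1 \<le> \<lceil>t * 2 ^ m\<rceil>" by linarith
  then have "real j = of_int \<lceil>t * 2 ^ m\<rceil> - 1" by (simp add: j_def)
  then have j: "real j < t * 2 ^ m" "t * 2 ^ m \<le> real (Suc j)" by linarith+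
  have "t * 2 ^ m \<le> real T * 2 ^ m" using T by (intro mult_right_mono) auto
  from order_less_le_trans[OF j(1) this] have "real j < real (T * 2 ^ m)" by simp
  then have jT: "j < T * 2 ^ m" by (simp only: of_nat_less_iff)
  have b: "real j / 2 ^ m < t" "t \<le> real (Suc j) / 2 ^ m" "0 \<le> real j / 2 ^ m" using j by (auto simp: field_simps)
  have "\<exists>\<delta>>0. \<delta> < t - real j / 2 ^ m \<and> (\<forall>r\<in>dyadic_points \<inter> {t-\<delta><..<t}. \<forall>s\<in>dyadic_points \<inter> {t-\<delta><..<t}. \<bar>f s - f r\<bar> \<le> e)"
  proof (rule one_sided_modulus[where a="real j / 2 ^ m" and b="real (Suc j) / 2 ^ m", OF e _ _ refl refl])
    show "\<exists>\<delta>'>0. \<delta>' < t - real j / 2 ^ m \<and> ((\<forall>x\<in>{t-\<delta>'<..<t}. x < r) \<or> (\<forall>x\<in>{t-\<delta>'<..<t}. s < x))"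
      if "\<delta> < t - real j / 2 ^ m" "s \<in> {t-\<delta><..<t}" for \<delta> r s
      using that by (intro exI[of _ "t - s"]) auto
  qed (use b m jT in \<open>auto simp del: of_nat_Suc\<close>)
  then obtain \<delta> where "0 < \<delta>" "\<delta> < t - real j / 2 ^ m"
    "\<forall>r\<in>dyadic_points \<inter> {t-\<delta><..<t}. \<forall>s\<in>dyadic_points \<inter> {t-\<delta><..<t}. \<bar>f s - f r\<bar> \<le> e" by blast
  moreover from this b have "\<delta> < t" by linarith
  ultimately show ?thesis by blast
qed

definition y :: "real \<Rightarrow> real" where "y t = lim (\<lambda>n. f (app n t))"

lemma y_tendsto:
  assumes t: "0 \<le> t" shows "(\<lambda>n. f (app n t)) \<longlonglongrightarrow> y t"
proof -
  have "Cauchy (\<lambda>n. f (app n t))"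
  proof (rule metric_CauchyI)
    fix e :: real assume "0 < e"
    obtain \<delta> where \<delta>: "0 < \<delta>" "\<forall>r\<in>dyadic_points \<inter> {t<..<t+\<delta>}. \<forall>s\<in>dyadic_points \<inter> {t<..<t+\<delta>}. \<bar>f s - f r\<bar> \<le> e / 2"
      using right_modulus[OF t, of "e/2"] \<open>0 < e\<close> by auto
    obtain N where N: "\<And>n. N \<le> n \<Longrightarrow> t < app n t \<and> app n t < t + \<delta>"
      using app_eventually[OF t, of "t + \<delta>"] \<delta>(1) by (auto simp: eventually_sequentially)
    have "dist (f (app i t)) (f (app k t)) < e" if "N \<le> i" "N \<le> k" for i k
    proof -
      have "\<bar>f (app i t) - f (app k t)\<bar> \<le> e / 2" using \<delta>(2) N[OF that(1)] N[OF that(2)] by auto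
      then show ?thesis using \<open>0 < e\<close> by (simp add: dist_real_def)
    qed
    then show "\<exists>M. \<forall>i\<ge>M. \<forall>k\<ge>M. dist (f (app i t)) (f (app k t)) < e" by blast
  qed
  then show ?thesis unfolding y_def by (simp add: Cauchy_convergent_iff convergent_LIMSEQ_iff)
qed

lemma y_close:
  assumes v: "0 \<le> v" "v < b" and r: "\<And>s. s \<in> dyadic_points \<Longrightarrow> v < s \<Longrightarrow> s < b \<Longrightarrow> \<bar>f s - x\<bar> \<le> e"
  shows "\<bar>y v - x\<bar> \<le> e"
proof (rule LIMSEQ_le_const2)
  show "(\<lambda>n. \<bar>f (app n v) - x\<bar>) \<longlonglongrightarrow> \<bar>y v - x\<bar>" by (intro tendsto_intros y_tendsto v)
  show "\<exists>N. \<forall>n\<ge>N. \<bar>f (app n v) - x\<bar> \<le> e"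
    using app_eventually[OF v] r by (fastforce simp: eventually_sequentially)
qed

lemma y_right_continuous:
  assumes t: "0 \<le> t" shows "(y \<longlongrightarrow> y t) (at_right t)"
proof (rule tendstoI)
  fix e :: real assume "0 < e"
  obtain \<delta> where \<delta>: "0 < \<delta>" "\<forall>r\<in>dyadic_points \<inter> {t<..<t+\<delta>}. \<forall>s\<in>dyadic_points \<inter> {t<..<t+\<delta>}. \<bar>f s - f r\<bar> \<le> e / 2"
    using right_modulus[OF t, of "e/2"] \<open>0 < e\<close> by auto
  have "dist (y v) (y t) < e" if v: "t < v" "v < t + \<delta>" for v
  proof -
    have "\<bar>y t - y v\<bar> \<le> e / 2"
    proof (rule y_close[of t "t + \<delta>"])
      fix s assume s: "s \<in> dyadic_points" "t < s" "s < t + \<delta>"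
      have "\<bar>y v - f s\<bar> \<le> e / 2"
        by (rule y_close[of v "t + \<delta>"]) (use \<delta> s v t in auto)
      then show "\<bar>f s - y v\<bar> \<le> e / 2" by (simp add: abs_minus_commute)
    qed (use t \<delta> in auto)
    then show ?thesis using \<open>0 < e\<close> by (simp add: dist_real_def abs_minus_commute)
  qed
  then show "\<forall>\<^sub>F v in at_right t. dist (y v) (y t) < e"
    using \<delta>(1) by (intro eventually_at_rightI[of t "t + \<delta>"]) auto
qed

lemma y_left_close:
  assumes t: "0 < t" and e: "0 < e"
  shows "\<exists>\<delta>>0. \<delta> < t \<and> (\<forall>v\<in>{t-\<delta><..<t}. \<forall>s\<in>dyadic_points \<inter> {t-\<delta><..<t}. \<bar>y v - f s\<bar> \<le> e)"
proof -
  obtain \<delta> where \<delta>: "0 < \<delta>" "\<delta> < t" "\<forall>r\<in>dyadic_points \<inter> {t-\<delta><..<t}. \<forall>s\<in>dyadic_points \<inter> {t-\<delta><..<t}. \<bar>f s - f r\<bar> \<le> e"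
    using left_modulus[OF t e] by blast
  have "\<bar>y v - f s\<bar> \<le> e" if "v \<in> {t-\<delta><..<t}" "s \<in> dyadic_points \<inter> {t-\<delta><..<t}" for v s
    by (rule y_close[of v t]) (use \<delta> that in auto)
  then show ?thesis using \<delta> by blast
qed

lemma dyadic_between:
  assumes "0 \<le> a" "a < b" shows "\<exists>s\<in>dyadic_points. a < s \<and> s < b"
proof -
  obtain n where "a < app n a" "app n a < b"
    using app_eventually[OF assms] by (auto simp: eventually_sequentially)
  then show ?thesis by (intro bexI[of _ "app n a"]) auto
qed

lemma y_left_limit:
  assumes t: "0 < t" shows "\<exists>l. (y \<longlongrightarrow> l) (at_left t)"
proof -
  have close: "\<exists>\<delta>>0. \<delta> < t \<and> (\<forall>v\<in>{t-\<delta><..<t}. \<forall>w\<in>{t-\<delta><..<t}. \<bar>y v - y w\<bar> \<le> e)" if "0 < e" for e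
  proof -
    have "0 < e / 2" using that by simp
    from y_left_close[OF t this]
    obtain \<delta> where \<delta>: "0 < \<delta>" "\<delta> < t" "\<forall>v\<in>{t-\<delta><..<t}. \<forall>s\<in>dyadic_points \<inter> {t-\<delta><..<t}. \<bar>y v - f s\<bar> \<le> e/2"
      by blast
    obtain s where s: "s \<in> dyadic_points" "t - \<delta> < s" "s < t" using dyadic_between[of "t - \<delta>" t] \<delta> by auto
    have "\<bar>y v - y w\<bar> \<le> e" if "v \<in> {t-\<delta><..<t}" "w \<in> {t-\<delta><..<t}" for v w
    proof -
      have "\<bar>y v - f s\<bar> \<le> e/2" "\<bar>y w - f s\<bar> \<le> e/2" using \<delta>(3) that s by auto
      then show ?thesis by linarith
    qed
    then show ?thesis using \<delta> by blast
  qed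
  define v where "v n = t - t / 2 ^ Suc n" for n :: nat
  have v_lim: "v \<longlonglongrightarrow> t"
  proof -
    have "(\<lambda>n. t - t * (1 / 2 ^ Suc n)) \<longlonglongrightarrow> t - t * 0"
      by (intro tendsto_intros LIMSEQ_Suc inverse_two_power_tendsto)
    then show ?thesis by (simp add: v_def[abs_def])
  qed
  have v_ev: "\<forall>\<^sub>F n in sequentially. v n \<in> {t-\<delta><..<t}" if "0 < \<delta>" for \<delta>
    using order_tendstoD(1)[OF v_lim, of "t - \<delta>"] that t by (auto simp: v_def elim!: eventually_mono)
  have "Cauchy (\<lambda>n. y (v n))"
  proof (rule metric_CauchyI)
    fix e :: real assume "0 < e"
    obtain \<delta> where \<delta>: "0 < \<delta>" "\<forall>v\<in>{t-\<delta><..<t}. \<forall>w\<in>{t-\<delta><..<t}. \<bar>y v - y w\<bar> \<le> e/2"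
      using close[of "e/2"] \<open>0 < e\<close> by auto
    obtain N where N: "\<And>n. N \<le> n \<Longrightarrow> v n \<in> {t-\<delta><..<t}"
      using v_ev[OF \<delta>(1)] by (auto simp: eventually_sequentially)
    have "dist (y (v i)) (y (v k)) < e" if "N \<le> i" "N \<le> k" for i k
    proof -
      have "\<bar>y (v i) - y (v k)\<bar> \<le> e/2" using \<delta>(2) N[OF that(1)] N[OF that(2)] by blast
      then show ?thesis using \<open>0 < e\<close> by (simp add: dist_real_def)
    qed
    then show "\<exists>M. \<forall>i\<ge>M. \<forall>k\<ge>M. dist (y (v i)) (y (v k)) < e" by blast
  qed
  then obtain l where l: "(\<lambda>n. y (v n)) \<longlonglongrightarrow> l" by (auto simp: Cauchy_convergent_iff convergent_def)
  have "(y \<longlongrightarrow> l) (at_left t)"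
  proof (rule tendstoI)
    fix e :: real assume "0 < e"
    obtain \<delta> where \<delta>: "0 < \<delta>" "\<forall>v\<in>{t-\<delta><..<t}. \<forall>w\<in>{t-\<delta><..<t}. \<bar>y v - y w\<bar> \<le> e/2"
      using close[of "e/2"] \<open>0 < e\<close> by auto
    have "dist (y w) l < e" if w: "t - \<delta> < w" "w < t" for w
    proof -
      have "\<bar>y w - l\<bar> \<le> e/2"
      proof (rule LIMSEQ_le_const2)
        show "(\<lambda>n. \<bar>y w - y (v n)\<bar>) \<longlonglongrightarrow> \<bar>y w - l\<bar>" by (intro tendsto_intros l)
        show "\<exists>N. \<forall>n\<ge>N. \<bar>y w - y (v n)\<bar> \<le> e/2"
          using v_ev[OF \<delta>(1)] \<delta>(2) w unfolding eventually_sequentially by (meson greaterThanLessThan_iff)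
      qed
      then show ?thesis using \<open>0 < e\<close> by (simp add: dist_real_def)
    qed
    then show "\<forall>\<^sub>F v in at_left t. dist (y v) l < e"
      using \<delta>(1) by (intro eventually_at_leftI[of "t - \<delta>" t]) auto
  qed
  then show ?thesis by blast
qed

text \<open>A jump at \<open>t\<close> is spread over at most two adjacent cells:
  \<open>i / 2 ^ n\<close> may equal \<open>t\<close>, but \<open>(i - 1) / 2 ^ n\<close> is
  strictly smaller, and \<open>(i + 1) / 2 ^ n\<close> is the approximation from above. In
  \<open>up\<close> it is enough to have good levels of arbitrary fineness, not all fine
  levels.\<close>

lemma y_no_positive_jump:
  assumes up: "\<And>c T k. 0 < c \<Longrightarrow> \<exists>n\<ge>k. \<forall>i<T * 2 ^ n. f (real (Suc i) / 2 ^ n) - f (real i / 2 ^ n) \<le> c"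
    and t: "0 < t" and l: "(y \<longlongrightarrow> l) (at_left t)"
  shows "y t \<le> l"
proof (rule field_le_epsilon)
  fix e :: real assume "0 < e"
  \<comment> \<open>Four errors of size \<open>c\<close> are collected below: two cell increments
    and one approximation each of \<open>l\<close> and \<open>y t\<close>.\<close>
  define c where "c = e / 6"
  have c: "0 < c" using \<open>0 < e\<close> by (simp add: c_def)
  obtain \<delta> where \<delta>: "0 < \<delta>" "\<delta> < t" "\<forall>v\<in>{t-\<delta><..<t}. \<forall>s\<in>dyadic_points \<inter> {t-\<delta><..<t}. \<bar>y v - f s\<bar> \<le> c"
    using y_left_close[OF t c] by blast
  have left: "\<bar>l - f s\<bar> \<le> c" if s: "s \<in> dyadic_points" "t - \<delta> < s" "s < t" for s
  proof (rule tendsto_upperbound)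
    show "((\<lambda>v. \<bar>y v - f s\<bar>) \<longlongrightarrow> \<bar>l - f s\<bar>) (at_left t)" by (intro tendsto_intros l)
    show "\<forall>\<^sub>F v in at_left t. \<bar>y v - f s\<bar> \<le> c"
      using \<delta> s by (intro eventually_at_leftI[of "t - \<delta>" t]) auto
  qed simp
  have "\<forall>\<^sub>F n in sequentially. \<bar>f (app n t) - y t\<bar> < c"
    using tendstoD[OF y_tendsto c, of t] t by (simp add: dist_real_def)
  moreover have "\<forall>\<^sub>F n in sequentially. 1 / 2 ^ n < \<delta> / 2"
    using order_tendstoD(2)[OF inverse_two_power_tendsto, of "\<delta> / 2"] \<delta> by simp
  ultimately have "\<forall>\<^sub>F n in sequentially. \<bar>f (app n t) - y t\<bar> < c \<and> 1 / 2 ^ n < \<delta> / 2"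
    by eventually_elim simp
  then obtain k where k: "\<And>n. k \<le> n \<Longrightarrow> \<bar>f (app n t) - y t\<bar> < c \<and> 1 / 2 ^ n < \<delta> / 2"
    by (auto simp: eventually_sequentially)
  define T where "T = nat \<lfloor>t\<rfloor> + 2"
  obtain n where n: "k \<le> n" "\<forall>i<T * 2 ^ n. f (real (Suc i) / 2 ^ n) - f (real i / 2 ^ n) \<le> c"
    using up[OF c] by blast
  define i where "i = nat \<lfloor>t * 2 ^ n\<rfloor>"
  have i: "real i \<le> t * 2 ^ n" "t * 2 ^ n < real i + 1"
    using t floor_correct[of "t * 2 ^ n"] by (auto simp: i_def) linarith?
  have app: "app n t = real (Suc i) / 2 ^ n" by (simp add: app_def i_def)
  have "2 < \<delta> * 2 ^ n" using k[OF n(1)] by (simp add: field_simps)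
  also have "\<delta> * 2 ^ n < t * 2 ^ n" using \<delta> by simp
  finally have "1 < t * 2 ^ n" by linarith
  then have i1: "1 \<le> i" using i by linarith
  have T: "t < real T" by (simp add: T_def) linarith
  have "real i < real (T * 2 ^ n)" using i(1) T by (simp add: order_le_less_trans[OF i(1)])
  then have iT: "i < T * 2 ^ n" by (simp only: of_nat_less_iff)
  have "f (real (Suc i) / 2 ^ n) - f (real i / 2 ^ n) \<le> c" using n(2) iT by blast
  moreover have "f (real i / 2 ^ n) - f (real (i - 1) / 2 ^ n) \<le> c"
    using n(2)[rule_format, of "i - 1"] iT i1 by simp
  moreover have "\<bar>l - f (real (i - 1) / 2 ^ n)\<bar> \<le> c"
  proof (rule left)
    have ri: "real (i - 1) = real i - 1" using i1 by simp
    show "real (i - 1) / 2 ^ n < t" using i unfolding ri by (simp add: field_simps)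
    have "t < (real i + 1) / 2 ^ n" using i by (simp add: pos_less_divide_eq)
    moreover have "(real i - 1) / 2 ^ n = (real i + 1) / 2 ^ n - 2 * (1 / 2 ^ n)"
      by (simp add: diff_divide_distrib add_divide_distrib)
    ultimately have "t - 2 * (1 / 2 ^ n) < real (i - 1) / 2 ^ n" unfolding ri by linarith
    then show "t - \<delta> < real (i - 1) / 2 ^ n" using k[OF n(1)] by linarith
  qed simp
  moreover have "\<bar>f (real (Suc i) / 2 ^ n) - y t\<bar> < c" using k[OF n(1)] app by simp
  ultimately show "y t \<le> l + e" using \<open>0 < e\<close> unfolding c_def by linarith
qed

end

section \<open>Path regularity\<close>

context prob_space
begin

lemma has_laplace_sum_indep:
  assumes I: "finite I" and ind: "indep_vars (\<lambda>_. borel) X I"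
    and lap: "\<And>i. i \<in> I \<Longrightarrow> has_laplace (distr M borel (X i)) (L i)"
  shows "has_laplace (distr M borel (\<lambda>\<omega>. \<Sum>i\<in>I. X i \<omega>)) (\<lambda>\<theta>. \<Prod>i\<in>I. L i \<theta>)"
proof -
  have rv: "X i \<in> borel_measurable M" if "i \<in> I" for i using ind that by (auto simp: indep_vars_def)
  have int: "integrable M (\<lambda>\<omega>. exp (\<theta> * X i \<omega>))" "(\<integral>\<omega>. exp (\<theta> * X i \<omega>) \<partial>M) = L i \<theta>"
    if "i \<in> I" "0 \<le> \<theta>" for i \<theta>
    using lap[OF that(1)] that(2) by (auto simp: has_laplace_distr[OF prob_space_axioms rv[OF that(1)]])
  have ind': "indep_vars (\<lambda>_. borel) (\<lambda>i \<omega>. exp (\<theta> * X i \<omega>)) I" for \<theta>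
    by (rule indep_vars_compose2[OF ind]) simp
  have e: "exp (\<theta> * (\<Sum>i\<in>I. X i \<omega>)) = (\<Prod>i\<in>I. exp (\<theta> * X i \<omega>))" for \<theta> \<omega>
    using I by (simp add: sum_distrib_left exp_sum)
  have "integrable M (\<lambda>\<omega>. exp (\<theta> * (\<Sum>i\<in>I. X i \<omega>))) \<and> (\<integral>\<omega>. exp (\<theta> * (\<Sum>i\<in>I. X i \<omega>)) \<partial>M) = (\<Prod>i\<in>I. L i \<theta>)"
    if "0 \<le> \<theta>" for \<theta>
    unfolding e using indep_vars_integrable[OF I ind'] indep_vars_lebesgue_integral[OF I ind'] int that by simp
  then show ?thesis
    using rv by (subst has_laplace_distr[OF prob_space_axioms]) auto
qed

lemma indep_vars_shift:
  fixes X :: "nat \<Rightarrow> 'a \<Rightarrow> real"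
  assumes "indep_vars (\<lambda>_. borel) X {..<a + N}"
  shows "indep_vars (\<lambda>_. borel) (\<lambda>i. X (a + i)) {..<N}"
proof -
  have "indep_vars (\<lambda>j. PiM {a + j} (\<lambda>_. borel)) (\<lambda>j \<omega>. restrict (\<lambda>i. X i \<omega>) {a + j}) {..<N}"
    by (rule indep_vars_restrict[OF assms]) (auto simp: disjoint_family_on_def)
  then have "indep_vars (\<lambda>_. borel) (\<lambda>j \<omega>. (\<lambda>f. f (a + j)) (restrict (\<lambda>i. X i \<omega>) {a + j})) {..<N}"
    by (rule indep_vars_compose2) (auto intro!: measurable_component_singleton)
  then show ?thesis by simp
qed

text \<open>Bounded continuous test functions carry the product formula to the almost sure limit.
  Indicators of half-lines are in turn pointwise limits of such functions, which settles a generator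
  of the Borel sets.\<close>

lemma indep_vars_AE_limit:
  fixes X :: "nat \<Rightarrow> 'i \<Rightarrow> 'a \<Rightarrow> real"
  assumes I: "finite I" and ind: "\<And>k. indep_vars (\<lambda>_. borel) (X k) I"
    and Y [measurable]: "\<And>i. i \<in> I \<Longrightarrow> Y i \<in> borel_measurable M"
    and lim: "\<And>i. i \<in> I \<Longrightarrow> AE \<omega> in M. (\<lambda>k. X k i \<omega>) \<longlonglongrightarrow> Y i \<omega>"
  shows "indep_vars (\<lambda>_. borel) Y I"
proof (cases "I = {}")
  case True
  then show ?thesis by (simp add: indep_vars_def indep_sets_def)
next
  case False
  have X: "X k i \<in> borel_measurable M" if "i \<in> I" for k i using ind that by (auto simp: indep_vars_def)
  \<comment> \<open>Stable under intersection. With \<open>UNIV\<close> among the sets, the product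
    formula over all of \<open>I\<close> contains the formula over every subset of
    \<open>I\<close>.\<close>
  let ?E = "insert UNIV (range (\<lambda>a::real. {..a}))"
  have cont: "(\<integral>\<omega>. (\<Prod>i\<in>I. g i (Y i \<omega>)) \<partial>M) = (\<Prod>i\<in>I. \<integral>\<omega>. g i (Y i \<omega>) \<partial>M)"
    if g: "\<And>i. i \<in> I \<Longrightarrow> continuous_on UNIV (g i)" "\<And>i x. i \<in> I \<Longrightarrow> 0 \<le> g i x \<and> g i x \<le> 1" for g :: "'i \<Rightarrow> real \<Rightarrow> real"
  proof -
    have gm: "g i \<in> borel_measurable borel" if "i \<in> I" for i using g(1)[OF that] by (rule borel_measurable_continuous_onI)
    have gX: "(\<lambda>\<omega>. g i (X k i \<omega>)) \<in> borel_measurable M" "(\<lambda>\<omega>. g i (Y i \<omega>)) \<in> borel_measurable M" if "i \<in> I" for k i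
      using measurable_compose[OF X gm] measurable_compose[OF Y gm] that by auto
    have bd: "norm (g i x) \<le> 1" if "i \<in> I" for i x using g(2)[OF that, of x] by simp
    have gint: "integrable M (\<lambda>\<omega>. g i (X k i \<omega>))" if "i \<in> I" for i k
      using gX[OF that] bd[OF that] by (intro integrable_const_bound[where B=1]) auto
    have pb: "norm (\<Prod>i\<in>I. g i (f i)) \<le> 1" for f
      unfolding prod_norm[symmetric] using bd by (intro prod_le_1) auto
    have glim: "AE \<omega> in M. (\<lambda>k. g i (X k i \<omega>)) \<longlonglongrightarrow> g i (Y i \<omega>)" if "i \<in> I" for i
      using lim[OF that]
    proof eventually_elim
      case (elim \<omega>)
      have "isCont (g i) (Y i \<omega>)" using g(1)[OF that] by (simp add: continuous_on_eq_continuous_at)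
      then show ?case using elim by (rule isCont_tendsto_compose)
    qed
    have "(\<lambda>k. \<integral>\<omega>. (\<Prod>i\<in>I. g i (X k i \<omega>)) \<partial>M) \<longlonglongrightarrow> (\<integral>\<omega>. (\<Prod>i\<in>I. g i (Y i \<omega>)) \<partial>M)"
    proof (rule integral_dominated_convergence[where w="\<lambda>_. 1"])
      have "AE \<omega> in M. \<forall>i\<in>I. (\<lambda>k. g i (X k i \<omega>)) \<longlonglongrightarrow> g i (Y i \<omega>)"
        using glim by (intro AE_finite_allI I)
      then show "AE \<omega> in M. (\<lambda>k. \<Prod>i\<in>I. g i (X k i \<omega>)) \<longlonglongrightarrow> (\<Prod>i\<in>I. g i (Y i \<omega>))"
        by eventually_elim (auto intro!: tendsto_prod)
    qed (use gX pb in \<open>auto intro!: borel_measurable_prod\<close>)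
    moreover have "(\<integral>\<omega>. (\<Prod>i\<in>I. g i (X k i \<omega>)) \<partial>M) = (\<Prod>i\<in>I. \<integral>\<omega>. g i (X k i \<omega>) \<partial>M)" for k
      by (intro indep_vars_lebesgue_integral I indep_vars_compose2[OF ind] gint gm)
    moreover have "(\<lambda>k. \<Prod>i\<in>I. \<integral>\<omega>. g i (X k i \<omega>) \<partial>M) \<longlonglongrightarrow> (\<Prod>i\<in>I. \<integral>\<omega>. g i (Y i \<omega>) \<partial>M)"
    proof (rule tendsto_prod)
      fix i assume i: "i \<in> I"
      show "(\<lambda>k. \<integral>\<omega>. g i (X k i \<omega>) \<partial>M) \<longlonglongrightarrow> (\<integral>\<omega>. g i (Y i \<omega>) \<partial>M)"
        by (rule integral_dominated_convergence[where w="\<lambda>_. 1"]) (use gX[OF i] bd[OF i] glim[OF i] in auto)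
    qed
    ultimately show ?thesis by (auto intro: LIMSEQ_unique)
  qed
  define cts_approx where "cts_approx A g \<longleftrightarrow> (\<forall>k. continuous_on UNIV (g k)) \<and> (\<forall>k x. 0 \<le> g k x \<and> g k x \<le> 1) \<and>
    (\<forall>x. (\<lambda>k. g k x) \<longlonglongrightarrow> indicator A x)" for A and g :: "nat \<Rightarrow> real \<Rightarrow> real"
  have approx: "\<exists>g. cts_approx A g"
    if A: "A \<in> ?E" for A
  proof -
    consider "A = UNIV" | a where "A = {..a}" using A by blast
    then show ?thesis
    proof cases
      case 1
      then show ?thesis by (intro exI[of _ "\<lambda>_ _. 1"]) (auto simp: cts_approx_def)
    next
      case 2
      \<comment> \<open>For \<open>k > 0\<close> this is 1 up to \<open>a\<close>, 0 from
        \<open>a + 1 / k\<close> on, and linear in between.\<close>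
      define g where "g k x = max 0 (min 1 (1 - real k * (x - a)))" for k :: nat and x
      have "(\<lambda>k. g k x) \<longlonglongrightarrow> indicator A x" for x
      proof (cases "x \<le> a")
        case True
        then have "real k * (x - a) \<le> 0" for k by (simp add: mult_nonneg_nonpos)
        then show ?thesis using True 2 by (simp add: g_def min_absorb1)
      next
        case False
        have "\<forall>\<^sub>F k in sequentially. g k x = 0"
        proof (rule eventually_sequentiallyI)
          fix k assume k: "nat \<lceil>1 / (x - a)\<rceil> \<le> k"
          then have "1 / (x - a) \<le> real k" by linarith
          then have "1 \<le> real k * (x - a)" using False by (simp add: field_simps)
          then show "g k x = 0" by (simp add: g_def)
        qed
        then show ?thesis using False 2 by (simp add: tendsto_eventually)
      qed
      moreover have "continuous_on UNIV (g k)" for k unfolding g_def by (intro continuous_intros)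
      ultimately show ?thesis by (intro exI[of _ g]) (auto simp: g_def cts_approx_def)
    qed
  qed
  have "prob (\<Inter>i\<in>I. Y i -` A i \<inter> space M) = (\<Prod>i\<in>I. prob (Y i -` A i \<inter> space M))" if A: "\<And>i. i \<in> I \<Longrightarrow> A i \<in> ?E" for A
  proof -
    have "\<exists>g. \<forall>i\<in>I. cts_approx (A i) (g i)" by (intro bchoice ballI approx A)
    then obtain g where g': "\<And>i. i \<in> I \<Longrightarrow> cts_approx (A i) (g i)" by blast
    have g: "\<And>i k. i \<in> I \<Longrightarrow> continuous_on UNIV (g i k)"
      "\<And>i k x. i \<in> I \<Longrightarrow> 0 \<le> g i k x \<and> g i k x \<le> 1" "\<And>i x. i \<in> I \<Longrightarrow> (\<lambda>k. g i k x) \<longlonglongrightarrow> indicator (A i) x"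
      using g' unfolding cts_approx_def by simp_all
    have Am [measurable]: "A i \<in> sets borel" if "i \<in> I" for i using A[OF that] by auto
    have gm: "g i k \<in> borel_measurable borel" if "i \<in> I" for i k using g(1)[OF that] by (rule borel_measurable_continuous_onI)
    have gY: "(\<lambda>\<omega>. g i k (Y i \<omega>)) \<in> borel_measurable M" if "i \<in> I" for i k
      using measurable_compose[OF Y gm] that by auto
    have AY: "(\<lambda>\<omega>. indicator (A i) (Y i \<omega>) :: real) \<in> borel_measurable M" if "i \<in> I" for i
      using Y[OF that] Am[OF that] by measurable
    have bd: "norm (g i k x) \<le> 1" if "i \<in> I" for i k x using g(2)[OF that, of k x] by simp
    have pb: "norm (\<Prod>i\<in>I. g i k (f i)) \<le> 1" for f k
      unfolding prod_norm[symmetric] using bd by (intro prod_le_1) auto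
    have "(\<lambda>k. \<integral>\<omega>. (\<Prod>i\<in>I. g i k (Y i \<omega>)) \<partial>M) \<longlonglongrightarrow> (\<integral>\<omega>. (\<Prod>i\<in>I. indicator (A i) (Y i \<omega>)) \<partial>M)"
      by (rule integral_dominated_convergence[where w="\<lambda>_. 1"])
         (use gY AY pb g(3) in \<open>auto intro!: borel_measurable_prod tendsto_prod\<close>)
    moreover have "(\<lambda>k. \<Prod>i\<in>I. \<integral>\<omega>. g i k (Y i \<omega>) \<partial>M) \<longlonglongrightarrow> (\<Prod>i\<in>I. \<integral>\<omega>. indicator (A i) (Y i \<omega>) \<partial>M)"
    proof (rule tendsto_prod)
      fix i assume i: "i \<in> I"
      show "(\<lambda>k. \<integral>\<omega>. g i k (Y i \<omega>) \<partial>M) \<longlonglongrightarrow> (\<integral>\<omega>. indicator (A i) (Y i \<omega>) \<partial>M)"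
        by (rule integral_dominated_convergence[where w="\<lambda>_. 1"]) (use gY[OF i] AY[OF i] bd[OF i] g(3)[OF i] in auto)
    qed
    ultimately have eq: "(\<integral>\<omega>. (\<Prod>i\<in>I. indicator (A i) (Y i \<omega>)) \<partial>M) = (\<Prod>i\<in>I. \<integral>\<omega>. indicator (A i) (Y i \<omega>) \<partial>M :: real)"
      using cont[of "\<lambda>i. g i _"] g by (auto intro: LIMSEQ_unique)
    have sets: "Y i -` A i \<inter> space M \<in> events" if "i \<in> I" for i using Y[OF that] Am[OF that] by (rule measurable_sets)
    have 1: "(\<integral>\<omega>. indicator (A i) (Y i \<omega>) \<partial>M) = prob (Y i -` A i \<inter> space M)" if "i \<in> I" for i
    proof -
      have "(\<integral>\<omega>. indicator (A i) (Y i \<omega>) \<partial>M) = (\<integral>\<omega>. indicator (Y i -` A i \<inter> space M) \<omega> \<partial>M :: real)"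
        by (intro Bochner_Integration.integral_cong) (auto split: split_indicator)
      then show ?thesis using sets[OF that] by simp
    qed
    have "(\<integral>\<omega>. (\<Prod>i\<in>I. indicator (A i) (Y i \<omega>)) \<partial>M) = (\<integral>\<omega>. indicator (\<Inter>i\<in>I. Y i -` A i \<inter> space M) \<omega> \<partial>M :: real)"
      using I False by (intro Bochner_Integration.integral_cong) (auto simp: indicator_def prod_zero_iff)
    also have "\<dots> = prob (\<Inter>i\<in>I. Y i -` A i \<inter> space M)"
      using sets I False by (simp add: sets.finite_INT)
    finally show ?thesis using eq 1 by simp
  qed
  moreover have "sets borel = sigma_sets UNIV ?E"
  proof -
    have "sets borel = sigma_sets UNIV (range (\<lambda>a::real. {..a}))" unfolding borel_eq_atMost by simp
    also have "\<dots> = sigma_sets UNIV ?E"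
      by (rule sigma_sets_eqI) (auto intro: sigma_sets_top)
    finally show ?thesis .
  qed
  moreover have "Int_stable ?E"
    by (rule Int_stableI) auto
  ultimately show ?thesis
    using Y I False by (subst indep_vars_finite[where E="\<lambda>_. ?E"]) (auto simp: Pi_iff)
qed

end

locale dyadic_levy = prob_space M for M :: "'a measure" +
  fixes Z :: "real \<Rightarrow> 'a \<Rightarrow> real" and \<psi> :: "real \<Rightarrow> real" and C :: real
  assumes Z_meas: "t \<in> dyadic_points \<Longrightarrow> Z t \<in> borel_measurable M"
    and Z_zero: "AE \<omega> in M. Z 0 \<omega> = 0"
    and Z_indep: "indep_vars (\<lambda>_. borel) (\<lambda>i \<omega>. Z (real (Suc i) / 2 ^ n) \<omega> - Z (real i / 2 ^ n) \<omega>) {..<K}"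
    and Z_law: "has_laplace (distr M borel (\<lambda>\<omega>. Z (real (Suc i) / 2 ^ n) \<omega> - Z (real i / 2 ^ n) \<omega>)) (\<lambda>\<theta>. exp (\<psi> \<theta> / 2 ^ n))"
    and \<psi>_pos: "0 < \<theta> \<Longrightarrow> 0 < \<psi> \<theta>" and \<psi>_le: "0 \<le> \<theta> \<Longrightarrow> \<psi> \<theta> \<le> C * (\<theta>\<^sup>2 + \<theta>)"
begin

lemma Z_grid [measurable]: "Z (real k / 2 ^ n) \<in> borel_measurable M"
  by (rule Z_meas) simp

lemma law_grid:
  assumes "i \<le> j"
  shows "has_laplace (distr M borel (\<lambda>\<omega>. Z (real j / 2 ^ n) \<omega> - Z (real i / 2 ^ n) \<omega>))
    (\<lambda>\<theta>. exp ((real j / 2 ^ n - real i / 2 ^ n) * \<psi> \<theta>))"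
proof -
  have "indep_vars (\<lambda>_. borel) (\<lambda>i \<omega>. Z (real (Suc i) / 2 ^ n) \<omega> - Z (real i / 2 ^ n) \<omega>) {i..<j}"
    by (rule indep_vars_subset[OF Z_indep[of n j]]) auto
  from has_laplace_sum_indep[OF _ this Z_law]
  have "has_laplace (distr M borel (\<lambda>\<omega>. \<Sum>k=i..<j. Z (real (Suc k) / 2 ^ n) \<omega> - Z (real k / 2 ^ n) \<omega>))
    (\<lambda>\<theta>. \<Prod>k=i..<j. exp (\<psi> \<theta> / 2 ^ n))" by simp
  also have "(\<lambda>\<omega>. \<Sum>k=i..<j. Z (real (Suc k) / 2 ^ n) \<omega> - Z (real k / 2 ^ n) \<omega>)
     = (\<lambda>\<omega>. Z (real j / 2 ^ n) \<omega> - Z (real i / 2 ^ n) \<omega>)"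
    using sum_Suc_diff'[OF assms, of "\<lambda>k. Z (real k / 2 ^ n) _"] by (simp only:)
  also have "(\<lambda>\<theta>. \<Prod>k=i..<j. exp (\<psi> \<theta> / 2 ^ n)) = (\<lambda>\<theta>. exp ((real j / 2 ^ n - real i / 2 ^ n) * \<psi> \<theta>))"
    using assms by (simp add: exp_of_nat_mult[symmetric] of_nat_diff diff_divide_distrib[symmetric])
  finally show ?thesis .
qed

lemma common_grid:
  assumes "s \<in> dyadic_points" "t \<in> dyadic_points"
  obtains n i j where "s = real i / 2 ^ n" "t = real j / 2 ^ n"
proof -
  obtain a b where "s \<in> grid a" "t \<in> grid b" using assms by (auto simp: dyadic_points_def)
  then have "s \<in> grid (max a b)" "t \<in> grid (max a b)"
    using grid_mono[of a "max a b"] grid_mono[of b "max a b"] by auto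
  then show ?thesis using that by (auto simp: grid_iff)
qed

lemma law:
  assumes "s \<in> dyadic_points" "t \<in> dyadic_points" "s \<le> t"
  shows "has_laplace (distr M borel (\<lambda>\<omega>. Z t \<omega> - Z s \<omega>)) (\<lambda>\<theta>. exp ((t - s) * \<psi> \<theta>))"
proof -
  obtain n i j where "s = real i / 2 ^ n" "t = real j / 2 ^ n" using common_grid assms by blast
  then show ?thesis using law_grid[of i j n] assms(3) by (simp add: divide_le_cancel)
qed

lemma \<psi>_0 [simp]: "\<psi> 0 = 0"
proof -
  have m: "(\<lambda>\<omega>. Z (real (Suc 0) / 2 ^ 0) \<omega> - Z (real 0 / 2 ^ 0) \<omega>) \<in> borel_measurable M"
    by (intro borel_measurable_diff Z_grid)
  have "(\<integral>\<omega>. exp (0 * (Z (real (Suc 0) / 2 ^ 0) \<omega> - Z (real 0 / 2 ^ 0) \<omega>)) \<partial>M) = exp (\<psi> 0 / 2 ^ 0)"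
    using Z_law[of 0 0] by (subst (asm) has_laplace_distr[OF prob_space_axioms m]) blast
  then show ?thesis by (simp add: prob_space)
qed

lemma \<psi>_nonneg: "0 \<le> \<theta> \<Longrightarrow> 0 \<le> \<psi> \<theta>"
  using \<psi>_pos[of \<theta>] by (cases "\<theta> = 0") auto

text \<open>The expanded square has expectation \<open>exp (h * \<psi> (2 * \<theta>)) - 2 * exp (h
  * \<psi> \<theta>) + 1\<close>, and the middle exponential is at least 1. The bound is of order
  \<open>h\<close> and replaces the second moment, which may be infinite.\<close>

lemma exp_square_bound:
  assumes X [measurable]: "X \<in> borel_measurable M" and h: "0 \<le> h" and \<theta>: "0 < \<theta>"
    and lap: "has_laplace (distr M borel X) (\<lambda>\<theta>. exp (h * \<psi> \<theta>))"
  shows "integrable M (\<lambda>\<omega>. (exp (\<theta> * X \<omega>) - 1)\<^sup>2)" "(\<integral>\<omega>. (exp (\<theta> * X \<omega>) - 1)\<^sup>2 \<partial>M) \<le> exp (h * \<psi> (2 * \<theta>)) - 1"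
proof -
  have e: "(exp (\<theta> * x) - 1)\<^sup>2 = exp ((2 * \<theta>) * x) - 2 * exp (\<theta> * x) + 1" for x
    by (simp add: power2_eq_square algebra_simps exp_add[symmetric])
  have int: "integrable M (\<lambda>\<omega>. exp (\<theta> * X \<omega>))" "(\<integral>\<omega>. exp (\<theta> * X \<omega>) \<partial>M) = exp (h * \<psi> \<theta>)" if "0 \<le> \<theta>" for \<theta>
    using lap that by (auto simp: has_laplace_distr[OF prob_space_axioms X])
  note i = int[of \<theta>] int[of "2 * \<theta>"]
  show "integrable M (\<lambda>\<omega>. (exp (\<theta> * X \<omega>) - 1)\<^sup>2)"
    unfolding e using i \<theta> by auto
  have "(\<integral>\<omega>. (exp (\<theta> * X \<omega>) - 1)\<^sup>2 \<partial>M) = exp (h * \<psi> (2 * \<theta>)) - 2 * exp (h * \<psi> \<theta>) + 1"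
    unfolding e using i \<theta> by (simp add: prob_space)
  moreover have "1 \<le> exp (h * \<psi> \<theta>)" using h \<psi>_pos[OF \<theta>] by simp
  ultimately show "(\<integral>\<omega>. (exp (\<theta> * X \<omega>) - 1)\<^sup>2 \<partial>M) \<le> exp (h * \<psi> (2 * \<theta>)) - 1" by linarith
qed

lemma exp_minus_one_le:
  assumes "0 \<le> h" "0 \<le> (a::real)" shows "exp (h * a) - 1 \<le> h * a * exp (h * a)"
proof -
  have "exp (h * a) * (1 - h * a) \<le> exp (h * a) * exp (- (h * a))"
    using exp_ge_add_one_self[of "- (h * a)"] by (intro mult_left_mono) auto
  then show ?thesis by (simp add: exp_minus algebra_simps)
qed

definition tail_const :: "real \<Rightarrow> real" where
  "tail_const c = \<psi> 2 * exp (\<psi> 2) / (1 - exp (- c))\<^sup>2"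

text \<open>Chebyshev's inequality for \<open>(exp x - 1)\<^sup>2\<close>. Outside
  \<open>[- c, c]\<close> this is at least \<open>(1 - exp (- c))\<^sup>2\<close>, the left side
  being the worse one.\<close>

lemma two_sided_tail:
  assumes X [measurable]: "X \<in> borel_measurable M" and h: "0 \<le> h" "h \<le> 1" and c: "0 < c"
    and lap: "has_laplace (distr M borel X) (\<lambda>\<theta>. exp (h * \<psi> \<theta>))"
  shows "prob {\<omega> \<in> space M. c < \<bar>X \<omega>\<bar>} \<le> tail_const c * h"
proof -
  have q: "0 < 1 - exp (- c)" using c by simp
  have "prob {\<omega> \<in> space M. c < \<bar>X \<omega>\<bar>} * (1 - exp (- c))\<^sup>2 = (\<integral>\<omega>. indicator {\<omega> \<in> space M. c < \<bar>X \<omega>\<bar>} \<omega> * (1 - exp (- c))\<^sup>2 \<partial>M)"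
    by simp
  also have "\<dots> \<le> (\<integral>\<omega>. (exp (1 * X \<omega>) - 1)\<^sup>2 \<partial>M)"
  proof (rule integral_mono)
    show "integrable M (\<lambda>\<omega>. indicator {\<omega> \<in> space M. c < \<bar>X \<omega>\<bar>} \<omega> * (1 - exp (- c))\<^sup>2)"
      by (intro integrable_mult_left integrable_const_bound[where B=1]) (auto split: split_indicator)
    show "integrable M (\<lambda>\<omega>. (exp (1 * X \<omega>) - 1)\<^sup>2)" by (rule exp_square_bound(1)[OF X h(1) _ lap]) simp
    fix \<omega>
    have "(1 - exp (- c))\<^sup>2 \<le> (exp x - 1)\<^sup>2" if "c < \<bar>x\<bar>" for x :: real
    proof (cases "0 \<le> x")
      case True
      then have "exp c \<le> exp x" using that by simp
      moreover have "1 - exp (- c) \<le> exp c - 1" using exp_ge_add_one_self[of c] exp_ge_add_one_self[of "-c"] by linarith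
      ultimately have "1 - exp (- c) \<le> exp x - 1" by linarith
      then show ?thesis using q by (intro power_mono) auto
    next
      case False
      then have "exp x \<le> exp (- c)" using that by simp
      then have "(1 - exp (- c))\<^sup>2 \<le> (1 - exp x)\<^sup>2" using q by (intro power_mono) auto
      then show ?thesis by (simp add: power2_commute)
    qed
    then show "indicator {\<omega> \<in> space M. c < \<bar>X \<omega>\<bar>} \<omega> * (1 - exp (- c))\<^sup>2 \<le> (exp (1 * X \<omega>) - 1)\<^sup>2"
      by (auto split: split_indicator)
  qed
  also have "\<dots> \<le> exp (h * \<psi> 2) - 1" using exp_square_bound(2)[OF X h(1) _ lap, of 1] by simp
  also have "\<dots> \<le> h * \<psi> 2 * exp (h * \<psi> 2)" using h \<psi>_nonneg by (intro exp_minus_one_le) auto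
  also have "\<dots> \<le> h * \<psi> 2 * exp (\<psi> 2)"
    using h \<psi>_nonneg[of 2] by (intro mult_left_mono) (auto simp: mult_left_le_one_le)
  finally show ?thesis using q by (simp add: tail_const_def field_simps)
qed

text \<open>The parameter \<theta> stays free: the denominator grows like
  \<open>exp (2 * \<theta> * c)\<close>, the exponent in the numerator only quadratically, so a
  large \<theta> makes the rate in \<open>h\<close> arbitrarily small.\<close>

lemma positive_tail:
  assumes X [measurable]: "X \<in> borel_measurable M" and h: "0 \<le> h" and c: "0 < c" and \<theta>: "0 < \<theta>"
    and lap: "has_laplace (distr M borel X) (\<lambda>\<theta>. exp (h * \<psi> \<theta>))"
  shows "prob {\<omega> \<in> space M. c < X \<omega>} \<le> (h * \<psi> (2 * \<theta>) * exp (h * \<psi> (2 * \<theta>))) / (exp (\<theta> * c) - 1)\<^sup>2"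
proof -
  have q: "0 < exp (\<theta> * c) - 1" using c \<theta> by simp
  have "prob {\<omega> \<in> space M. c < X \<omega>} * (exp (\<theta> * c) - 1)\<^sup>2 = (\<integral>\<omega>. indicator {\<omega> \<in> space M. c < X \<omega>} \<omega> * (exp (\<theta> * c) - 1)\<^sup>2 \<partial>M)"
    by simp
  also have "\<dots> \<le> (\<integral>\<omega>. (exp (\<theta> * X \<omega>) - 1)\<^sup>2 \<partial>M)"
  proof (rule integral_mono)
    show "integrable M (\<lambda>\<omega>. indicator {\<omega> \<in> space M. c < X \<omega>} \<omega> * (exp (\<theta> * c) - 1)\<^sup>2)"
      by (intro integrable_mult_left integrable_const_bound[where B=1]) (auto split: split_indicator)
    show "integrable M (\<lambda>\<omega>. (exp (\<theta> * X \<omega>) - 1)\<^sup>2)" by (rule exp_square_bound(1)[OF X h(1) \<theta> lap])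
    fix \<omega>
    have "(exp (\<theta> * c) - 1)\<^sup>2 \<le> (exp (\<theta> * x) - 1)\<^sup>2" if "c < x" for x :: real
      using that \<theta> q by (intro power_mono) auto
    then show "indicator {\<omega> \<in> space M. c < X \<omega>} \<omega> * (exp (\<theta> * c) - 1)\<^sup>2 \<le> (exp (\<theta> * X \<omega>) - 1)\<^sup>2"
      by (auto split: split_indicator)
  qed
  also have "\<dots> \<le> exp (h * \<psi> (2 * \<theta>)) - 1" by (rule exp_square_bound(2)[OF X h(1) \<theta> lap])
  also have "\<dots> \<le> h * \<psi> (2 * \<theta>) * exp (h * \<psi> (2 * \<theta>))" using h \<theta> \<psi>_nonneg by (intro exp_minus_one_le) auto
  finally show ?thesis using zero_less_power[OF q, of 2] by (simp only: pos_le_divide_eq)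
qed

end

section \<open>Double oscillations in dyadic cells and large upward increments\<close>

context dyadic_levy
begin

definition cell_pt :: "nat \<Rightarrow> nat \<Rightarrow> nat \<Rightarrow> nat \<Rightarrow> real" where
  "cell_pt m j n r = real (j * 2 ^ n + r) / 2 ^ (m + n)"

definition bad :: "real \<Rightarrow> nat \<Rightarrow> nat \<Rightarrow> nat \<Rightarrow> 'a set" where
  "bad c m j n = {\<omega> \<in> space M. \<exists>r s u. r < s \<and> s < u \<and> u \<le> 2 ^ n \<and>
     c < \<bar>Z (cell_pt m j n s) \<omega> - Z (cell_pt m j n r) \<omega>\<bar> \<and> c < \<bar>Z (cell_pt m j n u) \<omega> - Z (cell_pt m j n s) \<omega>\<bar>}"

lemma Z_cell [measurable]: "Z (cell_pt m j n r) \<in> borel_measurable M"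
  unfolding cell_pt_def by (rule Z_grid)

lemma bad_sets [measurable]: "bad c m j n \<in> events"
  unfolding bad_def by measurable

text \<open>Refining the subdivision of a cell keeps its old points, so bounds that are uniform in
  \<open>n\<close> pass to the union over all dyadic points of the cell.\<close>

lemma incseq_bad: "incseq (bad c m j)"
proof (rule incseq_SucI)
  fix n
  have e: "cell_pt m j n r = cell_pt m j (Suc n) (2 * r)" for r
    by (simp add: cell_pt_def field_simps)
  show "bad c m j n \<subseteq> bad c m j (Suc n)"
  proof
    fix \<omega> assume "\<omega> \<in> bad c m j n"
    then obtain r s u where "\<omega> \<in> space M" "r < s" "s < u" "u \<le> 2 ^ n"
     "c < \<bar>Z (cell_pt m j n s) \<omega> - Z (cell_pt m j n r) \<omega>\<bar>" "c < \<bar>Z (cell_pt m j n u) \<omega> - Z (cell_pt m j n s) \<omega>\<bar>"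
      by (auto simp: bad_def)
    then show "\<omega> \<in> bad c m j (Suc n)"
      unfolding bad_def e by (intro CollectI conjI exI[of _ "2 * r"] exI[of _ "2 * s"] exI[of _ "2 * u"]) auto
  qed
qed

text \<open>\<open>prob_two_oscillations\<close> at threshold \<open>c / 4\<close> for the
  \<open>2 ^ n\<close> increments within one cell. Every time difference inside the cell is at most
  \<open>1 / 2 ^ m\<close>, so the bound is free of \<open>n\<close>.\<close>

lemma prob_bad:
  assumes c: "0 < c" and small: "tail_const (c / 4) / 2 ^ m \<le> 1 / 2"
  shows "prob (bad c m j n) \<le> (2 * (tail_const (c / 4) / 2 ^ m))\<^sup>2"
proof -
  define \<xi> where "\<xi> l \<omega> = Z (cell_pt m j n (Suc l)) \<omega> - Z (cell_pt m j n l) \<omega>" for l \<omega>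
  have D: "(\<Sum>l=i..<k. \<xi> l \<omega>) = Z (cell_pt m j n k) \<omega> - Z (cell_pt m j n i) \<omega>" if "i \<le> k" for i k \<omega>
    unfolding \<xi>_def by (rule sum_Suc_diff'[OF that])
  have tc: "0 \<le> tail_const (c / 4)" using \<psi>_nonneg[of 2] by (simp add: tail_const_def)
  interpret increments M \<xi> "2 ^ n" "c / 4" "tail_const (c / 4) / 2 ^ m"
  proof
    show "indep_vars (\<lambda>_. borel) \<xi> {..<2 ^ n}"
      using indep_vars_shift[OF Z_indep[of "m + n" "j * 2 ^ n + 2 ^ n"]]
      by (simp add: \<xi>_def[abs_def] cell_pt_def)
    show "tail_const (c / 4) / 2 ^ m \<le> 1 / 2" by (rule small)
    fix i k :: nat assume ik: "i \<le> k" "k \<le> 2 ^ n"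
    have h: "cell_pt m j n k - cell_pt m j n i = (real k - real i) / 2 ^ (m + n)"
      by (simp add: cell_pt_def diff_divide_distrib[symmetric])
    have rk: "real k \<le> 2 ^ n" using ik(2) by (metis of_nat_le_iff of_nat_numeral of_nat_power)
    have h0: "0 \<le> (real k - real i) / 2 ^ (m + n)" using ik by simp
    have "real k - real i \<le> 2 ^ n" using rk of_nat_0_le_iff[of i] by linarith
    then have "(real k - real i) / 2 ^ (m + n) \<le> 2 ^ n / 2 ^ (m + n)" by (intro divide_right_mono) auto
    also have "\<dots> = 1 / 2 ^ m" by (simp add: power_add)
    finally have hm: "(real k - real i) / 2 ^ (m + n) \<le> 1 / 2 ^ m" .
    also have "(1::real) / 2 ^ m \<le> 1" by simp
    finally have h1: "(real k - real i) / 2 ^ (m + n) \<le> 1" .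
    have "prob {\<omega> \<in> space M. c / 4 < \<bar>Z (cell_pt m j n k) \<omega> - Z (cell_pt m j n i) \<omega>\<bar>} \<le> tail_const (c / 4) * ((real k - real i) / 2 ^ (m + n))"
    proof (rule two_sided_tail[OF _ h0 h1])
      have "has_laplace (distr M borel (\<lambda>\<omega>. Z (cell_pt m j n k) \<omega> - Z (cell_pt m j n i) \<omega>)) (\<lambda>\<theta>. exp ((cell_pt m j n k - cell_pt m j n i) * \<psi> \<theta>))"
        unfolding cell_pt_def using ik by (intro law_grid) auto
      then show "has_laplace (distr M borel (\<lambda>\<omega>. Z (cell_pt m j n k) \<omega> - Z (cell_pt m j n i) \<omega>)) (\<lambda>\<theta>. exp ((real k - real i) / 2 ^ (m + n) * \<psi> \<theta>))"
        by (simp only: h)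
    qed (use c in auto)
    also have "\<dots> \<le> tail_const (c / 4) * (1 / 2 ^ m)" using hm tc by (rule mult_left_mono)
    finally show "prob {\<omega> \<in> space M. c / 4 < \<bar>\<Sum>l=i..<k. \<xi> l \<omega>\<bar>} \<le> tail_const (c / 4) / 2 ^ m"
      by (simp add: D[OF ik(1)])
  qed
  have "bad c m j n = {\<omega> \<in> space M. \<exists>r s u. r < s \<and> s < u \<and> u \<le> 2 ^ n \<and> 4 * (c / 4) < \<bar>D r s \<omega>\<bar> \<and> 4 * (c / 4) < \<bar>D s u \<omega>\<bar>}"
    unfolding bad_def D_def by (intro Collect_cong conj_cong refl ex_cong1) (auto simp: D)
  then show ?thesis using prob_two_oscillations by simp
qed

lemma cell_grid:
  assumes t: "t \<in> dyadic_points" and b: "real j / 2 ^ m \<le> t" "t \<le> real (Suc j) / 2 ^ m"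
  shows "\<exists>n0. \<forall>n\<ge>n0. \<exists>r\<le>2 ^ n. t = cell_pt m j n r"
proof -
  obtain p where "t \<in> grid p" using t by (auto simp: dyadic_points_def)
  have "\<exists>r\<le>2 ^ n. t = cell_pt m j n r" if "p \<le> n" for n
  proof -
    have "t \<in> grid (m + n)" using \<open>t \<in> grid p\<close> grid_mono[of p "m + n"] that by auto
    then obtain k where k: "t = real k / 2 ^ (m + n)" by (auto simp: grid_iff)
    have "real j * 2 ^ n / 2 ^ (m + n) \<le> real k / 2 ^ (m + n)" using b(1) k by (simp add: power_add)
    then have "real (j * 2 ^ n) \<le> real k" by (simp add: divide_le_cancel)
    then have 1: "j * 2 ^ n \<le> k" by (simp only: of_nat_le_iff)
    have "real k / 2 ^ (m + n) \<le> real (Suc j) * 2 ^ n / 2 ^ (m + n)" using b(2) k by (simp add: power_add del: of_nat_Suc)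
    then have "real k \<le> real (Suc j * 2 ^ n)" by (simp add: divide_le_cancel del: of_nat_Suc mult_Suc)
    then have 2: "k \<le> Suc j * 2 ^ n" by (simp only: of_nat_le_iff)
    from 1 2 k show ?thesis by (intro exI[of _ "k - j * 2 ^ n"]) (auto simp: cell_pt_def)
  qed
  then show ?thesis by blast
qed

text \<open>Three dyadic points of the cell are eventually all points of its subdivision, so a
  violation would already be seen at a finite level.\<close>

lemma not_bad_regular:
  assumes \<omega>: "\<omega> \<in> space M" "\<And>n. \<omega> \<notin> bad c m j n"
    and rsu: "r \<in> dyadic_points" "s \<in> dyadic_points" "u \<in> dyadic_points"
      "real j / 2 ^ m \<le> r" "r < s" "s < u" "u \<le> real (Suc j) / 2 ^ m"
  shows "\<bar>Z s \<omega> - Z r \<omega>\<bar> \<le> c \<or> \<bar>Z u \<omega> - Z s \<omega>\<bar> \<le> c"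
proof (rule ccontr)
  assume neg: "\<not> ?thesis"
  obtain n1 where n1: "\<And>n. n1 \<le> n \<Longrightarrow> \<exists>k\<le>2 ^ n. r = cell_pt m j n k"
    using cell_grid[of r j m] rsu by auto
  obtain n2 where n2: "\<And>n. n2 \<le> n \<Longrightarrow> \<exists>k\<le>2 ^ n. s = cell_pt m j n k"
    using cell_grid[of s j m] rsu by auto
  obtain n3 where n3: "\<And>n. n3 \<le> n \<Longrightarrow> \<exists>k\<le>2 ^ n. u = cell_pt m j n k"
    using cell_grid[of u j m] rsu by auto
  define n where "n = max n1 (max n2 n3)"
  have "n1 \<le> n" "n2 \<le> n" "n3 \<le> n" by (auto simp: n_def)
  then obtain a b d where abd: "r = cell_pt m j n a" "s = cell_pt m j n b" "u = cell_pt m j n d" "d \<le> 2 ^ n"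
    using n1 n2 n3 by meson
  have "a < b" "b < d" using rsu unfolding abd cell_pt_def by (simp_all add: divide_less_cancel)
  then have "\<omega> \<in> bad c m j n" unfolding bad_def using \<omega>(1) abd neg by (auto simp: not_le)
  then show False using \<omega>(2) by blast
qed

text \<open>There are \<open>T * 2 ^ m\<close> cells, each bad with probability at most
  \<open>4 * K\<^sup>2 / 4 ^ m\<close>; the total is of order \<open>1 / 2 ^ m\<close>. A bound of
  order \<open>1 / 2 ^ m\<close> per cell would leave a constant, which is why the squared estimate
  is required.\<close>

lemma AE_cell_regular:
  assumes c: "0 < c"
  shows "AE \<omega> in M. \<exists>m. \<forall>j<T * 2 ^ m. \<forall>n. \<omega> \<notin> bad c m j n"
proof -
  define K where "K = tail_const (c / 4)"
  have K: "0 \<le> K" using \<psi>_nonneg[of 2] by (simp add: K_def tail_const_def)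
  define B where "B m = (\<Union>j<T * 2 ^ m. \<Union>n. bad c m j n)" for m
  have B [measurable]: "B m \<in> events" for m unfolding B_def by measurable
  have lim: "(\<lambda>m. (4 * T * K\<^sup>2) * (1 / 2 ^ m)) \<longlonglongrightarrow> (4 * T * K\<^sup>2) * 0"
    by (intro tendsto_intros inverse_two_power_tendsto)
  have "(\<lambda>m. K * (1 / 2 ^ m)) \<longlonglongrightarrow> K * 0"
    by (intro tendsto_intros inverse_two_power_tendsto)
  then have "\<forall>\<^sub>F m in sequentially. K * (1 / 2 ^ m) < 1 / 2"
    by (intro order_tendstoD) auto
  then have le: "\<forall>\<^sub>F m in sequentially. prob (\<Inter>m. B m) \<le> (4 * T * K\<^sup>2) * (1 / 2 ^ m)"
  proof eventually_elim
    case (elim m)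
    have cell: "prob (\<Union>n. bad c m j n) \<le> (2 * (K / 2 ^ m))\<^sup>2" for j
    proof (rule LIMSEQ_le_const2)
      show "(\<lambda>n. prob (bad c m j n)) \<longlonglongrightarrow> prob (\<Union>n. bad c m j n)"
        by (intro finite_Lim_measure_incseq incseq_bad) auto
      show "\<exists>N. \<forall>n\<ge>N. prob (bad c m j n) \<le> (2 * (K / 2 ^ m))\<^sup>2"
        using prob_bad[OF c, of m j] elim by (auto simp: K_def)
    qed
    have "prob (\<Inter>m. B m) \<le> prob (B m)" by (intro finite_measure_mono) auto
    also have "\<dots> \<le> (\<Sum>j<T * 2 ^ m. prob (\<Union>n. bad c m j n))"
      unfolding B_def by (intro finite_measure_subadditive_finite) auto
    also have "\<dots> \<le> (\<Sum>j<T * 2 ^ m. (2 * (K / 2 ^ m))\<^sup>2)" by (intro sum_mono cell)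
    also have "\<dots> = (4 * T * K\<^sup>2) * (1 / 2 ^ m)" by (simp add: power2_eq_square field_simps)
    finally show ?case .
  qed
  have "prob (\<Inter>m. B m) \<le> 0"
    using tendsto_lowerbound[OF lim le] by simp
  then have "prob (\<Inter>m. B m) = 0" using measure_nonneg[of M "\<Inter>m. B m"] by linarith
  then have "AE \<omega> in M. \<omega> \<notin> (\<Inter>m. B m)"
    by (intro AE_not_in) (auto simp: null_sets_def emeasure_eq_measure)
  then show ?thesis by eventually_elim (auto simp: B_def)
qed

lemma AE_osc_regular: "AE \<omega> in M. osc_regular (\<lambda>t. Z t \<omega>)"
proof -
  have "AE \<omega> in M. \<forall>q T. \<exists>m. \<forall>j<T * 2 ^ m. \<forall>n. \<omega> \<notin> bad (1 / real (Suc q)) m j n"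
    unfolding AE_all_countable by (intro allI AE_cell_regular) simp
  with AE_space show ?thesis
  proof eventually_elim
    case (elim \<omega>)
    show ?case
      unfolding osc_regular_def
    proof (intro allI impI)
      fix c :: real and T :: nat assume "0 < c"
      then obtain q where q: "1 / real (Suc q) < c" using nat_approx_posE by blast
      obtain m where m: "\<forall>j<T * 2 ^ m. \<forall>n. \<omega> \<notin> bad (1 / real (Suc q)) m j n" using elim(2) by blast
      have "\<bar>Z s \<omega> - Z r \<omega>\<bar> \<le> c \<or> \<bar>Z u \<omega> - Z s \<omega>\<bar> \<le> c"
        if "j < T * 2 ^ m" "r \<in> dyadic_points" "s \<in> dyadic_points" "u \<in> dyadic_points"
          "real j / 2 ^ m \<le> r \<and> r < s \<and> s < u \<and> u \<le> real (Suc j) / 2 ^ m" for j r s u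
        using not_bad_regular[OF elim(1), of "1 / real (Suc q)" m j r s u] m that q by fastforce
      then show "\<exists>m. \<forall>j<T * 2 ^ m. \<forall>r\<in>dyadic_points. \<forall>s\<in>dyadic_points. \<forall>u\<in>dyadic_points.
        real j / 2 ^ m \<le> r \<and> r < s \<and> s < u \<and> u \<le> real (Suc j) / 2 ^ m \<longrightarrow> \<bar>Z s \<omega> - Z r \<omega>\<bar> \<le> c \<or> \<bar>Z u \<omega> - Z s \<omega>\<bar> \<le> c"
        by blast
    qed
  qed
qed

text \<open>The order of choices matters: \<theta> comes first, so large that the squared
  exponential beats the quadratic numerator, and only then \<open>n\<close>, so large that
  \<open>exp (\<psi> (2 * \<theta>) / 2 ^ n)\<close> drops below 2.\<close>

lemma up_tail_small:
  assumes c: "0 < c" and e: "0 < e"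
  shows "\<forall>\<^sub>F n in sequentially. \<forall>i. 2 ^ n * prob {\<omega> \<in> space M. c < Z (real (Suc i) / 2 ^ n) \<omega> - Z (real i / 2 ^ n) \<omega>} \<le> e"
proof -
  have "((\<lambda>\<theta>::real. 2 * (\<bar>C\<bar> * ((2 * \<theta>)\<^sup>2 + 2 * \<theta>)) / (exp (\<theta> * c) - 1)\<^sup>2) \<longlongrightarrow> 0) at_top"
    using c by real_asymp
  then have "\<forall>\<^sub>F \<theta> in at_top. 2 * (\<bar>C\<bar> * ((2 * \<theta>)\<^sup>2 + 2 * \<theta>)) / (exp (\<theta> * c) - 1)\<^sup>2 < e"
    using e by (rule order_tendstoD)
  then have "\<forall>\<^sub>F \<theta> in at_top. 2 * (\<bar>C\<bar> * ((2 * \<theta>)\<^sup>2 + 2 * \<theta>)) / (exp (\<theta> * c) - 1)\<^sup>2 < e \<and> 0 < \<theta>"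
    using eventually_gt_at_top[of 0] by eventually_elim simp
  then obtain \<theta> where \<theta>: "2 * (\<bar>C\<bar> * ((2 * \<theta>)\<^sup>2 + 2 * \<theta>)) / (exp (\<theta> * c) - 1)\<^sup>2 < e" "0 < \<theta>"
    using eventually_happens[of _ "at_top :: real filter"] by (auto simp: trivial_limit_at_top_linorder)
  have \<psi>0: "0 \<le> \<psi> (2 * \<theta>)" using \<theta> \<psi>_nonneg by simp
  have "(\<lambda>n. exp (1 / 2 ^ n * \<psi> (2 * \<theta>))) \<longlonglongrightarrow> exp (0 * \<psi> (2 * \<theta>))"
    by (intro tendsto_intros inverse_two_power_tendsto)
  then have "\<forall>\<^sub>F n in sequentially. exp (1 / 2 ^ n * \<psi> (2 * \<theta>)) < 2"
    by (intro order_tendstoD) auto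
  then show ?thesis
  proof eventually_elim
    case (elim n)
    show ?case
    proof
      fix i
      have X: "(\<lambda>\<omega>. Z (real (Suc i) / 2 ^ n) \<omega> - Z (real i / 2 ^ n) \<omega>) \<in> borel_measurable M"
        by (intro borel_measurable_diff Z_grid)
      have q: "0 < (exp (\<theta> * c) - 1)\<^sup>2" using \<theta> c by (intro zero_less_power) simp
      have "2 ^ n * prob {\<omega> \<in> space M. c < Z (real (Suc i) / 2 ^ n) \<omega> - Z (real i / 2 ^ n) \<omega>}
          \<le> 2 ^ n * ((1 / 2 ^ n * \<psi> (2 * \<theta>) * exp (1 / 2 ^ n * \<psi> (2 * \<theta>))) / (exp (\<theta> * c) - 1)\<^sup>2)"
        using Z_law[of i n] \<theta> c by (intro mult_left_mono positive_tail[OF X]) auto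
      also have "\<dots> = \<psi> (2 * \<theta>) * exp (1 / 2 ^ n * \<psi> (2 * \<theta>)) / (exp (\<theta> * c) - 1)\<^sup>2" by simp
      also have "\<dots> \<le> (\<bar>C\<bar> * ((2 * \<theta>)\<^sup>2 + 2 * \<theta>)) * 2 / (exp (\<theta> * c) - 1)\<^sup>2"
      proof (intro divide_right_mono mult_mono)
        have "\<psi> (2 * \<theta>) \<le> C * ((2 * \<theta>)\<^sup>2 + 2 * \<theta>)" using \<psi>_le[of "2 * \<theta>"] \<theta> by simp
        also have "\<dots> \<le> \<bar>C\<bar> * ((2 * \<theta>)\<^sup>2 + 2 * \<theta>)" using \<theta> by (intro mult_right_mono) auto
        finally show "\<psi> (2 * \<theta>) \<le> \<bar>C\<bar> * ((2 * \<theta>)\<^sup>2 + 2 * \<theta>)" .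
      qed (use elim \<theta> in auto)
      also have "\<dots> \<le> e" using \<theta>(1) by (simp add: mult.commute)
      finally show "2 ^ n * prob {\<omega> \<in> space M. c < Z (real (Suc i) / 2 ^ n) \<omega> - Z (real i / 2 ^ n) \<omega>} \<le> e" .
    qed
  qed
qed

text \<open>The expected number of upward increments above \<open>c\<close> until time
  \<open>T\<close> tends to 0 as the level is refined, so almost no path has such an increment at
  every level from \<open>k\<close> on.\<close>

lemma AE_small_up:
  assumes c: "0 < c"
  shows "AE \<omega> in M. \<exists>n\<ge>k. \<forall>i<T * 2 ^ n. Z (real (Suc i) / 2 ^ n) \<omega> - Z (real i / 2 ^ n) \<omega> \<le> c"
proof -
  define E where "E n = (\<Union>i<T * 2 ^ n. {\<omega> \<in> space M. c < Z (real (Suc i) / 2 ^ n) \<omega> - Z (real i / 2 ^ n) \<omega>})" for n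
  have s: "{\<omega> \<in> space M. c < Z (real (Suc i) / 2 ^ n) \<omega> - Z (real i / 2 ^ n) \<omega>} \<in> events" for i n
    using Z_grid[of "Suc i" n] Z_grid[of i n] by measurable
  have E: "E n \<in> events" for n unfolding E_def using s by auto
  have I: "(\<Inter>n\<in>{k..}. E n) \<in> events" using E by (intro sets.countable_INT') auto
  have "prob (\<Inter>n\<in>{k..}. E n) \<le> 0"
  proof (rule field_le_epsilon)
    fix e :: real assume "0 < e"
    then have "0 < e / (real T + 1)" by simp
    from up_tail_small[OF c this] eventually_ge_at_top[of k]
    have "\<forall>\<^sub>F n in sequentially. (\<forall>i. 2 ^ n * prob {\<omega> \<in> space M. c < Z (real (Suc i) / 2 ^ n) \<omega> - Z (real i / 2 ^ n) \<omega>} \<le> e / (real T + 1)) \<and> k \<le> n"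
      by eventually_elim blast
    then obtain n where n: "\<And>i. 2 ^ n * prob {\<omega> \<in> space M. c < Z (real (Suc i) / 2 ^ n) \<omega> - Z (real i / 2 ^ n) \<omega>} \<le> e / (real T + 1)" "k \<le> n"
      by (auto simp: eventually_sequentially)
    have "prob (\<Inter>n\<in>{k..}. E n) \<le> prob (E n)" using n(2) E by (intro finite_measure_mono) auto
    also have "\<dots> \<le> (\<Sum>i<T * 2 ^ n. prob {\<omega> \<in> space M. c < Z (real (Suc i) / 2 ^ n) \<omega> - Z (real i / 2 ^ n) \<omega>})"
      unfolding E_def using s by (intro finite_measure_subadditive_finite) auto
    also have "\<dots> \<le> (\<Sum>i<T * 2 ^ n. e / (real T + 1) / 2 ^ n)"
    proof (rule sum_mono)
      fix i
      have "prob {\<omega> \<in> space M. c < Z (real (Suc i) / 2 ^ n) \<omega> - Z (real i / 2 ^ n) \<omega>} * 2 ^ n \<le> e / (real T + 1)"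
        using n(1)[of i] by (simp only: mult.commute)
      then show "prob {\<omega> \<in> space M. c < Z (real (Suc i) / 2 ^ n) \<omega> - Z (real i / 2 ^ n) \<omega>} \<le> e / (real T + 1) / 2 ^ n"
        by (subst pos_le_divide_eq) (simp_all only: zero_less_power zero_less_numeral)
    qed
    also have "\<dots> = real T * (e / (real T + 1))" by simp
    also have "\<dots> \<le> e" using \<open>0 < e\<close> by (simp add: field_simps)
    finally show "prob (\<Inter>n\<in>{k..}. E n) \<le> 0 + e" by simp
  qed
  then have "prob (\<Inter>n\<in>{k..}. E n) = 0" using measure_nonneg[of M "\<Inter>n\<in>{k..}. E n"] by linarith
  then have "AE \<omega> in M. \<omega> \<notin> (\<Inter>n\<in>{k..}. E n)"
    using I by (intro AE_not_in) (auto simp: null_sets_def emeasure_eq_measure)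
  with AE_space show ?thesis
    by eventually_elim (auto simp: E_def not_less)
qed

lemma AE_up: "AE \<omega> in M. \<forall>c>0. \<forall>T k. \<exists>n\<ge>k. \<forall>i<T * 2 ^ n. Z (real (Suc i) / 2 ^ n) \<omega> - Z (real i / 2 ^ n) \<omega> \<le> c"
proof -
  have "AE \<omega> in M. \<forall>q T k. \<exists>n\<ge>k. \<forall>i<T * 2 ^ n. Z (real (Suc i) / 2 ^ n) \<omega> - Z (real i / 2 ^ n) \<omega> \<le> 1 / real (Suc q)"
    unfolding AE_all_countable by (intro allI AE_small_up) simp
  then show ?thesis
  proof eventually_elim
    case (elim \<omega>)
    show ?case
    proof (intro allI impI)
      fix c :: real and T k :: nat assume "0 < c"
      then obtain q where q: "1 / real (Suc q) < c" using nat_approx_posE by blast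
      obtain n where n: "k \<le> n" "\<forall>i<T * 2 ^ n. Z (real (Suc i) / 2 ^ n) \<omega> - Z (real i / 2 ^ n) \<omega> \<le> 1 / real (Suc q)"
        using elim by blast
      then show "\<exists>n\<ge>k. \<forall>i<T * 2 ^ n. Z (real (Suc i) / 2 ^ n) \<omega> - Z (real i / 2 ^ n) \<omega> \<le> c"
        using q by (intro exI[of _ n]) (auto intro: order_trans less_imp_le)
    qed
  qed
qed

end

section \<open>Random walks with nonnegative mean\<close>

text \<open>The quotients \<open>(exp (\<theta> * x) - 1) / \<theta>\<close> decrease to
  \<open>x\<close> as \<theta> decreases to 0, and \<open>1 \<le> L \<theta>\<close> makes their
  expectations nonnegative. They lie below \<open>exp x - 1\<close>, so Fatou's lemma applied to the
  gap bounds the left tail of \<open>X\<close>, whose integrability is not known beforehand.\<close>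

lemma (in prob_space) mean_nonneg:
  assumes X [measurable]: "X \<in> borel_measurable M"
    and lap: "has_laplace (distr M borel X) L" and L: "\<And>\<theta>. 0 \<le> \<theta> \<Longrightarrow> 1 \<le> L \<theta>"
  shows "integrable M X" "0 \<le> expectation X"
proof -
  have int: "integrable M (\<lambda>\<omega>. exp (\<theta> * X \<omega>))" "(\<integral>\<omega>. exp (\<theta> * X \<omega>) \<partial>M) = L \<theta>" if "0 \<le> \<theta>" for \<theta>
    using lap that by (auto simp: has_laplace_distr[OF prob_space_axioms X])
  have i1: "integrable M (\<lambda>\<omega>. exp (X \<omega>))" using int(1)[of 1] by simp
  define B where "B = expectation (\<lambda>\<omega>. exp (X \<omega>) - 1)"
  have B0: "0 \<le> B" using int(2)[of 1] L[of 1] i1 by (simp add: B_def prob_space)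
  define \<theta> where "\<theta> n = 1 / real (Suc n)" for n
  have \<theta>: "0 < \<theta> n" "\<theta> n \<le> 1" for n by (auto simp: \<theta>_def)
  define g where "g n x = (exp x - 1) - (exp (\<theta> n * x) - 1) / \<theta> n" for n x
  have g0: "0 \<le> g n x" for n x
  proof -
    have "exp ((1 - \<theta> n) *\<^sub>R 0 + \<theta> n *\<^sub>R x) \<le> (1 - \<theta> n) * exp 0 + \<theta> n * exp x"
      using \<theta>[of n] by (intro convex_onD[OF exp_convex]) auto
    then have "exp (\<theta> n * x) - 1 \<le> (exp x - 1) * \<theta> n" by (simp add: algebra_simps)
    then show ?thesis using \<theta>[of n] by (simp add: g_def pos_divide_le_eq)
  qed
  have glim: "(\<lambda>n. g n x) \<longlonglongrightarrow> exp x - 1 - x" for x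
  proof -
    have "((\<lambda>y. exp (y * x)) has_real_derivative x) (at 0)"
      by (auto intro!: derivative_eq_intros)
    then have "((\<lambda>y. (exp (y * x) - 1) / y) \<longlongrightarrow> x) (at 0)" by (simp add: DERIV_def)
    moreover have "filterlim \<theta> (at 0) sequentially"
      using LIMSEQ_Suc[OF lim_1_over_n] by (auto simp: filterlim_at \<theta>_def[abs_def])
    ultimately have "(\<lambda>n. (exp (\<theta> n * x) - 1) / \<theta> n) \<longlonglongrightarrow> x" by (rule filterlim_compose)
    then show ?thesis unfolding g_def by (intro tendsto_intros)
  qed
  have gi: "integrable M (\<lambda>\<omega>. g n (X \<omega>))" for n
    unfolding g_def using i1 int(1)[OF less_imp_le[OF \<theta>(1)]] by auto
  have gB: "expectation (\<lambda>\<omega>. g n (X \<omega>)) \<le> B" for n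
  proof -
    have "expectation (\<lambda>\<omega>. g n (X \<omega>)) = B - (L (\<theta> n) - 1) / \<theta> n"
      unfolding g_def B_def using i1 int[OF less_imp_le[OF \<theta>(1)], of n] by (simp add: prob_space)
    also have "\<dots> \<le> B" using L[of "\<theta> n"] \<theta>[of n] by simp
    finally show ?thesis .
  qed
  have "(\<integral>\<^sup>+\<omega>. ennreal (exp (X \<omega>) - 1 - X \<omega>) \<partial>M) \<le> liminf (\<lambda>n. \<integral>\<^sup>+\<omega>. ennreal (g n (X \<omega>)) \<partial>M)"
  proof -
    have "(\<integral>\<^sup>+\<omega>. ennreal (exp (X \<omega>) - 1 - X \<omega>) \<partial>M) = (\<integral>\<^sup>+\<omega>. liminf (\<lambda>n. ennreal (g n (X \<omega>))) \<partial>M)"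
      by (intro nn_integral_cong lim_imp_Liminf[symmetric] tendsto_ennrealI glim) simp
    also have "\<dots> \<le> liminf (\<lambda>n. \<integral>\<^sup>+\<omega>. ennreal (g n (X \<omega>)) \<partial>M)"
      by (intro nn_integral_liminf) (simp add: g_def)
    finally show ?thesis .
  qed
  also have "\<dots> \<le> liminf (\<lambda>n. ennreal B)"
  proof (intro Liminf_mono always_eventually allI)
    fix n show "(\<integral>\<^sup>+\<omega>. ennreal (g n (X \<omega>)) \<partial>M) \<le> ennreal B"
      using gB[of n] by (subst nn_integral_eq_integral[OF gi]) (auto simp: g0 ennreal_leI)
  qed
  also have "\<dots> = ennreal B" by (simp add: Liminf_const)
  finally have fat: "(\<integral>\<^sup>+\<omega>. ennreal (exp (X \<omega>) - 1 - X \<omega>) \<partial>M) \<le> ennreal B" .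
  have pos: "0 \<le> exp x - 1 - x" for x :: real using exp_ge_add_one_self[of x] by linarith
  have ii: "integrable M (\<lambda>\<omega>. exp (X \<omega>) - 1 - X \<omega>)"
    using fat pos by (intro integrableI_nonneg) (auto simp: less_top[symmetric] top_unique)
  have "integrable M (\<lambda>\<omega>. (exp (X \<omega>) - 1) - (exp (X \<omega>) - 1 - X \<omega>))"
    by (rule Bochner_Integration.integrable_diff[OF _ ii]) (use i1 in simp)
  moreover have "(\<lambda>\<omega>. (exp (X \<omega>) - 1) - (exp (X \<omega>) - 1 - X \<omega>)) = X" by (simp add: fun_eq_iff)
  ultimately show iX: "integrable M X" by (simp only:)
  have "expectation (\<lambda>\<omega>. exp (X \<omega>) - 1 - X \<omega>) \<le> B"
    using fat nn_integral_eq_integral[OF ii] pos B0 by simp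
  then show "0 \<le> expectation X" using i1 iX by (simp add: B_def prob_space)
qed

primrec prefix_max :: "(nat \<Rightarrow> real) \<Rightarrow> nat \<Rightarrow> real" where
  "prefix_max f 0 = 0"
| "prefix_max f (Suc n) = max (prefix_max f n) (\<Sum>i<Suc n. f i)"

text \<open>The definition adds a step at the end of the walk, this recursion removes the first
  step. Comparing both ways of growing the maximum is the core of the recurrence argument: one
  bounds the growth of its expectation from above, the other from below.\<close>

lemma prefix_max_shift: "prefix_max f (Suc n) = max 0 (f 0 + prefix_max (\<lambda>i. f (Suc i)) n)"
proof (induction n)
  case (Suc n)
  have "prefix_max f (Suc (Suc n)) = max (prefix_max f (Suc n)) (\<Sum>i<Suc (Suc n). f i)" by simp
  also have "\<dots> = max (max 0 (f 0 + prefix_max (\<lambda>i. f (Suc i)) n)) (f 0 + (\<Sum>i<Suc n. f (Suc i)))"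
    unfolding Suc sum.lessThan_Suc_shift[of _ "Suc n"] ..
  also have "\<dots> = max 0 (f 0 + prefix_max (\<lambda>i. f (Suc i)) (Suc n))" by (simp add: max_add_distrib_right max.assoc)
  finally show ?case .
qed simp

lemma prefix_max_nonneg: "0 \<le> prefix_max f n" by (induction n) auto

lemma prefix_max_ge: "(\<Sum>i<n. f i) \<le> prefix_max f n" by (cases n) auto

lemma prefix_max_bound:
  assumes "\<And>k. k \<le> n \<Longrightarrow> (\<Sum>i<Suc k. f i) \<le> c"
  shows "f 0 + prefix_max (\<lambda>i. f (Suc i)) n \<le> c"
  using assms
proof (induction n)
  case (Suc n)
  have "f 0 + prefix_max (\<lambda>i. f (Suc i)) n \<le> c" using Suc by auto
  moreover have "f 0 + (\<Sum>i<Suc n. f (Suc i)) \<le> c"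
    using Suc(2)[of "Suc n"] unfolding sum.lessThan_Suc_shift[of _ "Suc n"] by simp
  ultimately show ?case by (simp add: max_def)
qed auto

lemma prefix_max_cong: "(\<And>i. i < n \<Longrightarrow> f i = g i) \<Longrightarrow> prefix_max f n = prefix_max g n"
  by (induction n) auto

text \<open>From every index a later one can be reached at an arbitrarily small loss. Losses of at
  most \<open>1 / 2 ^ Suc i\<close> add up to at most 1, so values above \<open>s 0 - 1\<close>
  recur at arbitrarily late indices.\<close>

lemma not_at_bot:
  fixes s :: "nat \<Rightarrow> real"
  assumes "\<And>a q. \<exists>k. s a - 1 / real (Suc q) < s (a + Suc k)"
  shows "\<not> filterlim s at_bot sequentially"
proof
  assume lim: "filterlim s at_bot sequentially"
  have "\<exists>a\<ge>i. s 0 - 1 + 1 / 2 ^ i \<le> s a" for i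
  proof (induction i)
    case (Suc i)
    then obtain a where a: "i \<le> a" "s 0 - 1 + 1 / 2 ^ i \<le> s a" by blast
    obtain k where k: "s a - 1 / real (Suc (2 ^ Suc i)) < s (a + Suc k)" using assms by blast
    have "1 / real (Suc (2 ^ Suc i)) \<le> 1 / 2 ^ Suc i" by (intro frac_le) auto
    moreover have "1 / 2 ^ i = 2 * (1 / 2 ^ Suc i :: real)" by simp
    ultimately have "s 0 - 1 + 1 / 2 ^ Suc i \<le> s (a + Suc k)" using a k by linarith
    then show ?case using a by (intro exI[of _ "a + Suc k"]) auto
  qed auto
  note big = this
  have "\<forall>\<^sub>F n in sequentially. s n < s 0 - 1"
    using lim by (simp add: filterlim_at_bot_dense)
  then obtain N where N: "\<And>n. N \<le> n \<Longrightarrow> s n < s 0 - 1" by (auto simp: eventually_sequentially)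
  obtain a where "N \<le> a" "s 0 - 1 + 1 / 2 ^ N \<le> s a" using big by blast
  then have "s 0 - 1 + 1 / 2 ^ N < s 0 - 1" using N[of a] by linarith
  then show False by simp
qed

locale iid_walk = prob_space M for M :: "'a measure" +
  fixes \<xi> :: "nat \<Rightarrow> 'a \<Rightarrow> real"
  assumes indep: "indep_vars (\<lambda>_. borel) \<xi> {..<n}"
    and ident: "distr M borel (\<xi> i) = distr M borel (\<xi> 0)"
    and int0: "integrable M (\<xi> 0)" and mean0: "0 \<le> expectation (\<xi> 0)"
begin

lemma rv [measurable]: "\<xi> i \<in> borel_measurable M"
  using indep[of "Suc i"] by (auto simp: indep_vars_def)

lemma int [simp]: "integrable M (\<xi> i)"
proof -
  have "integrable (distr M borel (\<xi> i)) (\<lambda>x. x)"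
    unfolding ident[of i] using int0 by (simp add: integrable_distr_eq)
  then show ?thesis by (simp add: integrable_distr_eq)
qed

lemma block_law:
  "distr M (PiM {..<Suc m} (\<lambda>_. borel)) (\<lambda>\<omega>. \<lambda>i\<in>{..<Suc m}. \<xi> (a + i) \<omega>) = PiM {..<Suc m} (\<lambda>_. distr M borel (\<xi> 0))"
proof -
  have "indep_vars (\<lambda>_. borel) (\<lambda>i. \<xi> (a + i)) {..<Suc m}" by (rule indep_vars_shift[OF indep])
  then have "distr M (PiM {..<Suc m} (\<lambda>_. borel)) (\<lambda>\<omega>. \<lambda>i\<in>{..<Suc m}. \<xi> (a + i) \<omega>) = PiM {..<Suc m} (\<lambda>i. distr M borel (\<xi> (a + i)))"
    by (subst (asm) indep_vars_iff_distr_eq_PiM) auto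
  then show ?thesis by (simp add: ident[of "a + _"])
qed

lemma stationary:
  assumes H: "H \<in> borel_measurable (PiM {..<Suc m} (\<lambda>_. borel))" and loc: "\<And>f. H (restrict f {..<Suc m}) = H f"
  shows "distr M borel (\<lambda>\<omega>. H (\<lambda>i. \<xi> (a + i) \<omega>)) = distr M borel (\<lambda>\<omega>. H (\<lambda>i. \<xi> i \<omega>))"
proof -
  have "distr M borel (\<lambda>\<omega>. H (\<lambda>i. \<xi> (a + i) \<omega>)) = distr (PiM {..<Suc m} (\<lambda>_. distr M borel (\<xi> 0))) borel H" for a
    unfolding block_law[of m a, symmetric]
    by (subst distr_distr[OF H]) (auto simp: o_def loc intro!: measurable_restrict)
  from this[of a] this[of 0] show ?thesis by simp
qed

lemma prefix_max_measurable:
  assumes "n + b \<le> m"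
  shows "(\<lambda>f. prefix_max (\<lambda>i. f (b + i)) n) \<in> borel_measurable (PiM {..<m} (\<lambda>_. borel :: real measure))"
  using assms
proof (induction n)
  case (Suc n)
  then show ?case
    by (simp del: sum.lessThan_Suc)
qed simp

lemma pm_int: "integrable M (\<lambda>\<omega>. prefix_max (\<lambda>i. \<xi> (a + i) \<omega>) n)"
  by (induction n) (auto simp del: sum.lessThan_Suc intro!: integrable_max Bochner_Integration.integrable_sum)

lemma pm_rv [measurable]: "(\<lambda>\<omega>. prefix_max (\<lambda>i. \<xi> (a + i) \<omega>) n) \<in> borel_measurable M"
  using pm_int by (rule borel_measurable_integrable)

lemma pm_expectation: "expectation (\<lambda>\<omega>. prefix_max (\<lambda>i. \<xi> (a + i) \<omega>) n) = expectation (\<lambda>\<omega>. prefix_max (\<lambda>i. \<xi> i \<omega>) n)"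
proof -
  have "distr M borel (\<lambda>\<omega>. prefix_max (\<lambda>i. \<xi> (a + i) \<omega>) n) = distr M borel (\<lambda>\<omega>. prefix_max (\<lambda>i. \<xi> i \<omega>) n)"
    using prefix_max_measurable[of n 0 "Suc n"]
    by (intro stationary[of "\<lambda>f. prefix_max f n" n]) (auto intro!: prefix_max_cong)
  then have "(\<integral>x. x \<partial>distr M borel (\<lambda>\<omega>. prefix_max (\<lambda>i. \<xi> (a + i) \<omega>) n)) = (\<integral>x. x \<partial>distr M borel (\<lambda>\<omega>. prefix_max (\<lambda>i. \<xi> i \<omega>) n))"
    by simp
  then show ?thesis using pm_rv[of 0 n] by (simp add: integral_distr)
qed

text \<open>The maximum of the nonempty partial sums up to length \<open>n + 1\<close>. Its positive
  part is \<open>prefix_max\<close> at \<open>Suc n\<close>; its negative part measures how far the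
  walk has stayed below its start.\<close>

definition N :: "nat \<Rightarrow> 'a \<Rightarrow> real" where
  "N n \<omega> = \<xi> 0 \<omega> + prefix_max (\<lambda>i. \<xi> (Suc i) \<omega>) n"

lemma N_int: "integrable M (N n)"
  unfolding N_def[abs_def] using pm_int[of 1 n] by auto

text \<open>The positive part of \<open>N n\<close> is \<open>N n\<close> plus its negative part,
  and by stationarity and \<open>mean0\<close> the expectation of \<open>N n\<close> is at least
  that of the maximum over \<open>n\<close> steps.\<close>

lemma increment_ge:
  "expectation (\<lambda>\<omega>. max 0 (- N n \<omega>)) \<le>
    expectation (\<lambda>\<omega>. prefix_max (\<lambda>i. \<xi> i \<omega>) (Suc n)) - expectation (\<lambda>\<omega>. prefix_max (\<lambda>i. \<xi> i \<omega>) n)"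
proof -
  have ineg: "integrable M (\<lambda>\<omega>. max 0 (- N n \<omega>))" using N_int by (intro integrable_max) auto
  have "expectation (\<lambda>\<omega>. prefix_max (\<lambda>i. \<xi> i \<omega>) (Suc n)) = expectation (\<lambda>\<omega>. N n \<omega> + max 0 (- N n \<omega>))"
  proof -
    have "prefix_max (\<lambda>i. \<xi> i \<omega>) (Suc n) = N n \<omega> + max 0 (- N n \<omega>)" for \<omega>
      unfolding prefix_max_shift N_def[symmetric] by (simp add: max_def)
    then show ?thesis by (simp only:)
  qed
  also have "\<dots> = expectation (N n) + expectation (\<lambda>\<omega>. max 0 (- N n \<omega>))"
    using N_int ineg by (rule Bochner_Integration.integral_add)
  also have "expectation (N n) = expectation (\<xi> 0) + expectation (\<lambda>\<omega>. prefix_max (\<lambda>i. \<xi> i \<omega>) n)"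
    unfolding N_def[abs_def] using pm_int[of 1 n] pm_expectation[of 1 n] by simp
  finally show ?thesis using mean0 by simp
qed

lemma excess_tendsto_0: "((\<lambda>K. expectation (\<lambda>\<omega>. max 0 (\<xi> 0 \<omega> - real K))) \<longlongrightarrow> 0) sequentially"
proof -
  have "(\<lambda>K. expectation (\<lambda>\<omega>. max 0 (\<xi> 0 \<omega> - real K))) \<longlonglongrightarrow> expectation (\<lambda>\<omega>. 0)"
  proof (rule integral_dominated_convergence[where w="\<lambda>\<omega>. \<bar>\<xi> 0 \<omega>\<bar>"])
    have "(\<lambda>K. max 0 (x - real K)) \<longlonglongrightarrow> 0" for x
    proof (rule tendsto_eventually, rule eventually_sequentiallyI)
      fix K assume "nat \<lceil>x\<rceil> \<le> K"
      then have "x \<le> real K" by linarith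
      then show "max 0 (x - real K) = 0" by simp
    qed
    then show "AE \<omega> in M. (\<lambda>K. max 0 (\<xi> 0 \<omega> - real K)) \<longlonglongrightarrow> 0" by simp
  qed (auto simp: int0)
  then show ?thesis by simp
qed

lemma excess_ident: "expectation (\<lambda>\<omega>. max 0 (\<xi> n \<omega> - K)) = expectation (\<lambda>\<omega>. max 0 (\<xi> 0 \<omega> - K))"
proof -
  have "(\<integral>x. max 0 (x - K) \<partial>distr M borel (\<xi> n)) = (\<integral>x. max 0 (x - K) \<partial>distr M borel (\<xi> 0))"
    unfolding ident[of n] ..
  then show ?thesis by (simp add: integral_distr)
qed

text \<open>The maximum grows only if the new sum is positive, and then by at most the last step.
  Since that step and the event are dependent, its excess over \<open>K\<close> is split off and the
  rest estimated by \<open>K\<close>.\<close>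

lemma increment_le:
  assumes K: "0 \<le> K"
  shows "expectation (\<lambda>\<omega>. prefix_max (\<lambda>i. \<xi> i \<omega>) (Suc n)) - expectation (\<lambda>\<omega>. prefix_max (\<lambda>i. \<xi> i \<omega>) n)
    \<le> K * prob {\<omega> \<in> space M. 0 < (\<Sum>i<Suc n. \<xi> i \<omega>)} + expectation (\<lambda>\<omega>. max 0 (\<xi> 0 \<omega> - K))"
proof -
  let ?A = "{\<omega> \<in> space M. 0 < (\<Sum>i<Suc n. \<xi> i \<omega>)}"
  have A: "?A \<in> events" by measurable
  have i1: "integrable M (\<lambda>\<omega>. K * indicator ?A \<omega>)"
    using A by (intro integrable_mult_right integrable_real_indicator) (auto simp: less_top[symmetric])
  have i2: "integrable M (\<lambda>\<omega>. max 0 (\<xi> n \<omega> - K))" by (intro integrable_max) auto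
  have "expectation (\<lambda>\<omega>. prefix_max (\<lambda>i. \<xi> i \<omega>) (Suc n)) - expectation (\<lambda>\<omega>. prefix_max (\<lambda>i. \<xi> i \<omega>) n)
    = expectation (\<lambda>\<omega>. prefix_max (\<lambda>i. \<xi> i \<omega>) (Suc n) - prefix_max (\<lambda>i. \<xi> i \<omega>) n)"
    using pm_int[of 0 n] pm_int[of 0 "Suc n"] by (intro Bochner_Integration.integral_diff[symmetric]) auto
  also have "\<dots> \<le> expectation (\<lambda>\<omega>. K * indicator ?A \<omega> + max 0 (\<xi> n \<omega> - K))"
  proof (rule integral_mono)
    show "integrable M (\<lambda>\<omega>. prefix_max (\<lambda>i. \<xi> i \<omega>) (Suc n) - prefix_max (\<lambda>i. \<xi> i \<omega>) n)"
      using pm_int[of 0 n] pm_int[of 0 "Suc n"] by (intro Bochner_Integration.integrable_diff) auto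
    show "integrable M (\<lambda>\<omega>. K * indicator ?A \<omega> + max 0 (\<xi> n \<omega> - K))" using i1 i2 by (rule Bochner_Integration.integrable_add)
    fix \<omega> assume \<omega>: "\<omega> \<in> space M"
    have ge: "(\<Sum>i<n. \<xi> i \<omega>) \<le> prefix_max (\<lambda>i. \<xi> i \<omega>) n" "0 \<le> prefix_max (\<lambda>i. \<xi> i \<omega>) n"
      by (rule prefix_max_ge, rule prefix_max_nonneg)
    show "prefix_max (\<lambda>i. \<xi> i \<omega>) (Suc n) - prefix_max (\<lambda>i. \<xi> i \<omega>) n \<le> K * indicator ?A \<omega> + max 0 (\<xi> n \<omega> - K)"
    proof (cases "(\<Sum>i<Suc n. \<xi> i \<omega>) \<le> prefix_max (\<lambda>i. \<xi> i \<omega>) n")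
      case True
      then have "prefix_max (\<lambda>i. \<xi> i \<omega>) (Suc n) = prefix_max (\<lambda>i. \<xi> i \<omega>) n" by (simp del: sum.lessThan_Suc)
      moreover have "0 \<le> K * indicator ?A \<omega>" using K by simp
      ultimately show ?thesis by simp
    next
      case False
      then have "\<omega> \<in> ?A" using ge(2) \<omega> by (simp del: sum.lessThan_Suc)
      moreover have "prefix_max (\<lambda>i. \<xi> i \<omega>) (Suc n) = (\<Sum>i<n. \<xi> i \<omega>) + \<xi> n \<omega>" using False by simp
      ultimately show ?thesis using ge(1) by simp
    qed
  qed
  also have "\<dots> = K * prob ?A + expectation (\<lambda>\<omega>. max 0 (\<xi> n \<omega> - K))"
    using i1 i2 A by (subst Bochner_Integration.integral_add) auto
  finally show ?thesis unfolding excess_ident[of n K] .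
qed

text \<open>Under drift a positive sum becomes improbable, so the expected growth of the maximum
  tends to 0, and with it the expected negative part of \<open>N n\<close>. Hence from every time on
  the walk almost surely rises above any level strictly below its current one, which by
  \<open>not_at_bot\<close> contradicts drift. The argument includes mean 0.\<close>

lemma not_drift: "\<not> (AE \<omega> in M. filterlim (\<lambda>n. \<Sum>i<n. \<xi> i \<omega>) at_bot sequentially)"
proof
  assume drift: "AE \<omega> in M. filterlim (\<lambda>n. \<Sum>i<n. \<xi> i \<omega>) at_bot sequentially"
  let ?A = "\<lambda>n. {\<omega> \<in> space M. 0 < (\<Sum>i<Suc n. \<xi> i \<omega>)}"
  have A: "?A n \<in> events" for n by measurable
  have pA: "(\<lambda>n. prob (?A n)) \<longlonglongrightarrow> 0"
  proof -
    have "(\<lambda>n. expectation (\<lambda>\<omega>. indicator (?A n) \<omega> :: real)) \<longlonglongrightarrow> expectation (\<lambda>\<omega>. 0)"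
    proof (rule integral_dominated_convergence[where w="\<lambda>_. 1"])
      show "AE \<omega> in M. (\<lambda>n. indicator (?A n) \<omega> :: real) \<longlonglongrightarrow> 0"
        using drift
      proof eventually_elim
        case (elim \<omega>)
        then have "\<forall>\<^sub>F n in sequentially. (\<Sum>i<n. \<xi> i \<omega>) < 0" by (simp add: filterlim_at_bot_dense)
        then have "\<forall>\<^sub>F n in sequentially. (\<Sum>i<Suc n. \<xi> i \<omega>) < 0" by (subst eventually_sequentially_Suc)
        then have "\<forall>\<^sub>F n in sequentially. indicator (?A n) \<omega> = (0::real)"
          by eventually_elim (auto split: split_indicator)
        then show ?case by (rule tendsto_eventually)
      qed
    qed (use A in \<open>auto split: split_indicator\<close>)
    then show ?thesis using A by simp
  qed
  define c where "c n = expectation (\<lambda>\<omega>. max 0 (- N n \<omega>))" for n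
  have c_lim: "c \<longlonglongrightarrow> 0"
  proof (rule LIMSEQ_I)
    fix e :: real assume "0 < e"
    then obtain K where K: "expectation (\<lambda>\<omega>. max 0 (\<xi> 0 \<omega> - real K)) < e / 2"
      using order_tendstoD(2)[OF excess_tendsto_0, of "e / 2"] by (auto simp: eventually_sequentially)
    have "(\<lambda>n. real K * prob (?A n)) \<longlonglongrightarrow> real K * 0" by (intro tendsto_intros pA)
    then have "\<forall>\<^sub>F n in sequentially. real K * prob (?A n) < e / 2"
      using \<open>0 < e\<close> by (intro order_tendstoD) auto
    then obtain n0 where n0: "\<And>n. n0 \<le> n \<Longrightarrow> real K * prob (?A n) < e / 2" by (auto simp: eventually_sequentially)
    have "norm (c n - 0) < e" if "n0 \<le> n" for n
    proof -
      have "0 \<le> c n" unfolding c_def by simp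
      moreover have "c n < e" using increment_ge[of n] increment_le[of "real K" n] n0[OF that] K unfolding c_def by linarith
      ultimately show ?thesis by simp
    qed
    then show "\<exists>no. \<forall>n\<ge>no. norm (c n - 0) < e" by blast
  qed
  have stay: "AE \<omega> in M. \<exists>k. - \<delta> < (\<Sum>i<Suc k. \<xi> (a + i) \<omega>)" if \<delta>: "0 < \<delta>" for a \<delta>
  proof -
    define E where "E n = {\<omega> \<in> space M. \<forall>k\<le>n. (\<Sum>i<Suc k. \<xi> (a + i) \<omega>) \<le> - \<delta>}" for n
    have E [measurable]: "E n \<in> events" for n unfolding E_def by measurable
    have "prob (E n) * \<delta> \<le> c n" for n
    proof -
      define H where "H f = f 0 + prefix_max (\<lambda>i. f (1 + i)) n" for f :: "nat \<Rightarrow> real"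
      have "distr M borel (\<lambda>\<omega>. H (\<lambda>i. \<xi> (a + i) \<omega>)) = distr M borel (\<lambda>\<omega>. H (\<lambda>i. \<xi> i \<omega>))"
      proof (rule stationary)
        show "H \<in> borel_measurable (PiM {..<Suc n} (\<lambda>_. borel))"
          unfolding H_def by (intro borel_measurable_add prefix_max_measurable measurable_component_singleton) auto
        show "H (restrict f {..<Suc n}) = H f" for f
          unfolding H_def by (intro arg_cong2[where f=plus] prefix_max_cong) auto
      qed
      then have "(\<integral>x. max 0 (- x) \<partial>distr M borel (\<lambda>\<omega>. H (\<lambda>i. \<xi> (a + i) \<omega>))) = (\<integral>x. max 0 (- x) \<partial>distr M borel (\<lambda>\<omega>. H (\<lambda>i. \<xi> i \<omega>)))" by simp
      moreover have m: "(\<lambda>\<omega>. H (\<lambda>i. \<xi> (a + i) \<omega>)) \<in> borel_measurable M" for a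
        unfolding H_def using pm_rv[of "Suc a" n] by simp
      ultimately have eq: "expectation (\<lambda>\<omega>. max 0 (- H (\<lambda>i. \<xi> (a + i) \<omega>))) = c n"
        using m[of 0] by (simp add: integral_distr c_def N_def H_def)
      have iH: "integrable M (\<lambda>\<omega>. max 0 (- H (\<lambda>i. \<xi> (a + i) \<omega>)))"
        unfolding H_def using pm_int[of "Suc a" n]
        by (intro integrable_max integrable_minus Bochner_Integration.integrable_add) auto
      have "prob (E n) * \<delta> = expectation (\<lambda>\<omega>. indicator (E n) \<omega> * \<delta>)" by simp
      also have "\<dots> \<le> expectation (\<lambda>\<omega>. max 0 (- H (\<lambda>i. \<xi> (a + i) \<omega>)))"
      proof (rule integral_mono[OF _ iH])
        show "integrable M (\<lambda>\<omega>. indicator (E n) \<omega> * \<delta>)"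
          by (intro integrable_mult_left integrable_real_indicator) (auto simp: less_top[symmetric])
        fix \<omega>
        show "indicator (E n) \<omega> * \<delta> \<le> max 0 (- H (\<lambda>i. \<xi> (a + i) \<omega>))"
          using prefix_max_bound[of n "\<lambda>i. \<xi> (a + i) \<omega>" "- \<delta>"] unfolding E_def H_def
          by (auto split: split_indicator simp del: sum.lessThan_Suc)
      qed
      finally show ?thesis by (simp add: eq)
    qed
    moreover have "(\<Inter>n. E n) \<in> events" by auto
    moreover have "prob (\<Inter>n. E n) \<le> prob (E n)" for n by (intro finite_measure_mono) auto
    ultimately have "prob (\<Inter>n. E n) * \<delta> \<le> c n" for n
      using \<delta> by (meson mult_right_mono less_imp_le order_trans)
    then have "prob (\<Inter>n. E n) * \<delta> \<le> 0" using c_lim by (intro LIMSEQ_le_const) auto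
    then have "prob (\<Inter>n. E n) \<le> 0" using \<delta> by (simp add: mult_le_0_iff)
    then have "prob (\<Inter>n. E n) = 0" using measure_nonneg[of M "\<Inter>n. E n"] by linarith
    then have "AE \<omega> in M. \<omega> \<notin> (\<Inter>n. E n)"
      by (intro AE_not_in) (auto simp: null_sets_def emeasure_eq_measure)
    with AE_space show ?thesis by eventually_elim (auto simp: E_def not_le simp del: sum.lessThan_Suc)
  qed
  have "AE \<omega> in M. \<forall>a q. \<exists>k. - (1 / real (Suc q)) < (\<Sum>i<Suc k. \<xi> (a + i) \<omega>)"
    unfolding AE_all_countable by (intro allI stay) simp
  with drift have "AE \<omega> in M. False"
  proof eventually_elim
    case (elim \<omega>)
    have s: "(\<Sum>i<a + Suc k. \<xi> i \<omega>) = (\<Sum>i<a. \<xi> i \<omega>) + (\<Sum>i<Suc k. \<xi> (a + i) \<omega>)" for a k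
      by (induction k) (auto simp: algebra_simps)
    have "\<exists>k. (\<Sum>i<a. \<xi> i \<omega>) - 1 / real (Suc q) < (\<Sum>i<a + Suc k. \<xi> i \<omega>)" for a q
    proof -
      obtain k where "- (1 / real (Suc q)) < (\<Sum>i<Suc k. \<xi> (a + i) \<omega>)" using elim(2) by blast
      then show ?thesis unfolding s by (intro exI[of _ k]) linarith
    qed
    from not_at_bot[of "\<lambda>n. \<Sum>i<n. \<xi> i \<omega>", OF this] elim(1) show ?case by blast
  qed
  then show False by (simp add: AE_False)
qed

end

text \<open>The path at integer times is a random walk, and
  \<open>exp (\<psi> \<theta>) \<ge> 1\<close> makes its mean nonnegative.\<close>

lemma (in levy_process) not_drifting:
  assumes lap: "has_laplace (distr M borel (X 1)) (\<lambda>\<theta>. exp (\<psi> \<theta>))" and \<psi>: "\<And>\<theta>. 0 \<le> \<theta> \<Longrightarrow> 0 \<le> \<psi> \<theta>"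
  shows "\<not> drifts_to_minus_infinity M X"
proof
  assume drift: "drifts_to_minus_infinity M X"
  define \<xi> where "\<xi> i \<omega> = X (real (Suc i)) \<omega> - X (real i) \<omega>" for i \<omega>
  have d: "distr M borel (\<xi> i) = distr M borel (X 1)" for i
    unfolding \<xi>_def[abs_def] using stationary_increments[of "real i" "real (Suc i)"] by simp
  have m: "\<xi> i \<in> borel_measurable M" for i
    unfolding \<xi>_def[abs_def] by (intro borel_measurable_diff measurable_X) auto
  have lap0: "has_laplace (distr M borel (\<xi> 0)) (\<lambda>\<theta>. exp (\<psi> \<theta>))" unfolding d by (rule lap)
  interpret iid_walk M \<xi>
  proof
    show "indep_vars (\<lambda>_. borel) \<xi> {..<n}" for n
      unfolding \<xi>_def[abs_def] by (rule indep_increments[of "\<lambda>i. real i"]) auto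
    show "distr M borel (\<xi> i) = distr M borel (\<xi> 0)" for i by (simp only: d)
    show "integrable M (\<xi> 0)" "0 \<le> expectation (\<xi> 0)"
      using mean_nonneg[OF m lap0] \<psi> by auto
  qed
  have "AE \<omega> in M. filterlim (\<lambda>n. \<Sum>i<n. \<xi> i \<omega>) at_bot sequentially"
    using drift unfolding drifts_to_minus_infinity_def
  proof eventually_elim
    case (elim \<omega>)
    have s: "(\<Sum>i<n. \<xi> i \<omega>) = - X 0 \<omega> + X (real n) \<omega>" for n
      by (induction n) (auto simp: \<xi>_def)
    have "filterlim (\<lambda>n. X (real n) \<omega>) at_bot sequentially"
      using filterlim_compose[OF elim filterlim_real_sequentially] .
    then have "\<forall>\<^sub>F n in sequentially. X (real n) \<omega> < b + X 0 \<omega>" for b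
      by (simp add: filterlim_at_bot_dense)
    then show ?case unfolding s filterlim_at_bot_dense by (simp add: algebra_simps)
  qed
  with not_drift show False by blast
qed

section \<open>The spectrally negative process of a concave function\<close>

context dyadic_levy
begin

text \<open>Where the limit fails to exist, \<open>lim\<close> yields some default value. This
  concerns a null set only, and measurability holds for every \<open>t\<close> regardless.\<close>

definition Y :: "real \<Rightarrow> 'a \<Rightarrow> real" where "Y t \<omega> = lim (\<lambda>n. Z (app n t) \<omega>)"

lemma Z_app [measurable]: "Z (app n t) \<in> borel_measurable M" by (rule Z_meas) simp

lemma Y_rv [measurable]: "Y t \<in> borel_measurable M"
  unfolding Y_def[abs_def] by (rule borel_measurable_lim_metric) (rule Z_app)

lemma Y_eq: "osc_regular (\<lambda>t. Z t \<omega>) \<Longrightarrow> (\<lambda>t. Y t \<omega>) = osc_path.y (\<lambda>t. Z t \<omega>)"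
  by (simp add: fun_eq_iff Y_def osc_path.y_def osc_path.intro)

lemma Y_lim:
  assumes "0 \<le> t" shows "AE \<omega> in M. (\<lambda>n. Z (app n t) \<omega>) \<longlonglongrightarrow> Y t \<omega>"
  using AE_osc_regular
proof eventually_elim
  case (elim \<omega>)
  interpret osc_path "\<lambda>t. Z t \<omega>" using elim by (rule osc_path.intro)
  show ?case using y_tendsto[OF \<open>0 \<le> t\<close>] Y_eq[OF elim] by (metis (no_types))
qed

lemma app_mono: "0 \<le> s \<Longrightarrow> s \<le> t \<Longrightarrow> app n s \<le> app n t"
  unfolding app_def by (intro divide_right_mono of_nat_mono add_right_mono nat_mono floor_mono mult_right_mono) auto

lemma Y_law:
  assumes "0 \<le> s" "s \<le> t"
  shows "has_laplace (distr M borel (\<lambda>\<omega>. Y t \<omega> - Y s \<omega>)) (\<lambda>\<theta>. exp ((t - s) * \<psi> \<theta>))"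
proof (rule laplace_AE_limit[of M "\<lambda>n \<omega>. Z (app n t) \<omega> - Z (app n s) \<omega>"])
  show "AE \<omega> in M. (\<lambda>n. Z (app n t) \<omega> - Z (app n s) \<omega>) \<longlonglongrightarrow> Y t \<omega> - Y s \<omega>"
    using Y_lim[of t] Y_lim[of s] assms by (auto intro: tendsto_diff)
  show "has_laplace (distr M borel (\<lambda>\<omega>. Z (app n t) \<omega> - Z (app n s) \<omega>)) (\<lambda>\<theta>. exp ((app n t - app n s) * \<psi> \<theta>))" for n
    using assms by (intro law app_mono) auto
  show "(\<lambda>n. exp ((app n t - app n s) * \<psi> \<theta>)) \<longlonglongrightarrow> exp ((t - s) * \<psi> \<theta>)" for \<theta>
    using assms by (intro tendsto_intros app_tendsto) auto
qed (auto intro: prob_space_axioms)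

text \<open>\<open>Y 0\<close> is a limit along times above 0 and need not agree with
  \<open>Z 0\<close> on every path. The transform of the difference is constantly 1, so its law is
  the point mass at 0.\<close>

lemma Y_zero: "AE \<omega> in M. Y 0 \<omega> = 0"
proof -
  have "has_laplace (distr M borel (\<lambda>\<omega>. Y 0 \<omega> - Z 0 \<omega>)) (\<lambda>\<theta>. exp (0 * \<psi> \<theta>))"
  proof (rule laplace_AE_limit[of M "\<lambda>n \<omega>. Z (app n 0) \<omega> - Z 0 \<omega>"])
    show "AE \<omega> in M. (\<lambda>n. Z (app n 0) \<omega> - Z 0 \<omega>) \<longlonglongrightarrow> Y 0 \<omega> - Z 0 \<omega>"
      using Y_lim[OF order_refl] by eventually_elim (auto intro: tendsto_diff)
    show "has_laplace (distr M borel (\<lambda>\<omega>. Z (app n 0) \<omega> - Z 0 \<omega>)) (\<lambda>\<theta>. exp ((app n 0 - 0) * \<psi> \<theta>))" for n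
      using app_bounds[of 0 n] by (intro law) auto
    show "(\<lambda>n. exp ((app n 0 - 0) * \<psi> \<theta>)) \<longlonglongrightarrow> exp (0 * \<psi> \<theta>)" for \<theta>
      using app_tendsto[of 0] by (intro tendsto_intros) auto
  qed (use Z_meas[of 0] in \<open>auto intro: prob_space_axioms\<close>)
  then have "has_laplace (distr M borel (\<lambda>\<omega>. Y 0 \<omega> - Z 0 \<omega>)) (\<lambda>\<theta>. 1)" by simp
  moreover have "has_laplace (return borel 0) (\<lambda>\<theta>. 1)"
  proof -
    interpret r: prob_space "return borel (0::real)" by (rule prob_space_return) simp
    show ?thesis
      by (rule has_laplace_nnI)
        (auto simp: nn_integral_return intro!: real_distribution.intro real_distribution_axioms.intro r.prob_space_axioms)
  qed
  ultimately have d: "distr M borel (\<lambda>\<omega>. Y 0 \<omega> - Z 0 \<omega>) = return borel 0" by (rule has_laplace_unique)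
  have "AE x in distr M borel (\<lambda>\<omega>. Y 0 \<omega> - Z 0 \<omega>). x = 0" unfolding d by (subst AE_return) auto
  then have "AE \<omega> in M. Y 0 \<omega> - Z 0 \<omega> = 0"
    using Z_meas[of 0] by (subst (asm) AE_distr_iff) auto
  with Z_zero show ?thesis by eventually_elim simp
qed

lemma Y_law0:
  assumes "0 \<le> t" shows "has_laplace (distr M borel (Y t)) (\<lambda>\<theta>. exp (t * \<psi> \<theta>))"
proof -
  have "distr M borel (\<lambda>\<omega>. Y t \<omega> - Y 0 \<omega>) = distr M borel (Y t)"
    using Y_zero by (intro distr_cong_AE) auto
  then show ?thesis using Y_law[of 0 t] assms by simp
qed

text \<open>The given times are replaced by grid points just above them. Increments between grid
  points are sums over disjoint blocks of grid increments, and independence survives the almost sure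
  limit.\<close>

lemma Y_indep:
  assumes t0: "0 \<le> t 0" and inc: "\<And>i. i < n \<Longrightarrow> t i \<le> t (Suc i)"
  shows "indep_vars (\<lambda>_. borel) (\<lambda>i \<omega>. Y (t (Suc i)) \<omega> - Y (t i) \<omega>) {..<n}"
proof (rule indep_vars_AE_limit[where X="\<lambda>k i \<omega>. Z (app k (t (Suc i))) \<omega> - Z (app k (t i)) \<omega>"])
  have mono: "t i \<le> t j" if "i \<le> j" "j \<le> n" for i j
    using that by (induction j rule: dec_induct) (auto intro: order_trans[OF _ inc])
  have tpos: "0 \<le> t i" if "i \<le> n" for i using mono[of 0 i] t0 that by simp
  show "AE \<omega> in M. (\<lambda>k. Z (app k (t (Suc i))) \<omega> - Z (app k (t i)) \<omega>) \<longlonglongrightarrow> Y (t (Suc i)) \<omega> - Y (t i) \<omega>"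
    if "i \<in> {..<n}" for i
    using Y_lim[of "t (Suc i)"] Y_lim[of "t i"] tpos[of i] tpos[of "Suc i"] that by (auto intro: tendsto_diff)
  show "indep_vars (\<lambda>_. borel) (\<lambda>i \<omega>. Z (app k (t (Suc i))) \<omega> - Z (app k (t i)) \<omega>) {..<n}" for k
  proof -
    define a where "a i = nat \<lfloor>t i * 2 ^ k\<rfloor> + 1" for i
    have amono: "a i \<le> a j" if "i \<le> j" "j \<le> n" for i j
      unfolding a_def using mono[OF that] by (intro add_right_mono nat_mono floor_mono mult_right_mono) auto
    define \<xi> where "\<xi> l \<omega> = Z (real (Suc l) / 2 ^ k) \<omega> - Z (real l / 2 ^ k) \<omega>" for l \<omega>
    have ind: "indep_vars (\<lambda>_. borel) \<xi> {..<a n}" unfolding \<xi>_def[abs_def] by (rule Z_indep)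
    have "indep_vars (\<lambda>i. PiM {a i..<a (Suc i)} (\<lambda>_. borel)) (\<lambda>i \<omega>. restrict (\<lambda>l. \<xi> l \<omega>) {a i..<a (Suc i)}) {..<n}"
    proof (rule indep_vars_restrict[OF ind])
      show "{a j..<a (Suc j)} \<subseteq> {..<a n}" if "j \<in> {..<n}" for j using amono[of "Suc j" n] that by auto
      show "disjoint_family_on (\<lambda>i. {a i..<a (Suc i)}) {..<n}"
        unfolding disjoint_family_on_def
      proof safe
        fix i j l assume *: "i < n" "j < n" "i \<noteq> j" "l \<in> {a i..<a (Suc i)}" "l \<in> {a j..<a (Suc j)}"
        then consider "Suc i \<le> j" | "Suc j \<le> i" by linarith
        then show "l \<in> {}" using amono[of "Suc i" j] amono[of "Suc j" i] * by cases auto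
      qed
    qed
    then have "indep_vars (\<lambda>_. borel) (\<lambda>i \<omega>. (\<lambda>f. \<Sum>l=a i..<a (Suc i). f l) (restrict (\<lambda>l. \<xi> l \<omega>) {a i..<a (Suc i)})) {..<n}"
      by (rule indep_vars_compose2) (auto intro!: borel_measurable_sum measurable_component_singleton)
    moreover have "(\<Sum>l=a i..<a (Suc i). restrict (\<lambda>l. \<xi> l \<omega>) {a i..<a (Suc i)} l) = Z (app k (t (Suc i))) \<omega> - Z (app k (t i)) \<omega>"
      if "i \<in> {..<n}" for i \<omega>
    proof -
      have "(\<Sum>l=a i..<a (Suc i). restrict (\<lambda>l. \<xi> l \<omega>) {a i..<a (Suc i)} l) = (\<Sum>l=a i..<a (Suc i). \<xi> l \<omega>)"
        by (intro sum.cong) auto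
      also have "\<dots> = Z (real (a (Suc i)) / 2 ^ k) \<omega> - Z (real (a i) / 2 ^ k) \<omega>"
        unfolding \<xi>_def using amono[of i "Suc i"] that by (intro sum_Suc_diff') auto
      finally show ?thesis by (simp add: app_def a_def)
    qed
    ultimately show ?thesis
      by (subst indep_vars_cong[OF refl _ refl, of _ _ "\<lambda>i \<omega>. (\<lambda>f. \<Sum>l=a i..<a (Suc i). f l) (restrict (\<lambda>l. \<xi> l \<omega>) {a i..<a (Suc i)})"]) (auto simp: fun_eq_iff)
  qed
qed auto

lemma Y_levy: "levy_process M Y"
proof unfold_locales
  show "Y t \<in> borel_measurable M" for t by (rule Y_rv)
  show "AE \<omega> in M. Y 0 \<omega> = 0" by (rule Y_zero)
  show "indep_vars (\<lambda>_. borel) (\<lambda>i \<omega>. Y (t (Suc i)) \<omega> - Y (t i) \<omega>) {..<n}"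
    if "0 \<le> t 0" "\<And>i. i < n \<Longrightarrow> t i \<le> t (Suc i)" for t n by (rule Y_indep[OF that])
  show "distr M borel (\<lambda>\<omega>. Y t \<omega> - Y s \<omega>) = distr M borel (Y (t - s))" if "0 \<le> s" "s \<le> t" for s t
    using that by (intro has_laplace_unique[OF Y_law Y_law0]) auto
  show "AE \<omega> in M. \<forall>t\<ge>0. ((\<lambda>s. Y s \<omega>) \<longlongrightarrow> Y t \<omega>) (at_right t)"
    using AE_osc_regular
  proof eventually_elim
    case (elim \<omega>)
    interpret osc_path "\<lambda>t. Z t \<omega>" using elim by (rule osc_path.intro)
    show ?case using y_right_continuous Y_eq[OF elim] by (metis (no_types))
  qed
  show "AE \<omega> in M. \<forall>t>0. \<exists>l. ((\<lambda>s. Y s \<omega>) \<longlongrightarrow> l) (at_left t)"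
    using AE_osc_regular
  proof eventually_elim
    case (elim \<omega>)
    interpret osc_path "\<lambda>t. Z t \<omega>" using elim by (rule osc_path.intro)
    show ?case using y_left_limit Y_eq[OF elim] by (metis (no_types))
  qed
qed

lemma Y_no_positive_jumps:
  "AE \<omega> in M. \<forall>t>0. \<forall>l. ((\<lambda>s. Y s \<omega>) \<longlongrightarrow> l) (at_left t) \<longrightarrow> Y t \<omega> \<le> l"
  using AE_osc_regular AE_up
proof eventually_elim
  case (elim \<omega>)
  interpret osc_path "\<lambda>t. Z t \<omega>" using elim(1) by (rule osc_path.intro)
  have "y t \<le> l" if "0 < t" "(y \<longlongrightarrow> l) (at_left t)" for t l
    using elim(2) that by (intro y_no_positive_jump) auto
  then show ?case using Y_eq[OF elim(1)] by (metis (no_types))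
qed

text \<open>Decreasing paths would keep \<open>exp (Y 1)\<close> at most 1, but its expectation is
  \<open>exp (\<psi> 1)\<close>, which exceeds 1.\<close>

lemma Y_not_minus_subordinator: "\<not> subordinator M (\<lambda>t \<omega>. - Y t \<omega>)"
proof
  assume "subordinator M (\<lambda>t \<omega>. - Y t \<omega>)"
  then have "AE \<omega> in M. mono_on {0..} (\<lambda>t. - Y t \<omega>)" by (simp add: subordinator_def)
  with Y_zero have "AE \<omega> in M. exp (1 * Y 1 \<omega>) \<le> 1"
  proof eventually_elim
    case (elim \<omega>)
    have "- Y 0 \<omega> \<le> - Y 1 \<omega>" using elim(2) by (rule mono_onD) auto
    then show ?case using elim(1) by simp
  qed
  moreover have i: "integrable M (\<lambda>\<omega>. exp (1 * Y 1 \<omega>))" "(\<integral>\<omega>. exp (1 * Y 1 \<omega>) \<partial>M) = exp (\<psi> 1)"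
    using Y_law0[of 1] by (auto simp: has_laplace_distr[OF prob_space_axioms Y_rv] dest!: spec[of _ 1])
  ultimately have "exp (\<psi> 1) \<le> (\<integral>\<omega>. 1 \<partial>M)"
    unfolding i(2)[symmetric] by (intro integral_mono_AE) auto
  then show False using \<psi>_pos[of 1] by (simp add: prob_space)
qed

theorem Y_spectrally_negative:
  "spectrally_negative_levy M Y" "laplace_exponent M Y \<psi>" "\<not> drifts_to_minus_infinity M Y"
proof -
  show "spectrally_negative_levy M Y"
    using Y_levy Y_no_positive_jumps Y_not_minus_subordinator by (simp add: spectrally_negative_levy_def)
  have l: "has_laplace (distr M borel (Y 1)) (\<lambda>\<theta>. exp (\<psi> \<theta>))" using Y_law0[of 1] by simp
  then show "laplace_exponent M Y \<psi>"
    by (auto simp: laplace_exponent_def has_laplace_distr[OF prob_space_axioms Y_rv])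
  interpret Y: levy_process M Y by (rule Y_levy)
  show "\<not> drifts_to_minus_infinity M Y" by (rule Y.not_drifting[OF l \<psi>_nonneg])
qed

end

text \<open>Exponents add over time, so uniqueness of transforms provides the consistency of the
  laws between dyadic levels. Positivity of \<open>W\<close> at one point makes the exponent
  positive.\<close>

theorem (in scale_shape) exists_process:
  assumes nz: "0 \<le> x0" "0 < W x0"
  obtains M :: "(real \<Rightarrow> real) measure" and Y where
    "spectrally_negative_levy M Y" "laplace_exponent M Y \<psi>" "\<not> drifts_to_minus_infinity M Y"
proof -
  have "\<exists>\<mu>. has_laplace \<mu> (\<lambda>\<theta>. exp (1 / 2 ^ n * \<psi> \<theta>))" for n by (rule exists_law) simp
  then obtain \<nu> :: "nat \<Rightarrow> real measure" where \<nu>: "\<And>n. has_laplace (\<nu> n) (\<lambda>\<theta>. exp (1 / 2 ^ n * \<psi> \<theta>))" by metis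
  interpret dyadic_consistent \<nu>
  proof (rule dyadic_consistent.intro)
    show "real_distribution (\<nu> n)" for n using \<nu>[of n] by (simp add: has_laplace_def)
    show "\<nu> n = (\<nu> (Suc n) \<star> \<nu> (Suc n))" for n
    proof (rule has_laplace_unique[OF \<nu>])
      show "has_laplace (\<nu> (Suc n) \<star> \<nu> (Suc n)) (\<lambda>\<theta>. exp (1 / 2 ^ n * \<psi> \<theta>))"
        using has_laplace_convolution[OF \<nu>[of "Suc n"] \<nu>[of "Suc n"]] by (simp add: exp_add[symmetric])
    qed
  qed
  interpret dyadic_levy proj.lim "\<lambda>t \<omega>. \<omega> t" \<psi> "W 1"
  proof
    show "has_laplace (distr proj.lim borel (\<lambda>\<omega>. \<omega> (real (Suc i) / 2 ^ n) - \<omega> (real i / 2 ^ n))) (\<lambda>\<theta>. exp (\<psi> \<theta> / 2 ^ n))" for i n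
      unfolding distr_increment using \<nu>[of n] by simp
    show "0 < \<psi> \<theta>" if "0 < \<theta>" for \<theta> using lap_pos[OF that nz] that by (simp add: \<psi>_def)
  qed (use lim_measurable start_zero indep_increments \<psi>_bound in auto)
  show ?thesis using Y_spectrally_negative that by blast
qed

section \<open>Small times and the Levy--Khintchine formula\<close>

text \<open>Increments above \<open>e\<close> on finer and finer grids would accumulate at some
  \<open>t\<close> in the unit interval. Pairs on one side of \<open>t\<close> contradict the
  one-sided limit there; pairs around \<open>t\<close> would need an upward jump.\<close>

lemma no_positive_jump_modulus:
  fixes f :: "real \<Rightarrow> real"
  assumes rc: "\<And>t. 0 \<le> t \<Longrightarrow> (f \<longlongrightarrow> f t) (at_right t)"
    and ll: "\<And>t. 0 < t \<Longrightarrow> \<exists>l. (f \<longlongrightarrow> l) (at_left t)"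
    and up: "\<And>t l. 0 < t \<Longrightarrow> (f \<longlongrightarrow> l) (at_left t) \<Longrightarrow> f t \<le> l"
    and e: "0 < e"
  shows "\<forall>\<^sub>F n in sequentially. \<forall>i\<le>n. f (real (Suc i) / real (Suc n)) - f (real i / real (Suc n)) \<le> e"
proof (rule ccontr)
  assume "\<not> ?thesis"
  then have "\<exists>n\<ge>N. \<exists>i\<le>n. e < f (real (Suc i) / real (Suc n)) - f (real i / real (Suc n))" for N
    by (auto simp: eventually_sequentially not_le)
  then have "\<forall>N. \<exists>n i. N \<le> n \<and> i \<le> n \<and> e < f (real (Suc i) / real (Suc n)) - f (real i / real (Suc n))" by blast
  then obtain n i where ni: "\<And>N. N \<le> n N" "\<And>N. i N \<le> n N"
    "\<And>N. e < f (real (Suc (i N)) / real (Suc (n N))) - f (real (i N) / real (Suc (n N)))"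
    by metis
  define s where "s N = real (i N) / real (Suc (n N))" for N
  define u where "u N = real (Suc (i N)) / real (Suc (n N))" for N
  have su: "u N = s N + 1 / real (Suc (n N))" for N by (simp add: s_def u_def add_divide_distrib)
  have s01: "s N \<in> {0..1}" for N using ni(2)[of N] by (auto simp: s_def)
  obtain t r where t: "t \<in> {0..1}" "strict_mono (r :: nat \<Rightarrow> nat)" "(s \<circ> r) \<longlonglongrightarrow> t"
    using compact_Icc[of "0::real" 1] s01 unfolding compact_def by (metis (no_types))
  have gap: "(\<lambda>N. 1 / real (Suc (n N))) \<longlonglongrightarrow> 0"
  proof (rule tendsto_sandwich[of "\<lambda>_. 0" _ _ "\<lambda>N. 1 / real (Suc N)"])
    show "(\<lambda>N. 1 / real (Suc N)) \<longlonglongrightarrow> 0" by (rule LIMSEQ_Suc[OF lim_1_over_n])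
    show "\<forall>\<^sub>F N in sequentially. 1 / real (Suc (n N)) \<le> 1 / real (Suc N)"
      using ni(1) by (intro always_eventually allI frac_le) auto
  qed auto
  have "(\<lambda>N. s (r N) + 1 / real (Suc (n (r N)))) \<longlonglongrightarrow> t + 0"
    using t(3) LIMSEQ_subseq_LIMSEQ[OF gap t(2)] by (intro tendsto_add) (auto simp: o_def)
  then have ur: "(\<lambda>N. u (r N)) \<longlonglongrightarrow> t" by (simp add: su)
  have sr: "(\<lambda>N. s (r N)) \<longlonglongrightarrow> t" using t(3) by (simp add: o_def)
  obtain b where b: "t < b" "\<And>x. t < x \<Longrightarrow> x < b \<Longrightarrow> \<bar>f x - f t\<bar> < e / 2"
    using tendstoD[OF rc[of t], of "e/2"] e t(1) by (auto simp: eventually_at_right_field dist_real_def)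
  define \<delta>1 where "\<delta>1 = b - t"
  have \<delta>1: "0 < \<delta>1" "\<And>x. t < x \<Longrightarrow> x < t + \<delta>1 \<Longrightarrow> \<bar>f x - f t\<bar> < e / 2" using b by (auto simp: \<delta>1_def)
  have right: "\<bar>f x - f t\<bar> < e / 2" if "t \<le> x" "x < t + \<delta>1" for x using \<delta>1(2)[of x] that e by (cases "x = t") auto
  have "\<exists>\<delta>2>0. \<exists>l. (0 < t \<longrightarrow> f t \<le> l) \<and> (\<forall>x. 0 \<le> x \<longrightarrow> t - \<delta>2 < x \<longrightarrow> x < t \<longrightarrow> \<bar>f x - l\<bar> < e / 2)"
  proof (cases "0 < t")
    case True
    then obtain l where l: "(f \<longlongrightarrow> l) (at_left t)" using ll by blast
    obtain b where b: "b < t" "\<And>x. b < x \<Longrightarrow> x < t \<Longrightarrow> \<bar>f x - l\<bar> < e / 2"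
      using tendstoD[OF l, of "e/2"] e by (auto simp: eventually_at_left_field dist_real_def)
    then show ?thesis using up[OF True l] by (intro exI[of _ "t - b"] conjI exI[of _ l]) auto
  next
    case False
    then show ?thesis using t(1) by (intro exI[of _ 1]) auto
  qed
  then obtain \<delta>2 l where \<delta>2: "0 < \<delta>2" "0 < t \<Longrightarrow> f t \<le> l" "\<And>x. 0 \<le> x \<Longrightarrow> t - \<delta>2 < x \<Longrightarrow> x < t \<Longrightarrow> \<bar>f x - l\<bar> < e / 2" by blast
  have "\<forall>\<^sub>F N in sequentially. t - \<delta>2 < s (r N) \<and> u (r N) < t + \<delta>1"
    using order_tendstoD(1)[OF sr, of "t - \<delta>2"] order_tendstoD(2)[OF ur, of "t + \<delta>1"] \<delta>1(1) \<delta>2(1)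
    by (simp add: eventually_conj_iff)
  then obtain N where N: "t - \<delta>2 < s (r N)" "u (r N) < t + \<delta>1" by (auto simp: eventually_sequentially)
  let ?s = "s (r N)" and ?u = "u (r N)"
  have s0: "0 \<le> ?s" using s01 by auto
  have lt: "?s < ?u" by (simp add: su)
  have "f ?u - f ?s \<le> e"
  proof (cases "t \<le> ?s")
    case True
    then show ?thesis using right[of ?s] right[of ?u] N(2) lt by linarith
  next
    case False
    then have t0: "0 < t" using s0 by linarith
    have a: "\<bar>f ?s - l\<bar> < e / 2" using \<delta>2(3)[OF s0 N(1)] False by linarith
    show ?thesis
    proof (cases "t \<le> ?u")
      case True
      then show ?thesis using a right[of ?u] N(2) \<delta>2(2)[OF t0] by linarith
    next
      case False
      then have "\<bar>f ?u - l\<bar> < e / 2" using \<delta>2(3)[of ?u] N(1) s0 lt by linarith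
      then show ?thesis using a by linarith
    qed
  qed
  then show False using ni(3)[of "r N"] by (simp add: s_def u_def)
qed

section \<open>Increments of a spectrally negative process over short times\<close>

context levy_process
begin

definition incr :: "nat \<Rightarrow> nat \<Rightarrow> 'a \<Rightarrow> real" where
  "incr n i \<omega> = X (real (Suc i) / real (Suc n)) \<omega> - X (real i / real (Suc n)) \<omega>"

lemma incr_rv [measurable]: "incr n i \<in> borel_measurable M"
  unfolding incr_def[abs_def] by (intro borel_measurable_diff measurable_X) auto

lemma incr_law: "distr M borel (incr n i) = distr M borel (X (1 / real (Suc n)))"
  unfolding incr_def[abs_def]
  using stationary_increments[of "real i / real (Suc n)" "real (Suc i) / real (Suc n)"]
  by (simp add: divide_right_mono diff_divide_distrib[symmetric])

lemma incr_indep: "indep_vars (\<lambda>_. borel) (incr n) {..<k}"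
  unfolding incr_def[abs_def] by (rule indep_increments[of "\<lambda>i. real i / real (Suc n)"]) (auto intro: divide_right_mono)

lemma incr_sum: "(\<Sum>i<Suc n. incr n i \<omega>) = X 1 \<omega> - X 0 \<omega>"
proof -
  have "(\<Sum>i=0..<Suc n. incr n i \<omega>) = X (real (Suc n) / real (Suc n)) \<omega> - X (real 0 / real (Suc n)) \<omega>"
    unfolding incr_def by (rule sum_Suc_diff') simp
  then show ?thesis by (simp add: atLeast0LessThan)
qed

text \<open>The power \<open>n + 1\<close> of this transform is the transform at time 1. Its
  finiteness is part of the claim, so the computation runs through nonnegative integrals, where
  independence gives the product formula without integrability.\<close>

lemma small_time_laplace:
  assumes \<psi>: "laplace_exponent M X \<psi>"
  shows "has_laplace (distr M borel (X (1 / real (Suc n)))) (\<lambda>\<theta>. exp (\<psi> \<theta> / real (Suc n)))"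
proof (rule has_laplace_nnI)
  have m: "X (1 / real (Suc n)) \<in> borel_measurable M" "X 1 \<in> borel_measurable M" "X 0 \<in> borel_measurable M"
    by (intro measurable_X; simp)+
  note [measurable] = m
  show "real_distribution (distr M borel (X (1 / real (Suc n))))" by (rule real_distribution_distr[OF m(1)])
  fix \<theta> :: real assume \<theta>: "0 \<le> \<theta>"
  have int: "integrable M (\<lambda>\<omega>. exp (\<theta> * X 1 \<omega>))" and ln: "\<psi> \<theta> = ln (\<integral>\<omega>. exp (\<theta> * X 1 \<omega>) \<partial>M)"
    using \<psi> \<theta> by (auto simp: laplace_exponent_def)
  \<comment> \<open>\<open>ln\<close> determines the expectation only once it is known to be
    positive.\<close>
  have "0 < (\<integral>\<omega>. exp (\<theta> * X 1 \<omega>) \<partial>M)"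
  proof (rule ccontr)
    assume "\<not> ?thesis"
    moreover have "0 \<le> (\<integral>\<omega>. exp (\<theta> * X 1 \<omega>) \<partial>M)" by simp
    ultimately have "(\<integral>\<omega>. exp (\<theta> * X 1 \<omega>) \<partial>M) = 0" by linarith
    then have "AE \<omega> in M. exp (\<theta> * X 1 \<omega>) = 0" using integral_nonneg_eq_0_iff_AE[OF int] by simp
    then show False by (simp add: AE_False)
  qed
  then have val: "(\<integral>\<omega>. exp (\<theta> * X 1 \<omega>) \<partial>M) = exp (\<psi> \<theta>)" by (simp add: ln)
  define a where "a = (\<integral>\<^sup>+x. ennreal (exp (\<theta> * x)) \<partial>distr M borel (X (1 / real (Suc n))))"
  have ai: "(\<integral>\<^sup>+\<omega>. ennreal (exp (\<theta> * incr n i \<omega>)) \<partial>M) = a" for i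
    unfolding a_def incr_law[of n i, symmetric] by (simp add: nn_integral_distr)
  have "(\<integral>\<^sup>+\<omega>. ennreal (exp (\<theta> * X 1 \<omega>)) \<partial>M) = (\<integral>\<^sup>+\<omega>. (\<Prod>i<Suc n. ennreal (exp (\<theta> * incr n i \<omega>))) \<partial>M)"
  proof (rule nn_integral_cong_AE)
    show "AE \<omega> in M. ennreal (exp (\<theta> * X 1 \<omega>)) = (\<Prod>i<Suc n. ennreal (exp (\<theta> * incr n i \<omega>)))"
      using starts_at_zero
    proof eventually_elim
      case (elim \<omega>)
      have "(\<Prod>i<Suc n. ennreal (exp (\<theta> * incr n i \<omega>))) = ennreal (exp (\<theta> * (\<Sum>i<Suc n. incr n i \<omega>)))"
        by (simp only: sum_distrib_left exp_sum[OF finite_lessThan] prod_ennreal[symmetric] exp_ge_zero)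
      then show ?case unfolding incr_sum by (simp add: elim)
    qed
  qed
  also have "\<dots> = (\<Prod>i<Suc n. \<integral>\<^sup>+\<omega>. ennreal (exp (\<theta> * incr n i \<omega>)) \<partial>M)"
    by (intro indep_vars_nn_integral indep_vars_compose2[OF incr_indep]) auto
  also have "\<dots> = a ^ Suc n" by (simp only: ai prod_constant card_lessThan)
  finally have pow: "a ^ Suc n = ennreal (exp (\<psi> \<theta>))"
    using nn_integral_eq_integral[OF int] val by simp
  have "a \<noteq> \<top>"
  proof
    assume "a = \<top>"
    then have "a ^ Suc n = \<top>" by (simp add: top_power_ennreal del: power_Suc)
    with pow show False by simp
  qed
  then obtain b where b: "a = ennreal b" "0 \<le> b" by (cases a) auto
  have "b ^ Suc n = exp (\<psi> \<theta>)" using pow b by (simp add: ennreal_power del: power_Suc)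
  also have "\<dots> = exp (\<psi> \<theta> / real (Suc n)) ^ Suc n" by (simp only: exp_of_nat_mult[symmetric]) simp
  finally have "b = exp (\<psi> \<theta> / real (Suc n))" using b(2) by (intro power_eq_imp_eq_base[of b "Suc n"]) auto
  then show "(\<integral>\<^sup>+x. ennreal (exp (\<theta> * x)) \<partial>distr M borel (X (1 / real (Suc n)))) = ennreal (exp (\<psi> \<theta> / real (Suc n)))"
    using b by (simp add: a_def)
qed simp

text \<open>On almost every path all \<open>n + 1\<close> increments up to time 1 are eventually at
  most \<open>e\<close>, so \<open>(1 - p n) ^ Suc n\<close> tends to 1. The inequality
  \<open>p \<le> - ln (1 - p)\<close> turns this into a statement on the rate.\<close>

lemma small_time_positive_tail:
  assumes up: "AE \<omega> in M. \<forall>t>0. \<forall>l. ((\<lambda>s. X s \<omega>) \<longlongrightarrow> l) (at_left t) \<longrightarrow> X t \<omega> \<le> l"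
    and e: "0 < e"
  shows "(\<lambda>n. real (Suc n) * measure (distr M borel (X (1 / real (Suc n)))) {e<..}) \<longlonglongrightarrow> 0"
proof -
  define p where "p n = measure (distr M borel (X (1 / real (Suc n)))) {e<..}" for n
  have p: "prob {\<omega> \<in> space M. incr n i \<omega> \<le> e} = 1 - p n" for n i
  proof -
    interpret d: real_distribution "distr M borel (incr n i)" by (rule real_distribution_distr) simp
    have "p n = d.prob {e<..}" by (simp add: p_def incr_law)
    also have "d.prob {e<..} = 1 - d.prob {..e}"
      using d.prob_compl[of "{..e}"] by (simp add: d.space_eq_univ Compl_eq_Diff_UNIV[symmetric])
    also have "d.prob {..e} = prob {\<omega> \<in> space M. incr n i \<omega> \<le> e}"
      by (simp add: measure_distr vimage_def Int_def conj_commute)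
    finally show ?thesis by simp
  qed
  have p01: "0 \<le> p n" "p n \<le> 1" for n
    using p[of n 0] by (auto simp: p_def) (metis diff_ge_0_iff_ge measure_nonneg)
  define A where "A n = {\<omega> \<in> space M. \<forall>i\<in>{..<Suc n}. incr n i \<omega> \<le> e}" for n
  have A: "A n \<in> events" for n unfolding A_def by measurable
  have pA: "prob (A n) = (1 - p n) ^ Suc n" for n
  proof -
    have "prob (\<Inter>i\<in>{..<Suc n}. incr n i -` {..e} \<inter> space M) = (\<Prod>i\<in>{..<Suc n}. prob (incr n i -` {..e} \<inter> space M))"
      by (rule indep_varsD[OF incr_indep]) auto
    moreover have "(\<Inter>i\<in>{..<Suc n}. incr n i -` {..e} \<inter> space M) = A n" by (auto simp: A_def)
    moreover have "incr n i -` {..e} \<inter> space M = {\<omega> \<in> space M. incr n i \<omega> \<le> e}" for i by auto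
    ultimately show ?thesis by (simp only: p prod_constant card_lessThan)
  qed
  have "(\<lambda>n. \<integral>\<omega>. indicator (A n) \<omega> \<partial>M :: real) \<longlonglongrightarrow> (\<integral>\<omega>. 1 \<partial>M)"
  proof (rule integral_dominated_convergence[where w="\<lambda>_. 1"])
    show "AE \<omega> in M. (\<lambda>n. indicator (A n) \<omega> :: real) \<longlonglongrightarrow> 1"
      using right_continuous_paths left_limits up AE_space
    proof eventually_elim
      case (elim \<omega>)
      have "\<forall>\<^sub>F n in sequentially. \<forall>i\<le>n. X (real (Suc i) / real (Suc n)) \<omega> - X (real i / real (Suc n)) \<omega> \<le> e"
        using elim e by (intro no_positive_jump_modulus) auto
      then have "\<forall>\<^sub>F n in sequentially. indicator (A n) \<omega> = (1::real)"
        by eventually_elim (use elim in \<open>auto simp: A_def incr_def less_Suc_eq_le\<close>)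
      then show ?case by (rule tendsto_eventually)
    qed
  qed (use A in \<open>auto split: split_indicator\<close>)
  then have lim: "(\<lambda>n. (1 - p n) ^ Suc n) \<longlonglongrightarrow> 1" using A by (simp add: pA prob_space del: power_Suc)
  have "(\<lambda>n. - ln ((1 - p n) ^ Suc n)) \<longlonglongrightarrow> - ln 1"
    by (intro tendsto_intros lim) simp
  then have lnlim: "(\<lambda>n. - ln ((1 - p n) ^ Suc n)) \<longlonglongrightarrow> 0" by simp
  have "(\<lambda>n. real (Suc n) * p n) \<longlonglongrightarrow> 0"
  proof (rule tendsto_sandwich[OF _ _ tendsto_const lnlim])
    show "\<forall>\<^sub>F n in sequentially. 0 \<le> real (Suc n) * p n" using p01 by simp
    have "\<forall>\<^sub>F n in sequentially. 1/2 < (1 - p n) ^ Suc n" using lim by (intro order_tendstoD) auto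
    then show "\<forall>\<^sub>F n in sequentially. real (Suc n) * p n \<le> - ln ((1 - p n) ^ Suc n)"
    proof eventually_elim
      case (elim n)
      then have "1 - p n \<noteq> 0" by auto
      then have pos: "0 < 1 - p n" using p01[of n] by linarith
      have "ln ((1 - p n) ^ Suc n) = real (Suc n) * ln (1 - p n)" by (simp add: ln_realpow pos del: power_Suc)
      also have "\<dots> \<le> real (Suc n) * (- p n)" using ln_le_minus_one[OF pos] by (intro mult_left_mono) auto
      finally show ?case by simp
    qed
  qed
  then show ?thesis by (simp add: p_def)
qed

end

text \<open>\<open>tail\<close> is the form in which the absence of positive jumps enters the
  analysis of the exponent.\<close>

locale small_time =
  fixes \<mu> :: "nat \<Rightarrow> real measure" and \<psi> :: "real \<Rightarrow> real"
  assumes lap: "has_laplace (\<mu> n) (\<lambda>\<theta>. exp (\<psi> \<theta> / real (Suc n)))"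
    and tail: "0 < e \<Longrightarrow> (\<lambda>n. real (Suc n) * measure (\<mu> n) {e<..}) \<longlonglongrightarrow> 0"
begin

sublocale \<mu>: real_distribution "\<mu> n" for n using lap[of n] by (simp add: has_laplace_def)

definition r :: "nat \<Rightarrow> real" where "r n = real (Suc n)"

lemma r_pos [simp]: "0 < r n" "r n \<noteq> 0" "0 \<le> r n" by (auto simp: r_def)

lemma int [simp]: "0 \<le> \<theta> \<Longrightarrow> integrable (\<mu> n) (\<lambda>x. exp (\<theta> * x))"
  and val: "0 \<le> \<theta> \<Longrightarrow> (\<integral>x. exp (\<theta> * x) \<partial>\<mu> n) = exp (\<psi> \<theta> / r n)"
  using lap[of n] by (auto simp: has_laplace_def r_def)

lemma prob_one: "\<mu>.prob n UNIV = 1" using \<mu>.prob_space[of n] by (simp add: \<mu>.space_eq_univ)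

text \<open>The integral of \<open>exp (\<theta> * x) - 1\<close> against the law rescaled by
  \<open>r n\<close>, a difference quotient of \<open>exp\<close> at 0.\<close>

definition A :: "nat \<Rightarrow> real \<Rightarrow> real" where "A n \<theta> = r n * (exp (\<psi> \<theta> / r n) - 1)"

lemma A_lim: "(\<lambda>n. A n \<theta>) \<longlonglongrightarrow> \<psi> \<theta>"
proof -
  have "((\<lambda>y. exp (y * \<psi> \<theta>)) has_real_derivative \<psi> \<theta>) (at 0)"
    by (auto intro!: derivative_eq_intros)
  then have "((\<lambda>y. (exp (y * \<psi> \<theta>) - 1) / y) \<longlongrightarrow> \<psi> \<theta>) (at 0)" by (simp add: DERIV_def)
  moreover have "filterlim (\<lambda>n. 1 / r n) (at 0) sequentially"
    using LIMSEQ_Suc[OF lim_1_over_n] by (auto simp: filterlim_at r_def)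
  ultimately have "(\<lambda>n. (exp (1 / r n * \<psi> \<theta>) - 1) / (1 / r n)) \<longlonglongrightarrow> \<psi> \<theta>" by (rule filterlim_compose)
  then show ?thesis by (simp add: A_def mult.commute)
qed

lemma square_val:
  assumes "0 \<le> k" "0 \<le> \<theta>"
  shows "integrable (\<mu> n) (\<lambda>x. (exp (k * x) - 1)\<^sup>2 * exp (\<theta> * x))"
    and "r n * (\<integral>x. (exp (k * x) - 1)\<^sup>2 * exp (\<theta> * x) \<partial>\<mu> n) = A n (2 * k + \<theta>) - 2 * A n (k + \<theta>) + A n \<theta>"
proof -
  have e: "(exp (k * x) - 1)\<^sup>2 * exp (\<theta> * x) = exp ((2 * k + \<theta>) * x) - 2 * exp ((k + \<theta>) * x) + exp (\<theta> * x)" for x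
    by (simp add: power2_eq_square algebra_simps exp_add[symmetric])
  show "integrable (\<mu> n) (\<lambda>x. (exp (k * x) - 1)\<^sup>2 * exp (\<theta> * x))"
    unfolding e using assms by (intro Bochner_Integration.integrable_add Bochner_Integration.integrable_diff integrable_mult_right int) auto
  have v: "(\<integral>x. (exp (k * x) - 1)\<^sup>2 * exp (\<theta> * x) \<partial>\<mu> n) = exp (\<psi> (2 * k + \<theta>) / r n) - 2 * exp (\<psi> (k + \<theta>) / r n) + exp (\<psi> \<theta> / r n)"
    unfolding e using assms int[of "2 * k + \<theta>" n] int[of "k + \<theta>" n] int[of \<theta> n] val[of "2 * k + \<theta>" n] val[of "k + \<theta>" n] val[of \<theta> n]
    by simp
  show "r n * (\<integral>x. (exp (k * x) - 1)\<^sup>2 * exp (\<theta> * x) \<partial>\<mu> n) = A n (2 * k + \<theta>) - 2 * A n (k + \<theta>) + A n \<theta>"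
    unfolding v A_def by (simp add: algebra_simps)
qed

lemma \<psi>_0 [simp]: "\<psi> 0 = 0"
  using val[of 0 0] prob_one[of 0] by (simp add: r_def)

lemma A_0 [simp]: "A n 0 = 0" by (simp add: A_def)

lemma exp_tail_int: "0 \<le> k \<Longrightarrow> integrable (\<mu> n) (\<lambda>x. exp (k * x) * indicator {e<..} x)"
  by (rule Bochner_Integration.integrable_bound[OF int[of k n]]) (auto split: split_indicator)

text \<open>\<open>tail\<close> controls rescaled masses, not exponential moments. These are bounded
  at the larger exponent \<open>k + 1\<close> by means of \<open>square_val\<close>; a cut at
  \<open>K\<close> then gains a factor \<open>exp (- K)\<close> beyond it and uses the vanishing
  mass below it.\<close>

lemma exp_tail:
  assumes k: "0 \<le> k" and e: "0 < e"
  shows "(\<lambda>n. r n * (\<integral>x. exp (k * x) * indicator {e<..} x \<partial>\<mu> n)) \<longlonglongrightarrow> 0"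
proof -
  \<comment> \<open>Makes \<open>exp ((k + 1) * x) * q\<^sup>2\<close> at most
    \<open>(exp ((k + 1) * x) - 1)\<^sup>2\<close> for all \<open>x > e\<close>.\<close>
  define q where "q = 1 - exp (- ((k + 1) * e))"
  have q: "0 < q" using k e by (simp add: q_def)
  have "(\<lambda>n. A n (2 * (k + 1) + 0) - 2 * A n ((k + 1) + 0) + A n 0) \<longlonglongrightarrow> \<psi> (2 * (k + 1) + 0) - 2 * \<psi> ((k + 1) + 0) + \<psi> 0"
    by (intro tendsto_intros A_lim)
  then have "Bseq (\<lambda>n. A n (2 * (k + 1) + 0) - 2 * A n ((k + 1) + 0) + A n 0)"
    by (intro convergent_imp_Bseq convergentI)
  then obtain B where B: "0 < B" "\<And>n. \<bar>A n (2 * (k + 1) + 0) - 2 * A n ((k + 1) + 0) + A n 0\<bar> \<le> B"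
    by (auto elim!: BseqE)
  have big: "r n * (\<integral>x. exp ((k + 1) * x) * indicator {e<..} x \<partial>\<mu> n) \<le> B / q\<^sup>2" for n
  proof -
    have "(\<integral>x. exp ((k + 1) * x) * indicator {e<..} x \<partial>\<mu> n) \<le> (\<integral>x. ((exp ((k + 1) * x) - 1)\<^sup>2 * exp (0 * x)) / q\<^sup>2 \<partial>\<mu> n)"
    proof (rule integral_mono)
      show "integrable (\<mu> n) (\<lambda>x. exp ((k + 1) * x) * indicator {e<..} x)" using k by (intro exp_tail_int) auto
      show "integrable (\<mu> n) (\<lambda>x. ((exp ((k + 1) * x) - 1)\<^sup>2 * exp (0 * x)) / q\<^sup>2)"
        using k by (intro integrable_divide square_val(1)) auto
      fix x
      have "exp ((k + 1) * x) * q\<^sup>2 \<le> (exp ((k + 1) * x) - 1)\<^sup>2" if "e < x"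
      proof -
        let ?E = "exp ((k + 1) * x)"
        have "exp (- ((k + 1) * x)) \<le> exp (- ((k + 1) * e))" using that k by simp
        then have "q \<le> 1 - exp (- ((k + 1) * x))" by (simp add: q_def)
        then have "?E * q \<le> ?E * (1 - exp (- ((k + 1) * x)))" by (intro mult_left_mono) auto
        also have "\<dots> = ?E - 1" by (simp add: right_diff_distrib exp_minus)
        finally have "(?E * q)\<^sup>2 \<le> (?E - 1)\<^sup>2" using q by (intro power_mono) auto
        moreover have "?E * q\<^sup>2 \<le> (?E * q)\<^sup>2"
        proof -
          have "1 \<le> ?E" using that e k by simp
          then have "?E * q\<^sup>2 \<le> ?E * (?E * q\<^sup>2)" by (intro mult_left_mono) (auto simp: mult_le_cancel_right1)
          then show ?thesis by (simp add: power2_eq_square ac_simps)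
        qed
        ultimately show ?thesis by linarith
      qed
      then show "exp ((k + 1) * x) * indicator {e<..} x \<le> ((exp ((k + 1) * x) - 1)\<^sup>2 * exp (0 * x)) / q\<^sup>2"
        using q by (auto simp: pos_le_divide_eq split: split_indicator)
    qed
    then have "r n * (\<integral>x. exp ((k + 1) * x) * indicator {e<..} x \<partial>\<mu> n) \<le> r n * ((\<integral>x. ((exp ((k + 1) * x) - 1)\<^sup>2 * exp (0 * x)) \<partial>\<mu> n) / q\<^sup>2)"
      by (intro mult_left_mono) auto
    also have "\<dots> = (A n (2 * (k + 1) + 0) - 2 * A n ((k + 1) + 0) + A n 0) / q\<^sup>2"
      using square_val(2)[of "k + 1" 0 n] k by (simp only: times_divide_eq_right add_nonneg_nonneg zero_le_one order_refl)
    also have "\<dots> \<le> B / q\<^sup>2" using B(2)[of n] by (intro divide_right_mono) auto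
    finally show ?thesis .
  qed
  show ?thesis
  proof (rule LIMSEQ_I)
    fix \<epsilon> :: real assume \<epsilon>: "0 < \<epsilon>"
    have "((\<lambda>K. exp (- K) * (B / q\<^sup>2)) \<longlongrightarrow> 0) at_top" by real_asymp
    then have "\<forall>\<^sub>F K in at_top. exp (- K) * (B / q\<^sup>2) < \<epsilon> / 2" using \<epsilon> by (intro order_tendstoD) auto
    then obtain K where K: "exp (- K) * (B / q\<^sup>2) < \<epsilon> / 2"
      using eventually_happens[of _ "at_top :: real filter"] by (auto simp: trivial_limit_at_top_linorder)
    have "(\<lambda>n. exp (k * K) * (r n * measure (\<mu> n) {e<..})) \<longlonglongrightarrow> exp (k * K) * 0"
      unfolding r_def by (intro tendsto_intros tail e)
    from order_tendstoD(2)[OF this, of "\<epsilon> / 2"] \<epsilon>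
    have "\<forall>\<^sub>F n in sequentially. exp (k * K) * (r n * measure (\<mu> n) {e<..}) < \<epsilon> / 2" by simp
    then obtain n0 where n0: "\<And>n. n0 \<le> n \<Longrightarrow> exp (k * K) * (r n * measure (\<mu> n) {e<..}) < \<epsilon> / 2"
      by (auto simp: eventually_sequentially)
    have "norm (r n * (\<integral>x. exp (k * x) * indicator {e<..} x \<partial>\<mu> n) - 0) < \<epsilon>" if "n0 \<le> n" for n
    proof -
      have i1: "integrable (\<mu> n) (\<lambda>x. exp (k * K) * indicator {e<..} x)"
        by (intro integrable_mult_right \<mu>.integrable_const_bound[where B=1]) (auto split: split_indicator)
      have i2: "integrable (\<mu> n) (\<lambda>x. exp (- K) * (exp ((k + 1) * x) * indicator {e<..} x))"
        using k by (intro integrable_mult_right exp_tail_int) auto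
      have "(\<integral>x. exp (k * x) * indicator {e<..} x \<partial>\<mu> n)
          \<le> (\<integral>x. exp (k * K) * indicator {e<..} x + exp (- K) * (exp ((k + 1) * x) * indicator {e<..} x) \<partial>\<mu> n)"
      proof (rule integral_mono[OF exp_tail_int[OF k] Bochner_Integration.integrable_add[OF i1 i2]])
        fix x
        have "exp (k * x) \<le> exp (k * K) + exp (- K) * exp ((k + 1) * x)"
        proof (cases "x \<le> K")
          case True
          then have "exp (k * x) \<le> exp (k * K)" using k by (simp add: mult_left_mono)
          then show ?thesis by (simp add: add_increasing2)
        next
          case False
          then have "exp (k * x) \<le> exp (- K + (k + 1) * x)" by (simp add: algebra_simps)
          then have "exp (k * x) \<le> exp (- K) * exp ((k + 1) * x)" by (simp only: exp_add)
          then show ?thesis by (simp add: add_increasing)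
        qed
        then show "exp (k * x) * indicator {e<..} x \<le> exp (k * K) * indicator {e<..} x + exp (- K) * (exp ((k + 1) * x) * indicator {e<..} x)"
          by (auto split: split_indicator)
      qed
      also have "\<dots> = exp (k * K) * measure (\<mu> n) {e<..} + exp (- K) * (\<integral>x. exp ((k + 1) * x) * indicator {e<..} x \<partial>\<mu> n)"
        using i1 i2 by (subst Bochner_Integration.integral_add) auto
      finally have "r n * (\<integral>x. exp (k * x) * indicator {e<..} x \<partial>\<mu> n) \<le>
          r n * (exp (k * K) * measure (\<mu> n) {e<..} + exp (- K) * (\<integral>x. exp ((k + 1) * x) * indicator {e<..} x \<partial>\<mu> n))"
        by (intro mult_left_mono) auto
      also have "\<dots> = exp (k * K) * (r n * measure (\<mu> n) {e<..}) + exp (- K) * (r n * (\<integral>x. exp ((k + 1) * x) * indicator {e<..} x \<partial>\<mu> n))"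
        by (simp add: algebra_simps)
      also have "\<dots> \<le> exp (k * K) * (r n * measure (\<mu> n) {e<..}) + exp (- K) * (B / q\<^sup>2)"
        by (intro add_left_mono mult_left_mono big) auto
      also have "\<dots> < \<epsilon>" using n0[OF that] K by linarith
      finally have "r n * (\<integral>x. exp (k * x) * indicator {e<..} x \<partial>\<mu> n) < \<epsilon>" .
      moreover have "0 \<le> r n * (\<integral>x. exp (k * x) * indicator {e<..} x \<partial>\<mu> n)" by (intro mult_nonneg_nonneg Bochner_Integration.integral_nonneg) auto
      ultimately show ?thesis by simp
    qed
    then show "\<exists>no. \<forall>n\<ge>no. norm (r n * (\<integral>x. exp (k * x) * indicator {e<..} x \<partial>\<mu> n) - 0) < \<epsilon>" by blast
  qed
qed

definition mass :: "nat \<Rightarrow> real" where "mass n = A n 2 - 2 * A n 1"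

lemma mass: "r n * (\<integral>x. (exp x - 1)\<^sup>2 \<partial>\<mu> n) = mass n" and sq_int: "integrable (\<mu> n) (\<lambda>x. (exp x - 1)\<^sup>2)"
  and mass_nonneg: "0 \<le> mass n"
proof -
  show *: "r n * (\<integral>x. (exp x - 1)\<^sup>2 \<partial>\<mu> n) = mass n" using square_val(2)[of 1 0 n] by (simp add: mass_def)
  show "integrable (\<mu> n) (\<lambda>x. (exp x - 1)\<^sup>2)" using square_val(1)[of 1 0 n] by simp
  show "0 \<le> mass n" unfolding *[symmetric] by simp
qed

lemma mass_lim: "mass \<longlonglongrightarrow> \<psi> 2 - 2 * \<psi> 1"
  unfolding mass_def[abs_def] by (intro tendsto_intros A_lim)

lemma \<psi>_eq: "0 \<le> \<theta> \<Longrightarrow> \<psi> \<theta> = ln (\<integral>x. exp (\<theta> * x) \<partial>\<mu> 0)"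
  using val[of \<theta> 0] by (simp add: r_def)

text \<open>Gives the limiting transform the limit 1 at 0, so that no mass escapes to the
  left.\<close>

lemma \<psi>_right_continuous:
  assumes a: "0 \<le> a" shows "((\<lambda>\<theta>. \<psi> (\<theta> + a)) \<longlongrightarrow> \<psi> a) (at_right 0)"
proof -
  have "((\<lambda>\<theta>. \<integral>x. exp ((\<theta> + a) * x) \<partial>\<mu> 0) \<longlongrightarrow> (\<integral>x. exp (a * x) \<partial>\<mu> 0)) (at_right 0)"
  proof (rule tendsto_integral_at_within[where w="\<lambda>x. exp (a * x) + exp ((1 + a) * x)"])
    show "integrable (\<mu> 0) (\<lambda>x. exp (a * x) + exp ((1 + a) * x))" using a by auto
    have "((\<lambda>h. exp ((h + a) * x)) \<longlongrightarrow> exp ((0 + a) * x)) (at_right 0)" for x by (intro tendsto_intros)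
    then show "AE x in \<mu> 0. ((\<lambda>h. exp ((h + a) * x)) \<longlongrightarrow> exp (a * x)) (at_right 0)" by simp
    have "exp ((h + a) * x) \<le> exp (a * x) + exp ((1 + a) * x)" if "0 < h" "h < 1" for h x :: real
    proof (cases "0 \<le> x")
      case True
      then have "h * x \<le> 1 * x" using that by (intro mult_right_mono) auto
      then have "exp ((h + a) * x) \<le> exp ((1 + a) * x)" by (simp add: algebra_simps)
      then show ?thesis by (simp add: add_increasing)
    next
      case False
      then have "h * x \<le> 0" using that by (simp add: mult_nonneg_nonpos)
      then have "exp ((h + a) * x) \<le> exp (a * x)" by (simp add: algebra_simps)
      then show ?thesis by (simp add: add_increasing2)
    qed
    then show "\<forall>\<^sub>F h in at_right 0. AE x in \<mu> 0. norm (exp ((h + a) * x)) \<le> exp (a * x) + exp ((1 + a) * x)"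
      unfolding eventually_at by (intro exI[of _ 1]) auto
  qed auto
  moreover have "(\<integral>x. exp (a * x) \<partial>\<mu> 0) \<noteq> 0" using val[OF a, of 0] by simp
  ultimately have "((\<lambda>\<theta>. ln (\<integral>x. exp ((\<theta> + a) * x) \<partial>\<mu> 0)) \<longlongrightarrow> ln (\<integral>x. exp (a * x) \<partial>\<mu> 0)) (at_right 0)"
    by (intro tendsto_ln)
  moreover have "\<forall>\<^sub>F \<theta> in at_right 0. ln (\<integral>x. exp ((\<theta> + a) * x) \<partial>\<mu> 0) = \<psi> (\<theta> + a)"
    unfolding eventually_at using \<psi>_eq[symmetric] a by (intro exI[of _ 1]) auto
  ultimately show ?thesis using \<psi>_eq[OF a] by (simp add: Lim_transform_eventually)
qed

text \<open>The measures with density \<open>r n * (exp x - 1)\<^sup>2\<close> have second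
  differences of \<open>A n\<close> as transforms, which converge. Divided by their masses they are
  probability laws to which \<open>laplace_closure\<close> applies.\<close>

lemma weak_limit:
  obtains s :: "nat \<Rightarrow> nat" and m :: "real measure" where "strict_mono s" "finite_measure m" "sets m = sets borel"
    "\<And>f B. (\<And>x. isCont f x) \<Longrightarrow> (\<And>x. \<bar>f x\<bar> \<le> B) \<Longrightarrow>
       (\<lambda>k. r (s k) * (\<integral>x. (exp x - 1)\<^sup>2 * f x \<partial>\<mu> (s k))) \<longlonglongrightarrow> (\<integral>x. f x \<partial>m)"
proof (cases "\<psi> 2 - 2 * \<psi> 1 = 0")
  \<comment> \<open>The masses tend to 0, so there is nothing to normalise and the limit is the null
    measure.\<close>
  case True
  show ?thesis
  proof (rule that[of id "null_measure borel"])
    fix f :: "real \<Rightarrow> real" and B assume f: "\<And>x. isCont f x" "\<And>x. \<bar>f x\<bar> \<le> B"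
    have fm: "f \<in> borel_measurable borel" by (intro borel_measurable_continuous_onI continuous_at_imp_continuous_on) (use f in auto)
    have "(\<lambda>n. r n * (\<integral>x. (exp x - 1)\<^sup>2 * f x \<partial>\<mu> n)) \<longlonglongrightarrow> 0"
    proof (rule Lim_null_comparison)
      show "(\<lambda>n. mass n * B) \<longlonglongrightarrow> 0" using tendsto_mult[OF mass_lim tendsto_const, of B] True by simp
      show "\<forall>\<^sub>F n in sequentially. norm (r n * (\<integral>x. (exp x - 1)\<^sup>2 * f x \<partial>\<mu> n)) \<le> mass n * B"
      proof (intro always_eventually allI)
        fix n
        have iB: "integrable (\<mu> n) (\<lambda>x. (exp x - 1)\<^sup>2 * B)" using sq_int[of n] by simp
        have bd: "norm ((exp x - 1)\<^sup>2 * f x) \<le> (exp x - 1)\<^sup>2 * B" for x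
          using f(2)[of x] by (auto simp: abs_mult intro!: mult_left_mono)
        have "integrable (\<mu> n) (\<lambda>x. (exp x - 1)\<^sup>2 * f x)"
          by (rule Bochner_Integration.integrable_bound[OF iB])
             (use fm bd in \<open>auto intro: order_trans[OF _ abs_ge_self]\<close>)
        then have "norm (\<integral>x. (exp x - 1)\<^sup>2 * f x \<partial>\<mu> n) \<le> (\<integral>x. (exp x - 1)\<^sup>2 * B \<partial>\<mu> n)"
          by (rule Bochner_Integration.integral_norm_bound_integral[OF _ iB]) (rule bd)
        then have "r n * norm (\<integral>x. (exp x - 1)\<^sup>2 * f x \<partial>\<mu> n) \<le> r n * (\<integral>x. (exp x - 1)\<^sup>2 * B \<partial>\<mu> n)"
          by (intro mult_left_mono) auto
        also have "\<dots> = mass n * B" unfolding mass[symmetric] by simp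
        finally show "norm (r n * (\<integral>x. (exp x - 1)\<^sup>2 * f x \<partial>\<mu> n)) \<le> mass n * B" by (simp add: abs_mult)
      qed
    qed
    then show "(\<lambda>k. r (id k) * (\<integral>x. (exp x - 1)\<^sup>2 * f x \<partial>\<mu> (id k))) \<longlonglongrightarrow> (\<integral>x. f x \<partial>null_measure borel)"
      by (simp add: integral_null_measure)
  qed (auto simp: strict_mono_id intro!: finite_measureI)
next
  case False
  define c where "c = \<psi> 2 - 2 * \<psi> 1"
  have "0 \<le> c" unfolding c_def using mass_lim mass_nonneg by (intro LIMSEQ_le_const) auto
  then have c: "0 < c" using False by (simp add: c_def)
  have "\<forall>\<^sub>F n in sequentially. 0 < mass n" using mass_lim c unfolding c_def by (rule order_tendstoD)
  then obtain N where N: "\<And>n. N \<le> n \<Longrightarrow> 0 < mass n" by (auto simp: eventually_sequentially)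
  define g where "g n x = r n * (exp x - 1)\<^sup>2 / mass n" for n x
  have g0: "0 \<le> g n x" for n x using mass_nonneg[of n] by (simp add: g_def)
  have gm [measurable]: "g n \<in> borel_measurable borel" for n unfolding g_def by measurable
  define \<nu> where "\<nu> k = density (\<mu> (k + N)) (g (k + N))" for k
  have \<nu>int: "(\<integral>x. f x \<partial>\<nu> k) = r (k + N) * (\<integral>x. (exp x - 1)\<^sup>2 * f x \<partial>\<mu> (k + N)) / mass (k + N)"
    if [measurable]: "f \<in> borel_measurable borel" for f :: "real \<Rightarrow> real" and k
  proof -
    have "(\<integral>x. f x \<partial>\<nu> k) = (\<integral>x. g (k + N) x *\<^sub>R f x \<partial>\<mu> (k + N))"
      unfolding \<nu>_def by (rule integral_density) (auto simp: g0)
    also have "\<dots> = (\<integral>x. r (k + N) / mass (k + N) * ((exp x - 1)\<^sup>2 * f x) \<partial>\<mu> (k + N))"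
      by (intro Bochner_Integration.integral_cong) (auto simp: g_def)
    also have "\<dots> = r (k + N) / mass (k + N) * (\<integral>x. (exp x - 1)\<^sup>2 * f x \<partial>\<mu> (k + N))"
      by (rule integral_mult_right_zero)
    finally show ?thesis by simp
  qed
  define L where "L k \<theta> = (A (k + N) (2 + \<theta>) - 2 * A (k + N) (1 + \<theta>) + A (k + N) \<theta>) / mass (k + N)" for k \<theta>
  have lap\<nu>: "has_laplace (\<nu> k) (L k)" for k
  proof -
    have i: "integrable (\<nu> k) (\<lambda>x. exp (\<theta> * x))" if "0 \<le> \<theta>" for \<theta>
    proof -
      have "integrable (\<mu> (k + N)) (\<lambda>x. r (k + N) / mass (k + N) * ((exp (1 * x) - 1)\<^sup>2 * exp (\<theta> * x)))"
        using that by (intro integrable_mult_right square_val(1)) auto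
      then have "integrable (\<mu> (k + N)) (\<lambda>x. g (k + N) x *\<^sub>R exp (\<theta> * x))" by (simp add: g_def mult.assoc)
      then show ?thesis unfolding \<nu>_def by (subst integrable_density) (auto simp: g0)
    qed
    have v: "(\<integral>x. exp (\<theta> * x) \<partial>\<nu> k) = L k \<theta>" if "0 \<le> \<theta>" for \<theta>
      using square_val(2)[of 1 \<theta> "k + N"] that by (simp add: \<nu>int L_def)
    have "emeasure (\<nu> k) (space (\<nu> k)) = 1"
    proof -
      have "emeasure (\<nu> k) (space (\<nu> k)) = (\<integral>\<^sup>+x. ennreal (exp (0 * x)) \<partial>\<nu> k)" by simp
      also have "\<dots> = ennreal (L k 0)" using i[of 0] v[of 0] by (subst nn_integral_eq_integral) auto
      also have "L k 0 = 1" using N[of "k + N"] by (simp add: L_def mass_def)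
      finally show ?thesis by simp
    qed
    then have "real_distribution (\<nu> k)"
      by (intro real_distribution.intro prob_spaceI real_distribution_axioms.intro) (simp_all add: \<nu>_def)
    then show ?thesis using i v by (simp add: has_laplace_def)
  qed
  define K where "K \<theta> = (\<psi> (2 + \<theta>) - 2 * \<psi> (1 + \<theta>) + \<psi> \<theta>) / c" for \<theta>
  have LK: "(\<lambda>k. L k \<theta>) \<longlonglongrightarrow> K \<theta>" for \<theta>
    unfolding L_def K_def using c
    by (intro tendsto_divide tendsto_add tendsto_diff tendsto_mult tendsto_const LIMSEQ_ignore_initial_segment A_lim
        mass_lim[folded c_def]) auto
  have "((\<lambda>\<theta>. (\<psi> (\<theta> + 2) - 2 * \<psi> (\<theta> + 1) + \<psi> (\<theta> + 0)) / c) \<longlongrightarrow> (\<psi> 2 - 2 * \<psi> 1 + \<psi> 0) / c) (at_right 0)"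
    using c by (intro tendsto_intros \<psi>_right_continuous) auto
  then have K1: "(K \<longlongrightarrow> 1) (at_right 0)" using c by (simp add: K_def[abs_def] c_def add.commute)
  obtain s \<mu>' where s: "strict_mono s" "has_laplace \<mu>' K" "weak_conv_m (\<nu> \<circ> s) \<mu>'"
    using laplace_closure[OF lap\<nu> LK K1] by blast
  interpret \<mu>': real_distribution \<mu>' using s(2) by (simp add: has_laplace_def)
  have rd: "real_distribution ((\<nu> \<circ> s) k)" for k using lap\<nu> by (simp add: has_laplace_def)
  define m where "m = density \<mu>' (\<lambda>_. ennreal c)"
  show ?thesis
  proof (rule that[of "\<lambda>k. s k + N" m])
    show "strict_mono (\<lambda>k. s k + N)" using s(1) by (simp add: strict_mono_def)
    show "finite_measure m"
      by (rule finite_measureI) (simp add: m_def emeasure_density nn_integral_cmult \<mu>'.emeasure_space_1 ennreal_mult_eq_top_iff)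
    show "sets m = sets borel" by (simp add: m_def)
    fix f :: "real \<Rightarrow> real" and B assume f: "\<And>x. isCont f x" "\<And>x. \<bar>f x\<bar> \<le> B"
    have fm [measurable]: "f \<in> borel_measurable borel" by (intro borel_measurable_continuous_onI continuous_at_imp_continuous_on) (use f in auto)
    have "(\<lambda>k. \<integral>x. f x \<partial>((\<nu> \<circ> s) k)) \<longlonglongrightarrow> (\<integral>x. f x \<partial>\<mu>')"
      by (rule weak_conv_imp_integral_bdd_continuous_conv[OF rd \<mu>'.real_distribution_axioms s(3)]) (use f in auto)
    then have "(\<lambda>k. mass (s k + N) * (\<integral>x. f x \<partial>\<nu> (s k))) \<longlonglongrightarrow> c * (\<integral>x. f x \<partial>\<mu>')"
      using LIMSEQ_subseq_LIMSEQ[OF LIMSEQ_ignore_initial_segment[OF mass_lim[folded c_def], of N] s(1)]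
      by (intro tendsto_mult) (auto simp: o_def)
    moreover have "mass (s k + N) * (\<integral>x. f x \<partial>\<nu> (s k)) = r (s k + N) * (\<integral>x. (exp x - 1)\<^sup>2 * f x \<partial>\<mu> (s k + N))" for k
      using N[of "s k + N"] by (simp add: \<nu>int)
    moreover have "c * (\<integral>x. f x \<partial>\<mu>') = (\<integral>x. f x \<partial>m)"
      unfolding m_def using c by (subst integral_density) auto
    ultimately show "(\<lambda>k. r (s k + N) * (\<integral>x. (exp x - 1)\<^sup>2 * f x \<partial>\<mu> (s k + N))) \<longlonglongrightarrow> (\<integral>x. f x \<partial>m)" by simp
  qed
qed

end

text \<open>
  The Levy--Khintchine integrand normalised by \<open>(e\<^sup>x - 1)\<^sup>2\<close> and compensated by \<open>e\<^sup>x - 1\<close> instead of a truncation;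
  the linear term of the exponent is then \<open>\<theta> * \<psi> 1\<close>, since the kernel vanishes at \<open>\<theta> = 1\<close>.
\<close>

definition lk_kernel :: "real \<Rightarrow> real \<Rightarrow> real" where
  "lk_kernel \<theta> x = (if x = 0 then (\<theta>\<^sup>2 - \<theta>) / 2 else (exp (\<theta> * x) - 1 - \<theta> * (exp x - 1)) / (exp x - 1)\<^sup>2)"

lemma lk_kernel_mult: "(exp x - 1)\<^sup>2 * lk_kernel \<theta> x = exp (\<theta> * x) - 1 - \<theta> * (exp x - 1)"
  by (simp add: lk_kernel_def)

lemma isCont_lk_kernel: "isCont (lk_kernel \<theta>) x"
proof (cases "x = 0")
  case True
  have "((\<lambda>x. (exp (\<theta> * x) - 1 - \<theta> * (exp x - 1)) / (exp x - 1)\<^sup>2) \<longlongrightarrow> \<theta> * \<theta> / 2 - \<theta> / 2) (at 0)"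
    by real_asymp
  then have "((\<lambda>x. (exp (\<theta> * x) - 1 - \<theta> * (exp x - 1)) / (exp x - 1)\<^sup>2) \<longlongrightarrow> (\<theta>\<^sup>2 - \<theta>) / 2) (at 0)"
    by (simp add: power2_eq_square diff_divide_distrib)
  then have "(lk_kernel \<theta> \<longlongrightarrow> (\<theta>\<^sup>2 - \<theta>) / 2) (at 0)"
    by (rule Lim_transform_eventually) (auto simp: eventually_at lk_kernel_def intro!: exI[of _ 1])
  then show ?thesis using True by (simp add: isCont_def lk_kernel_def)
next
  case False
  have "isCont (\<lambda>x. (exp (\<theta> * x) - 1 - \<theta> * (exp x - 1)) / (exp x - 1)\<^sup>2) x"
    using False by (intro continuous_intros) auto
  moreover have "\<forall>\<^sub>F y in nhds x. (exp (\<theta> * y) - 1 - \<theta> * (exp y - 1)) / (exp y - 1)\<^sup>2 = lk_kernel \<theta> y"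
    using t1_space_nhds[OF False] by eventually_elim (simp add: lk_kernel_def)
  ultimately show ?thesis by (simp add: isCont_cong)
qed

text \<open>To the left of -1 the denominator stays away from 0 and the numerator is bounded;
  between -1 and 1 continuity suffices. On the far right the kernel grows like
  \<open>exp ((\<theta> - 2) * x)\<close> when \<theta> > 2.\<close>

lemma lk_kernel_bounded:
  assumes \<theta>: "0 \<le> \<theta>"
  obtains B where "0 \<le> B" "\<And>x. x \<le> 1 \<Longrightarrow> \<bar>lk_kernel \<theta> x\<bar> \<le> B"
proof -
  have "compact (lk_kernel \<theta> ` {-1..1})"
    by (intro compact_continuous_image compact_Icc continuous_at_imp_continuous_on) (use isCont_lk_kernel in auto)
  then have "bounded (lk_kernel \<theta> ` {-1..1})" by (rule compact_imp_bounded)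
  then obtain B1 where "\<forall>y\<in>lk_kernel \<theta> ` {-1..1}. norm y \<le> B1" unfolding bounded_iff by blast
  then have B1: "\<bar>lk_kernel \<theta> x\<bar> \<le> B1" if "x \<in> {-1..1}" for x using that by simp
  define q where "q = (1 - exp (- 1) :: real)\<^sup>2"
  have q: "0 < q" by (simp add: q_def)
  have "\<bar>lk_kernel \<theta> x\<bar> \<le> (2 + \<theta>) / q" if "x \<le> -1" for x
  proof -
    have "exp x \<le> exp (- 1)" using that by simp
    then have "q \<le> (1 - exp x)\<^sup>2" unfolding q_def by (intro power_mono) auto
    then have q2: "q \<le> (exp x - 1)\<^sup>2" by (simp add: power2_commute)
    have "\<theta> * x \<le> 0" using that \<theta> by (intro mult_nonneg_nonpos) auto
    then have e1: "exp (\<theta> * x) \<le> 1" by simp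
    have "\<theta> * (1 - exp x) \<le> \<theta> * 1" using \<theta> by (intro mult_left_mono) auto
    moreover have "0 \<le> \<theta> * (1 - exp x)" using \<theta> that by simp
    ultimately have num: "\<bar>exp (\<theta> * x) - 1 - \<theta> * (exp x - 1)\<bar> \<le> 2 + \<theta>"
    proof -
      have "\<theta> * (exp x - 1) = - (\<theta> * (1 - exp x))" by (simp add: algebra_simps)
      then show ?thesis
        using e1 exp_gt_zero[of "\<theta> * x"] \<open>\<theta> * (1 - exp x) \<le> \<theta> * 1\<close> \<open>0 \<le> \<theta> * (1 - exp x)\<close> by linarith
    qed
    from num have "\<bar>exp (\<theta> * x) - 1 - \<theta> * (exp x - 1)\<bar> / (exp x - 1)\<^sup>2 \<le> (2 + \<theta>) / q"
      using q q2 \<theta> by (intro frac_le) auto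
    then show ?thesis using that by (simp add: lk_kernel_def abs_divide)
  qed
  then have "\<bar>lk_kernel \<theta> x\<bar> \<le> max 0 (max B1 ((2 + \<theta>) / q))" if "x \<le> 1" for x
    using B1[of x] that by (cases "x \<le> -1") (auto simp: le_max_iff_disj)
  then show ?thesis using that[of "max 0 (max B1 ((2 + \<theta>) / q))"] by auto
qed

context small_time
begin

text \<open>The kernel may be unbounded on the right, where the limit measure turns out to have no
  mass. It is therefore frozen from 1 on at its value at 1, and the error made before the limit is
  absorbed by the exponential tails.\<close>

theorem levy_khintchine:
  obtains m :: "real measure" where "finite_measure m" "sets m = sets borel" "emeasure m {0<..} = 0"
    "\<And>\<theta>. 0 \<le> \<theta> \<Longrightarrow> integrable m (lk_kernel \<theta>) \<and> \<psi> \<theta> = \<theta> * \<psi> 1 + (\<integral>x. lk_kernel \<theta> x \<partial>m)"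
proof -
  obtain s m where s: "strict_mono s" and m: "finite_measure m" and sets: "sets m = sets borel"
    and lim: "\<And>f B. (\<And>x. isCont f x) \<Longrightarrow> (\<And>x. \<bar>f x\<bar> \<le> B) \<Longrightarrow>
       (\<lambda>k. r (s k) * (\<integral>x. (exp x - 1)\<^sup>2 * f x \<partial>\<mu> (s k))) \<longlonglongrightarrow> (\<integral>x. f x \<partial>m)"
    using weak_limit by blast
  interpret m: finite_measure m by (rule m)
  have [measurable_cong]: "sets m = sets borel" by (rule sets)
  have null: "emeasure m {e<..} = 0" if e: "0 < e" for e
  proof -
    \<comment> \<open>A continuous ramp, 0 up to \<open>e / 2\<close> and 1 from \<open>e\<close>
      on; it separates the indicators of the two half-lines.\<close>
    define g where "g x = max 0 (min 1 (2 * x / e - 1))" for x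
    have gc: "isCont g x" for x unfolding g_def using e by (intro continuous_intros) auto
    have gb: "\<bar>g x\<bar> \<le> 1" "0 \<le> g x" for x by (auto simp: g_def)
    have gm [measurable]: "g \<in> borel_measurable borel" unfolding g_def by measurable
    have gi: "integrable m g" by (rule m.integrable_const_bound[where B=1]) (use gb in auto)
    have le: "(\<integral>x. (exp x - 1)\<^sup>2 * g x \<partial>\<mu> n) \<le> (\<integral>x. exp (2 * x) * indicator {e/2<..} x \<partial>\<mu> n)" for n
    proof (rule integral_mono)
      show "integrable (\<mu> n) (\<lambda>x. (exp x - 1)\<^sup>2 * g x)"
        by (rule Bochner_Integration.integrable_bound[OF sq_int]) (use gb in \<open>auto simp: abs_mult mult_left_le\<close>)
      show "integrable (\<mu> n) (\<lambda>x. exp (2 * x) * indicator {e/2<..} x)" by (rule exp_tail_int) simp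
      fix x
      show "(exp x - 1)\<^sup>2 * g x \<le> exp (2 * x) * indicator {e/2<..} x"
      proof (cases "e/2 < x")
        case True
        then have x: "0 < x" using e by linarith
        have "(exp x - 1)\<^sup>2 * g x \<le> (exp x - 1)\<^sup>2 * 1" using gb[of x] by (intro mult_left_mono) auto
        also have "\<dots> \<le> (exp x)\<^sup>2 * 1" using x by (intro mult_right_mono power_mono) auto
        also have "\<dots> = exp (2 * x)" by (simp add: exp_double)
        finally show ?thesis using True by simp
      next
        case False
        then have "2 * x / e - 1 \<le> 0" using e by (simp add: field_simps)
        then show ?thesis using False by (simp add: g_def)
      qed
    qed
    have l0: "(\<lambda>k. r (s k) * (\<integral>x. exp (2 * x) * indicator {e/2<..} x \<partial>\<mu> (s k))) \<longlonglongrightarrow> 0"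
      using LIMSEQ_subseq_LIMSEQ[OF exp_tail[of 2 "e/2"] s] e by (simp add: o_def)
    have "(\<integral>x. g x \<partial>m) \<le> 0"
      by (rule LIMSEQ_le[OF lim[of g 1] l0]) (use gc gb le in \<open>auto intro!: mult_left_mono\<close>)
    have "measure m {e<..} = (\<integral>x. indicator {e<..} x \<partial>m)" by (simp add: sets_eq_imp_space_eq[OF sets])
    also have "\<dots> \<le> (\<integral>x. g x \<partial>m)"
    proof (rule integral_mono[OF _ gi])
      show "integrable m (indicator {e<..} :: real \<Rightarrow> real)" by (rule m.integrable_const_bound[where B=1]) (auto split: split_indicator)
      show "indicator {e<..} x \<le> g x" for x
        using e gb[of x] by (auto simp: g_def field_simps split: split_indicator)
    qed
    also have "\<dots> \<le> 0" by fact
    finally have "measure m {e<..} = 0" using measure_nonneg[of m "{e<..}"] by linarith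
    then show ?thesis by (simp add: m.emeasure_eq_measure)
  qed
  have pos_null: "emeasure m {0<..} = 0"
  proof -
    have "{0<..} = (\<Union>q. {1 / real (Suc q)<..})"
    proof (intro set_eqI iffI)
      fix x :: real assume "x \<in> {0<..}"
      then obtain q where "1 / real (Suc q) < x" using nat_approx_posE[of x] by auto
      then show "x \<in> (\<Union>q. {1 / real (Suc q)<..})" by blast
    next
      fix x :: real assume "x \<in> (\<Union>q. {1 / real (Suc q)<..})"
      then obtain q where "1 / real (Suc q) < x" by blast
      moreover have "0 < 1 / real (Suc q)" by simp
      ultimately show "x \<in> {0<..}" unfolding greaterThan_iff by linarith
    qed
    moreover have "(\<Union>q. {1 / real (Suc q)<..}) \<in> null_sets m"
      using null by (intro null_sets_UN) (auto simp: null_sets_def sets)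
    ultimately show ?thesis by (simp add: null_sets_def)
  qed
  have AE: "AE x in m. x \<le> 0"
  proof (rule AE_I[OF _ pos_null])
    show "{x \<in> space m. \<not> x \<le> 0} \<subseteq> {0<..}" by auto
  qed (simp add: sets)
  have "integrable m (lk_kernel \<theta>) \<and> \<psi> \<theta> = \<theta> * \<psi> 1 + (\<integral>x. lk_kernel \<theta> x \<partial>m)" if \<theta>: "0 \<le> \<theta>" for \<theta>
  proof
    obtain B where B: "0 \<le> B" "\<And>x. x \<le> 1 \<Longrightarrow> \<bar>lk_kernel \<theta> x\<bar> \<le> B" using lk_kernel_bounded[OF \<theta>] by blast
    define h where "h x = lk_kernel \<theta> (min x 1)" for x
    have hc: "isCont h x" for x
      unfolding h_def by (rule isCont_o2[OF _ isCont_lk_kernel]) (intro continuous_intros)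
    have hb: "\<bar>h x\<bar> \<le> B" for x unfolding h_def by (rule B(2)) simp
    have km [measurable]: "lk_kernel \<theta> \<in> borel_measurable borel"
      by (intro borel_measurable_continuous_onI continuous_at_imp_continuous_on) (use isCont_lk_kernel in auto)
    have hm [measurable]: "h \<in> borel_measurable borel" unfolding h_def by measurable
    have hi: "integrable m h" by (rule m.integrable_const_bound[where B=B]) (use hb in auto)
    have eqAE: "AE x in m. h x = lk_kernel \<theta> x" using AE by eventually_elim (simp add: h_def)
    show "integrable m (lk_kernel \<theta>)" using hi by (rule integrable_cong_AE_imp) (use eqAE in \<open>auto simp: eq_commute\<close>)
    have inth: "(\<integral>x. h x \<partial>m) = (\<integral>x. lk_kernel \<theta> x \<partial>m)" by (rule integral_cong_AE) (use eqAE in auto)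
    \<comment> \<open>Collects the bounds of the integrands for \<open>x > 1\<close>: the first
      three summands dominate the term with \<open>lk_kernel\<close>, the last one the term with
      \<open>h\<close>.\<close>
    define t where "t n = r n * (\<integral>x. exp (\<theta> * x) * indicator {1<..} x \<partial>\<mu> n) + (1 + \<theta>) * (r n * (\<integral>x. exp (0 * x) * indicator {1<..} x \<partial>\<mu> n))
       + \<theta> * (r n * (\<integral>x. exp (1 * x) * indicator {1<..} x \<partial>\<mu> n)) + B * (r n * (\<integral>x. exp (2 * x) * indicator {1<..} x \<partial>\<mu> n))" for n
    have "t \<longlonglongrightarrow> 0 + (1 + \<theta>) * 0 + \<theta> * 0 + B * 0"
      unfolding t_def[abs_def] using \<theta> by (intro tendsto_intros exp_tail) auto
    then have tlim: "t \<longlonglongrightarrow> 0" by simp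
    have close: "\<bar>(A n \<theta> - \<theta> * A n 1) - r n * (\<integral>x. (exp x - 1)\<^sup>2 * h x \<partial>\<mu> n)\<bar> \<le> t n" for n
    proof -
      have i1: "integrable (\<mu> n) (\<lambda>x. (exp x - 1)\<^sup>2 * lk_kernel \<theta> x)"
        unfolding lk_kernel_mult using \<theta> int[of \<theta> n] int[of 1 n] by auto
      have v1: "r n * (\<integral>x. (exp x - 1)\<^sup>2 * lk_kernel \<theta> x \<partial>\<mu> n) = A n \<theta> - \<theta> * A n 1"
      proof -
        have "(\<integral>x. (exp x - 1)\<^sup>2 * lk_kernel \<theta> x \<partial>\<mu> n) = exp (\<psi> \<theta> / r n) - 1 - \<theta> * (exp (\<psi> 1 / r n) - 1)"
          unfolding lk_kernel_mult using \<theta> int[of \<theta> n] int[of 1 n] val[of \<theta> n] val[of 1 n] prob_one[of n] by simp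
        then show ?thesis by (simp only: A_def) (simp add: algebra_simps)
      qed
      have i2: "integrable (\<mu> n) (\<lambda>x. (exp x - 1)\<^sup>2 * h x)"
      proof (rule Bochner_Integration.integrable_bound[of _ "\<lambda>x. (exp x - 1)\<^sup>2 * B"])
        show "integrable (\<mu> n) (\<lambda>x. (exp x - 1)\<^sup>2 * B)" using sq_int[of n] by simp
        show "AE x in \<mu> n. norm ((exp x - 1)\<^sup>2 * h x) \<le> norm ((exp x - 1)\<^sup>2 * B)"
          using hb B(1) by (intro AE_I2) (auto simp: abs_mult intro!: mult_left_mono)
      qed measurable
      let ?I = "\<lambda>x. indicator {1<..} x :: real"
      have it: "integrable (\<mu> n) (\<lambda>x. exp (k * x) * ?I x)" if "0 \<le> k" for k by (rule exp_tail_int[OF that])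
      have ib: "integrable (\<mu> n) (\<lambda>x. exp (\<theta> * x) * ?I x + (1 + \<theta>) * (exp (0 * x) * ?I x) + \<theta> * (exp (1 * x) * ?I x) + B * (exp (2 * x) * ?I x))"
        using \<theta> by (intro Bochner_Integration.integrable_add integrable_mult_right it) auto
      have "(A n \<theta> - \<theta> * A n 1) - r n * (\<integral>x. (exp x - 1)\<^sup>2 * h x \<partial>\<mu> n)
         = r n * (\<integral>x. (exp x - 1)\<^sup>2 * lk_kernel \<theta> x - (exp x - 1)\<^sup>2 * h x \<partial>\<mu> n)"
        using i1 i2 unfolding v1[symmetric] by (simp add: right_diff_distrib)
      also have "\<bar>\<dots>\<bar> = r n * \<bar>\<integral>x. (exp x - 1)\<^sup>2 * lk_kernel \<theta> x - (exp x - 1)\<^sup>2 * h x \<partial>\<mu> n\<bar>" by (simp add: abs_mult)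
      also have "\<dots> \<le> r n * (\<integral>x. exp (\<theta> * x) * ?I x + (1 + \<theta>) * (exp (0 * x) * ?I x) + \<theta> * (exp (1 * x) * ?I x) + B * (exp (2 * x) * ?I x) \<partial>\<mu> n)"
      proof (intro mult_left_mono)
        show "\<bar>\<integral>x. (exp x - 1)\<^sup>2 * lk_kernel \<theta> x - (exp x - 1)\<^sup>2 * h x \<partial>\<mu> n\<bar> \<le>
          (\<integral>x. exp (\<theta> * x) * ?I x + (1 + \<theta>) * (exp (0 * x) * ?I x) + \<theta> * (exp (1 * x) * ?I x) + B * (exp (2 * x) * ?I x) \<partial>\<mu> n)"
          unfolding real_norm_def[symmetric]
        proof (rule Bochner_Integration.integral_norm_bound_integral[OF Bochner_Integration.integrable_diff[OF i1 i2] ib])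
          fix x
          show "norm ((exp x - 1)\<^sup>2 * lk_kernel \<theta> x - (exp x - 1)\<^sup>2 * h x)
            \<le> exp (\<theta> * x) * ?I x + (1 + \<theta>) * (exp (0 * x) * ?I x) + \<theta> * (exp (1 * x) * ?I x) + B * (exp (2 * x) * ?I x)"
          proof (cases "1 < x")
            case True
            have "\<bar>(exp x - 1)\<^sup>2 * h x\<bar> \<le> (exp x)\<^sup>2 * B"
              unfolding abs_mult using True hb by (intro mult_mono) (auto intro!: power_mono)
            moreover have "(exp x)\<^sup>2 * B = B * exp (2 * x)" by (simp add: exp_double)
            moreover have "\<bar>(exp x - 1)\<^sup>2 * lk_kernel \<theta> x\<bar> \<le> exp (\<theta> * x) + (1 + \<theta>) + \<theta> * exp x"
            proof -
              have "0 \<le> \<theta> * exp x" using \<theta> by simp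
              then show ?thesis unfolding lk_kernel_mult using \<theta> exp_gt_zero[of "\<theta> * x"] by (simp add: algebra_simps abs_le_iff)
            qed
            ultimately show ?thesis using True by simp
          qed (simp add: h_def min_def)
        qed
      qed simp
      also have "\<dots> = t n" unfolding t_def using \<theta> it[of \<theta>] it[of 0] it[of 1] it[of 2] by (simp add: algebra_simps)
      finally show ?thesis .
    qed
    have "(\<lambda>k. (A (s k) \<theta> - \<theta> * A (s k) 1) - r (s k) * (\<integral>x. (exp x - 1)\<^sup>2 * h x \<partial>\<mu> (s k))) \<longlonglongrightarrow> 0"
    proof (rule Lim_null_comparison)
      show "(\<lambda>k. t (s k)) \<longlonglongrightarrow> 0" using LIMSEQ_subseq_LIMSEQ[OF tlim s] by (simp add: o_def)
    qed (use close in auto)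
    moreover have "(\<lambda>k. (A (s k) \<theta> - \<theta> * A (s k) 1) - r (s k) * (\<integral>x. (exp x - 1)\<^sup>2 * h x \<partial>\<mu> (s k))) \<longlonglongrightarrow>
       (\<psi> \<theta> - \<theta> * \<psi> 1) - (\<integral>x. h x \<partial>m)"
      using LIMSEQ_subseq_LIMSEQ[OF A_lim s] hc hb
      by (intro tendsto_diff tendsto_mult tendsto_const lim[of h B]) (auto simp: o_def)
    ultimately have "(\<psi> \<theta> - \<theta> * \<psi> 1) - (\<integral>x. h x \<partial>m) = 0" by (rule LIMSEQ_unique[rotated])
    then show "\<psi> \<theta> = \<theta> * \<psi> 1 + (\<integral>x. lk_kernel \<theta> x \<partial>m)" by (simp add: inth)
  qed
  then show ?thesis using that[of m] m sets pos_null by blast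
qed

end

section \<open>Bernstein functions\<close>

lemma exp_convex_bound:
  fixes x t :: real assumes "0 \<le> t" "t \<le> 1" shows "exp (t * x) \<le> 1 + t * (exp x - 1)"
proof -
  have "exp ((1 - t) *\<^sub>R 0 + t *\<^sub>R x) \<le> (1 - t) * exp 0 + t * exp x"
    using assms by (intro convex_onD[OF exp_convex]) auto
  then show ?thesis by (simp add: algebra_simps)
qed

lemma one_minus_exp_bound:
  assumes "0 < \<theta>" "0 \<le> s" shows "1 - exp (- \<theta> * s) \<le> max 1 \<theta> * (1 - exp (- s :: real))"
proof (cases "\<theta> \<le> 1")
  case True
  then have "\<theta> * s \<le> 1 * s" using assms by (intro mult_right_mono) auto
  then show ?thesis using True by simp
next
  case False
  then have "exp ((1 / \<theta>) * (- \<theta> * s)) \<le> 1 + (1 / \<theta>) * (exp (- \<theta> * s) - 1)" by (intro exp_convex_bound) auto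
  then have "\<theta> * exp (- s) \<le> \<theta> + (exp (- \<theta> * s) - 1)" using False by (simp add: field_simps)
  then show ?thesis using False by (simp add: max_def algebra_simps)
qed

lemma min_le_one_minus_exp:
  assumes "0 \<le> s" shows "(1 - exp (- 1)) * min 1 s \<le> 1 - exp (- s :: real)"
proof (cases "1 \<le> s")
  case False
  then show ?thesis using exp_convex_bound[of s "-1"] assms by (simp add: algebra_simps)
qed (use assms in simp)

locale lk_triplet = finite_measure m for m :: "real measure" +
  fixes \<psi> :: "real \<Rightarrow> real"
  assumes sets_m [measurable_cong]: "sets m = sets borel"
    and null_pos: "emeasure m {0<..} = 0"
    and lk: "0 \<le> \<theta> \<Longrightarrow> integrable m (lk_kernel \<theta>)" "0 \<le> \<theta> \<Longrightarrow> \<psi> \<theta> = \<theta> * \<psi> 1 + (\<integral>x. lk_kernel \<theta> x \<partial>m)"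
    and \<psi>_pos: "0 < \<theta> \<Longrightarrow> 0 < \<psi> \<theta>"
begin

text \<open>Undoes the normalisation: away from 0, \<open>k\<close> is the density of the Levy
  measure with respect to \<open>m\<close>. At 0 the convention \<open>1 / 0 = 0\<close> gives
  0.\<close>

definition k :: "real \<Rightarrow> real" where "k x = 1 / (exp x - 1)\<^sup>2"

definition tail :: "real \<Rightarrow> ennreal" where
  "tail s = (\<integral>\<^sup>+x. indicator {..- s} x * ennreal (k x) \<partial>m)"

text \<open>The density of \<open>\<Upsilon>\<close> at \<open>s\<close> is the mass that the Levy measure of the process puts on \<open>(-\<infinity>, -s]\<close>.\<close>

definition \<Upsilon> :: "real measure" where
  "\<Upsilon> = density (restrict_space lborel {0<..}) tail"

lemma k_measurable [measurable]: "k \<in> borel_measurable borel" unfolding k_def by measurable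

lemma k_nonneg: "0 \<le> k x" by (simp add: k_def)

lemma joint_measurable: "(\<lambda>(s, x). f s * (indicator {..- s} x * ennreal (k x))) \<in> borel_measurable (lborel \<Otimes>\<^sub>M m)"
  if [measurable]: "f \<in> borel_measurable borel" for f :: "real \<Rightarrow> ennreal"
proof -
  have "(\<lambda>(s, x). f s * (indicator {..- s} x * ennreal (k x))) =
    (\<lambda>p. f (fst p) * ((if snd p \<le> - fst p then 1 else 0) * ennreal (k (snd p))))"
    by (auto simp: fun_eq_iff split: split_indicator)
  then show ?thesis by simp
qed

lemma tail_measurable [measurable]: "tail \<in> borel_measurable borel"
proof -
  have "(\<lambda>s. \<integral>\<^sup>+x. 1 * (indicator {..- s} x * ennreal (k x)) \<partial>m) \<in> borel_measurable lborel"
    using joint_measurable[of "\<lambda>_. 1"] by (intro borel_measurable_nn_integral) simp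
  then show ?thesis by (simp add: tail_def[abs_def])
qed

lemma sets_\<Upsilon>: "sets \<Upsilon> = sets (restrict_space borel {0<..})"
  by (simp add: \<Upsilon>_def sets_restrict_space)

lemma space_\<Upsilon>: "space \<Upsilon> = {0<..}"
  by (simp add: \<Upsilon>_def space_restrict_space)

text \<open>By Fubini, integrating \<open>f\<close> against the tail of the Levy measure amounts to
  integrating the primitive of \<open>f\<close> against the Levy measure itself.\<close>

lemma nn_integral_\<Upsilon>:
  assumes [measurable]: "f \<in> borel_measurable borel"
  shows "(\<integral>\<^sup>+s. f s \<partial>\<Upsilon>) = (\<integral>\<^sup>+x. indicator {..<0} x * ennreal (k x) * (\<integral>\<^sup>+s. f s * indicator {0<..- x} s \<partial>lborel) \<partial>m)"
proof -
  interpret p: pair_sigma_finite lborel m ..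
  have "(\<integral>\<^sup>+s. f s \<partial>\<Upsilon>) = (\<integral>\<^sup>+s. tail s * f s * indicator {0<..} s \<partial>lborel)"
    unfolding \<Upsilon>_def
    by (subst nn_integral_density) (auto simp: nn_integral_restrict_space intro: measurable_restrict_space1)
  also have "\<dots> = (\<integral>\<^sup>+s. (\<integral>\<^sup>+x. (f s * indicator {0<..} s) * (indicator {..- s} x * ennreal (k x)) \<partial>m) \<partial>lborel)"
    unfolding tail_def by (intro nn_integral_cong) (simp add: nn_integral_cmult[symmetric] ac_simps)
  also have "\<dots> = (\<integral>\<^sup>+x. (\<integral>\<^sup>+s. (f s * indicator {0<..} s) * (indicator {..- s} x * ennreal (k x)) \<partial>lborel) \<partial>m)"
    by (rule p.Fubini'[symmetric]) (rule joint_measurable, measurable)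
  also have "\<dots> = (\<integral>\<^sup>+x. indicator {..<0} x * ennreal (k x) * (\<integral>\<^sup>+s. f s * indicator {0<..- x} s \<partial>lborel) \<partial>m)"
  proof (intro nn_integral_cong)
    fix x
    have "(\<integral>\<^sup>+s. (f s * indicator {0<..} s) * (indicator {..- s} x * ennreal (k x)) \<partial>lborel) =
      (\<integral>\<^sup>+s. (indicator {..<0} x * ennreal (k x)) * (f s * indicator {0<..- x} s) \<partial>lborel)"
      by (intro nn_integral_cong) (auto split: split_indicator simp: ac_simps)
    then show "(\<integral>\<^sup>+s. (f s * indicator {0<..} s) * (indicator {..- s} x * ennreal (k x)) \<partial>lborel) =
      indicator {..<0} x * ennreal (k x) * (\<integral>\<^sup>+s. f s * indicator {0<..- x} s \<partial>lborel)"
      by (simp add: nn_integral_cmult)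
  qed
  finally show ?thesis .
qed

lemma nn_integral_\<Upsilon>_FTC:
  assumes F: "\<And>s. 0 \<le> s \<Longrightarrow> (F has_real_derivative f s) (at s)" and f: "f \<in> borel_measurable borel"
    and f0: "\<And>s. 0 \<le> s \<Longrightarrow> 0 \<le> f s" "f 0 = 0"
  shows "(\<integral>\<^sup>+s. ennreal (f s) \<partial>\<Upsilon>) = (\<integral>\<^sup>+x. ennreal (indicator {..<0} x * (k x * (F (- x) - F 0))) \<partial>m)"
proof -
  note [measurable] = f
  have inner: "(\<integral>\<^sup>+s. ennreal (f s) * indicator {0<..y} s \<partial>lborel) = ennreal (F y - F 0)" if "0 \<le> y" for y
  proof -
    have "(\<integral>\<^sup>+s. ennreal (f s) * indicator {0<..y} s \<partial>lborel) = (\<integral>\<^sup>+s. ennreal (f s) * indicator {0..y} s \<partial>lborel)"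
      using f0(2) by (intro nn_integral_cong) (auto split: split_indicator simp: order_le_less)
    also have "\<dots> = ennreal (F y - F 0)"
      using that by (intro nn_integral_FTC_Icc) (auto intro: F f0)
    finally show ?thesis .
  qed
  have "(\<integral>\<^sup>+s. ennreal (f s) \<partial>\<Upsilon>) = (\<integral>\<^sup>+x. indicator {..<0} x * ennreal (k x) * (\<integral>\<^sup>+s. ennreal (f s) * indicator {0<..- x} s \<partial>lborel) \<partial>m)"
    by (rule nn_integral_\<Upsilon>) measurable
  also have "\<dots> = (\<integral>\<^sup>+x. ennreal (indicator {..<0} x * (k x * (F (- x) - F 0))) \<partial>m)"
    by (intro nn_integral_cong) (auto split: split_indicator simp: inner ennreal_mult' k_nonneg)
  finally show ?thesis .
qed

text \<open>The variance of the Gaussian part, since \<open>lk_kernel \<theta>\<close> takes the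
  value \<open>(\<theta>\<^sup>2 - \<theta>) / 2\<close> at 0.\<close>

definition m0 :: real where "m0 = measure m {0}"

lemma lk_negative:
  assumes "0 \<le> \<theta>"
  shows "has_bochner_integral m (\<lambda>x. indicator {..<0} x * lk_kernel \<theta> x) (\<psi> \<theta> - \<theta> * \<psi> 1 - m0 * ((\<theta>\<^sup>2 - \<theta>) / 2))"
proof -
  have km [measurable]: "lk_kernel \<theta> \<in> borel_measurable borel"
    by (intro borel_measurable_continuous_onI continuous_at_imp_continuous_on) (use isCont_lk_kernel in auto)
  have AE: "AE x in m. x \<le> 0"
  proof (rule AE_I[OF _ null_pos])
    show "{x \<in> space m. \<not> x \<le> 0} \<subseteq> {0<..}" by auto
  qed (simp add: sets_m)
  have "has_bochner_integral m (\<lambda>x. lk_kernel \<theta> x - indicator {0} x * ((\<theta>\<^sup>2 - \<theta>) / 2)) ((\<psi> \<theta> - \<theta> * \<psi> 1) - m0 * ((\<theta>\<^sup>2 - \<theta>) / 2))"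
  proof (intro has_bochner_integral_diff has_bochner_integral_mult_left)
    show "has_bochner_integral m (lk_kernel \<theta>) (\<psi> \<theta> - \<theta> * \<psi> 1)"
      using lk[OF assms] by (auto simp: has_bochner_integral_iff)
    show "has_bochner_integral m (indicator {0}) m0"
      unfolding m0_def by (intro has_bochner_integral_real_indicator) (auto simp: sets_m less_top[symmetric])
  qed
  then show ?thesis
  proof (rule has_bochner_integral_cong_AE[THEN iffD1, rotated 3])
    show "AE x in m. lk_kernel \<theta> x - indicator {0} x * ((\<theta>\<^sup>2 - \<theta>) / 2) = indicator {..<0} x * lk_kernel \<theta> x"
      using AE by eventually_elim (auto simp: lk_kernel_def split: split_indicator)
  qed auto
qed

text \<open>The integral equals \<open>\<psi> 1 + m0 * (\<theta> - 1) / 2 - \<psi> \<theta> /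
  \<theta>\<close>, and the last term is dropped thanks to \<open>\<psi> \<theta> > 0\<close>.
  Without this sign the tail of the Levy measure need not be integrable at infinity.\<close>

lemma small_\<theta>:
  assumes \<theta>: "0 < \<theta>" "\<theta> < 1"
  shows "(\<integral>\<^sup>+s. ennreal (exp (- \<theta> * s) - exp (- s)) \<partial>\<Upsilon>) \<le> ennreal (\<psi> 1 + m0 * (\<theta> - 1) / 2)" "0 \<le> \<psi> 1 + m0 * (\<theta> - 1) / 2"
proof -
  define F where "F s = (1 - exp (- \<theta> * s)) / \<theta> - (1 - exp (- s))" for s
  have nn: "0 \<le> exp (- \<theta> * s) - exp (- s)" if "0 \<le> s" for s
    using mult_right_mono[of \<theta> 1 s] \<theta> that by simp
  have dF: "(F has_real_derivative exp (- \<theta> * s) - exp (- s)) (at s)" for s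
    unfolding F_def using \<theta> by (auto intro!: derivative_eq_intros)
  have "(\<integral>\<^sup>+s. ennreal (exp (- \<theta> * s) - exp (- s)) \<partial>\<Upsilon>) = (\<integral>\<^sup>+x. ennreal (indicator {..<0} x * (k x * (F (- x) - F 0))) \<partial>m)"
    by (rule nn_integral_\<Upsilon>_FTC) (use nn dF in auto)
  also have "(\<lambda>x. indicator {..<0} x * (k x * (F (- x) - F 0))) = (\<lambda>x. - (indicator {..<0} x * lk_kernel \<theta> x / \<theta>))"
    using \<theta> by (auto simp: fun_eq_iff F_def k_def lk_kernel_def divide_simps algebra_simps split: split_indicator)
  also have "(\<integral>\<^sup>+x. ennreal (- (indicator {..<0} x * lk_kernel \<theta> x / \<theta>)) \<partial>m) = ennreal (- ((\<psi> \<theta> - \<theta> * \<psi> 1 - m0 * ((\<theta>\<^sup>2 - \<theta>) / 2)) / \<theta>))"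
  proof -
    have hb: "has_bochner_integral m (\<lambda>x. - (indicator {..<0} x * lk_kernel \<theta> x / \<theta>)) (- ((\<psi> \<theta> - \<theta> * \<psi> 1 - m0 * ((\<theta>\<^sup>2 - \<theta>) / 2)) / \<theta>))"
      using \<theta> by (intro has_bochner_integral_minus has_bochner_integral_divide lk_negative) auto
    have "0 \<le> - (indicator {..<0} x * lk_kernel \<theta> x / \<theta>)" for x
    proof (cases "x < 0")
      case True
      have "exp (\<theta> * x) - 1 - \<theta> * (exp x - 1) \<le> 0" using exp_convex_bound[of \<theta> x] \<theta> by linarith
      then show ?thesis using True \<theta> by (simp add: lk_kernel_def divide_nonpos_nonneg divide_le_0_iff)
    qed simp
    then show ?thesis
      using nn_integral_eq_integral[of m "\<lambda>x. - (indicator {..<0} x * lk_kernel \<theta> x / \<theta>)"] has_bochner_integral_integrable[of m]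
        hb[unfolded has_bochner_integral_iff, THEN conjunct1]
      unfolding has_bochner_integral_integral_eq[OF hb] by blast
  qed
  also have e: "- ((\<psi> \<theta> - \<theta> * \<psi> 1 - m0 * ((\<theta>\<^sup>2 - \<theta>) / 2)) / \<theta>) = \<psi> 1 + m0 * (\<theta> - 1) / 2 - \<psi> \<theta> / \<theta>"
    using \<theta> by (simp add: field_simps power2_eq_square)
  finally have v: "(\<integral>\<^sup>+s. ennreal (exp (- \<theta> * s) - exp (- s)) \<partial>\<Upsilon>) = ennreal (\<psi> 1 + m0 * (\<theta> - 1) / 2 - \<psi> \<theta> / \<theta>)" .
  have p: "0 < \<psi> \<theta> / \<theta>" using \<psi>_pos[of \<theta>] \<theta> by simp
  then show "(\<integral>\<^sup>+s. ennreal (exp (- \<theta> * s) - exp (- s)) \<partial>\<Upsilon>) \<le> ennreal (\<psi> 1 + m0 * (\<theta> - 1) / 2)"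
    unfolding v by (intro ennreal_leI) (use p in linarith)
  have "(\<integral>x. indicator {..<0} x * lk_kernel \<theta> x \<partial>m) \<le> (\<integral>x. 0 \<partial>m)"
  proof (rule integral_mono)
    fix x
    show "indicator {..<0} x * lk_kernel \<theta> x \<le> 0"
    proof (cases "x < 0")
      case True
      have "exp (\<theta> * x) - 1 - \<theta> * (exp x - 1) \<le> 0" using exp_convex_bound[of \<theta> x] \<theta> by linarith
      then show ?thesis using True by (simp add: lk_kernel_def divide_le_0_iff)
    qed simp
  qed (use lk_negative[of \<theta>] \<theta> in \<open>auto simp: has_bochner_integral_iff\<close>)
  then have "\<psi> \<theta> - \<theta> * \<psi> 1 - m0 * ((\<theta>\<^sup>2 - \<theta>) / 2) \<le> 0"
    using lk_negative[of \<theta>] \<theta> by (simp add: has_bochner_integral_iff)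
  then have "0 \<le> - ((\<psi> \<theta> - \<theta> * \<psi> 1 - m0 * ((\<theta>\<^sup>2 - \<theta>) / 2)) / \<theta>)" using \<theta> by (simp add: divide_le_0_iff)
  then show "0 \<le> \<psi> 1 + m0 * (\<theta> - 1) / 2" using p unfolding e by linarith
qed

lemma borel_\<Upsilon>: "f \<in> borel_measurable borel \<Longrightarrow> f \<in> borel_measurable \<Upsilon>"
  unfolding measurable_cong_sets[OF sets_\<Upsilon> refl] by (rule measurable_restrict_space1)

text \<open>Fatou's lemma for \<theta> decreasing to 0. The slack in the resulting bound is the
  later constant \<kappa>.\<close>

lemma finite_\<Upsilon>: "(\<integral>\<^sup>+s. ennreal (1 - exp (- s)) \<partial>\<Upsilon>) \<le> ennreal (\<psi> 1 - m0 / 2)" "0 \<le> \<psi> 1 - m0 / 2"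
proof -
  define \<theta> where "\<theta> n = 1 / real (Suc (Suc n))" for n
  have \<theta>: "0 < \<theta> n" "\<theta> n < 1" for n by (auto simp: \<theta>_def)
  have \<theta>lim: "\<theta> \<longlonglongrightarrow> 0" unfolding \<theta>_def[abs_def] by (intro LIMSEQ_Suc lim_1_over_n)
  have "(\<lambda>n. \<psi> 1 + m0 * (\<theta> n - 1) / 2) \<longlonglongrightarrow> \<psi> 1 + m0 * (0 - 1) / 2"
    by (intro tendsto_intros \<theta>lim) auto
  then have lim: "(\<lambda>n. \<psi> 1 + m0 * (\<theta> n - 1) / 2) \<longlonglongrightarrow> \<psi> 1 - m0 / 2" by simp
  show "0 \<le> \<psi> 1 - m0 / 2" using lim small_\<theta>(2)[OF \<theta>] by (intro LIMSEQ_le_const) auto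
  have "(\<integral>\<^sup>+s. ennreal (1 - exp (- s)) \<partial>\<Upsilon>) = (\<integral>\<^sup>+s. liminf (\<lambda>n. ennreal (exp (- \<theta> n * s) - exp (- s))) \<partial>\<Upsilon>)"
  proof (intro nn_integral_cong lim_imp_Liminf[symmetric] tendsto_ennrealI)
    fix s
    have "(\<lambda>n. exp (- \<theta> n * s) - exp (- s)) \<longlonglongrightarrow> exp (- 0 * s) - exp (- s)"
      by (intro tendsto_intros \<theta>lim)
    then show "(\<lambda>n. exp (- \<theta> n * s) - exp (- s)) \<longlonglongrightarrow> 1 - exp (- s)" by simp
  qed simp
  also have "\<dots> \<le> liminf (\<lambda>n. \<integral>\<^sup>+s. ennreal (exp (- \<theta> n * s) - exp (- s)) \<partial>\<Upsilon>)"
    by (intro nn_integral_liminf borel_\<Upsilon>) measurable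
  also have "\<dots> \<le> liminf (\<lambda>n. ennreal (\<psi> 1 + m0 * (\<theta> n - 1) / 2))"
    by (intro Liminf_mono always_eventually allI small_\<theta> \<theta>)
  also have "\<dots> = ennreal (\<psi> 1 - m0 / 2)"
    by (intro lim_imp_Liminf tendsto_ennrealI lim) simp
  finally show "(\<integral>\<^sup>+s. ennreal (1 - exp (- s)) \<partial>\<Upsilon>) \<le> ennreal (\<psi> 1 - m0 / 2)" .
qed

lemma \<Upsilon>_integrable:
  assumes \<theta>: "0 < \<theta>" shows "integrable \<Upsilon> (\<lambda>s. 1 - exp (- \<theta> * s))"
proof -
  have 1: "integrable \<Upsilon> (\<lambda>s. 1 - exp (- s))"
  proof (rule integrableI_nonneg)
    show "AE s in \<Upsilon>. 0 \<le> 1 - exp (- s)" by (intro AE_I2) (simp add: space_\<Upsilon>)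
    show "(\<integral>\<^sup>+s. ennreal (1 - exp (- s)) \<partial>\<Upsilon>) < \<infinity>" using finite_\<Upsilon>(1) by (rule order_le_less_trans) simp
  qed (intro borel_\<Upsilon>, measurable)
  show ?thesis
  proof (rule Bochner_Integration.integrable_bound[OF integrable_mult_right[OF 1, of "max 1 \<theta>"]])
    show "AE s in \<Upsilon>. norm (1 - exp (- \<theta> * s)) \<le> norm (max 1 \<theta> * (1 - exp (- s)))"
    proof (intro AE_I2)
      fix s assume "s \<in> space \<Upsilon>"
      then have s: "0 \<le> s" by (simp add: space_\<Upsilon>)
      have "0 \<le> 1 - exp (- \<theta> * s)" using s \<theta> by simp
      then show "norm (1 - exp (- \<theta> * s)) \<le> norm (max 1 \<theta> * (1 - exp (- s)))"
        using one_minus_exp_bound[OF \<theta> s] by simp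
    qed
  qed (intro borel_\<Upsilon>, measurable)
qed

text \<open>A single \<theta> pairs \<open>k\<close> with the uncompensated primitive of
  \<open>1 - exp (- \<theta> * s)\<close>; subtracting the case \<theta> = 1 cancels the term
  \<open>- x\<close> and leaves the kernel divided by \<theta>.\<close>

lemma \<Upsilon>_value:
  assumes \<theta>: "0 < \<theta>"
  shows "has_bochner_integral m (\<lambda>x. indicator {..<0} x * (k x * (- x - (1 - exp (\<theta> * x)) / \<theta>))) (\<integral>s. 1 - exp (- \<theta> * s) \<partial>\<Upsilon>)"
proof -
  define F where "F s = s - (1 - exp (- \<theta> * s)) / \<theta>" for s
  have dF: "(F has_real_derivative 1 - exp (- \<theta> * s)) (at s)" for s
    unfolding F_def using \<theta> by (auto intro!: derivative_eq_intros)
  have nn: "0 \<le> 1 - exp (- \<theta> * s)" if "0 \<le> s" for s using that \<theta> by simp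
  have "(\<integral>\<^sup>+s. ennreal (1 - exp (- \<theta> * s)) \<partial>\<Upsilon>) = (\<integral>\<^sup>+x. ennreal (indicator {..<0} x * (k x * (F (- x) - F 0))) \<partial>m)"
    by (rule nn_integral_\<Upsilon>_FTC) (use nn dF in auto)
  moreover have "(\<integral>\<^sup>+s. ennreal (1 - exp (- \<theta> * s)) \<partial>\<Upsilon>) = ennreal (\<integral>s. 1 - exp (- \<theta> * s) \<partial>\<Upsilon>)"
    using nn by (intro nn_integral_eq_integral \<Upsilon>_integrable \<theta> AE_I2) (simp add: space_\<Upsilon>)
  ultimately have v: "(\<integral>\<^sup>+x. ennreal (indicator {..<0} x * (k x * (F (- x) - F 0))) \<partial>m) = ennreal (\<integral>s. 1 - exp (- \<theta> * s) \<partial>\<Upsilon>)" by simp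
  have pos: "0 \<le> indicator {..<0} x * (k x * (F (- x) - F 0))" for x
  proof -
    have "0 \<le> F (- x) - F 0" if "x < 0"
    proof -
      have "1 + \<theta> * x \<le> exp (\<theta> * x)" by (rule exp_ge_add_one_self)
      then show ?thesis using \<theta> by (simp add: F_def field_simps)
    qed
    then show ?thesis by (auto split: split_indicator intro!: mult_nonneg_nonneg k_nonneg)
  qed
  have "0 \<le> (\<integral>s. 1 - exp (- \<theta> * s) \<partial>\<Upsilon>)"
    using nn by (intro integral_nonneg_AE AE_I2) (simp add: space_\<Upsilon>)
  then have "has_bochner_integral m (\<lambda>x. indicator {..<0} x * (k x * (F (- x) - F 0))) (\<integral>s. 1 - exp (- \<theta> * s) \<partial>\<Upsilon>)"
    by (intro has_bochner_integral_nn_integral[OF _ _ _ v] AE_I2 pos) (auto simp: F_def)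
  then show ?thesis by (simp add: F_def)
qed

text \<open>\<kappa> is forced by the value at \<theta> = 1 and is nonnegative by
  \<open>finite_\<Upsilon>\<close>. The other values follow from the difference to \<theta> = 1,
  where the Levy--Khintchine kernel reappears.\<close>

theorem bernstein:
  obtains \<kappa> d \<phi> where "bernstein_representation \<kappa> d \<Upsilon> \<phi>" "\<And>\<theta>. 0 < \<theta> \<Longrightarrow> \<phi> \<theta> = \<psi> \<theta> / \<theta>"
proof -
  define J where "J \<theta> = (\<integral>s. 1 - exp (- \<theta> * s) \<partial>\<Upsilon>)" for \<theta>
  define \<kappa> where "\<kappa> = \<psi> 1 - m0 / 2 - J 1"
  define \<phi> where "\<phi> \<theta> = \<kappa> + m0 / 2 * \<theta> + J \<theta>" for \<theta>
  have "ennreal (J 1) = (\<integral>\<^sup>+s. ennreal (1 - exp (- s)) \<partial>\<Upsilon>)"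
    unfolding J_def using \<Upsilon>_integrable[of 1] by (subst nn_integral_eq_integral[symmetric]) (auto intro!: AE_I2 simp: space_\<Upsilon>)
  then have "ennreal (J 1) \<le> ennreal (\<psi> 1 - m0 / 2)" using finite_\<Upsilon>(1) by simp
  then have \<kappa>: "0 \<le> \<kappa>" using finite_\<Upsilon>(2) by (simp add: \<kappa>_def)
  have "bernstein_representation \<kappa> (m0 / 2) \<Upsilon> \<phi>"
    unfolding bernstein_representation_def
  proof (intro conjI allI impI)
    show "0 \<le> m0 / 2" by (simp add: m0_def)
    have q: "0 < 1 - exp (- 1 :: real)" by simp
    have "(\<integral>\<^sup>+x. ennreal (min 1 x) \<partial>\<Upsilon>) \<le> (\<integral>\<^sup>+x. ennreal (1 / (1 - exp (- 1))) * ennreal (1 - exp (- x)) \<partial>\<Upsilon>)"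
    proof (intro nn_integral_mono)
      fix x assume "x \<in> space \<Upsilon>"
      then have "0 \<le> x" by (simp add: space_\<Upsilon>)
      then have "min 1 x \<le> 1 / (1 - exp (- 1)) * (1 - exp (- x))"
        using min_le_one_minus_exp[of x] q by (simp add: field_simps)
      then show "ennreal (min 1 x) \<le> ennreal (1 / (1 - exp (- 1))) * ennreal (1 - exp (- x))"
        using q by (subst ennreal_mult'[symmetric]) (auto intro: ennreal_leI)
    qed
    also have "\<dots> = ennreal (1 / (1 - exp (- 1))) * (\<integral>\<^sup>+x. ennreal (1 - exp (- x)) \<partial>\<Upsilon>)"
      by (intro nn_integral_cmult borel_\<Upsilon>) measurable
    also have "\<dots> \<le> ennreal (1 / (1 - exp (- 1))) * ennreal (\<psi> 1 - m0 / 2)" by (intro mult_left_mono finite_\<Upsilon>) auto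
    also have "\<dots> < \<infinity>" by (simp add: ennreal_mult_less_top)
    finally show "(\<integral>\<^sup>+x. ennreal (min 1 x) \<partial>\<Upsilon>) < \<infinity>" .
  qed (use \<kappa> in \<open>auto simp: \<phi>_def J_def sets_\<Upsilon>\<close>)
  moreover have "\<phi> \<theta> = \<psi> \<theta> / \<theta>" if \<theta>: "0 < \<theta>" for \<theta>
  proof -
    have "has_bochner_integral m (\<lambda>x. indicator {..<0} x * (k x * (- x - (1 - exp (\<theta> * x)) / \<theta>)) -
      indicator {..<0} x * (k x * (- x - (1 - exp (1 * x)) / 1))) (J \<theta> - J 1)"
      unfolding J_def by (intro has_bochner_integral_diff \<Upsilon>_value \<theta>) simp
    also have "(\<lambda>x. indicator {..<0} x * (k x * (- x - (1 - exp (\<theta> * x)) / \<theta>)) -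
      indicator {..<0} x * (k x * (- x - (1 - exp (1 * x)) / 1))) = (\<lambda>x. indicator {..<0} x * lk_kernel \<theta> x / \<theta>)"
      using \<theta> by (auto simp: fun_eq_iff k_def lk_kernel_def divide_simps algebra_simps split: split_indicator)
    finally have "J \<theta> - J 1 = (\<psi> \<theta> - \<theta> * \<psi> 1 - m0 * ((\<theta>\<^sup>2 - \<theta>) / 2)) / \<theta>"
      using has_bochner_integral_divide[OF lk_negative[of \<theta>], of \<theta>] \<theta>
      by (intro has_bochner_integral_eq) auto
    also have "\<dots> = \<psi> \<theta> / \<theta> - \<psi> 1 - m0 * (\<theta> - 1) / 2"
      using \<theta> by (simp add: field_simps power2_eq_square)
    finally show ?thesis by (simp add: \<phi>_def \<kappa>_def field_simps)
  qed
  ultimately show ?thesis using that by blast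
qed

end

section \<open>Tails of measures on the open half-line\<close>

locale tail_measure =
  fixes \<Upsilon> :: "real measure"
  assumes sets_\<Upsilon>: "sets \<Upsilon> = sets (restrict_space borel {0<..})"
    and emeasure_Ioi: "0 < y \<Longrightarrow> emeasure \<Upsilon> {y<..} < \<infinity>"
begin

lemma space_\<Upsilon>: "space \<Upsilon> = {0<..}"
  using sets_eq_imp_space_eq[OF sets_\<Upsilon>] by (simp add: space_restrict_space)

lemma borel_\<Upsilon>: "f \<in> borel_measurable borel \<Longrightarrow> f \<in> measurable \<Upsilon> N" if "sets N = sets borel" for f :: "real \<Rightarrow> 'b::topological_space"
  unfolding measurable_cong_sets[OF sets_\<Upsilon> that] by (rule measurable_restrict_space1)

lemma id_\<Upsilon> [measurable]: "(\<lambda>z. z) \<in> borel_measurable \<Upsilon>"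
  by (rule borel_\<Upsilon>) auto

lemma Ioi_sets: "0 \<le> y \<Longrightarrow> {y<..} \<in> sets \<Upsilon>"
  unfolding sets_\<Upsilon> by (auto simp: sets_restrict_space_iff)

sublocale \<Upsilon>: sigma_finite_measure \<Upsilon>
proof
  show "\<exists>A. countable A \<and> A \<subseteq> sets \<Upsilon> \<and> \<Union> A = space \<Upsilon> \<and> (\<forall>a\<in>A. emeasure \<Upsilon> a \<noteq> \<infinity>)"
  proof (intro exI conjI)
    show "\<Union> (range (\<lambda>n. {1 / real (Suc n)<..})) = space \<Upsilon>"
      unfolding space_\<Upsilon>
    proof (intro set_eqI iffI)
      fix x :: real assume "x \<in> {0<..}"
      then obtain q where "1 / real (Suc q) < x" using nat_approx_posE[of x] by auto
      then show "x \<in> \<Union> (range (\<lambda>n. {1 / real (Suc n)<..}))" by blast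
    next
      fix x :: real assume "x \<in> \<Union> (range (\<lambda>n. {1 / real (Suc n)<..}))"
      then obtain q where "1 / real (Suc q) < x" by blast
      moreover have "0 < 1 / real (Suc q)" by simp
      ultimately show "x \<in> {0<..}" unfolding greaterThan_iff by linarith
    qed
    show "\<forall>a\<in>range (\<lambda>n. {1 / real (Suc n)<..}). emeasure \<Upsilon> a \<noteq> \<infinity>"
      using emeasure_Ioi by (auto simp: less_top simp del: of_nat_Suc)
  qed (auto intro!: Ioi_sets)
qed

definition T :: "real \<Rightarrow> real" where "T y = measure \<Upsilon> {y<..}"

lemma emeasure_T: "0 < y \<Longrightarrow> emeasure \<Upsilon> {y<..} = ennreal (T y)"
  unfolding T_def using emeasure_Ioi[of y] by (intro emeasure_eq_ennreal_measure) auto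

text \<open>Up to an endpoint, \<open>min x z\<close> is the length of the set of \<open>y\<close>
  in \<open>{0<..x}\<close> below \<open>z\<close>, so Fubini turns the integrated tail into an
  integral against \<Upsilon>.\<close>

lemma tail_meas: "(\<lambda>y. indicator {0<..x} y * T y) \<in> borel_measurable lborel"
  and nn_tail: "0 \<le> x \<Longrightarrow> (\<integral>\<^sup>+y. ennreal (indicator {0<..x} y * T y) \<partial>lborel) = (\<integral>\<^sup>+z. ennreal (min x z) \<partial>\<Upsilon>)"
proof -
  interpret p: pair_sigma_finite lborel \<Upsilon> ..
  have jm: "(\<lambda>(y, z). indicator {0<..x} y * indicator {y<..} z :: ennreal) \<in> borel_measurable (lborel \<Otimes>\<^sub>M \<Upsilon>)"
  proof -
    have "(\<lambda>(y, z). indicator {0<..x} y * indicator {y<..} z :: ennreal) =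
       (\<lambda>p. (if 0 < fst p \<and> fst p \<le> x then 1 else 0) * (if fst p < snd p then 1 else 0))"
      by (auto simp: fun_eq_iff split: split_indicator)
    then show ?thesis by simp
  qed
  have e: "(\<integral>\<^sup>+z. indicator {0<..x} y * indicator {y<..} z \<partial>\<Upsilon>) = ennreal (indicator {0<..x} y * T y)" for y
    by (cases "y \<in> {0<..x}") (auto simp: emeasure_T[symmetric] Ioi_sets)
  show "(\<lambda>y. indicator {0<..x} y * T y) \<in> borel_measurable lborel"
  proof -
    have "(\<lambda>y. \<integral>\<^sup>+z. indicator {0<..x} y * indicator {y<..} z \<partial>\<Upsilon>) \<in> borel_measurable lborel"
      using jm by (intro \<Upsilon>.borel_measurable_nn_integral) simp
    then have "(\<lambda>y. enn2real (ennreal (indicator {0<..x} y * T y))) \<in> borel_measurable lborel"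
      unfolding e by measurable
    then show ?thesis by (simp add: T_def)
  qed
  assume x: "0 \<le> x"
  have "(\<integral>\<^sup>+y. ennreal (indicator {0<..x} y * T y) \<partial>lborel) = (\<integral>\<^sup>+y. (\<integral>\<^sup>+z. indicator {0<..x} y * indicator {y<..} z \<partial>\<Upsilon>) \<partial>lborel)"
    by (simp only: e)
  also have "\<dots> = (\<integral>\<^sup>+z. (\<integral>\<^sup>+y. indicator {0<..x} y * indicator {y<..} z \<partial>lborel) \<partial>\<Upsilon>)"
    by (rule p.Fubini'[symmetric]) (rule jm)
  also have "\<dots> = (\<integral>\<^sup>+z. ennreal (min x z) \<partial>\<Upsilon>)"
  proof (intro nn_integral_cong)
    fix z assume "z \<in> space \<Upsilon>"
    then have z: "0 < z" by (simp add: space_\<Upsilon>)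
    have "(\<integral>\<^sup>+y. indicator {0<..x} y * indicator {y<..} z \<partial>lborel) = (\<integral>\<^sup>+y. indicator {0<..min x z} y \<partial>lborel)"
    proof (rule nn_integral_cong_AE)
      show "AE y in lborel. indicator {0<..x} y * indicator {y<..} z = (indicator {0<..min x z} y :: ennreal)"
        using AE_lborel_singleton[of z] by eventually_elim (auto split: split_indicator)
    qed
    then show "(\<integral>\<^sup>+y. indicator {0<..x} y * indicator {y<..} z \<partial>lborel) = ennreal (min x z)"
      using x z by simp
  qed
  finally show "(\<integral>\<^sup>+y. ennreal (indicator {0<..x} y * T y) \<partial>lborel) = (\<integral>\<^sup>+z. ennreal (min x z) \<partial>\<Upsilon>)" .
qed

end

section \<open>The integrated tail of a Bernstein representation\<close>

locale bernstein_rep =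
  fixes \<kappa> d :: real and \<Upsilon> :: "real measure" and \<phi> :: "real \<Rightarrow> real"
  assumes rep: "bernstein_representation \<kappa> d \<Upsilon> \<phi>"
begin

lemma \<kappa>: "0 \<le> \<kappa>" and d: "0 \<le> d"
  and fin_min: "(\<integral>\<^sup>+x. ennreal (min 1 x) \<partial>\<Upsilon>) < \<infinity>"
  and \<phi>: "0 \<le> \<theta> \<Longrightarrow> \<phi> \<theta> = \<kappa> + d * \<theta> + (\<integral>x. 1 - exp (- \<theta> * x) \<partial>\<Upsilon>)"
  using rep by (auto simp: bernstein_representation_def)

sublocale tail_measure \<Upsilon>
proof
  show s: "sets \<Upsilon> = sets (restrict_space borel {0<..})" using rep by (simp add: bernstein_representation_def)
  fix y :: real assume y: "0 < y"
  have m: "{y<..} \<in> sets \<Upsilon>" unfolding s using y by (auto simp: sets_restrict_space_iff)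
  have "ennreal (min 1 y) * emeasure \<Upsilon> {y<..} = (\<integral>\<^sup>+x. ennreal (min 1 y) * indicator {y<..} x \<partial>\<Upsilon>)"
    using y by (simp add: nn_integral_cmult_indicator m)
  also have "\<dots> \<le> (\<integral>\<^sup>+x. ennreal (min 1 x) \<partial>\<Upsilon>)"
    by (intro nn_integral_mono) (auto split: split_indicator intro!: ennreal_leI)
  finally have "ennreal (min 1 y) * emeasure \<Upsilon> {y<..} < \<infinity>" using fin_min by (rule order_le_less_trans)
  then show "emeasure \<Upsilon> {y<..} < \<infinity>" using y by (auto simp: ennreal_mult_less_top)
qed

lemma min_bound: "0 \<le> c \<Longrightarrow> 0 < z \<Longrightarrow> min c z \<le> max 1 c * min 1 (z::real)"
proof (cases "c \<le> 1")
  case False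
  assume "0 \<le> c" "0 < z"
  show ?thesis
  proof (cases "z \<le> 1")
    case True
    then have "1 * z \<le> c * z" using False \<open>0 < z\<close> by (intro mult_right_mono) auto
    then show ?thesis using True False by (simp add: min_def max_def)
  qed (use False in \<open>simp add: min_def max_def\<close>)
qed (auto simp: min_def max_def)

lemma min1_int: "integrable \<Upsilon> (\<lambda>z. min 1 z)"
  by (rule integrableI_nonneg) (use fin_min in \<open>auto simp: space_\<Upsilon> intro!: AE_I2\<close>)

lemma min_int:
  assumes c: "0 \<le> c" shows "integrable \<Upsilon> (\<lambda>z. min c z)"
proof (rule Bochner_Integration.integrable_bound[OF integrable_mult_right[OF min1_int, of "max 1 c"]])
  show "AE z in \<Upsilon>. norm (min c z) \<le> norm (max 1 c * min 1 z)"
    using min_bound[OF c] c by (intro AE_I2) (simp add: space_\<Upsilon>)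
qed measurable

lemma one_minus_exp_le_min:
  fixes \<theta> z :: real
  assumes "0 < \<theta>" "0 < z" shows "0 \<le> 1 - exp (- \<theta> * z)" "1 - exp (- \<theta> * z) \<le> max 1 \<theta> * min 1 z"
proof -
  show "0 \<le> 1 - exp (- \<theta> * z)" using mult_pos_pos[OF assms] by simp
  have "1 - exp (- \<theta> * z) \<le> min 1 (\<theta> * z)" using exp_ge_add_one_self[of "- \<theta> * z"] by simp
  also have "\<dots> \<le> max 1 \<theta> * min 1 z"
  proof (cases "1 < z")
    case False
    have "\<theta> * z \<le> max 1 \<theta> * z" using assms by (intro mult_right_mono) auto
    moreover have "min 1 z = z" using False by simp
    ultimately show ?thesis by linarith
  qed (auto simp: min_def)
  finally show "1 - exp (- \<theta> * z) \<le> max 1 \<theta> * min 1 z" .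
qed

lemma exp_int: "0 < \<theta> \<Longrightarrow> integrable \<Upsilon> (\<lambda>z. 1 - exp (- \<theta> * z))"
proof (rule Bochner_Integration.integrable_bound[OF integrable_mult_right[OF min1_int, of "max 1 \<theta>"]])
  assume "0 < \<theta>"
  then show "AE z in \<Upsilon>. norm (1 - exp (- \<theta> * z)) \<le> norm (max 1 \<theta> * min 1 z)"
    using one_minus_exp_le_min[of \<theta>] by (intro AE_I2) (simp add: space_\<Upsilon>)
qed measurable

lemma \<phi>_0: "\<phi> 0 = \<kappa>" using \<phi>[of 0] by simp

lemma \<phi>_tendsto: "(\<phi> \<longlongrightarrow> \<kappa>) (at_right 0)"
proof -
  have "((\<lambda>\<theta>. \<integral>z. 1 - exp (- \<theta> * z) \<partial>\<Upsilon>) \<longlongrightarrow> (\<integral>z. 0 \<partial>\<Upsilon>)) (at_right 0)"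
  proof (rule tendsto_integral_at_within[where w="\<lambda>z. min 1 z"])
    have "((\<lambda>h. 1 - exp (- h * z)) \<longlongrightarrow> 1 - exp (- 0 * z)) (at_right 0)" for z :: real by (intro tendsto_intros)
    then show "AE z in \<Upsilon>. ((\<lambda>h. 1 - exp (- h * z)) \<longlongrightarrow> 0) (at_right 0)" by simp
    have "norm (1 - exp (- h * z)) \<le> min 1 z" if "0 < h" "h < 1" "0 < z" for h z
      using one_minus_exp_le_min[of h z] that by (simp add: max_def split: if_splits)
    then show "\<forall>\<^sub>F h in at_right 0. AE z in \<Upsilon>. norm (1 - exp (- h * z)) \<le> min 1 z"
      unfolding eventually_at by (intro exI[of _ 1]) (auto intro!: AE_I2 simp: space_\<Upsilon>)
  qed (use min1_int in auto)
  then have "((\<lambda>\<theta>. \<kappa> + d * \<theta> + (\<integral>z. 1 - exp (- \<theta> * z) \<partial>\<Upsilon>)) \<longlongrightarrow> \<kappa> + d * 0 + (\<integral>z. 0 \<partial>\<Upsilon>)) (at_right 0)"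
    by (intro tendsto_intros)
  then have "((\<lambda>\<theta>. \<kappa> + d * \<theta> + (\<integral>z. 1 - exp (- \<theta> * z) \<partial>\<Upsilon>)) \<longlongrightarrow> \<kappa>) (at_right 0)" by simp
  moreover have "\<forall>\<^sub>F \<theta> in at_right 0. \<kappa> + d * \<theta> + (\<integral>z. 1 - exp (- \<theta> * z) \<partial>\<Upsilon>) = \<phi> \<theta>"
    unfolding eventually_at by (intro exI[of _ 1]) (simp add: \<phi>)
  ultimately show ?thesis by (rule Lim_transform_eventually)
qed

text \<open>The integrated tail, written with \<open>min\<close> so that continuity and concavity in
  \<open>x\<close> can be read off the integrand.\<close>

definition I :: "real \<Rightarrow> real" where "I x = (\<integral>z. min x z \<partial>\<Upsilon>)"

lemma nn_I: "0 \<le> x \<Longrightarrow> (\<integral>\<^sup>+z. ennreal (min x z) \<partial>\<Upsilon>) = ennreal (I x)"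
  unfolding I_def by (intro nn_integral_eq_integral min_int AE_I2) (auto simp: space_\<Upsilon>)

lemma I_nonneg: "0 \<le> x \<Longrightarrow> 0 \<le> I x"
  unfolding I_def by (intro integral_nonneg_AE AE_I2) (auto simp: space_\<Upsilon>)

lemma tail_integral:
  assumes x: "0 \<le> x"
  shows "has_bochner_integral lborel (\<lambda>y. indicator {0<..x} y * T y) (I x)"
  using tail_meas nn_tail[OF x] nn_I[OF x]
  by (intro has_bochner_integral_nn_integral) (auto simp: I_nonneg x T_def)

lemma I_continuous: "continuous_on {0..} I"
  unfolding continuous_on_def
proof
  fix x0 :: real assume x0: "x0 \<in> {0..}"
  show "(I \<longlongrightarrow> I x0) (at x0 within {0..})"
    unfolding I_def
  proof (rule tendsto_integral_at_within[where w="\<lambda>z. min (x0 + 1) z"])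
    show "AE z in \<Upsilon>. ((\<lambda>h. min h z) \<longlongrightarrow> min x0 z) (at x0 within {0..})"
      by (intro AE_I2 tendsto_intros)
    show "\<forall>\<^sub>F h in at x0 within {0..}. AE z in \<Upsilon>. norm (min h z) \<le> min (x0 + 1) z"
      unfolding eventually_at by (intro exI[of _ 1]) (auto intro!: AE_I2 simp: space_\<Upsilon> dist_real_def)
  qed (use min_int[of "x0 + 1"] x0 in auto)
qed

lemma laplace_min:
  assumes \<theta>: "0 < \<theta>" and z: "0 < z"
  shows "(\<integral>\<^sup>+x. ennreal (indicator {0..} x * (exp (- \<theta> * x) * min x z)) \<partial>lborel) = ennreal ((1 - exp (- \<theta> * z)) / \<theta>\<^sup>2)"
proof -
  have "(\<integral>\<^sup>+x. ennreal (indicator {0..} x * (exp (- \<theta> * x) * min x z)) \<partial>lborel) =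
    (\<integral>\<^sup>+x. ennreal (exp (- \<theta> * x) * x) * indicator {0..z} x + ennreal (exp (- \<theta> * x) * z) * indicator {z..} x \<partial>lborel)"
  proof (rule nn_integral_cong_AE)
    show "AE x in lborel. ennreal (indicator {0..} x * (exp (- \<theta> * x) * min x z)) =
      ennreal (exp (- \<theta> * x) * x) * indicator {0..z} x + ennreal (exp (- \<theta> * x) * z) * indicator {z..} x"
      using AE_lborel_singleton[of z] by eventually_elim (use z in \<open>auto split: split_indicator simp: min_def\<close>)
  qed
  also have "\<dots> = (\<integral>\<^sup>+x. ennreal (exp (- \<theta> * x) * x) * indicator {0..z} x \<partial>lborel) + (\<integral>\<^sup>+x. ennreal (exp (- \<theta> * x) * z) * indicator {z..} x \<partial>lborel)"
    by (intro nn_integral_add) auto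
  also have "(\<integral>\<^sup>+x. ennreal (exp (- \<theta> * x) * x) * indicator {0..z} x \<partial>lborel) =
     ennreal ((- exp (- \<theta> * z) * (z / \<theta> + 1 / \<theta>\<^sup>2)) - (- exp (- \<theta> * 0) * (0 / \<theta> + 1 / \<theta>\<^sup>2)))"
  proof (rule nn_integral_FTC_Icc[where F="\<lambda>x. - exp (- \<theta> * x) * (x / \<theta> + 1 / \<theta>\<^sup>2)"])
    fix x :: real assume "x \<in> {0..z}"
    show "((\<lambda>x. - exp (- \<theta> * x) * (x / \<theta> + 1 / \<theta>\<^sup>2)) has_real_derivative exp (- \<theta> * x) * x) (at x)"
      using \<theta> by (auto intro!: derivative_eq_intros simp: field_simps power2_eq_square)
  qed (use z in auto)
  also have "(\<integral>\<^sup>+x. ennreal (exp (- \<theta> * x) * z) * indicator {z..} x \<partial>lborel) = ennreal (0 - (- exp (- \<theta> * z) * z / \<theta>))"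
  proof (rule nn_integral_FTC_atLeast[where F="\<lambda>x. - exp (- \<theta> * x) * z / \<theta>"])
    show "((\<lambda>x. - exp (- \<theta> * x) * z / \<theta>) \<longlongrightarrow> 0) at_top" using \<theta> by real_asymp
    fix x :: real
    show "((\<lambda>x. - exp (- \<theta> * x) * z / \<theta>) has_real_derivative exp (- \<theta> * x) * z) (at x)"
      using \<theta> by (auto intro!: derivative_eq_intros)
  qed (use z in auto)
  also have "ennreal ((- exp (- \<theta> * z) * (z / \<theta> + 1 / \<theta>\<^sup>2)) - (- exp (- \<theta> * 0) * (0 / \<theta> + 1 / \<theta>\<^sup>2))) + ennreal (0 - (- exp (- \<theta> * z) * z / \<theta>))
     = ennreal ((1 - exp (- \<theta> * z)) / \<theta>\<^sup>2)"
  proof (subst ennreal_plus[symmetric])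
    have "0 \<le> 1 - exp (- \<theta> * z) * (\<theta> * z + 1)"
    proof -
      have "exp (- \<theta> * z) * (\<theta> * z + 1) \<le> exp (- \<theta> * z) * exp (\<theta> * z)"
        using exp_ge_add_one_self[of "\<theta> * z"] by (intro mult_left_mono) (auto simp: add.commute)
      then show ?thesis by (simp add: exp_minus)
    qed
    then have "0 \<le> (1 - exp (- \<theta> * z) * (\<theta> * z + 1)) / \<theta>\<^sup>2" by simp
    then show "0 \<le> - exp (- \<theta> * z) * (z / \<theta> + 1 / \<theta>\<^sup>2) - (- exp (- \<theta> * 0) * (0 / \<theta> + 1 / \<theta>\<^sup>2))"
      using \<theta> by (simp add: field_simps power2_eq_square)
  qed (use \<theta> z in \<open>auto simp: field_simps power2_eq_square\<close>)
  finally show ?thesis .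
qed

text \<open>For fixed \<open>z\<close> the transform of \<open>min x z\<close> is the Bernstein
  integrand divided by \<open>\<theta>\<^sup>2\<close>; Fubini does the rest.\<close>

lemma laplace_I:
  assumes \<theta>: "0 < \<theta>"
  shows "has_bochner_integral lborel (\<lambda>x. indicator {0..} x * (exp (- \<theta> * x) * I x)) ((\<integral>z. 1 - exp (- \<theta> * z) \<partial>\<Upsilon>) / \<theta>\<^sup>2)"
proof -
  interpret p: pair_sigma_finite lborel \<Upsilon> ..
  define f where "f x z = ennreal (indicator {0..} x * (exp (- \<theta> * x) * min x z))" for x z :: real
  have jm: "(\<lambda>(x, z). f x z) \<in> borel_measurable (lborel \<Otimes>\<^sub>M \<Upsilon>)"
  proof -
    have "(\<lambda>(x, z). f x z) = (\<lambda>p. ennreal ((if 0 \<le> fst p then 1 else 0) * (exp (- \<theta> * fst p) * min (fst p) (snd p))))"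
      by (auto simp: fun_eq_iff f_def split: split_indicator)
    then show ?thesis by simp
  qed
  have e: "(\<integral>\<^sup>+z. f x z \<partial>\<Upsilon>) = ennreal (indicator {0..} x * (exp (- \<theta> * x) * I x))" for x
  proof (cases "0 \<le> x")
    case True
    have "(\<integral>\<^sup>+z. f x z \<partial>\<Upsilon>) = (\<integral>\<^sup>+z. ennreal (exp (- \<theta> * x)) * ennreal (min x z) \<partial>\<Upsilon>)"
      using True by (intro nn_integral_cong) (simp add: f_def ennreal_mult')
    also have "\<dots> = ennreal (exp (- \<theta> * x)) * ennreal (I x)" using nn_I[OF True] by (simp add: nn_integral_cmult)
    finally show ?thesis using True by (simp add: ennreal_mult')
  qed (simp add: f_def)
  have Im: "(\<lambda>x. indicator {0..} x * (exp (- \<theta> * x) * I x)) \<in> borel_measurable lborel"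
  proof -
    have "(\<lambda>x. exp (- \<theta> * x) * (indicator {0..} x * I x)) \<in> borel_measurable borel"
      using borel_measurable_continuous_on_indicator[OF _ I_continuous] by (simp add: mult.commute)
    then show ?thesis by (simp add: ac_simps)
  qed
  have J0: "0 \<le> (\<integral>z. 1 - exp (- \<theta> * z) \<partial>\<Upsilon>)"
    using one_minus_exp_le_min(1)[OF \<theta>] by (intro integral_nonneg_AE AE_I2) (simp add: space_\<Upsilon>)
  have "(\<integral>\<^sup>+x. ennreal (indicator {0..} x * (exp (- \<theta> * x) * I x)) \<partial>lborel) = (\<integral>\<^sup>+x. \<integral>\<^sup>+z. f x z \<partial>\<Upsilon> \<partial>lborel)"
    by (simp only: e)
  also have "\<dots> = (\<integral>\<^sup>+z. \<integral>\<^sup>+x. f x z \<partial>lborel \<partial>\<Upsilon>)" by (rule p.Fubini'[symmetric]) (rule jm)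
  also have "\<dots> = (\<integral>\<^sup>+z. ennreal ((1 - exp (- \<theta> * z)) / \<theta>\<^sup>2) \<partial>\<Upsilon>)"
    unfolding f_def by (intro nn_integral_cong laplace_min \<theta>) (simp add: space_\<Upsilon>)
  also have "\<dots> = ennreal ((\<integral>z. 1 - exp (- \<theta> * z) \<partial>\<Upsilon>) / \<theta>\<^sup>2)"
    using exp_int[OF \<theta>] one_minus_exp_le_min(1)[OF \<theta>] by (subst nn_integral_eq_integral) (auto intro!: AE_I2 simp: space_\<Upsilon>)
  finally show ?thesis
    using Im J0 I_nonneg by (intro has_bochner_integral_nn_integral) (auto split: split_indicator)
qed

definition V :: "real \<Rightarrow> real" where
  "V x = (if x < 0 then 0 else d + \<kappa> * x + (LBINT y:{0<..x}. measure \<Upsilon> {y<..}))"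

lemma V_eq: "0 \<le> x \<Longrightarrow> V x = d + \<kappa> * x + I x"
  using tail_integral[of x] by (auto simp: V_def set_lebesgue_integral_def has_bochner_integral_iff T_def)

lemma V_nonneg: "0 \<le> V x"
  using I_nonneg[of x] \<kappa> d V_eq[of x] by (cases "0 \<le> x") (auto simp: V_def)

lemma V_continuous: "continuous_on {0..} V"
proof -
  have "continuous_on {0..} (\<lambda>x. d + \<kappa> * x + I x)" by (intro continuous_intros I_continuous)
  then show ?thesis by (rule continuous_on_eq) (simp add: V_eq)
qed

lemma laplace_V:
  assumes \<theta>: "0 < \<theta>"
  shows "has_bochner_integral lborel (\<lambda>x. indicator {0..} x * (exp (- \<theta> * x) * V x)) (\<phi> \<theta> / \<theta>\<^sup>2)"
proof -
  have "has_bochner_integral lborel (\<lambda>x. indicator {0..} x * (exp (- \<theta> * x) * (d + \<kappa> * x)) + indicator {0..} x * (exp (- \<theta> * x) * I x))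
    ((d / \<theta> + \<kappa> / \<theta>\<^sup>2) + (\<integral>z. 1 - exp (- \<theta> * z) \<partial>\<Upsilon>) / \<theta>\<^sup>2)"
    by (intro has_bochner_integral_add laplace_I has_bochner_integral_laplace_affine \<theta> \<kappa> d)
  also have "(\<lambda>x. indicator {0..} x * (exp (- \<theta> * x) * (d + \<kappa> * x)) + indicator {0..} x * (exp (- \<theta> * x) * I x))
     = (\<lambda>x. indicator {0..} x * (exp (- \<theta> * x) * V x))"
    by (auto simp: fun_eq_iff V_eq algebra_simps split: split_indicator)
  also have "(d / \<theta> + \<kappa> / \<theta>\<^sup>2) + (\<integral>z. 1 - exp (- \<theta> * z) \<partial>\<Upsilon>) / \<theta>\<^sup>2 = \<phi> \<theta> / \<theta>\<^sup>2"
    using \<theta> by (simp add: \<phi> field_simps power2_eq_square)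
  finally show ?thesis .
qed

lemma V_scale_function:
  assumes "\<And>\<theta>. 0 < \<theta> \<Longrightarrow> 1 / \<psi> \<theta> = \<phi> \<theta> / \<theta>\<^sup>2"
  shows "scale_function \<psi> V"
  using laplace_V V_nonneg V_continuous assms
  by (auto simp: scale_function_def set_integrable_def set_lebesgue_integral_def has_bochner_integral_iff V_def)

lemma V_concave: "concave_on {0..} V"
  unfolding concave_on_def
proof (rule convex_onI)
  fix t x y :: real assume t: "0 < t" "t < 1" and xy: "x \<in> {0..}" "y \<in> {0..}"
  let ?w = "(1 - t) * x + t * y"
  have w: "0 \<le> ?w" using t xy by simp
  have "(1 - t) * I x + t * I y = (\<integral>z. (1 - t) * min x z + t * min y z \<partial>\<Upsilon>)"
    unfolding I_def using min_int[of x] min_int[of y] xy by simp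
  also have "\<dots> \<le> I ?w"
    unfolding I_def
  proof (rule integral_mono)
    show "integrable \<Upsilon> (\<lambda>z. (1 - t) * min x z + t * min y z)"
      using min_int[of x] min_int[of y] xy by auto
    show "integrable \<Upsilon> (\<lambda>z. min ?w z)" by (rule min_int[OF w])
    fix z
    have "(1 - t) * min x z + t * min y z \<le> ?w" using t by (intro add_mono mult_left_mono) auto
    moreover have "(1 - t) * min x z + t * min y z \<le> (1 - t) * z + t * z" using t by (intro add_mono mult_left_mono) auto
    ultimately show "(1 - t) * min x z + t * min y z \<le> min ?w z" by (simp add: algebra_simps)
  qed
  finally have "(1 - t) * I x + t * I y \<le> I ?w" .
  then show "- V ((1 - t) *\<^sub>R x + t *\<^sub>R y) \<le> (1 - t) * - V x + t * - V y"
    using w xy by (simp add: V_eq algebra_simps)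
qed (rule convex_real_interval)

lemma V_derivative:
  assumes T: "continuous_on {0<..} T" and x: "0 < x"
  shows "(V has_real_derivative \<kappa> + T x) (at x)"
proof -
  \<comment> \<open>The tail may explode at 0, so the fundamental theorem is applied from an
    interior point.\<close>
  define a where "a = x / 2"
  have a: "0 < a" "a < x" using x by (auto simp: a_def)
  have Icc: "I y = I a + integral {a..y} T" if "a \<le> y" for y
  proof -
    have "has_bochner_integral lborel (\<lambda>z. indicator {0<..y} z * T z - indicator {0<..a} z * T z) (I y - I a)"
      using that a by (intro has_bochner_integral_diff tail_integral) auto
    also have "(\<lambda>z. indicator {0<..y} z * T z - indicator {0<..a} z * T z) = (\<lambda>z. indicator {a<..y} z * T z)"
      using that a by (auto simp: fun_eq_iff split: split_indicator)
    finally have h: "has_bochner_integral lborel (\<lambda>z. indicator {a<..y} z * T z) (I y - I a)" .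
    have "has_bochner_integral lborel (\<lambda>z. indicator {a..y} z * T z) (I y - I a)"
    proof (rule has_bochner_integral_cong_AE[THEN iffD1, OF _ _ _ h])
      show "AE z in lborel. indicator {a<..y} z * T z = indicator {a..y} z * T z"
        using AE_lborel_singleton[of a] by eventually_elim (auto split: split_indicator)
      have "continuous_on {a..y} T" using T by (rule continuous_on_subset) (use a in auto)
      from borel_measurable_continuous_on_indicator[OF _ this]
      show "(\<lambda>z. indicator {a..y} z * T z) \<in> borel_measurable lborel" by (simp add: mult.commute)
    qed (use h in \<open>auto simp: has_bochner_integral_iff\<close>)
    then have "set_integrable lborel {a..y} T" "(LBINT z:{a..y}. T z) = I y - I a"
      by (auto simp: set_integrable_def set_lebesgue_integral_def has_bochner_integral_iff)
    then show ?thesis using set_borel_integral_eq_integral(2)[of "{a..y}" T] by simp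
  qed
  have "continuous_on {a..x + 1} T" using T by (rule continuous_on_subset) (use a in auto)
  from integral_has_real_derivative[OF this, of x] a
  have "((\<lambda>y. integral {a..y} T) has_real_derivative T x) (at x within {a..x + 1})" by auto
  then have "((\<lambda>y. integral {a..y} T) has_real_derivative T x) (at x)"
    using a by (simp add: at_within_interior[of x "{a..x+1}"])
  then have "((\<lambda>y. d + \<kappa> * y + (I a + integral {a..y} T)) has_real_derivative \<kappa> + T x) (at x)"
    by (auto intro!: derivative_eq_intros)
  then show ?thesis
  proof (rule has_field_derivative_transform_within_open)
    show "x \<in> {a<..}" using a by simp
    show "d + \<kappa> * y + (I a + integral {a..y} T) = V y" if "y \<in> {a<..}" for y
      using Icc[of y] V_eq[of y] that a by simp
  qed simp
qed

lemma V_shape: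
  assumes "convex_on {0<..} T"
  shows "concave_with_convex_derivative V"
proof -
  have c: "continuous_on {0<..} T" using assms by (intro convex_on_continuous) auto
  have deriv: "deriv V x = \<kappa> + T x" if "0 < x" for x
    using V_derivative[OF c that] by (rule DERIV_imp_deriv)
  have "convex_on {0<..} (\<lambda>x. \<kappa> + T x)" using assms by (intro convex_on_add convex_on_const[THEN iffD2]) auto
  have "convex_on {0<..} (deriv V)"
  proof (rule convex_onI)
    fix t x y :: real assume t: "0 < t" "t < 1" and xy: "x \<in> {0<..}" "y \<in> {0<..}"
    have "0 < (1 - t) * x + t * y" using t xy by (auto intro!: add_pos_pos mult_pos_pos)
    then show "deriv V ((1 - t) *\<^sub>R x + t *\<^sub>R y) \<le> (1 - t) * deriv V x + t * deriv V y"
      using convex_onD[OF \<open>convex_on {0<..} (\<lambda>x. \<kappa> + T x)\<close>, of t x y] t xy by (simp add: deriv)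
  qed (rule convex_real_interval)
  moreover have "V differentiable (at x)" if "0 < x" for x
    using V_derivative[OF c that] by (auto simp: real_differentiable_def)
  ultimately show ?thesis using V_concave by (simp add: concave_with_convex_derivative_def)
qed

text \<open>A non-increasing density \<open>u\<close> makes \<open>- u b\<close> a subgradient of
  the tail at \<open>b\<close>, as comparison of \<open>u\<close> with the constant
  \<open>u b\<close> on either side shows. Averaging the supporting line at the intermediate point
  gives convexity; jumps of \<open>u\<close> do no harm.\<close>

lemma T_convex:
  assumes "has_nonincreasing_density \<Upsilon>"
  shows "convex_on {0<..} T"
proof -
  obtain u where u0: "\<forall>x>0. 0 \<le> u x" and anti: "antimono_on {0<..} u"
    and dens: "\<Upsilon> = density (restrict_space lborel {0<..}) (\<lambda>x. ennreal (u x))"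
    using assms by (auto simp: has_nonincreasing_density_def)
  have um: "(\<lambda>x. ennreal (u x)) \<in> borel_measurable (restrict_space lborel {0<..})"
  proof -
    have "mono_on {0<..} (\<lambda>x. - u x)" using anti by (auto simp: monotone_on_def)
    then have "(\<lambda>x. - u x) \<in> borel_measurable (restrict_space borel {0<..})" by (rule borel_measurable_mono_on_fnc)
    then have "u \<in> borel_measurable (restrict_space borel {0<..})" by simp
    moreover have "sets (restrict_space lborel {0<..}) = sets (restrict_space borel {0::real<..})" by (simp add: sets_restrict_space)
    ultimately have "u \<in> borel_measurable (restrict_space lborel {0<..})" by (simp cong: measurable_cong_sets)
    then show ?thesis by measurable
  qed
  have Ioc: "emeasure \<Upsilon> {a<..b} = (\<integral>\<^sup>+x. ennreal (u x) * indicator {a<..b} x \<partial>lborel)" if "0 < a" for a b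
  proof -
    have s: "{a<..b} \<in> sets (restrict_space lborel {0<..})" using that by (auto simp: sets_restrict_space_iff)
    have "emeasure \<Upsilon> {a<..b} = (\<integral>\<^sup>+x. ennreal (u x) * indicator {a<..b} x \<partial>restrict_space lborel {0<..})"
      unfolding dens by (rule emeasure_density[OF um s])
    also have "\<dots> = (\<integral>\<^sup>+x. ennreal (u x) * indicator {a<..b} x * indicator {0<..} x \<partial>lborel)"
      by (rule nn_integral_restrict_space) simp
    also have "\<dots> = (\<integral>\<^sup>+x. ennreal (u x) * indicator {a<..b} x \<partial>lborel)"
      using that by (intro nn_integral_cong) (auto split: split_indicator)
    finally show ?thesis .
  qed
  have diff: "ennreal (T a) = ennreal (T b) + emeasure \<Upsilon> {a<..b}" if "0 < a" "a \<le> b" for a b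
  proof -
    have s: "{a<..b} \<in> sets \<Upsilon>" unfolding sets_\<Upsilon> using that by (auto simp: sets_restrict_space_iff)
    have "emeasure \<Upsilon> ({b<..} \<union> {a<..b}) = emeasure \<Upsilon> {b<..} + emeasure \<Upsilon> {a<..b}"
      using that s by (intro plus_emeasure[symmetric] Ioi_sets) auto
    moreover have "{b<..} \<union> {a<..b} = {a<..}" using that by auto
    ultimately show ?thesis using that by (simp add: emeasure_T)
  qed
  have T0: "0 \<le> T a" for a by (simp add: T_def)
  have sub: "T b - u b * (y - b) \<le> T y" if b: "0 < b" and y: "0 < y" for b y
  proof (cases "b \<le> y")
    case True
    have "emeasure \<Upsilon> {b<..y} \<le> (\<integral>\<^sup>+x. ennreal (u b) * indicator {b<..y} x \<partial>lborel)"
      unfolding Ioc[OF b] using anti b by (intro nn_integral_mono) (auto split: split_indicator intro!: ennreal_leI simp: monotone_on_def)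
    also have "\<dots> = ennreal (u b * (y - b))"
      using True u0 b by (simp add: nn_integral_cmult_indicator ennreal_mult')
    finally have "ennreal (T b) \<le> ennreal (T y) + ennreal (u b * (y - b))"
      unfolding diff[OF b True] by (intro add_left_mono)
    also have "\<dots> = ennreal (T y + u b * (y - b))" using True u0 b T0 by (intro ennreal_plus[symmetric]) auto
    finally have "T b \<le> T y + u b * (y - b)" using True u0 b T0[of y] by (subst (asm) ennreal_le_iff) auto
    then show ?thesis by simp
  next
    case False
    have "ennreal (u b * (b - y)) = (\<integral>\<^sup>+x. ennreal (u b) * indicator {y<..b} x \<partial>lborel)"
      using False u0 b by (simp add: nn_integral_cmult_indicator ennreal_mult')
    also have "\<dots> \<le> emeasure \<Upsilon> {y<..b}"
      unfolding Ioc[OF y] using anti y by (intro nn_integral_mono) (auto split: split_indicator intro!: ennreal_leI simp: monotone_on_def)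
    finally have "ennreal (T b) + ennreal (u b * (b - y)) \<le> ennreal (T y)"
      using diff[OF y, of b] False by (simp add: add_left_mono)
    then have "ennreal (T b + u b * (b - y)) \<le> ennreal (T y)" using False u0 b T0 by (simp add: ennreal_plus)
    then have "T b + u b * (b - y) \<le> T y" using T0 by (simp add: ennreal_le_iff)
    then show ?thesis by (simp add: algebra_simps)
  qed
  show ?thesis
  proof (rule convex_onI)
    fix t x y :: real assume t: "0 < t" "t < 1" and xy: "x \<in> {0<..}" "y \<in> {0<..}"
    define b where "b = (1 - t) * x + t * y"
    have b: "0 < b" using t xy by (auto simp: b_def intro!: add_pos_pos mult_pos_pos)
    have "(1 - t) * (T b - u b * (x - b)) + t * (T b - u b * (y - b)) \<le> (1 - t) * T x + t * T y"
      using t xy b by (intro add_mono mult_left_mono sub) auto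
    moreover have "(1 - t) * (T b - u b * (x - b)) + t * (T b - u b * (y - b)) = T b"
    proof -
      have "(1 - t) * (x - b) + t * (y - b) = 0" by (simp add: b_def algebra_simps)
      moreover have "(1 - t) * (T b - u b * (x - b)) + t * (T b - u b * (y - b)) = T b - u b * ((1 - t) * (x - b) + t * (y - b))"
        by (simp add: algebra_simps)
      ultimately show ?thesis by simp
    qed
    ultimately show "T ((1 - t) *\<^sub>R x + t *\<^sub>R y) \<le> (1 - t) * T x + t * T y" by (simp add: b_def)
  qed (rule convex_real_interval)
qed

end

section \<open>Scale functions and conjugate Bernstein functions\<close>

text \<open>The third difference is the increment over \<open>h\<close> of the second difference
  \<open>D\<close>, whose derivative is a second difference of the convex function
  \<open>deriv W\<close>. At \<open>x = 0\<close>, where \<open>W\<close> need not be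
  differentiable, continuity of \<open>D\<close> suffices.\<close>

lemma scale_shape_concave:
  assumes nn: "\<And>x. 0 \<le> x \<Longrightarrow> 0 \<le> W x" and cont: "continuous_on {0..} W" and sh: "concave_with_convex_derivative W"
  shows "scale_shape W"
proof
  fix x h :: real assume x: "0 \<le> x" and h: "0 < h"
  define D where "D y = W (y + 2 * h) - 2 * W (y + h) + W y" for y
  have W': "(W has_real_derivative deriv W y) (at y)" if "0 < y" for y
    using sh that by (auto simp: concave_with_convex_derivative_def DERIV_deriv_iff_real_differentiable)
  have "D x \<le> D (x + h)"
  proof (rule DERIV_nonneg_imp_increasing_open[where f=D])
    fix y assume "x < y" "y < x + h"
    then have y: "0 < y" using x by simp
    have s: "((\<lambda>y. W (y + c)) has_real_derivative deriv W (y + c)) (at y)" if "0 \<le> c" for c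
      using W'[of "y + c"] y that by (simp add: DERIV_shift)
    have "(D has_real_derivative deriv W (y + 2 * h) - 2 * deriv W (y + h) + deriv W y) (at y)"
      unfolding D_def using h by (intro DERIV_add DERIV_diff DERIV_cmult s W'[OF y]) auto
    moreover have "deriv W (y + h) \<le> (1 - 1 / 2) * deriv W y + 1 / 2 * deriv W (y + 2 * h)"
    proof -
      have "deriv W ((1 - 1 / 2) *\<^sub>R y + (1 / 2) *\<^sub>R (y + 2 * h)) \<le> (1 - 1 / 2) * deriv W y + 1 / 2 * deriv W (y + 2 * h)"
        using sh y h by (intro convex_onD[of "{0<..}"]) (auto simp: concave_with_convex_derivative_def)
      moreover have "(1 - 1 / 2) *\<^sub>R y + (1 / 2) *\<^sub>R (y + 2 * h) = y + h" by (simp add: field_simps)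
      ultimately show ?thesis by simp
    qed
    ultimately show "\<exists>z. (D has_real_derivative z) (at y) \<and> 0 \<le> z" by (intro exI conjI) auto
  next
    have "continuous_on {x..x + h} (\<lambda>y. W (y + c))" if "0 \<le> c" for c
      using x that by (intro continuous_on_compose2[OF cont] continuous_intros) auto
    from this[of "2 * h"] this[of h] this[of 0] show "continuous_on {x..x + h} D"
      unfolding D_def using h by (auto intro!: continuous_intros)
  qed (use h in simp)
  moreover have "x + h + 2 * h = x + 3 * h" "x + h + h = x + 2 * h" by simp_all
  ultimately show "0 \<le> W (x + 3 * h) - 3 * W (x + 2 * h) + 3 * W (x + h) - W x" by (simp add: D_def)
qed (use assms in \<open>auto simp: concave_with_convex_derivative_def\<close>)

context bernstein_rep
begin

text \<open>\<open>\<phi> \<theta>0 \<noteq> 0\<close> rules out \<open>V = 0\<close>, for which the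
  exponent would vanish.\<close>

lemma exists_process:
  assumes sh: "concave_with_convex_derivative V" and nz: "0 < \<theta>0" "\<phi> \<theta>0 \<noteq> 0"
  obtains N :: "(real \<Rightarrow> real) measure" and Y \<psi> where
    "spectrally_negative_levy N Y" "laplace_exponent N Y \<psi>" "\<not> drifts_to_minus_infinity N Y"
    "\<And>\<theta>. 0 \<le> \<theta> \<Longrightarrow> \<psi> \<theta> = \<theta> * \<phi> \<theta>"
proof -
  interpret S: scale_shape V by (rule scale_shape_concave[OF V_nonneg V_continuous sh])
  have lap: "S.lap \<theta> = \<phi> \<theta> / \<theta>\<^sup>2" if "0 < \<theta>" for \<theta>
    using S.lap_bochner(1)[OF that] laplace_V[OF that] by (rule has_bochner_integral_eq)
  have "\<exists>x\<ge>0. 0 < V x"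
  proof (rule ccontr)
    assume "\<not> ?thesis"
    then have "V x = 0" if "0 \<le> x" for x using V_nonneg[of x] that by force
    then have "(\<lambda>x. indicator {0..} x *\<^sub>R (exp (- \<theta>0 * x) * V x)) = (\<lambda>x. 0)" by (auto simp: fun_eq_iff split: split_indicator)
    then have "S.lap \<theta>0 = 0" unfolding S.lap_def set_lebesgue_integral_def by (simp only: Bochner_Integration.integral_zero)
    then show False using nz by (simp add: lap)
  qed
  then obtain x0 where "0 \<le> x0" "0 < V x0" by blast
  then obtain N :: "(real \<Rightarrow> real) measure" and Y where NY:
    "spectrally_negative_levy N Y" "laplace_exponent N Y S.\<psi>" "\<not> drifts_to_minus_infinity N Y"
    by (rule S.exists_process)
  have "S.\<psi> \<theta> = \<theta> * \<phi> \<theta>" if "0 \<le> \<theta>" for \<theta>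
    using that by (cases "\<theta> = 0") (auto simp: S.\<psi>_def lap power3_eq_cube power2_eq_square)
  then show thesis using NY that by blast
qed

lemma is_quotient_exponent:
  assumes "\<And>\<theta>. 0 < \<theta> \<Longrightarrow> g \<theta> \<noteq> 0 \<and> \<phi> \<theta> = \<theta> / g \<theta>" "\<And>\<theta>. 0 \<le> \<theta> \<Longrightarrow> \<psi> \<theta> = \<theta> * \<phi> \<theta>"
  shows "is_quotient \<psi> (\<lambda>\<theta>. \<theta>\<^sup>2) g"
proof -
  have e: "\<theta> * \<phi> \<theta> = \<theta>\<^sup>2 / g \<theta>" if "0 < \<theta>" for \<theta> using assms(1)[OF that] by (simp add: power2_eq_square)
  have "((\<lambda>\<theta>. \<theta> * \<phi> \<theta>) \<longlongrightarrow> 0 * \<kappa>) (at_right 0)" by (intro tendsto_intros \<phi>_tendsto)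
  moreover have "\<forall>\<^sub>F \<theta> in at_right 0. \<theta> * \<phi> \<theta> = \<theta>\<^sup>2 / g \<theta>"
    unfolding eventually_at by (intro exI[of _ 1]) (simp add: e)
  ultimately have "((\<lambda>\<theta>. \<theta>\<^sup>2 / g \<theta>) \<longlongrightarrow> 0) (at_right 0)" by (simp add: Lim_transform_eventually)
  then show ?thesis using assms by (simp add: is_quotient_def flip: e)
qed

lemma is_quotient_id:
  assumes "\<And>\<theta>. 0 < \<theta> \<Longrightarrow> g \<theta> \<noteq> 0 \<and> \<phi> \<theta> = \<theta> / g \<theta>"
  shows "is_quotient \<phi> (\<lambda>\<theta>. \<theta>) g"
proof -
  have "\<forall>\<^sub>F \<theta> in at_right 0. \<phi> \<theta> = \<theta> / g \<theta>"
    unfolding eventually_at by (intro exI[of _ 1]) (simp add: assms)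
  then have "((\<lambda>\<theta>. \<theta> / g \<theta>) \<longlongrightarrow> \<kappa>) (at_right 0)" by (rule Lim_transform_eventually[OF \<phi>_tendsto])
  then show ?thesis using assms by (simp add: is_quotient_def \<phi>_0)
qed

lemma conjugate_scale_function:
  assumes "\<And>\<theta>. 0 < \<theta> \<Longrightarrow> g \<theta> \<noteq> 0 \<and> \<phi> \<theta> = \<theta> / g \<theta>" "\<And>\<theta>. 0 \<le> \<theta> \<Longrightarrow> \<psi> \<theta> = \<theta> * g \<theta>"
  shows "scale_function \<psi> V"
  by (rule V_scale_function) (use assms in \<open>simp add: power2_eq_square\<close>)

end

context levy_process
begin

lemma levy_process_uminus: "levy_process M (\<lambda>t \<omega>. - X t \<omega>)"
proof
  show "(\<lambda>\<omega>. - X t \<omega>) \<in> borel_measurable M" if "0 \<le> t" for t using measurable_X[OF that] by simp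
  show "AE \<omega> in M. - X 0 \<omega> = 0" using starts_at_zero by simp
  show "indep_vars (\<lambda>_. borel) (\<lambda>i \<omega>. - X (t (Suc i)) \<omega> - - X (t i) \<omega>) {..<n}"
    if "0 \<le> t 0" "\<And>i. i < n \<Longrightarrow> t i \<le> t (Suc i)" for t :: "nat \<Rightarrow> real" and n
  proof -
    have "indep_vars (\<lambda>_. borel) (\<lambda>i \<omega>. - (X (t (Suc i)) \<omega> - X (t i) \<omega>)) {..<n}"
      by (rule indep_vars_compose2[OF indep_increments[OF that]]) auto
    moreover have "(\<lambda>i \<omega>. - (X (t (Suc i)) \<omega> - X (t i) \<omega>)) = (\<lambda>i \<omega>. - X (t (Suc i)) \<omega> - - X (t i) \<omega>)"
      by (simp add: fun_eq_iff)
    ultimately show ?thesis by metis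
  qed
  show "distr M borel (\<lambda>\<omega>. - X t \<omega> - - X s \<omega>) = distr M borel (\<lambda>\<omega>. - X (t - s) \<omega>)" if st: "0 \<le> s" "s \<le> t" for s t
  proof -
    have m: "(\<lambda>\<omega>. X t \<omega> - X s \<omega>) \<in> borel_measurable M" "X (t - s) \<in> borel_measurable M"
      using st by (auto intro!: borel_measurable_diff measurable_X)
    have "distr (distr M borel (\<lambda>\<omega>. X t \<omega> - X s \<omega>)) borel uminus = distr (distr M borel (X (t - s))) borel uminus"
      by (simp only: stationary_increments[OF st])
    moreover have "(\<lambda>\<omega>. - X t \<omega> - - X s \<omega>) = uminus \<circ> (\<lambda>\<omega>. X t \<omega> - X s \<omega>)" "(\<lambda>\<omega>. - X (t - s) \<omega>) = uminus \<circ> X (t - s)"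
      by (simp_all add: fun_eq_iff)
    ultimately show ?thesis using distr_distr[OF _ m(1), of uminus borel] distr_distr[OF _ m(2), of uminus borel] by simp
  qed
  show "AE \<omega> in M. \<forall>t\<ge>0. ((\<lambda>s. - X s \<omega>) \<longlongrightarrow> - X t \<omega>) (at_right t)"
    using right_continuous_paths by eventually_elim (simp add: tendsto_minus)
  show "AE \<omega> in M. \<forall>t>0. \<exists>l. ((\<lambda>s. - X s \<omega>) \<longlongrightarrow> l) (at_left t)"
    using left_limits by eventually_elim (metis tendsto_minus)
qed

text \<open>Increments over times \<open>1 / (n + 1)\<close> vanish almost surely, so the path is 0
  at all nonnegative rational times and, by right continuity, at all times.\<close>

lemma zero_exponent_subordinator:
  assumes \<psi>: "laplace_exponent M X \<psi>" and zero: "\<And>\<theta>. 0 < \<theta> \<Longrightarrow> \<psi> \<theta> = 0"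
  shows "subordinator M (\<lambda>t \<omega>. - X t \<omega>)"
proof -
  have \<psi>0: "\<psi> \<theta> = 0" if "0 \<le> \<theta>" for \<theta>
    using that \<psi> zero[of \<theta>] by (cases "\<theta> = 0") (auto simp: laplace_exponent_def prob_space)
  have l0: "has_laplace (return borel 0) (\<lambda>_. 1)"
    unfolding has_laplace_def
  proof (intro conjI allI impI)
    show "real_distribution (return borel (0::real))"
      by (intro real_distribution.intro real_distribution_axioms.intro prob_space_return) simp_all
    interpret r: prob_space "return borel (0::real)" by (rule prob_space_return) simp
    show "integrable (return borel 0) (\<lambda>x. exp (\<theta> * x))" for \<theta> :: real
      by (rule r.integrable_const_bound[of _ 1]) (simp_all add: AE_return)
  qed (simp add: integral_return)
  have law: "distr M borel (X (1 / real (Suc n))) = return borel 0" for n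
  proof (rule has_laplace_unique[OF _ l0])
    show "has_laplace (distr M borel (X (1 / real (Suc n)))) (\<lambda>_. 1)"
      using small_time_laplace[OF \<psi>, of n] \<psi>0 by (simp add: has_laplace_def)
  qed
  have "AE \<omega> in M. incr n i \<omega> = 0" for n i
  proof -
    have "AE x in distr M borel (incr n i). x = 0" unfolding incr_law law by (simp add: AE_return)
    then show ?thesis by (subst (asm) AE_distr_iff) auto
  qed
  then have "AE \<omega> in M. \<forall>n i. incr n i \<omega> = 0" by (simp add: AE_all_countable)
  then have "AE \<omega> in M. \<forall>t\<ge>0. X t \<omega> = 0"
    using starts_at_zero right_continuous_paths
  proof eventually_elim
    case (elim \<omega>)
    have q: "X (real k / real (Suc n)) \<omega> = 0" for k n
      by (induction k) (use elim(1,2) in \<open>auto simp: incr_def\<close>)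
    show ?case
    proof (intro allI impI)
      fix t :: real assume t: "0 \<le> t"
      show "X t \<omega> = 0"
      proof (rule ccontr)
        assume "X t \<omega> \<noteq> 0"
        then have "\<forall>\<^sub>F s in at_right t. X s \<omega> \<noteq> 0"
          using elim(3) t by (intro tendsto_imp_eventually_ne[of _ "X t \<omega>"]) auto
        then obtain b where b: "t < b" "\<And>s. t < s \<Longrightarrow> s < b \<Longrightarrow> X s \<omega> \<noteq> 0"
          by (auto simp: eventually_at_right_field)
        obtain r where r: "r \<in> \<rat>" "t < r" "r < b" using Rats_dense_in_real[OF b(1)] by blast
        then obtain k n where "n \<noteq> 0" "\<bar>r\<bar> = real k / real n" using Rats_abs_nat_div_natE[of r] by metis
        then have "r = real k / real (Suc (n - 1))" using r t by simp
        then show False using b(2)[OF r(2,3)] q[of k "n - 1"] by simp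
      qed
    qed
  qed
  then have "AE \<omega> in M. mono_on {0..} (\<lambda>t. - X t \<omega>)"
    by eventually_elim (simp add: mono_on_def)
  then show ?thesis using levy_process_uminus by (simp add: subordinator_def)
qed

end

lemma bernstein_of_exponent:
  assumes X: "spectrally_negative_levy M X" and \<psi>: "laplace_exponent M X \<psi>" and pos: "\<And>\<theta>. 0 < \<theta> \<Longrightarrow> 0 < \<psi> \<theta>"
  obtains \<kappa> d \<Upsilon> \<phi> where "bernstein_representation \<kappa> d \<Upsilon> \<phi>" "\<And>\<theta>. 0 < \<theta> \<Longrightarrow> \<phi> \<theta> = \<psi> \<theta> / \<theta>"
proof -
  interpret levy_process M X using X by (simp add: spectrally_negative_levy_def)
  interpret small_time "\<lambda>n. distr M borel (X (1 / real (Suc n)))" \<psi>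
  proof
    show "has_laplace (distr M borel (X (1 / real (Suc n)))) (\<lambda>\<theta>. exp (\<psi> \<theta> / real (Suc n)))" for n
      by (rule small_time_laplace[OF \<psi>])
    show "(\<lambda>n. real (Suc n) * measure (distr M borel (X (1 / real (Suc n)))) {e<..}) \<longlonglongrightarrow> 0" if "0 < e" for e
      using X that by (intro small_time_positive_tail) (simp_all add: spectrally_negative_levy_def)
  qed
  obtain m where m: "finite_measure m" "sets m = sets borel" "emeasure m {0<..} = 0"
    "\<And>\<theta>. 0 \<le> \<theta> \<Longrightarrow> integrable m (lk_kernel \<theta>) \<and> \<psi> \<theta> = \<theta> * \<psi> 1 + (\<integral>x. lk_kernel \<theta> x \<partial>m)"
    using levy_khintchine by metis
  interpret lk_triplet m \<psi>
    by (intro lk_triplet.intro lk_triplet_axioms.intro m(1-3) conjunct1[OF m(4)] conjunct2[OF m(4)] pos)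
  show thesis by (rule bernstein) (rule that)
qed

text \<open>The image under \<open>exp\<close> of the Lebesgue--Stieltjes measure of \<open>\<lambda>s. - T (exp s)\<close>; the change of
  variable moves the possible explosion of \<open>T\<close> at 0 to \<open>-\<infinity>\<close>.\<close>

lemma exists_measure_with_tail:
  fixes T :: "real \<Rightarrow> real"
  assumes anti: "\<And>x y. 0 < x \<Longrightarrow> x \<le> y \<Longrightarrow> T y \<le> T x" and cont: "continuous_on {0<..} T"
    and lim: "(T \<longlongrightarrow> 0) at_top"
  obtains \<Upsilon> where "tail_measure \<Upsilon>" "\<And>y. 0 < y \<Longrightarrow> measure \<Upsilon> {y<..} = T y"
proof -
  have T0: "0 \<le> T x" if "0 < x" for x
    by (rule tendsto_upperbound[OF lim]) (use anti that in \<open>auto simp: eventually_at_top_linorder\<close>)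
  define F where "F s = - T (exp s)" for s
  have mono: "F x \<le> F y" if "x \<le> y" for x y using anti[of "exp x" "exp y"] that by (simp add: F_def)
  have "continuous_on UNIV F"
    unfolding F_def by (intro continuous_intros continuous_on_compose2[OF cont]) auto
  then have rc: "continuous (at_right a) F" for a
    by (simp add: continuous_on_eq_continuous_at continuous_at_imp_continuous_at_within)
  define \<mu> where "\<mu> = interval_measure F"
  have sets: "sets \<mu> = sets borel" by (simp add: \<mu>_def)
  have tail: "emeasure \<mu> {s<..} = ennreal (T (exp s))" for s
  proof -
    \<comment> \<open>The interval measure is known on bounded intervals; the half-line is exhausted
      by them, and the vanishing of \<open>T\<close> at infinity makes the limit
      \<open>T (exp s)\<close>.\<close>
    have "(\<lambda>n. emeasure \<mu> {s<..s + real n}) \<longlonglongrightarrow> emeasure \<mu> (\<Union>n. {s<..s + real n})"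
      by (rule Lim_emeasure_incseq) (auto simp: sets incseq_def)
    also have "(\<Union>n. {s<..s + real n}) = {s<..}"
    proof (intro set_eqI iffI)
      fix x assume "x \<in> {s<..}"
      moreover obtain n where "x - s \<le> real n" using real_arch_simple by blast
      ultimately have "x \<in> {s<..s + real n}" by auto
      then show "x \<in> (\<Union>n. {s<..s + real n})" by blast
    qed auto
    finally have l: "(\<lambda>n. emeasure \<mu> {s<..s + real n}) \<longlonglongrightarrow> emeasure \<mu> {s<..}" .
    have "filterlim (\<lambda>n. exp (s + real n)) at_top sequentially"
      by (intro filterlim_compose[OF exp_at_top] filterlim_tendsto_add_at_top[OF tendsto_const] filterlim_real_sequentially)
    from filterlim_compose[OF lim this]
    have "(\<lambda>n. ennreal (T (exp s) - T (exp (s + real n)))) \<longlonglongrightarrow> ennreal (T (exp s) - 0)"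
      by (intro tendsto_ennrealI tendsto_diff tendsto_const)
    moreover have "emeasure \<mu> {s<..s + real n} = ennreal (T (exp s) - T (exp (s + real n)))" for n
      unfolding \<mu>_def by (subst emeasure_interval_measure_Ioc[OF _ mono rc]) (simp_all add: F_def)
    ultimately show ?thesis using LIMSEQ_unique[OF l] by simp
  qed
  have exp_m: "exp \<in> measurable \<mu> (restrict_space borel {0<..})"
    by (rule measurable_restrict_space2) (simp_all add: measurable_cong_sets[OF sets refl])
  define \<Upsilon> where "\<Upsilon> = distr \<mu> (restrict_space borel {0<..}) exp"
  have em: "emeasure \<Upsilon> {y<..} = ennreal (T y)" if y: "0 < y" for y
  proof -
    have "{y<..} \<in> sets (restrict_space borel {0<..})" using y by (auto simp: sets_restrict_space_iff)
    then have "emeasure \<Upsilon> {y<..} = emeasure \<mu> (exp -` {y<..} \<inter> space \<mu>)"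
      unfolding \<Upsilon>_def by (rule emeasure_distr[OF exp_m])
    also have "exp -` {y<..} \<inter> space \<mu> = {ln y<..}"
      using y sets_eq_imp_space_eq[OF sets] by (auto simp flip: exp_less_cancel_iff[of "ln y"])
    finally show ?thesis using y by (simp add: tail)
  qed
  show thesis
  proof (rule that)
    show "tail_measure \<Upsilon>" using em by (auto simp: tail_measure_def \<Upsilon>_def)
    show "measure \<Upsilon> {y<..} = T y" if "0 < y" for y
      using em[OF that] T0[OF that] by (simp add: measure_def)
  qed
qed

context scale_shape
begin

lemma deriv_bounds:
  assumes D: "\<And>x. 0 < x \<Longrightarrow> (W has_real_derivative g x) (at x)" and xy: "0 < x" "x < y"
  shows "g y * (y - x) \<le> W y - W x" "W y - W x \<le> g x * (y - x)"
proof -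
  have *: "W x \<le> W c + g c * (x - c)" if "0 < c" "0 < x" for c x
  proof -
    have "- W x - - W c \<ge> - g c * (x - c)"
    proof (rule convex_on_imp_above_tangent[where A="{0<..}"])
      show "convex_on {0<..} (\<lambda>x. - W x)"
        using concave unfolding concave_on_def by (rule convex_on_subset) (auto simp: convex_real_interval)
      have "((\<lambda>x. - W x) has_real_derivative - g c) (at c)" using D[OF \<open>0 < c\<close>] by (intro derivative_intros)
      then show "((\<lambda>x. - W x) has_real_derivative - g c) (at c within {0<..})" by (rule has_field_derivative_at_within)
    qed (use that in \<open>auto simp: interior_open\<close>)
    then show ?thesis by simp
  qed
  show "g y * (y - x) \<le> W y - W x" using *[of y x] xy by (simp add: algebra_simps)
  show "W y - W x \<le> g x * (y - x)" using *[of x y] xy by simp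
qed

text \<open>Concavity makes \<open>g\<close> decreasing, monotonicity of \<open>W\<close> makes it
  nonnegative. Its limit at infinity is \<kappa>, the remainder is the tail of \<Upsilon>, and
  \<open>d\<close> is the value \<open>W 0\<close>, which the derivative cannot see.\<close>

lemma bernstein_data:
  assumes D: "\<And>x. 0 < x \<Longrightarrow> (W has_real_derivative g x) (at x)" and gc: "continuous_on {0<..} g"
  obtains \<kappa> d \<Upsilon> where "0 \<le> \<kappa>" "0 \<le> d" "sets \<Upsilon> = sets (restrict_space borel {0<..})"
    "(\<integral>\<^sup>+x. ennreal (min 1 x) \<partial>\<Upsilon>) < \<infinity>"
    "\<And>x. 0 \<le> x \<Longrightarrow> W x = d + \<kappa> * x + (LBINT y:{0<..x}. measure \<Upsilon> {y<..})"
proof -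
  note b = deriv_bounds[OF D]
  have g_anti: "g y \<le> g x" if "0 < x" "x \<le> y" for x y
  proof (cases "x = y")
    case False
    then have "x < y" using that by simp
    with \<open>0 < x\<close> have "g y * (y - x) \<le> g x * (y - x)" using b[of x y] by (meson order_trans)
    moreover have "0 < y - x" using \<open>x < y\<close> by simp
    ultimately show ?thesis by (rule mult_right_le_imp_le)
  qed simp
  have g0: "0 \<le> g x" if "0 < x" for x
  proof -
    have "0 \<le> g x * (x + 1 - x)" using b(2)[of x "x + 1"] mono[of x "x + 1"] that by auto
    then show ?thesis by simp
  qed
  define \<kappa> where "\<kappa> = (INF x\<in>{0<..}. g x)"
  have bdd: "bdd_below (g ` {0<..})" using g0 by (auto simp: bdd_below_def)
  have \<kappa>0: "0 \<le> \<kappa>" unfolding \<kappa>_def using g0 by (intro cINF_greatest) auto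
  have \<kappa>_le: "\<kappa> \<le> g x" if "0 < x" for x unfolding \<kappa>_def using that by (intro cINF_lower[OF bdd]) auto
  have lim: "(g \<longlongrightarrow> \<kappa>) at_top"
  proof (rule order_tendstoI)
    fix a assume "a < \<kappa>"
    then show "\<forall>\<^sub>F x in at_top. a < g x"
      by (intro eventually_at_top_linorderI[of 1] less_le_trans[OF _ \<kappa>_le]) auto
  next
    fix a assume "\<kappa> < a"
    then obtain x where x: "0 < x" "g x < a" unfolding \<kappa>_def by (auto simp: cINF_less_iff[OF _ bdd])
    then show "\<forall>\<^sub>F y in at_top. g y < a"
      by (intro eventually_at_top_linorderI[of x] le_less_trans[OF g_anti x(2)])
  qed
  define T where "T x = g x - \<kappa>" for x
  have Tc: "continuous_on {0<..} T" unfolding T_def by (intro continuous_intros gc)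
  have Ta: "T y \<le> T x" if "0 < x" "x \<le> y" for x y using g_anti[OF that] by (simp add: T_def)
  have Tl: "(T \<longlongrightarrow> 0) at_top" unfolding T_def using tendsto_diff[OF lim tendsto_const[of \<kappa>]] by simp
  obtain \<Upsilon> where \<Upsilon>: "tail_measure \<Upsilon>" and tail: "\<And>y. 0 < y \<Longrightarrow> measure \<Upsilon> {y<..} = T y"
    using exists_measure_with_tail[OF Ta Tc Tl] by blast
  interpret \<Upsilon>: tail_measure \<Upsilon> by (rule \<Upsilon>)
  have int: "has_bochner_integral lborel (\<lambda>y. indicator {0<..x} y * \<Upsilon>.T y) (W x - W 0 - \<kappa> * x)" if x: "0 < x" for x
  proof -
    have A: "((\<lambda>y. W y - \<kappa> * y) \<longlongrightarrow> W 0 - \<kappa> * 0) (at_right 0)"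
    proof -
      have "(W \<longlongrightarrow> W 0) (at 0 within {0..})" using cont by (auto simp: continuous_on_def)
      then have "(W \<longlongrightarrow> W 0) (at_right 0)" by (rule tendsto_within_subset) auto
      then show ?thesis by (intro tendsto_intros)
    qed
    have "isCont (\<lambda>y. W y - \<kappa> * y) x" using DERIV_isCont[OF D[OF x]] by (intro continuous_intros)
    then have B: "((\<lambda>y. W y - \<kappa> * y) \<longlongrightarrow> W x - \<kappa> * x) (at_left x)"
      by (simp add: continuous_at filterlim_at_split)
    have F: "((\<lambda>y. W y - \<kappa> * y) has_real_derivative T y) (at y)" if "0 < y" for y
      unfolding T_def using D[OF that] by (auto intro!: derivative_eq_intros)
    have Tcont: "isCont T y" if "0 < y" for y
      using Tc that by (simp add: continuous_on_eq_continuous_at)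
    have T0: "0 \<le> T y" if "0 < y" for y using \<kappa>_le[OF that] by (simp add: T_def)
    \<comment> \<open>\<open>g\<close> may be unbounded near 0. As \<open>T\<close> is nonnegative,
      the improper fundamental theorem gives integrability as well, the boundary value at 0 being
      supplied by continuity of \<open>W\<close>.\<close>
    have "set_integrable lborel (einterval (ereal 0) (ereal x)) T"
      and "(LBINT y=ereal 0..ereal x. T y) = (W x - \<kappa> * x) - (W 0 - \<kappa> * 0)"
      by (rule interval_integral_FTC_nonneg[where F="\<lambda>y. W y - \<kappa> * y"];
          use x F Tcont T0 A B in \<open>simp add: ereal_tendsto_simps1\<close>)+
    moreover have "einterval (ereal 0) (ereal x) = {0<..<x}" by (auto simp: einterval_def)
    ultimately have h: "has_bochner_integral lborel (\<lambda>y. indicator {0<..<x} y * T y) (W x - W 0 - \<kappa> * x)"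
      using x by (simp add: set_integrable_def set_lebesgue_integral_def has_bochner_integral_iff
          interval_lebesgue_integral_def algebra_simps)
    show ?thesis
    proof (rule has_bochner_integral_cong_AE[THEN iffD1, OF _ _ _ h])
      show "AE y in lborel. indicator {0<..<x} y * T y = indicator {0<..x} y * \<Upsilon>.T y"
        using AE_lborel_singleton[of x] by eventually_elim (auto simp: \<Upsilon>.T_def tail split: split_indicator)
    qed (use h \<Upsilon>.tail_meas in \<open>auto simp: has_bochner_integral_iff\<close>)
  qed
  show thesis
  proof (rule that)
    show "0 \<le> \<kappa>" by (rule \<kappa>0)
    show "0 \<le> W 0" by (rule nonneg) simp
    show "sets \<Upsilon> = sets (restrict_space borel {0<..})" by (rule \<Upsilon>.sets_\<Upsilon>)
    have "(\<integral>\<^sup>+x. ennreal (min 1 x) \<partial>\<Upsilon>) = (\<integral>\<^sup>+y. ennreal (indicator {0<..1} y * \<Upsilon>.T y) \<partial>lborel)"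
      by (rule \<Upsilon>.nn_tail[symmetric]) simp
    also have "\<dots> = ennreal (\<integral>y. indicator {0<..1} y * \<Upsilon>.T y \<partial>lborel)"
      using int[of 1] by (intro nn_integral_eq_integral) (auto simp: has_bochner_integral_iff \<Upsilon>.T_def)
    finally show "(\<integral>\<^sup>+x. ennreal (min 1 x) \<partial>\<Upsilon>) < \<infinity>" by simp
    show "W x = W 0 + \<kappa> * x + (LBINT y:{0<..x}. measure \<Upsilon> {y<..})" if "0 \<le> x" for x
    proof (cases "x = 0")
      case False
      then have "(LBINT y:{0<..x}. measure \<Upsilon> {y<..}) = W x - W 0 - \<kappa> * x"
        using int[of x] that by (simp add: set_lebesgue_integral_def has_bochner_integral_iff \<Upsilon>.T_def)
      then show ?thesis by simp
    qed (simp add: set_lebesgue_integral_def)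
  qed
qed

end

text \<open>All claims follow from \<open>\<phi> \<theta> * \<phi>s \<theta> = \<theta>\<close> for
  \<theta> > 0, and the situation is symmetric in the pair.\<close>

lemma conjugate_scale_functions:
  assumes B: "bernstein_rep \<kappa> d \<Upsilon> \<phi>" and Bs: "bernstein_rep \<kappa>s ds \<Upsilon>s \<phi>s"
    and conj: "\<And>\<theta>. 0 < \<theta> \<Longrightarrow> \<phi>s \<theta> \<noteq> 0 \<and> \<phi> \<theta> = \<theta> / \<phi>s \<theta>"
    and \<psi>: "\<And>\<theta>. 0 \<le> \<theta> \<Longrightarrow> \<psi> \<theta> = \<theta> * \<phi> \<theta>" and \<psi>s: "\<And>\<theta>. 0 \<le> \<theta> \<Longrightarrow> \<psi>s \<theta> = \<theta> * \<phi>s \<theta>"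
  shows "conjugate_bernstein \<phi> \<phi>s" "is_quotient \<psi> (\<lambda>\<theta>. \<theta>\<^sup>2) \<phi>s" "is_quotient \<psi>s (\<lambda>\<theta>. \<theta>\<^sup>2) \<phi>"
    "scale_function \<psi> (bernstein_rep.V \<kappa>s ds \<Upsilon>s)" "scale_function \<psi>s (bernstein_rep.V \<kappa> d \<Upsilon>)"
proof -
  interpret B: bernstein_rep \<kappa> d \<Upsilon> \<phi> by (rule B)
  interpret Bs: bernstein_rep \<kappa>s ds \<Upsilon>s \<phi>s by (rule Bs)
  have conj': "\<phi> \<theta> \<noteq> 0 \<and> \<phi>s \<theta> = \<theta> / \<phi> \<theta>" if "0 < \<theta>" for \<theta> using conj[OF that] that by simp
  have "bernstein_function \<phi>" "bernstein_function \<phi>s"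
    using B.rep Bs.rep by (auto simp: bernstein_function_def)
  then show "conjugate_bernstein \<phi> \<phi>s" using B.is_quotient_id[OF conj] by (simp add: conjugate_bernstein_def)
  show "is_quotient \<psi> (\<lambda>\<theta>. \<theta>\<^sup>2) \<phi>s" by (rule B.is_quotient_exponent[OF conj \<psi>])
  show "is_quotient \<psi>s (\<lambda>\<theta>. \<theta>\<^sup>2) \<phi>" by (rule Bs.is_quotient_exponent[OF conj' \<psi>s])
  show "scale_function \<psi> Bs.V" by (rule Bs.conjugate_scale_function[OF conj' \<psi>])
  show "scale_function \<psi>s B.V" by (rule B.conjugate_scale_function[OF conj \<psi>s])
qed

theorem corollary1:
  shows
    "(\<forall>\<phi> \<phi>s \<kappa> d \<Upsilon> \<kappa>s ds \<Upsilon>s.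
        conjugate_bernstein \<phi> \<phi>s \<and>
        bernstein_representation \<kappa> d \<Upsilon> \<phi> \<and>
        bernstein_representation \<kappa>s ds \<Upsilon>s \<phi>s \<and>
        has_nonincreasing_density \<Upsilon> \<and> has_nonincreasing_density \<Upsilon>s \<longrightarrow>
        (\<exists>W Ws \<psi> \<psi>s
           (N :: (real \<Rightarrow> real) measure) Y (Ns :: (real \<Rightarrow> real) measure) Ys.
           concave_with_convex_derivative W \<and>
           (\<forall>x\<ge>0. W x = ds + \<kappa>s * x + (LBINT y:{0<..x}. measure \<Upsilon>s {y<..})) \<and>
           (\<forall>x\<ge>0. Ws x = d + \<kappa> * x + (LBINT y:{0<..x}. measure \<Upsilon> {y<..})) \<and>
           spectrally_negative_levy N Y \<and> laplace_exponent N Y \<psi> \<and>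
           \<not> drifts_to_minus_infinity N Y \<and> scale_function \<psi> W \<and>
           spectrally_negative_levy Ns Ys \<and> laplace_exponent Ns Ys \<psi>s \<and>
           \<not> drifts_to_minus_infinity Ns Ys \<and> scale_function \<psi>s Ws \<and>
           is_quotient \<psi> (\<lambda>\<theta>. \<theta>\<^sup>2) \<phi>s \<and> (\<forall>\<theta>\<ge>0. \<psi> \<theta> = \<theta> * \<phi> \<theta>) \<and>
           is_quotient \<psi>s (\<lambda>\<theta>. \<theta>\<^sup>2) \<phi> \<and> (\<forall>\<theta>\<ge>0. \<psi>s \<theta> = \<theta> * \<phi>s \<theta>)))
     \<and>
     (\<forall>(M :: 'a measure) X \<psi> W.
        spectrally_negative_levy M X \<and> laplace_exponent M X \<psi> \<and>
        \<not> drifts_to_minus_infinity M X \<and> scale_function \<psi> W \<and>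
        concave_with_convex_derivative W \<longrightarrow>
        (\<exists>\<phi> \<phi>s \<kappa> d \<Upsilon> \<kappa>s ds \<Upsilon>s \<psi>s Ws (Ns :: (real \<Rightarrow> real) measure) Ys.
           conjugate_bernstein \<phi> \<phi>s \<and>
           bernstein_representation \<kappa> d \<Upsilon> \<phi> \<and>
           bernstein_representation \<kappa>s ds \<Upsilon>s \<phi>s \<and>
           spectrally_negative_levy Ns Ys \<and> laplace_exponent Ns Ys \<psi>s \<and>
           \<not> drifts_to_minus_infinity Ns Ys \<and> scale_function \<psi>s Ws \<and>
           is_quotient \<psi> (\<lambda>\<theta>. \<theta>\<^sup>2) \<phi>s \<and> (\<forall>\<theta>\<ge>0. \<psi> \<theta> = \<theta> * \<phi> \<theta>) \<and>
           is_quotient \<psi>s (\<lambda>\<theta>. \<theta>\<^sup>2) \<phi> \<and> (\<forall>\<theta>\<ge>0. \<psi>s \<theta> = \<theta> * \<phi>s \<theta>) \<and>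
           (\<forall>x\<ge>0. W x = ds + \<kappa>s * x + (LBINT y:{0<..x}. measure \<Upsilon>s {y<..})) \<and>
           (\<forall>x\<ge>0. Ws x = d + \<kappa> * x + (LBINT y:{0<..x}. measure \<Upsilon> {y<..}))))"
proof (intro conjI allI impI)
  fix \<phi> \<phi>s :: "real \<Rightarrow> real" and \<kappa> d \<kappa>s ds :: real and \<Upsilon> \<Upsilon>s :: "real measure"
  assume *: "conjugate_bernstein \<phi> \<phi>s \<and> bernstein_representation \<kappa> d \<Upsilon> \<phi> \<and>
    bernstein_representation \<kappa>s ds \<Upsilon>s \<phi>s \<and> has_nonincreasing_density \<Upsilon> \<and> has_nonincreasing_density \<Upsilon>s"
  interpret B: bernstein_rep \<kappa> d \<Upsilon> \<phi> using * by (simp add: bernstein_rep_def)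
  interpret Bs: bernstein_rep \<kappa>s ds \<Upsilon>s \<phi>s using * by (simp add: bernstein_rep_def)
  have conj: "\<phi>s \<theta> \<noteq> 0 \<and> \<phi> \<theta> = \<theta> / \<phi>s \<theta>" if "0 < \<theta>" for \<theta>
    using * that by (simp add: conjugate_bernstein_def is_quotient_def)
  have sh: "concave_with_convex_derivative B.V" "concave_with_convex_derivative Bs.V"
    using * B.V_shape[OF B.T_convex] Bs.V_shape[OF Bs.T_convex] by simp_all
  have nz: "\<phi> 1 \<noteq> 0" "\<phi>s 1 \<noteq> 0" using conj[of 1] by simp_all
  \<comment> \<open>Each process is built from the function \<open>V\<close> of its own Bernstein
    function, which is the scale function of the other process.\<close>
  obtain N :: "(real \<Rightarrow> real) measure" and Y \<psi> where N: "spectrally_negative_levy N Y" "laplace_exponent N Y \<psi>"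
    "\<not> drifts_to_minus_infinity N Y" and \<psi>: "\<And>\<theta>. 0 \<le> \<theta> \<Longrightarrow> \<psi> \<theta> = \<theta> * \<phi> \<theta>"
    using B.exists_process[OF sh(1) zero_less_one nz(1)] by metis
  obtain Ns :: "(real \<Rightarrow> real) measure" and Ys \<psi>s where Ns: "spectrally_negative_levy Ns Ys" "laplace_exponent Ns Ys \<psi>s"
    "\<not> drifts_to_minus_infinity Ns Ys" and \<psi>s: "\<And>\<theta>. 0 \<le> \<theta> \<Longrightarrow> \<psi>s \<theta> = \<theta> * \<phi>s \<theta>"
    using Bs.exists_process[OF sh(2) zero_less_one nz(2)] by metis
  note c = conjugate_scale_functions[OF B.bernstein_rep_axioms Bs.bernstein_rep_axioms conj \<psi> \<psi>s]
  show "\<exists>W Ws \<psi> \<psi>s (N :: (real \<Rightarrow> real) measure) Y (Ns :: (real \<Rightarrow> real) measure) Ys.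
     concave_with_convex_derivative W \<and>
     (\<forall>x\<ge>0. W x = ds + \<kappa>s * x + (LBINT y:{0<..x}. measure \<Upsilon>s {y<..})) \<and>
     (\<forall>x\<ge>0. Ws x = d + \<kappa> * x + (LBINT y:{0<..x}. measure \<Upsilon> {y<..})) \<and>
     spectrally_negative_levy N Y \<and> laplace_exponent N Y \<psi> \<and>
     \<not> drifts_to_minus_infinity N Y \<and> scale_function \<psi> W \<and>
     spectrally_negative_levy Ns Ys \<and> laplace_exponent Ns Ys \<psi>s \<and>
     \<not> drifts_to_minus_infinity Ns Ys \<and> scale_function \<psi>s Ws \<and>
     is_quotient \<psi> (\<lambda>\<theta>. \<theta>\<^sup>2) \<phi>s \<and> (\<forall>\<theta>\<ge>0. \<psi> \<theta> = \<theta> * \<phi> \<theta>) \<and>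
     is_quotient \<psi>s (\<lambda>\<theta>. \<theta>\<^sup>2) \<phi> \<and> (\<forall>\<theta>\<ge>0. \<psi>s \<theta> = \<theta> * \<phi>s \<theta>)"
  proof (rule exI[of _ Bs.V], rule exI[of _ B.V], rule exI[of _ \<psi>], rule exI[of _ \<psi>s], rule exI[of _ N],
      rule exI[of _ Y], rule exI[of _ Ns], rule exI[of _ Ys], intro conjI allI impI)
  qed (use N Ns c sh \<psi> \<psi>s in \<open>simp_all add: B.V_def Bs.V_def\<close>)
next
  fix M :: "'a measure" and X :: "real \<Rightarrow> 'a \<Rightarrow> real" and \<psi> W :: "real \<Rightarrow> real"
  assume *: "spectrally_negative_levy M X \<and> laplace_exponent M X \<psi> \<and>
    \<not> drifts_to_minus_infinity M X \<and> scale_function \<psi> W \<and> concave_with_convex_derivative W"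
  interpret levy_process M X using * by (simp add: spectrally_negative_levy_def)
  have W: "\<And>x. 0 \<le> W x" "\<And>x. x < 0 \<Longrightarrow> W x = 0" "continuous_on {0..} W"
    and lap: "\<And>\<theta>. 0 < \<theta> \<Longrightarrow> (LBINT x:{0..}. exp (- \<theta> * x) * W x) = 1 / \<psi> \<theta>"
    using * by (auto simp: scale_function_def)
  have sh: "concave_with_convex_derivative W" using * by simp
  interpret S: scale_shape W by (rule scale_shape_concave[OF W(1,3) sh])
  \<comment> \<open>By the convention \<open>1 / 0 = 0\<close> the transform condition would admit
    \<open>W = 0\<close> together with \<open>\<psi> \<theta> = 0\<close>. That exponent belongs to
    the zero process, the negative of a subordinator.\<close>
  have "\<exists>x\<ge>0. 0 < W x"
  proof (rule ccontr)
    assume "\<not> ?thesis"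
    then have "W x = 0" for x using W(1)[of x] W(2)[of x] by (metis le_less linorder_not_less)
    then have "W = (\<lambda>x. 0)" by (simp add: fun_eq_iff)
    then have "\<psi> \<theta> = 0" if "0 < \<theta>" for \<theta> using lap[OF that] by simp
    then have "subordinator M (\<lambda>t \<omega>. - X t \<omega>)" using * by (intro zero_exponent_subordinator[of \<psi>]) auto
    then show False using * by (simp add: spectrally_negative_levy_def)
  qed
  then obtain x0 where x0: "0 \<le> x0" "0 < W x0" by blast
  \<comment> \<open>Positivity of the exponent is read off the scale function, whose transform is
    positive once \<open>W\<close> is positive somewhere.\<close>
  have pos: "0 < \<psi> \<theta>" if "0 < \<theta>" for \<theta>
    using S.lap_pos[OF that x0] lap[OF that] by (simp add: S.lap_def)
  have \<psi>0: "\<psi> 0 = 0" using * by (simp add: laplace_exponent_def prob_space)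
  obtain \<kappa> d \<Upsilon> \<phi> where rep: "bernstein_representation \<kappa> d \<Upsilon> \<phi>" and \<phi>: "\<And>\<theta>. 0 < \<theta> \<Longrightarrow> \<phi> \<theta> = \<psi> \<theta> / \<theta>"
    using bernstein_of_exponent[of M X \<psi>] * pos by metis
  interpret B: bernstein_rep \<kappa> d \<Upsilon> \<phi> using rep by (simp add: bernstein_rep_def)
  have D: "(W has_real_derivative deriv W x) (at x)" if "0 < x" for x
    using sh that by (auto simp: concave_with_convex_derivative_def DERIV_deriv_iff_real_differentiable)
  have "continuous_on {0<..} (deriv W)"
    using sh by (intro convex_on_continuous) (auto simp: concave_with_convex_derivative_def)
  from S.bernstein_data[OF D this] obtain \<kappa>s ds \<Upsilon>s where s: "0 \<le> \<kappa>s" "0 \<le> ds" "sets \<Upsilon>s = sets (restrict_space borel {0<..})"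
    "(\<integral>\<^sup>+x. ennreal (min 1 x) \<partial>\<Upsilon>s) < \<infinity>"
    and Weq: "\<And>x. 0 \<le> x \<Longrightarrow> W x = ds + \<kappa>s * x + (LBINT y:{0<..x}. measure \<Upsilon>s {y<..})" by metis
  \<comment> \<open>\<open>W\<close> is the function \<open>V\<close> of the data just found, so its
    transform identifies this Bernstein function with
    \<open>\<theta>\<^sup>2 / \<psi> \<theta>\<close>.\<close>
  define \<phi>s where "\<phi>s \<theta> = \<kappa>s + ds * \<theta> + (\<integral>x. 1 - exp (- \<theta> * x) \<partial>\<Upsilon>s)" for \<theta>
  interpret Bs: bernstein_rep \<kappa>s ds \<Upsilon>s \<phi>s
    by unfold_locales (use s in \<open>simp add: bernstein_representation_def \<phi>s_def\<close>)
  have WV: "W = Bs.V" using W(2) Weq by (auto simp: fun_eq_iff Bs.V_def)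
  have \<phi>s: "\<phi>s \<theta> = \<theta>\<^sup>2 / \<psi> \<theta>" if "0 < \<theta>" for \<theta>
  proof -
    have "\<phi>s \<theta> / \<theta>\<^sup>2 = 1 / \<psi> \<theta>"
      using Bs.laplace_V[OF that] lap[OF that] by (simp add: WV set_lebesgue_integral_def has_bochner_integral_iff)
    then show ?thesis using that by (simp add: field_simps)
  qed
  have conj: "\<phi>s \<theta> \<noteq> 0 \<and> \<phi> \<theta> = \<theta> / \<phi>s \<theta>" if "0 < \<theta>" for \<theta>
    using pos[OF that] that by (simp add: \<phi>s \<phi> power2_eq_square)
  have \<psi>: "\<psi> \<theta> = \<theta> * \<phi> \<theta>" if "0 \<le> \<theta>" for \<theta>
    using that by (cases "\<theta> = 0") (simp_all add: \<psi>0 \<phi>)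
  have "\<phi>s 1 \<noteq> 0" using conj[of 1] by simp
  then obtain Ns :: "(real \<Rightarrow> real) measure" and Ys \<psi>s where Ns: "spectrally_negative_levy Ns Ys" "laplace_exponent Ns Ys \<psi>s"
    "\<not> drifts_to_minus_infinity Ns Ys" and \<psi>s: "\<And>\<theta>. 0 \<le> \<theta> \<Longrightarrow> \<psi>s \<theta> = \<theta> * \<phi>s \<theta>"
    using Bs.exists_process[OF sh[unfolded WV] zero_less_one] by metis
  note c = conjugate_scale_functions[OF B.bernstein_rep_axioms Bs.bernstein_rep_axioms conj \<psi> \<psi>s]
  show "\<exists>\<phi> \<phi>s \<kappa> d \<Upsilon> \<kappa>s ds \<Upsilon>s \<psi>s Ws (Ns :: (real \<Rightarrow> real) measure) Ys.
     conjugate_bernstein \<phi> \<phi>s \<and>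
     bernstein_representation \<kappa> d \<Upsilon> \<phi> \<and>
     bernstein_representation \<kappa>s ds \<Upsilon>s \<phi>s \<and>
     spectrally_negative_levy Ns Ys \<and> laplace_exponent Ns Ys \<psi>s \<and>
     \<not> drifts_to_minus_infinity Ns Ys \<and> scale_function \<psi>s Ws \<and>
     is_quotient \<psi> (\<lambda>\<theta>. \<theta>\<^sup>2) \<phi>s \<and> (\<forall>\<theta>\<ge>0. \<psi> \<theta> = \<theta> * \<phi> \<theta>) \<and>
     is_quotient \<psi>s (\<lambda>\<theta>. \<theta>\<^sup>2) \<phi> \<and> (\<forall>\<theta>\<ge>0. \<psi>s \<theta> = \<theta> * \<phi>s \<theta>) \<and>
     (\<forall>x\<ge>0. W x = ds + \<kappa>s * x + (LBINT y:{0<..x}. measure \<Upsilon>s {y<..})) \<and>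
     (\<forall>x\<ge>0. Ws x = d + \<kappa> * x + (LBINT y:{0<..x}. measure \<Upsilon> {y<..}))"
  proof (rule exI[of _ \<phi>], rule exI[of _ \<phi>s], rule exI[of _ \<kappa>], rule exI[of _ d], rule exI[of _ \<Upsilon>],
      rule exI[of _ \<kappa>s], rule exI[of _ ds], rule exI[of _ \<Upsilon>s], rule exI[of _ \<psi>s], rule exI[of _ B.V],
      rule exI[of _ Ns], rule exI[of _ Ys], intro conjI allI impI)
  qed (use Ns c rep Bs.rep Weq \<psi> \<psi>s in \<open>simp_all add: B.V_def\<close>)
qed

end
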